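(* Let $d\ge 2$ be an integer, let $a_0\in\mathbb{R}$, and let $f$ be a real-valued $C^{d+1}$ function defined on a neighbourhood of $a_0$ such that the curve $C(t)=(t,f(t))$ is of type $d$ at $a_0$, i.e. $f^{(k)}(a_0)=0$ for $1\le k<d$ and $f^{(d)}(a_0)\neq 0$. Then there exists $\epsilon_0>0$ such that for every interval $I\subseteq(a_0-\epsilon_0,a_0+\epsilon_0)$ and every $\epsilon>0$, $$N_f(Q,\delta)=|I|\,\delta Q^2+O\Big(\delta^{\frac12}\big(\log\tfrac1\delta\big)Q^{2-\frac{1}{2(d-1)}}+\delta^{\frac1d}Q^{2-\frac1d}+Q^{1+\epsilon}\Big)$$ for all integers $Q\ge1$ and all $\delta\in(Q^{-1},\tfrac12)$, where the implied constant does not depend on $Q$ or $\delta$. In particular, $N_f(Q,\delta)=(|I|+o(1))\delta Q^2$ as $Q\to\infty$ whenever $\delta\in(Q^{-\frac{1}{d-1}+\epsilon},\tfrac12)$ for some fixed $\epsilon>0$.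
   Context: For a compact interval $I$, a function $f:I\to\mathbb{R}$, an integer $Q\ge1$ and $\delta\in(0,\tfrac12)$, define $$N_f(Q,\delta):=\#\{(a,q)\in\mathbb{Z}\times\mathbb{N}: 1\le q\le Q,\ \tfrac aq\in I,\ \|qf(\tfrac aq)\|<\delta\},$$ where $\|x\|:=\min_{k\in\mathbb{Z}}|x-k|$ and $|I|$ denotes the length of $I$. The implied constant in $O(\cdot)$ may depend on $f$, $d$, the interval and $\epsilon$, but not on $Q$ or $\delta$. *)

theory Defs
  imports "HOL-Analysis.Analysis"
begin

definition C_k_on :: "nat \<Rightarrow> (real \<Rightarrow> real) \<Rightarrow> real set \<Rightarrow> bool" where
  "C_k_on k f U \<longleftrightarrow>
     (\<forall>j<k. \<forall>x\<in>U. (deriv ^^ j) f differentiable (at x)) \<and>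
     (\<forall>j\<le>k. continuous_on U ((deriv ^^ j) f))"

definition curve_of_type :: "nat \<Rightarrow> (real \<Rightarrow> real) \<Rightarrow> real \<Rightarrow> bool" where
  "curve_of_type d f a0 \<longleftrightarrow>
     (\<forall>k. 1 \<le> k \<and> k < d \<longrightarrow> (deriv ^^ k) f a0 = 0) \<and> (deriv ^^ d) f a0 \<noteq> 0"

text \<open>The infimum below is attained, so it is the minimum over the integers.\<close>

definition int_dist :: "real \<Rightarrow> real" where
  "int_dist x = (INF k::int. \<bar>x - of_int k\<bar>)"

text \<open>The fractions are not required to be reduced: pairs \<open>(a, q)\<close> are counted.
  For bounded \<open>I\<close> the set is finite.\<close>

definition rat_count :: "(real \<Rightarrow> real) \<Rightarrow> real set \<Rightarrow> nat \<Rightarrow> real \<Rightarrow> nat" where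
  "rat_count f I Q \<delta> =
     card {(a::int, q::nat). 1 \<le> q \<and> q \<le> Q \<and> of_int a / of_nat q \<in> I \<and>
             int_dist (of_nat q * f (of_int a / of_nat q)) < \<delta>}"

end

theory Submission
  imports Defs "HOL-Analysis.Analysis" "HOL-Real_Asymp.Real_Asymp"
begin

text \<open>
  Fejer smoothing bounds the discrepancy by weighted exponential sums over the rationals
  \<open>a/q\<close>, with frequencies \<open>j\<close> up to \<open>Q\<close>. Poisson summation in \<open>a\<close> and the method of stationary phase,
  applied with the sum over \<open>q\<close> kept inside as the derivative of a Dirichlet kernel, turn such a sum over a
  piece where \<open>f''\<close> has constant order \<open>\<kappa>\<close> into a sum over the pairs \<open>(j, k)\<close> of
  \<open>min Q (1 / \<parallel>j f\<^sup>*(k/j)\<parallel>)\<close>, where \<open>f\<^sup>*\<close> is the Legendre dual of \<open>f\<close>. The pairs with small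
  \<open>\<parallel>j f\<^sup>*(k/j)\<parallel>\<close> are rational points near the dual curve; they are counted, uniformly in \<open>\<kappa>\<close>, by strong
  induction on the height: on short arcs such points lie on a line, and the lines carrying many of them are
  rational points of smaller height near the original curve. The interval is cut dyadically around the flat
  point, and a core of radius about \<open>Q\<close> to the power \<open>-1/(d-1)\<close> is estimated by first derivatives; it
  produces the term \<open>\<delta> powr (1/d) * Q powr (2 - 1/d)\<close>.
\<close>

subsection \<open>Rational points near a curve\<close>

text \<open>The pieces next to the core have curvature of order \<kappa> = Q^(-(d-2)/(d-1)), so
  every estimate has to be uniform in \<kappa>. This dictates how the count is normalised: windows
  of length \<open>min 1 (1/\<kappa>)\<close> and tolerances in units of
  \<open>min 1 \<kappa>\<close> pass into those of the dual curve when \<kappa> becomes 1/\<kappa>,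
  so that one induction treats a curve and its dual together. It closes because, under the tolerance
  assumed there, a line with three points of height D on one short arc has height O(D^(1-\<eta>/2)),
  and this saving pays for the logarithmically many dyadic heights. Poisson summation takes a finite
  form, integration against a Fejer kernel of order Q^4. After the substitution a = q x all
  denominators share the phase j f(x) + i x; this is why the sum over q can stay inside. The leading
  term of a piece, Q sqrt(Q/\<kappa>), is largest next to the core, where it is of order
  Q^(2-1/(2(d-1))); for d \<ge> 3 the other pieces follow in geometric progression, for d = 2 there
  is only one. No factor log Q may be lost on this term, since the theorem allows only
  log(1/\<delta>) beside it.\<close>

definition legendre_pair ::
 "real \<Rightarrow> real \<Rightarrow> (real \<Rightarrow> real) \<Rightarrow> (real \<Rightarrow> real) \<Rightarrow> (real \<Rightarrow> real) \<Rightarrow> (real \<Rightarrow> real) \<Rightarrow> bool"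
where
 "legendre_pair L \<kappa> f f1 g g1 \<longleftrightarrow>
   (\<forall>x y. \<kappa> / (2*L) * (y-x)^2 \<le> f y - f x - f1 x * (y-x) \<and>
      f y - f x - f1 x * (y-x) \<le> L * \<kappa> / 2 * (y-x)^2) \<and>
   (\<forall>x y. (1/\<kappa>) / (2*L) * (y-x)^2 \<le> g y - g x - g1 x * (y-x) \<and>
      g y - g x - g1 x * (y-x) \<le> L * (1/\<kappa>) / 2 * (y-x)^2) \<and>
   (\<forall>x. g1 (f1 x) = x) \<and> (\<forall>y. f1 (g1 y) = y) \<and> (\<forall>x. f x + g (f1 x) = x * f1 x)"

text \<open>Legendre duality is an involution that inverts the curvature scale. The bounds are
  imposed on the whole line and through second-order remainders, so that this swap is exact and no
  domain has to be followed through the induction.\<close>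

lemma legendre_pair_sym:
 assumes "legendre_pair L \<kappa> f f1 g g1" "\<kappa> > 0"
 shows "legendre_pair L (1/\<kappa>) g g1 f f1"
proof -
 have "g y + f (g1 y) = y * g1 y" for y
  using assms(1) unfolding legendre_pair_def by (metis add.commute mult.commute)
 then show ?thesis using assms unfolding legendre_pair_def by simp
qed

text \<open>Vertical translates keep slopes and constants; wide neighbourhoods of the curve are
  later tiled by narrow neighbourhoods of such translates.\<close>

lemma legendre_pair_shift:
 assumes "legendre_pair L \<kappa> f f1 g g1"
 shows "legendre_pair L \<kappa> (\<lambda>x. f x + c) f1 (\<lambda>y. g y - c) g1"
 using assms unfolding legendre_pair_def by simp

lemma legendre_lower: "legendre_pair L \<kappa> f f1 g g1 \<Longrightarrow> \<kappa> / (2*L) * (y-x)^2 \<le> f y - f x - f1 x * (y-x)"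
 and legendre_upper: "legendre_pair L \<kappa> f f1 g g1 \<Longrightarrow> f y - f x - f1 x * (y-x) \<le> L * \<kappa> / 2 * (y-x)^2"
 unfolding legendre_pair_def by blast+

lemma legendre_deriv_lower:
 assumes "legendre_pair L \<kappa> f f1 g g1"
 shows "\<kappa> / L * (y-x)^2 \<le> (f1 y - f1 x) * (y - x)"
proof -
 have "\<kappa> / (2*L) * (y-x)^2 + \<kappa> / (2*L) * (x-y)^2 \<le> (f1 y - f1 x) * (y - x)"
  using legendre_lower[OF assms, of y x] legendre_lower[OF assms, of x y]
  by (simp add: algebra_simps)
 then show ?thesis by (simp add: power2_commute[of x y])
qed

lemma legendre_deriv_upper:
 assumes "legendre_pair L \<kappa> f f1 g g1"
 shows "(f1 y - f1 x) * (y - x) \<le> L * \<kappa> * (y-x)^2"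
proof -
 have "(f1 y - f1 x) * (y - x) \<le> L * \<kappa> / 2 * (y-x)^2 + L * \<kappa> / 2 * (x-y)^2"
  using legendre_upper[OF assms, of y x] legendre_upper[OF assms, of x y]
  by (simp add: algebra_simps)
 then show ?thesis by (simp add: power2_commute[of x y])
qed

lemma legendre_deriv_le:
 assumes "legendre_pair L \<kappa> f f1 g g1" "x \<le> y"
 shows "f1 y - f1 x \<le> L * \<kappa> * (y - x)"
proof (cases "x = y")
 case False
 then have "y - x > 0" using assms by simp
 moreover have "(f1 y - f1 x) * (y - x) \<le> (L * \<kappa> * (y-x)) * (y - x)"
  using legendre_deriv_upper[OF assms(1), of y x] by (simp add: power2_eq_square algebra_simps)
 ultimately show ?thesis by (metis mult_le_cancel_right_pos)
qed auto

lemma legendre_deriv_ge: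
 assumes "legendre_pair L \<kappa> f f1 g g1" "x \<le> y"
 shows "f1 y - f1 x \<ge> \<kappa> / L * (y - x)"
proof (cases "x = y")
 case False
 then have "y - x > 0" using assms by simp
 moreover have "(f1 y - f1 x) * (y - x) \<ge> (\<kappa> / L * (y-x)) * (y - x)"
  using legendre_deriv_lower[OF assms(1), of y x] by (simp add: power2_eq_square mult.assoc)
 ultimately show ?thesis by (metis mult_le_cancel_right_pos)
qed auto

text \<open>The middle expression is the second divided difference with its denominators cleared,
  the form in which the determinant of three rational points meets the curve. It is the combination
  of the two remainders at \<open>x2\<close> in which the tangent slope cancels.\<close>

lemma legendre_second_diff:
 assumes "legendre_pair L \<kappa> f f1 g g1" "x1 < x2" "x2 < x3"
 shows "\<kappa>/(2*L) * (x2-x1) * (x3-x2) * (x3-x1) \<le> (x2-x1)*(f x3 - f x2) - (x3-x2)*(f x2 - f x1)" (is ?A)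
  and "(x2-x1)*(f x3 - f x2) - (x3-x2)*(f x2 - f x1) \<le> L*\<kappa>/2 * (x2-x1) * (x3-x2) * (x3-x1)" (is ?B)
proof -
 let ?a = "x2-x1" and ?b = "x3-x2"
 have pos: "?a \<ge> 0" "?b \<ge> 0" using assms by auto
 have 1: "?a * (\<kappa> / (2*L) * ?b^2) \<le> ?a * (f x3 - f x2 - f1 x2 * ?b)"
  "?b * (\<kappa> / (2*L) * (x1-x2)^2) \<le> ?b * (f x1 - f x2 - f1 x2 * (x1-x2))"
  using pos legendre_lower[OF assms(1)] by (blast intro: mult_left_mono)+
 have 2: "?a * (f x3 - f x2 - f1 x2 * ?b) \<le> ?a * (L*\<kappa> / 2 * ?b^2)"
  "?b * (f x1 - f x2 - f1 x2 * (x1-x2)) \<le> ?b * (L*\<kappa> / 2 * (x1-x2)^2)"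
  using pos legendre_upper[OF assms(1)] by (blast intro: mult_left_mono)+
 have e: "?a * (c * ?b^2) + ?b * (c * (x1-x2)^2) = c * ?a * ?b * (x3-x1)" for c :: real
  by (simp add: power2_eq_square algebra_simps)
 have l: "?a * (f x3 - f x2 - f1 x2 * ?b) + ?b * (f x1 - f x2 - f1 x2 * (x1-x2))
   = ?a * (f x3 - f x2) - ?b * (f x2 - f x1)" by algebra
 show ?A using 1 e[of "\<kappa>/(2*L)"] l by linarith
 show ?B using 2 e[of "L*\<kappa>/2"] l by linarith
qed

text \<open>A line cannot follow a strictly convex curve at three distant points. Subtracting the
  line leaves the second difference unchanged; that difference is at least of order \<kappa> times
  the product of the three gaps, and at most 2\<epsilon> times the outer gap, which cancels.\<close>

lemma legendre_collinear_gaps: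
 assumes lp: "legendre_pair L \<kappa> f f1 g g1" and pos: "\<kappa> > 0" "L \<ge> 1" and x: "x1 < x2" "x2 < x3"
  and n: "\<bar>f x1 - (A * x1 + B)\<bar> \<le> \<epsilon>" "\<bar>f x2 - (A * x2 + B)\<bar> \<le> \<epsilon>" "\<bar>f x3 - (A * x3 + B)\<bar> \<le> \<epsilon>"
 shows "(x2-x1) * (x3-x2) \<le> 4 * L * \<epsilon> / \<kappa>"
proof -
 define h where "h x = f x - (A * x + B)" for x
 let ?a = "x2-x1" and ?b = "x3-x2"
 have "?a*(f x3 - f x2) - ?b*(f x2 - f x1) = ?a*(h x3 - h x2) - ?b*(h x2 - h x1)"
  by (simp add: h_def algebra_simps)
 also have "... \<le> ?a * (2*\<epsilon>) + ?b * (2*\<epsilon>)"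
 proof -
  have "?a*(h x3 - h x2) \<le> ?a * (2*\<epsilon>)" using n x unfolding h_def by (intro mult_left_mono) linarith+
  moreover have "?b*(h x1 - h x2) \<le> ?b * (2*\<epsilon>)" using n x unfolding h_def by (intro mult_left_mono) linarith+
  ultimately show ?thesis by (simp add: algebra_simps)
 qed
 finally have "\<kappa>/(2*L) * ?a * ?b * (x3-x1) \<le> 2*\<epsilon> * (x3-x1)"
  using legendre_second_diff(1)[OF lp x] by (simp add: algebra_simps)
 moreover have "x3 - x1 > 0" using x by simp
 ultimately have "\<kappa>/(2*L) * ?a * ?b \<le> 2*\<epsilon>" by (metis mult_le_cancel_right_pos)
 then show ?thesis using pos by (simp add: field_simps)
qed

text \<open>A line close to the curve at two points is close to the tangent of the same slope:
  \<open>g A + B\<close> is the vertical gap between these parallels, because the curve minus the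
  line has its minimum at \<open>g1 A\<close>, with value \<open>-(g A + B)\<close>. The condition
  \<open>side\<close> places \<open>u\<close> between the minimum and \<open>v\<close>, so that
  convexity bounds the slope at \<open>u\<close> by the chord slope 2\<epsilon>/l.\<close>

lemma legendre_pair_near_tangent:
 assumes lp: "legendre_pair L \<kappa> f f1 g g1" and pos: "\<kappa> > 0" "L \<ge> 1" and uv: "l > 0" "\<bar>v - u\<bar> \<ge> l"
  and n: "\<bar>f u - (A * u + B)\<bar> \<le> \<epsilon>" "\<bar>f v - (A * v + B)\<bar> \<le> \<epsilon>"
  and side: "g1 A \<le> u \<and> u \<le> v \<or> v \<le> u \<and> u \<le> g1 A"
 shows "\<bar>f1 u - A\<bar> \<le> 2*\<epsilon>/l" "\<bar>g A + B\<bar> \<le> \<epsilon> + (2*\<epsilon>/l)^2 * L/\<kappa>"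
proof -
 define h where "h x = f x - (A * x + B)" for x
 have f1A: "f1 (g1 A) = A" using lp unfolding legendre_pair_def by blast
 have gA: "h (g1 A) = - (g A + B)"
 proof -
  have "f (g1 A) + g (f1 (g1 A)) = g1 A * f1 (g1 A)" using lp unfolding legendre_pair_def by blast
  then show ?thesis by (simp add: h_def f1A algebra_simps)
 qed
 have low: "h y \<ge> h x + (f1 x - A) * (y - x)" for x y
 proof -
  have "0 \<le> \<kappa> / (2*L) * (y-x)^2" using pos by simp
  then show ?thesis using legendre_lower[OF lp, of y x] by (simp add: h_def algebra_simps)
 qed
 have sgn: "(f1 u - A) * (v - u) \<ge> 0"
 proof -
  have "f1 u - A \<ge> 0" if "g1 A \<le> u"
  proof -
   have "0 \<le> \<kappa> / L * (u - g1 A)" using that pos by simp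
   then show ?thesis using legendre_deriv_ge[OF lp that] f1A by simp
  qed
  moreover have "f1 u - A \<le> 0" if "u \<le> g1 A"
  proof -
   have "0 \<le> \<kappa> / L * (g1 A - u)" using that pos by simp
   then show ?thesis using legendre_deriv_ge[OF lp that] f1A by simp
  qed
  ultimately show ?thesis using side by (auto intro: mult_nonneg_nonneg mult_nonpos_nonpos)
 qed
 have "\<bar>f1 u - A\<bar> * l \<le> \<bar>f1 u - A\<bar> * \<bar>v - u\<bar>" using uv by (intro mult_left_mono) auto
 also have "... = (f1 u - A) * (v - u)" using sgn by (simp add: abs_mult[symmetric])
 also have "... \<le> 2*\<epsilon>" using low[of u v] n unfolding h_def by linarith
 finally show 1: "\<bar>f1 u - A\<bar> \<le> 2*\<epsilon>/l" using uv by (simp add: field_simps)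
 let ?d = "u - g1 A"
 have d0: "\<kappa> / L * ?d^2 \<le> (f1 u - A) * ?d"
  using legendre_deriv_lower[OF lp, of u "g1 A"] f1A by simp
 have "\<kappa> / L * \<bar>?d\<bar> \<le> \<bar>f1 u - A\<bar>"
 proof (cases "?d = 0")
  case False
  have "(\<kappa> / L * \<bar>?d\<bar>) * \<bar>?d\<bar> = \<kappa> / L * ?d^2" by (simp add: power2_eq_square)
  also have "... \<le> \<bar>(f1 u - A) * ?d\<bar>" using d0 by linarith
  also have "... = \<bar>f1 u - A\<bar> * \<bar>?d\<bar>" by (simp add: abs_mult)
  finally show ?thesis using False by (metis mult_le_cancel_right_pos zero_less_abs_iff)
 qed auto
 then have d1: "\<bar>?d\<bar> \<le> L/\<kappa> * \<bar>f1 u - A\<bar>" using pos by (simp add: field_simps)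
 have "(f1 u - A) * ?d \<le> \<bar>f1 u - A\<bar> * \<bar>?d\<bar>" by (simp add: abs_mult[symmetric])
 also have "... \<le> \<bar>f1 u - A\<bar> * (L/\<kappa> * \<bar>f1 u - A\<bar>)" using d1 by (intro mult_left_mono) auto
 also have "... = L/\<kappa> * \<bar>f1 u - A\<bar>^2" by (simp add: power2_eq_square)
 also have "... \<le> L/\<kappa> * (2*\<epsilon>/l)^2" using 1 pos by (intro mult_left_mono power_mono) auto
 finally have "(f1 u - A) * ?d \<le> (2*\<epsilon>/l)^2 * L/\<kappa>" by (simp add: mult.commute)
 moreover have "h (g1 A) \<ge> h u - (f1 u - A) * ?d" using low[of u "g1 A"] by (simp add: algebra_simps)
 moreover have "h u \<ge> h (g1 A)" using low[of "g1 A" u] f1A by simp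
 ultimately show "\<bar>g A + B\<bar> \<le> \<epsilon> + (2*\<epsilon>/l)^2 * L/\<kappa>" using n(1) gA unfolding h_def by linarith
qed

section \<open>Integer lines through rational points\<close>

lemma line_through_points:
 fixes q1 a1 b1 q2 a2 b2 :: int
 assumes "q1 * a2 \<noteq> a1 * q2"
 obtains j k m :: int where "j > 0" "gcd j (gcd k m) = 1"
  "j * b1 = k * a1 - m * q1" "j * b2 = k * a2 - m * q2"
proof -
 \<comment> \<open>Cross product of the vectors (q, a, b) of the two points; division by the gcd
   gives the primitive line, and the sign makes j positive. The line has slope k/j and intercept
   -m/j, so (j, k, m) is the candidate for a rational point near the dual curve.\<close>
 define j0 k0 m0 where "j0 = q1*a2 - a1*q2" "k0 = q1*b2 - b1*q2" "m0 = b1*a2 - a1*b2"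
 define g where "g = gcd j0 (gcd k0 m0)"
 have g: "g > 0" using assms unfolding g_def j0_k0_m0_def by (simp add: gcd_pos_int)
 define s where "s = sgn j0"
 have s: "s * j0 > 0" "s = 1 \<or> s = -1" using assms unfolding s_def j0_k0_m0_def by (auto simp: sgn_if)
 have dv: "g dvd j0" "g dvd k0" "g dvd m0" unfolding g_def
  by (meson gcd_dvd1 gcd_dvd2 dvd_trans)+
 then obtain j k m where jkm: "j0 = g * j" "k0 = g * k" "m0 = g * m" by (auto elim!: dvdE)
 have "g * gcd j (gcd k m) = g" using g unfolding jkm
  using g_def jkm by (metis abs_of_pos gcd_mult_distrib_int)
 then have c: "gcd j (gcd k m) = 1" using g by simp
 have e: "j * b1 = k * a1 + m * q1" "j * b2 = k * a2 + m * q2"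
 proof -
  have eq: "q1*a2 - a1*q2 = g * j" "q1*b2 - b1*q2 = g * k" "b1*a2 - a1*b2 = g * m"
   using jkm unfolding j0_k0_m0_def .
  have "g * (j * b1) = g * (k * a1 + m * q1)" using eq by algebra
  then show "j * b1 = k * a1 + m * q1" using g by simp
  have "g * (j * b2) = g * (k * a2 + m * q2)" using eq by algebra
  then show "j * b2 = k * a2 + m * q2" using g by simp
 qed
 show ?thesis
 proof (rule that[of "s*j" "s*k" "- s*m"])
  show "s * j > 0" using s g jkm by (simp add: zero_less_mult_iff mult.left_commute)
  show "gcd (s*j) (gcd (s*k) (- s*m)) = 1" using s c by auto
  show "s*j * b1 = s*k * a1 - (- s*m) * q1" "s*j * b2 = s*k * a2 - (- s*m) * q2"
   using e by (simp_all add: mult.assoc distrib_left[symmetric])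
 qed
qed

lemma det_zero_on_line:
 fixes q1 a1 b1 q2 a2 b2 q3 a3 b3 j k m :: int
 assumes "q1 * a2 \<noteq> a1 * q2" "j * b1 = k * a1 - m * q1" "j * b2 = k * a2 - m * q2"
  and "q1*(a2*b3 - b2*a3) - a1*(q2*b3 - b2*q3) + b1*(q2*a3 - a2*q3) = 0"
 shows "j * b3 = k * a3 - m * q3"
proof -
 have "(q1*a2 - a1*q2) * (j * b3) = (q1*a2 - a1*q2) * (k * a3 - m * q3)"
  using assms(2-4) by algebra
 then show ?thesis using assms(1) by simp
qed

text \<open>By the line equations j divides k and m times the determinant, and trivially j times it;
  since gcd(j, k, m) = 1 it divides the determinant itself. Hence distinct abscissae on a line of
  height j are at least j/(q1 q2) apart.\<close>

lemma line_spacing: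
 fixes q1 a1 b1 q2 a2 b2 j k m :: int
 assumes "gcd j (gcd k m) = 1" "j * b1 = k * a1 - m * q1" "j * b2 = k * a2 - m * q2"
 shows "j dvd q1 * a2 - a1 * q2"
proof -
 let ?w = "q1 * a2 - a1 * q2"
 have "k * ?w = j * (q1*b2 - b1*q2)" using assms(2,3) by algebra
 then have "j dvd k * ?w" by simp
 moreover have "m * ?w = j * (a1*b2 - b1*a2)" using assms(2,3) by algebra
 then have "j dvd m * ?w" by simp
 ultimately have "j dvd gcd (j * ?w) (gcd (k * ?w) (m * ?w))" by simp
 also have "gcd (j * ?w) (gcd (k * ?w) (m * ?w)) = \<bar>gcd j (gcd k m) * ?w\<bar>"
 proof -
  have "gcd (k * ?w) (m * ?w) = \<bar>?w\<bar> * gcd k m" by (metis gcd_mult_distrib_int mult.commute)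
  then have "gcd (j * ?w) (gcd (k * ?w) (m * ?w)) = gcd (?w * j) (?w * gcd k m)"
   by (metis abs_mult gcd_abs2_int mult.commute abs_abs)
  also have "... = \<bar>?w\<bar> * gcd j (gcd k m)" by (metis gcd_mult_distrib_int)
  finally show ?thesis by (simp add: abs_mult)
 qed
 finally show ?thesis using assms(1) by simp
qed

lemma card_spaced_le:
 fixes S :: "real set"
 assumes "finite S" "g > 0" "T \<ge> 0" "\<And>x. x \<in> S \<Longrightarrow> a \<le> x \<and> x \<le> a + T"
  "\<And>x y. x \<in> S \<Longrightarrow> y \<in> S \<Longrightarrow> x < y \<Longrightarrow> y - x \<ge> g"
 shows "real (card S) \<le> T / g + 1"
proof -
 let ?h = "\<lambda>x. nat \<lfloor>(x - a) / g\<rfloor>"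
 have mono: "?h x \<noteq> ?h y" if "x \<in> S" "y \<in> S" "x < y" for x y
 proof -
  have "(y - a)/g - (x - a)/g = (y - x)/g" by (simp add: diff_divide_distrib)
  moreover have "(y - x)/g \<ge> 1" using assms(5)[OF that] assms(2) by simp
  ultimately have "(y - a)/g \<ge> (x - a)/g + 1" by linarith
  then have "\<lfloor>(y - a)/g\<rfloor> \<ge> \<lfloor>(x - a)/g\<rfloor> + 1" by linarith
  moreover have "\<lfloor>(x - a)/g\<rfloor> \<ge> 0" using assms(4)[OF that(1)] assms(2) by simp
  ultimately show ?thesis by linarith
 qed
 then have "inj_on ?h S" by (intro inj_onI) (metis linorder_neqE_linordered_idom)
 moreover have "?h ` S \<subseteq> {..nat \<lfloor>T/g\<rfloor>}"
 proof clarsimp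
  fix x assume "x \<in> S"
  then have "(x - a)/g \<le> T/g" using assms(2) assms(4)[of x] by (intro divide_right_mono) auto
  then show "nat \<lfloor>(x - a)/g\<rfloor> \<le> nat \<lfloor>T/g\<rfloor>" by (intro nat_mono floor_mono)
 qed
 ultimately have "card S \<le> card {..nat \<lfloor>T/g\<rfloor>}" by (intro card_inj_on_le) auto
 then have "real (card S) \<le> real (nat \<lfloor>T/g\<rfloor>) + 1" by simp
 also have "real (nat \<lfloor>T/g\<rfloor>) \<le> T/g" using assms by simp
 finally show ?thesis by simp
qed

section \<open>Rational points of one dyadic height\<close>

definition near_pts :: "(real \<Rightarrow> real) \<Rightarrow> nat \<Rightarrow> real \<Rightarrow> real \<Rightarrow> real \<Rightarrow> (int \<times> int \<times> int) set" where
 "near_pts f D s R \<rho> = {(q, a, b). int D \<le> q \<and> q < 2 * int D \<and>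
   s \<le> of_int a / of_int q \<and> of_int a / of_int q \<le> s + R \<and>
   \<bar>of_int b - of_int q * f (of_int a / of_int q)\<bar> \<le> \<rho>}"

definition prim_pts :: "(real \<Rightarrow> real) \<Rightarrow> nat \<Rightarrow> real \<Rightarrow> real \<Rightarrow> real \<Rightarrow> (int \<times> int \<times> int) set" where
 "prim_pts f D s R \<rho> = {(q, a, b) \<in> near_pts f D s R \<rho>. gcd q (gcd a b) = 1}"

text \<open>A crude bound that settles finiteness and the heights below the threshold of the
  induction. Subtracting the two ceilings moves a and b into boxes with 2 D + 1 and 3
  elements.\<close>

lemma near_pts_trivial:
 assumes "D \<ge> 1" "R \<le> 1" "\<rho> \<le> 1"
 shows "finite (near_pts f D s R \<rho>)" "card (near_pts f D s R \<rho>) \<le> D * (2*D+1) * 3"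
proof -
 let ?S = "near_pts f D s R \<rho>"
 define \<phi> :: "int \<times> int \<times> int \<Rightarrow> int \<times> int \<times> int" where
  "\<phi> = (\<lambda>(q, a, b). (q, a - \<lceil>s * of_int q\<rceil>, b - \<lceil>of_int q * f (of_int a / of_int q) - \<rho>\<rceil>))"
 let ?T = "{int D..<2*int D} \<times> {0..2*int D} \<times> {0..2::int}"
 have inj: "inj_on \<phi> ?S" unfolding \<phi>_def inj_on_def by (auto simp: case_prod_beta)
 have sub: "\<phi> ` ?S \<subseteq> ?T"
 proof safe
  fix q a b q' a' b' assume p: "(q, a, b) \<in> ?S" "(q', a', b') = \<phi> (q, a, b)"
  have q: "int D \<le> q" "q < 2 * int D" using p by (auto simp: near_pts_def)
  then have q0: "real_of_int q > 0" using assms by linarith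
  have q2: "real_of_int q \<le> 2 * real D" using q by linarith
  have a: "s * q \<le> a" "a \<le> (s + R) * q" using p q0 by (auto simp: near_pts_def field_simps)
  have "R * q \<le> 1 * (2 * real D)" using assms q0 q2 by (intro mult_mono) auto
  then have a2: "real_of_int a \<le> s * q + 2 * real D" using a by (simp add: algebra_simps)
  have b: "of_int q * f (of_int a / of_int q) - \<rho> \<le> b" "b \<le> of_int q * f (of_int a / of_int q) - \<rho> + 2"
   using p assms by (auto simp: near_pts_def)
  have "a - \<lceil>s * of_int q\<rceil> \<ge> 0" "b - \<lceil>of_int q * f (of_int a / of_int q) - \<rho>\<rceil> \<ge> 0"
   using a(1) b(1) by (simp_all add: ceiling_le_iff)
  moreover have "a - \<lceil>s * of_int q\<rceil> \<le> 2 * int D" using a2 by linarith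
  moreover have "b - \<lceil>of_int q * f (of_int a / of_int q) - \<rho>\<rceil> \<le> 2" using b(2) by linarith
  ultimately show "q' \<in> {int D..<2*int D}" "a' \<in> {0..2*int D}" "b' \<in> {0..2}"
   using p q by (auto simp: \<phi>_def)
 qed
 have fT: "finite ?T" by simp
 show "finite ?S" using inj sub fT by (metis finite_imageD finite_subset)
 have "card ?S \<le> card ?T" using inj sub fT by (metis card_inj_on_le)
 also have "card ?T = D * (2*D+1) * 3" by (simp add: card_cartesian_product nat_add_distrib nat_mult_distrib algebra_simps)
 finally show "card ?S \<le> D * (2*D+1) * 3" .
qed

lemma prim_pts_subset: "prim_pts f D s R \<rho> \<subseteq> near_pts f D s R \<rho>"
 unfolding prim_pts_def by auto

lemma prim_pts_trivial:
 assumes "D \<ge> 1" "R \<le> 1" "\<rho> \<le> 1"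
 shows "finite (prim_pts f D s R \<rho>)" "card (prim_pts f D s R \<rho>) \<le> D * (2*D+1) * 3"
 using near_pts_trivial[OF assms] prim_pts_subset
 by (meson finite_subset card_mono le_trans)+

abbreviation abscissa :: "int \<times> int \<times> int \<Rightarrow> real" where
 "abscissa p \<equiv> (case p of (q, a, b) \<Rightarrow> of_int a / of_int q)"

definition on_line :: "int \<times> int \<times> int \<Rightarrow> int \<times> int \<times> int \<Rightarrow> bool" where
 "on_line l p = (case l of (j, k, m) \<Rightarrow> case p of (q, a, b) \<Rightarrow> j * b = k * a - m * q)"

lemma near_pts_bounds:
 assumes "(q, a, b) \<in> near_pts f D s R \<rho>" "D \<ge> 1"
 shows "q > 0" "real D \<le> of_int q" "of_int q < 2 * real D"
  "\<bar>of_int b / of_int q - f (of_int a / of_int q)\<bar> \<le> \<rho> / real D"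
proof -
 have q: "int D \<le> q" "q < 2 * int D" "\<bar>of_int b - of_int q * f (of_int a / of_int q)\<bar> \<le> \<rho>"
  using assms by (auto simp: near_pts_def)
 show q': "q > 0" "real D \<le> of_int q" "of_int q < 2 * real D" using q assms by linarith+
 have "\<rho> \<ge> 0" using q(3) by linarith
 have "\<bar>of_int b / of_int q - f (of_int a / of_int q)\<bar>
   = \<bar>of_int b - of_int q * f (of_int a / of_int q)\<bar> / of_int q"
 proof -
  have "of_int b / of_int q - f (of_int a / of_int q) = (of_int b - of_int q * f (of_int a / of_int q)) / of_int q"
   using q' by (simp add: diff_divide_distrib)
  then show ?thesis using q' by simp
 qed
 also have "... \<le> \<rho> / real D" using q(3) q' assms \<open>\<rho> \<ge> 0\<close> by (intro frac_le) auto
 finally show "\<bar>of_int b / of_int q - f (of_int a / of_int q)\<bar> \<le> \<rho> / real D" .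
qed

text \<open>Two ordinates over one abscissa differ by a multiple of 1/(q q'), hence by at least 1/(4
  D^2) if at all, but also by at most 2\<rho>/D; 8 D \<rho> < 1 separates the two. Proportional
  primitive vectors with positive q then coincide.\<close>

lemma prim_pts_abscissa_inj:
 assumes "D \<ge> 1" "8 * real D * \<rho> < 1"
 shows "inj_on abscissa (prim_pts f D s R \<rho>)"
proof (rule inj_onI)
 fix u v assume uv: "u \<in> prim_pts f D s R \<rho>" "v \<in> prim_pts f D s R \<rho>" "abscissa u = abscissa v"
 obtain q a b q' a' b' where uv': "u = (q, a, b)" "v = (q', a', b')" by (cases u, cases v)
 have p: "(q, a, b) \<in> prim_pts f D s R \<rho>" "(q', a', b') \<in> prim_pts f D s R \<rho>"
  and e: "real_of_int a / real_of_int q = real_of_int a' / real_of_int q'"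
  using uv unfolding uv' by auto
 have n: "(q, a, b) \<in> near_pts f D s R \<rho>" "(q', a', b') \<in> near_pts f D s R \<rho>"
  using p prim_pts_subset by blast+
 define x where "x = real_of_int a' / real_of_int q'"
 note B = near_pts_bounds[OF n(1) assms(1)] and B' = near_pts_bounds[OF n(2) assms(1)]
 have D: "real D > 0" using assms by simp
 have aq: "a * q' = a' * q" using e B(1) B'(1) by (simp add: field_simps) (metis of_int_eq_iff of_int_mult mult.commute)
 have bq: "b * q' = b' * q"
 proof (rule ccontr)
  assume "b * q' \<noteq> b' * q"
  then have "\<bar>b * q' - b' * q\<bar> \<ge> 1" by linarith
  then have 1: "1 \<le> \<bar>of_int (b * q' - b' * q) :: real\<bar>" by linarith
  have "1 / (4 * real D^2) \<le> 1 / (of_int q * of_int q')"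
  proof -
   have "of_int q * of_int q' \<le> (2 * real D) * (2 * real D)" using B B' by (intro mult_mono) auto
   moreover have "real_of_int q * of_int q' > 0" using B(1) B'(1) by simp
   ultimately show ?thesis by (intro frac_le) (auto simp: power2_eq_square)
  qed
  also have "... \<le> \<bar>of_int (b * q' - b' * q)\<bar> / (of_int q * of_int q')"
   using 1 B(1) B'(1) by (intro divide_right_mono) auto
  also have "... = \<bar>of_int b / of_int q - of_int b' / of_int q'\<bar>"
  proof -
   have "of_int b / of_int q - of_int b' / of_int q' = of_int (b * q' - b' * q) / (real_of_int q * of_int q')"
    using B(1) B'(1) by (simp add: field_simps)
   then show ?thesis using B(1) B'(1) by (simp add: abs_mult)
  qed
  also have "... \<le> 2 * (\<rho> / real D)" using B(4) B'(4) unfolding e x_def[symmetric] by linarith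
  finally show False using assms D by (simp add: field_simps power2_eq_square)
 qed
 have g: "gcd q (gcd a b) = 1" "gcd q' (gcd a' b') = 1" using p by (auto simp: prim_pts_def)
 have "q * gcd q' (gcd a' b') = q' * gcd q (gcd a b)"
 proof -
  have "q * gcd q' (gcd a' b') = gcd (q * q') (gcd (q * a') (q * b'))"
   using B(1) by (metis abs_of_pos gcd_mult_distrib_int)
  also have "... = gcd (q' * q) (gcd (q' * a) (q' * b))" using aq bq by (simp add: mult.commute)
  also have "... = q' * gcd q (gcd a b)" using B'(1) by (metis abs_of_pos gcd_mult_distrib_int)
  finally show ?thesis .
 qed
 then have "q = q'" using g by simp
 then show "u = v" using aq bq B(1) uv' by simp
qed

lemma near_pts_on_line:
 assumes "(q, a, b) \<in> near_pts f D s R \<rho>" "D \<ge> 1" "j > 0" "on_line (j, k, m) (q, a, b)"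
 shows "\<bar>f (of_int a / of_int q) - (of_int k / of_int j * (of_int a / of_int q) + - of_int m / of_int j)\<bar> \<le> \<rho> / real D"
proof -
 note B = near_pts_bounds[OF assms(1,2)]
 have "of_int j * of_int b = (of_int k * of_int a - of_int m * of_int q :: real)"
  using assms(4) unfolding on_line_def by (simp flip: of_int_mult of_int_diff)
 then have "of_int b / of_int q = of_int k / of_int j * (of_int a / of_int q) + (- of_int m / of_int j :: real)"
  using B(1) assms(3) by (simp add: field_simps)
 then show ?thesis using B(4) by (simp add: abs_minus_commute)
qed

lemma near_pts_spacing:
 assumes "(q, a, b) \<in> near_pts f D s R \<rho>" "(q', a', b') \<in> near_pts f D s R \<rho>" "D \<ge> 1"
  "j > 0" "gcd j (gcd k m) = 1" "on_line (j, k, m) (q, a, b)" "on_line (j, k, m) (q', a', b')"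
  "of_int a / of_int q < (of_int a' / of_int q' :: real)"
 shows "of_int a' / of_int q' - of_int a / of_int q \<ge> of_int j / (4 * real D^2)"
proof -
 note B = near_pts_bounds[OF assms(1,3)] and B' = near_pts_bounds[OF assms(2,3)]
 have "j dvd q * a' - a * q'" by (rule line_spacing[OF assms(5)]) (use assms(6,7) in \<open>auto simp: on_line_def\<close>)
 moreover have e: "of_int a' / of_int q' - of_int a / of_int q = of_int (q * a' - a * q') / (real_of_int q * of_int q')"
  using B(1) B'(1) by (simp add: field_simps)
 have p: "real_of_int q * of_int q' > 0" using B(1) B'(1) by simp
 have "of_int (q * a' - a * q') / (real_of_int q * of_int q') > 0" using e assms(8) by linarith
 then have "real_of_int (q * a' - a * q') > 0" using p zero_less_divide_iff by (metis less_asym)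
 then have "q * a' - a * q' > 0" by linarith
 ultimately have "q * a' - a * q' \<ge> j" by (simp add: zdvd_imp_le)
 then have j: "real_of_int (q * a' - a * q') \<ge> of_int j" by linarith
 have "of_int q * of_int q' \<le> (2 * real D) * (2 * real D)" using B B' by (intro mult_mono) auto
 then have "of_int j / (4 * real D^2) \<le> of_int (q * a' - a * q') / (real_of_int q * of_int q')"
  using j p assms(4) by (intro frac_le) (auto simp: power2_eq_square)
 then show ?thesis using e by simp
qed

text \<open>The determinant is an integer, equal to q1 q2 q3 times the second difference of the
  ordinates. The denominators contribute at most 8 D^3, the curve at most L \<kappa> s0^3/8 and the
  deviations 2\<rho> s0/D, so the two conditions on \<open>s0\<close> leave at most 2/3.\<close>

lemma det_small_sorted:
 assumes lp: "legendre_pair L \<kappa> f f1 g g1" and pos: "\<kappa> > 0" "L \<ge> 1" "D \<ge> 1"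
  and p: "(q1, a1, b1) \<in> near_pts f D s R \<rho>" "(q2, a2, b2) \<in> near_pts f D s R \<rho>" "(q3, a3, b3) \<in> near_pts f D s R \<rho>"
  and x: "of_int a1 / of_int q1 < (of_int a2 / of_int q2 :: real)" "of_int a2 / of_int q2 < (of_int a3 / of_int q3 :: real)"
  and s: "of_int a3 / of_int q3 - of_int a1 / of_int q1 \<le> s0"
   "L * \<kappa> * real D^3 * s0^3 \<le> 1/3" "16 * real D^2 * \<rho> * s0 \<le> 1/3"
 shows "q1*(a2*b3 - b2*a3) - a1*(q2*b3 - b2*q3) + b1*(q2*a3 - a2*q3) = 0"
proof -
 note B1 = near_pts_bounds[OF p(1) pos(3)] and B2 = near_pts_bounds[OF p(2) pos(3)] and B3 = near_pts_bounds[OF p(3) pos(3)]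
 define x1 x2 x3 y1 y2 y3 :: real where xy: "x1 = of_int a1 / of_int q1" "x2 = of_int a2 / of_int q2" "x3 = of_int a3 / of_int q3"
  "y1 = of_int b1 / of_int q1" "y2 = of_int b2 / of_int q2" "y3 = of_int b3 / of_int q3"
 define \<epsilon> where "\<epsilon> = \<rho> / real D"
 have D: "real D > 0" using pos by simp
 let ?det = "q1*(a2*b3 - b2*a3) - a1*(q2*b3 - b2*q3) + b1*(q2*a3 - a2*q3)"
 let ?a = "x2-x1" and ?b = "x3-x2" and ?c = "x3-x1"
 have x': "x1 < x2" "x2 < x3" "?c \<le> s0" using x s unfolding xy by auto
 have e0: "\<epsilon> \<ge> 0" using B1(4) unfolding \<epsilon>_def by linarith
 have "of_int ?det = of_int q1 * of_int q2 * of_int q3 * (?a*(y3 - y2) - ?b*(y2 - y1))"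
  unfolding xy using B1(1) B2(1) B3(1) by (simp add: field_simps)
 then have d1: "\<bar>of_int ?det :: real\<bar> = of_int q1 * of_int q2 * of_int q3 * \<bar>?a*(y3 - y2) - ?b*(y2 - y1)\<bar>"
  using B1(1) B2(1) B3(1) by (simp add: abs_mult)
 have ey: "\<bar>y1 - f x1\<bar> \<le> \<epsilon>" "\<bar>y2 - f x2\<bar> \<le> \<epsilon>" "\<bar>y3 - f x3\<bar> \<le> \<epsilon>"
  using B1(4) B2(4) B3(4) unfolding xy \<epsilon>_def by auto
 let ?F = "?a*(f x3 - f x2) - ?b*(f x2 - f x1)"
 have "?a*(y3 - y2) - ?b*(y2 - y1) = ?F + ?a * ((y3 - f x3) - (y2 - f x2)) - ?b * ((y2 - f x2) - (y1 - f x1))"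
  by (simp add: algebra_simps)
 moreover have "\<bar>?a * ((y3 - f x3) - (y2 - f x2))\<bar> \<le> ?a * (2*\<epsilon>)" "\<bar>?b * ((y2 - f x2) - (y1 - f x1))\<bar> \<le> ?b * (2*\<epsilon>)"
  unfolding abs_mult using x' ey by (auto intro!: mult_mono)
 moreover have "?a * (2*\<epsilon>) + ?b * (2*\<epsilon>) = 2*\<epsilon>*?c" by (simp add: algebra_simps)
 ultimately have "\<bar>?a*(y3 - y2) - ?b*(y2 - y1)\<bar> \<le> \<bar>?F\<bar> + 2*\<epsilon>*?c" by linarith
 also have "\<bar>?F\<bar> \<le> L*\<kappa>/2 * ?a * ?b * ?c"
 proof -
  have "\<kappa>/(2*L) * ?a * ?b * ?c \<ge> 0" using x' pos by simp
  then show ?thesis using legendre_second_diff[OF lp x'(1,2)] by linarith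
 qed
 also have "... \<le> L*\<kappa>/8 * s0^3"
 proof -
  have "4 * (?a * ?b) \<le> ?c^2"
  proof -
   have "?c^2 - 4 * (?a * ?b) = (?a - ?b)^2" by (simp add: power2_eq_square algebra_simps)
   then show ?thesis by (metis diff_ge_0_iff_ge zero_le_power2)
  qed
  then have "L*\<kappa>/8 * ?c * (4 * (?a * ?b)) \<le> L*\<kappa>/8 * ?c * ?c^2" using x' pos by (intro mult_left_mono) auto
  moreover have "?c^3 \<le> s0^3" using x' by (intro power_mono) auto
  then have "L*\<kappa>/8 * ?c^3 \<le> L*\<kappa>/8 * s0^3" using pos by (intro mult_left_mono) auto
  moreover have "L*\<kappa>/8 * ?c * (4 * (?a * ?b)) = L*\<kappa>/2 * ?a * ?b * ?c" "L*\<kappa>/8 * ?c * ?c^2 = L*\<kappa>/8 * ?c^3"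
   by (simp_all add: power2_eq_square power3_eq_cube)
  ultimately show ?thesis by linarith
 qed
 also have "2*\<epsilon>*?c \<le> 2*\<epsilon> * s0" using x' e0 by (intro mult_left_mono) auto
 finally have d2: "\<bar>?a*(y3 - y2) - ?b*(y2 - y1)\<bar> \<le> L*\<kappa>/8 * s0^3 + 2*\<epsilon> * s0" by linarith
 have q3: "of_int q1 * of_int q2 * of_int q3 \<le> (2*real D) * (2*real D) * (2*real D)"
  using B1 B2 B3 by (intro mult_mono) auto
 have "\<bar>of_int ?det :: real\<bar> \<le> ((2*real D) * (2*real D) * (2*real D)) * (L*\<kappa>/8 * s0^3 + 2*\<epsilon> * s0)"
  unfolding d1 by (rule mult_mono[OF q3 d2]) auto
 also have "... = L * \<kappa> * real D^3 * s0^3 + 16 * real D^2 * \<rho> * s0"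
  unfolding \<epsilon>_def using D by (simp add: power2_eq_square power3_eq_cube field_simps)
 also have "... < 1" using s by linarith
 finally have "\<bar>?det\<bar> < 1" by linarith
 then show ?thesis by linarith
qed

text \<open>Permuting the points changes at most the sign, and points with equal abscissa coincide,
  so the sorted case suffices.\<close>

lemma det_small:
 assumes lp: "legendre_pair L \<kappa> f f1 g g1" and pos: "\<kappa> > 0" "L \<ge> 1" "D \<ge> 1" "8 * real D * \<rho> < 1"
  and p: "(q1, a1, b1) \<in> prim_pts f D s R \<rho>" "(q2, a2, b2) \<in> prim_pts f D s R \<rho>" "(q3, a3, b3) \<in> prim_pts f D s R \<rho>"
  and x: "\<bar>of_int a2 / of_int q2 - of_int a1 / of_int q1\<bar> \<le> s0" "\<bar>of_int a3 / of_int q3 - of_int a1 / of_int q1\<bar> \<le> s0"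
    "\<bar>of_int a3 / of_int q3 - of_int a2 / of_int q2\<bar> \<le> s0"
  and s: "L * \<kappa> * real D^3 * s0^3 \<le> 1/3" "16 * real D^2 * \<rho> * s0 \<le> 1/3"
 shows "q1*(a2*b3 - b2*a3) - a1*(q2*b3 - b2*q3) + b1*(q2*a3 - a2*q3) = 0"
proof -
 define x1 x2 x3 :: real where xs: "x1 = of_int a1 / of_int q1" "x2 = of_int a2 / of_int q2" "x3 = of_int a3 / of_int q3"
 have n: "(q1, a1, b1) \<in> near_pts f D s R \<rho>" "(q2, a2, b2) \<in> near_pts f D s R \<rho>" "(q3, a3, b3) \<in> near_pts f D s R \<rho>"
  using p prim_pts_subset by blast+
 have inj: "u = v" if "u \<in> prim_pts f D s R \<rho>" "v \<in> prim_pts f D s R \<rho>" "abscissa u = abscissa v" for u v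
  using prim_pts_abscissa_inj[OF pos(3,4)] that unfolding inj_on_def by blast
 note S = det_small_sorted[OF lp pos(1,2,3) _ _ _ _ _ _ s]
 have x': "x2 - x1 \<le> s0" "x1 - x2 \<le> s0" "x3 - x1 \<le> s0" "x1 - x3 \<le> s0" "x3 - x2 \<le> s0" "x2 - x3 \<le> s0"
  using x unfolding xs by auto
 consider "x1 = x2" | "x1 = x3" | "x2 = x3" | "x1 < x2" "x2 < x3" | "x1 < x3" "x3 < x2" | "x2 < x1" "x1 < x3"
  | "x2 < x3" "x3 < x1" | "x3 < x1" "x1 < x2" | "x3 < x2" "x2 < x1" by linarith
 then show ?thesis
 proof cases
  case 1
  then have "q1 = q2" "a1 = a2" "b1 = b2" using inj[OF p(1,2)] by (simp_all add: xs)
  then show ?thesis by (simp add: algebra_simps)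
 next
  case 2
  then have "q1 = q3" "a1 = a3" "b1 = b3" using inj[OF p(1,3)] by (simp_all add: xs)
  then show ?thesis by (simp add: algebra_simps)
 next
  case 3
  then have "q2 = q3" "a2 = a3" "b2 = b3" using inj[OF p(2,3)] by (simp_all add: xs)
  then show ?thesis by (simp add: algebra_simps)
 next
  case 4 show ?thesis by (rule S[OF n(1,2,3) 4(1)[unfolded xs] 4(2)[unfolded xs] x'(3)[unfolded xs]])
 next
  case 5 show ?thesis using S[OF n(1,3,2) 5(1)[unfolded xs] 5(2)[unfolded xs] x'(1)[unfolded xs]] by algebra
 next
  case 6 show ?thesis using S[OF n(2,1,3) 6(1)[unfolded xs] 6(2)[unfolded xs] x'(5)[unfolded xs]] by algebra
 next
  case 7 show ?thesis using S[OF n(2,3,1) 7(1)[unfolded xs] 7(2)[unfolded xs] x'(2)[unfolded xs]] by algebra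
 next
  case 8 show ?thesis using S[OF n(3,1,2) 8(1)[unfolded xs] 8(2)[unfolded xs] x'(6)[unfolded xs]] by algebra
 next
  case 9 show ?thesis using S[OF n(3,2,1) 9(1)[unfolded xs] 9(2)[unfolded xs] x'(4)[unfolded xs]] by algebra
 qed
qed

text \<open>Rational lines carrying at least three primitive points, as points near the dual curve.\<close>

definition dual_lines ::
 "real \<Rightarrow> real \<Rightarrow> (real \<Rightarrow> real) \<Rightarrow> (real \<Rightarrow> real) \<Rightarrow> nat \<Rightarrow> real \<Rightarrow> real \<Rightarrow> real \<Rightarrow> (int \<times> int \<times> int) set" where
 "dual_lines L \<kappa> f1 g D s R \<rho> = {(j, k, m). 1 \<le> j \<and> of_int j \<le> 8 * real D^2 * sqrt (L * (\<rho> / real D) / \<kappa>) \<and>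
   gcd j (gcd k m) = 1 \<and> f1 s - 8 * real D * \<rho> \<le> of_int k / of_int j \<and>
   of_int k / of_int j \<le> f1 (s + R) + 8 * real D * \<rho> \<and>
   \<bar>of_int m - of_int j * g (of_int k / of_int j)\<bar> \<le> 128 * L * \<rho>^2 * real D^2 / (\<kappa> * of_int j)}"

text \<open>By the gap bound every point on the line is within \<open>T\<close> of the leftmost or
  of the rightmost one, and the points are spaced by j/(4 D^2). The quotient of \<open>T\<close> and
  the spacing is exactly H0/j, which is at least 1, so the two extra units are absorbed in 4
  H0/j.\<close>

lemma card_on_line_le:
 assumes lp: "legendre_pair L \<kappa> f f1 g g1" and pos: "\<kappa> > 0" "L \<ge> 1" "D \<ge> 1" "8 * real D * \<rho> < 1" "\<rho> \<ge> 0" "R \<le> 1"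
  and j: "j \<ge> 1" "gcd j (gcd k m) = 1" "of_int j \<le> H0" and H0: "H0 = 8 * real D^2 * sqrt (L * (\<rho> / real D) / \<kappa>)"
 shows "real (card {p \<in> prim_pts f D s R \<rho>. on_line (j, k, m) p}) \<le> 4 * H0 / of_int j"
proof -
 define P where "P = {p \<in> prim_pts f D s R \<rho>. on_line (j, k, m) p}"
 define X where "X = abscissa ` P"
 define T where "T = 2 * sqrt (L * (\<rho> / real D) / \<kappa>)"
 define g0 where "g0 = of_int j / (4 * real D^2)"
 have D: "real D > 0" using pos by simp
 have r1: "\<rho> \<le> 1" using pos(4,5) D
 proof -
  have "\<rho> * 1 \<le> \<rho> * (8 * real D)" using pos by (intro mult_left_mono) auto
  then show ?thesis using pos by (simp add: mult.commute)
 qed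
 have T0: "T \<ge> 0" unfolding T_def using pos by simp
 have T2: "T^2 = 4 * L * (\<rho> / real D) / \<kappa>" unfolding T_def using pos by (simp add: power_mult_distrib)
 have g0: "g0 > 0" unfolding g0_def using D j by simp
 have Tg: "T / g0 = H0 / of_int j" unfolding T_def g0_def H0 using D j by (simp add: field_simps)
 have finP: "finite P" unfolding P_def using prim_pts_trivial(1)[OF pos(3,6) r1] by simp
 have injX: "inj_on abscissa P" using prim_pts_abscissa_inj[OF pos(3,4)] unfolding P_def by (rule inj_on_subset) auto
 have near: "\<bar>f x - (of_int k / of_int j * x + - of_int m / of_int j)\<bar> \<le> \<rho> / real D" if xX: "x \<in> X" for x
 proof -
  obtain q a b where p: "(q, a, b) \<in> prim_pts f D s R \<rho>" "on_line (j, k, m) (q, a, b)" "x = of_int a / of_int q"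
   using xX unfolding X_def P_def by auto
  then have "(q, a, b) \<in> near_pts f D s R \<rho>" using prim_pts_subset by blast
  from near_pts_on_line[OF this pos(3) _ p(2)] j show ?thesis by (simp add: p(3))
 qed
 have gap: "y - x \<ge> g0" if xy: "x \<in> X" "y \<in> X" "x < y" for x y
 proof -
  obtain q a b where p: "(q, a, b) \<in> prim_pts f D s R \<rho>" "on_line (j, k, m) (q, a, b)" "x = of_int a / of_int q"
   using xy unfolding X_def P_def by auto
  obtain q' a' b' where p': "(q', a', b') \<in> prim_pts f D s R \<rho>" "on_line (j, k, m) (q', a', b')" "y = of_int a' / of_int q'"
   using xy unfolding X_def P_def by auto
  have n: "(q, a, b) \<in> near_pts f D s R \<rho>" "(q', a', b') \<in> near_pts f D s R \<rho>" using p p' prim_pts_subset by blast+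
  show ?thesis unfolding g0_def p(3) p'(3)
   by (rule near_pts_spacing[OF n pos(3) _ j(2) p(2) p'(2)]) (use j xy p p' in auto)
 qed
 show ?thesis
 proof (cases "X = {}")
  case True
  then have "P = {}" unfolding X_def by simp
  moreover have "H0 / of_int j \<ge> 0" using Tg T0 g0 by (metis divide_nonneg_pos)
  ultimately show ?thesis by (simp add: P_def[symmetric])
 next
  case False
  have finX: "finite X" unfolding X_def using finP by simp
  define a b where "a = Min X" and "b = Max X"
  have ab: "a \<in> X" "b \<in> X" "\<And>x. x \<in> X \<Longrightarrow> a \<le> x \<and> x \<le> b" unfolding a_def b_def using finX False by auto
  define X1 X2 where "X1 = {x \<in> X. x \<le> a + T}" and "X2 = {x \<in> X. b - T \<le> x}"
  have "X = X1 \<union> X2"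
  proof -
   have "x \<in> X1 \<or> x \<in> X2" if "x \<in> X" for x
   proof (rule ccontr)
    assume "\<not> ?thesis"
    then have c: "x - a > T" "b - x > T" using that unfolding X1_def X2_def by auto
    then have "a < x" "x < b" using T0 by auto
    from legendre_collinear_gaps[OF lp pos(1,2) this near[OF ab(1)] near[OF that] near[OF ab(2)]]
    have "(x - a) * (b - x) \<le> T^2" unfolding T2 by simp
    moreover have "(x - a) * (b - x) > T * T" using c T0 by (intro mult_strict_mono) auto
    ultimately show False by (simp add: power2_eq_square)
   qed
   then show ?thesis unfolding X1_def X2_def by auto
  qed
  then have "card X \<le> card X1 + card X2" by (metis card_Un_le)
  moreover have "real (card X1) \<le> T / g0 + 1"
   by (rule card_spaced_le[where a = a]) (use finX g0 T0 ab gap in \<open>auto simp: X1_def\<close>)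
  moreover have "real (card X2) \<le> T / g0 + 1"
   by (rule card_spaced_le[where a = "b - T"]) (use finX g0 T0 ab gap in \<open>auto simp: X2_def\<close>)
  moreover have "card X = card P" unfolding X_def by (rule card_image[OF injX])
  ultimately have "real (card P) \<le> 2 * (H0 / of_int j) + 2" unfolding Tg by linarith
  moreover have "H0 / of_int j \<ge> 1" using j by simp
  ultimately show ?thesis unfolding P_def by simp
 qed
qed

text \<open>All determinants on the arc vanish, so its points lie on the line through two of them.
  Three points on this line force it to be nearly tangent; this bounds its height, locates its slope
  and puts it near the dual curve.\<close>

lemma heavy_arc_line:
 assumes lp: "legendre_pair L \<kappa> f f1 g g1" and pos: "\<kappa> > 0" "L \<ge> 1" "D \<ge> 1" "8 * real D * \<rho> < 1" "\<rho> \<ge> 0"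
  and s: "L * \<kappa> * real D^3 * s0^3 \<le> 1/3" "16 * real D^2 * \<rho> * s0 \<le> 1/3"
  and A: "A \<subseteq> prim_pts f D s R \<rho>" "finite A" "card A \<ge> 3"
   "\<And>p p'. p \<in> A \<Longrightarrow> p' \<in> A \<Longrightarrow> \<bar>abscissa p - abscissa p'\<bar> \<le> s0"
 shows "\<exists>l \<in> dual_lines L \<kappa> f1 g D s R \<rho>. \<forall>p \<in> A. on_line l p"
proof -
 have D: "real D > 0" using pos by simp
 have injA: "inj_on abscissa A" using prim_pts_abscissa_inj[OF pos(3,4)] A(1) by (rule inj_on_subset)
 define X where "X = abscissa ` A"
 have finX: "finite X" "card X \<ge> 3" unfolding X_def using A card_image[OF injA] by auto
 obtain x1 x2 x3 where x: "x1 \<in> X" "x2 \<in> X" "x3 \<in> X" "x1 < x2" "x2 < x3"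
 proof -
  have ne: "X \<noteq> {}" using finX by auto
  have "\<not> X \<subseteq> {Min X, Max X}"
  proof
   assume "X \<subseteq> {Min X, Max X}"
   then have "card X \<le> card {Min X, Max X}" by (intro card_mono) auto
   also have "... \<le> 2" by (simp add: card_insert_if)
   finally show False using finX by simp
  qed
  then obtain y where y: "y \<in> X" "y \<noteq> Min X" "y \<noteq> Max X" by auto
  then have "Min X < y" "y < Max X" using finX Min_le[OF finX(1) y(1)] Max_ge[OF finX(1) y(1)] by linarith+
  then show ?thesis using that[of "Min X" y "Max X"] y ne finX by auto
 qed
 obtain q1 a1 b1 where p1: "(q1, a1, b1) \<in> A" "x1 = of_int a1 / of_int q1" using x(1) unfolding X_def by auto
 obtain q2 a2 b2 where p2: "(q2, a2, b2) \<in> A" "x2 = of_int a2 / of_int q2" using x(2) unfolding X_def by auto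
 obtain q3 a3 b3 where p3: "(q3, a3, b3) \<in> A" "x3 = of_int a3 / of_int q3" using x(3) unfolding X_def by auto
 have n: "(q1, a1, b1) \<in> near_pts f D s R \<rho>" "(q2, a2, b2) \<in> near_pts f D s R \<rho>" "(q3, a3, b3) \<in> near_pts f D s R \<rho>"
  using p1 p2 p3 A(1) prim_pts_subset by blast+
 note B1 = near_pts_bounds[OF n(1) pos(3)] and B2 = near_pts_bounds[OF n(2) pos(3)]
 have "q1 * a2 \<noteq> a1 * q2"
 proof
  assume "q1 * a2 = a1 * q2"
  then have "real_of_int q1 * of_int a2 = of_int a1 * of_int q2" by (simp flip: of_int_mult)
  then have "x1 = x2" unfolding p1 p2 using B1(1) B2(1) by (simp add: field_simps)
  then show False using x by simp
 qed
 then obtain j k m where l: "j > 0" "gcd j (gcd k m) = 1" "j * b1 = k * a1 - m * q1" "j * b2 = k * a2 - m * q2"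
  using line_through_points by blast
 have on: "on_line (j, k, m) p" if "p \<in> A" for p
 proof -
  obtain q a b where p: "p = (q, a, b)" by (cases p)
  have "q1*(a2*b - b2*a) - a1*(q2*b - b2*q) + b1*(q2*a - a2*q) = 0"
  proof (rule det_small[OF lp pos(1-4) _ _ _ _ _ _ s])
   show "(q1, a1, b1) \<in> prim_pts f D s R \<rho>" "(q2, a2, b2) \<in> prim_pts f D s R \<rho>" "(q, a, b) \<in> prim_pts f D s R \<rho>"
    using p1 p2 that p A(1) by auto
  qed (use A(4)[OF p1(1) p2(1)] A(4)[OF that p1(1)] A(4)[OF that p2(1)] in \<open>auto simp: p abs_minus_commute\<close>)
  from det_zero_on_line[OF \<open>q1 * a2 \<noteq> a1 * q2\<close> l(3,4) this] show ?thesis by (simp add: on_line_def p)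
 qed
 define \<epsilon> where "\<epsilon> = \<rho> / real D"
 define l0 where "l0 = of_int j / (4 * real D^2)"
 have l0: "l0 > 0" unfolding l0_def using l D by simp
 let ?A = "of_int k / of_int j :: real" and ?B = "- of_int m / of_int j :: real"
 have gaps: "x2 - x1 \<ge> l0" "x3 - x2 \<ge> l0" unfolding l0_def p1(2) p2(2) p3(2)
  using near_pts_spacing[OF n(1,2) pos(3) l(1,2) on[OF p1(1)] on[OF p2(1)]]
   near_pts_spacing[OF n(2,3) pos(3) l(1,2) on[OF p2(1)] on[OF p3(1)]] x p1 p2 p3 by auto
 have close: "\<bar>f x1 - (?A * x1 + ?B)\<bar> \<le> \<epsilon>" "\<bar>f x2 - (?A * x2 + ?B)\<bar> \<le> \<epsilon>" "\<bar>f x3 - (?A * x3 + ?B)\<bar> \<le> \<epsilon>"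
  unfolding \<epsilon>_def p1(2) p2(2) p3(2)
  by (rule near_pts_on_line[OF n(1) pos(3) l(1) on[OF p1(1)]] near_pts_on_line[OF n(2) pos(3) l(1) on[OF p2(1)]]
    near_pts_on_line[OF n(3) pos(3) l(1) on[OF p3(1)]])+
 \<comment> \<open>Both gaps are at least the spacing l0 = j/(4 D^2), while their product is at most
   4 L \<epsilon>/\<kappa>. This is where the bound on j in \<open>dual_lines\<close> comes
   from.\<close>
 have "l0 * l0 \<le> (x2 - x1) * (x3 - x2)" using gaps l0 by (intro mult_mono) auto
 also have "... \<le> 4 * L * \<epsilon> / \<kappa>" by (rule legendre_collinear_gaps[OF lp pos(1,2) x(4,5) close])
 finally have "l0^2 \<le> 4 * (L * \<epsilon> / \<kappa>)" by (simp add: power2_eq_square)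
 then have "l0 \<le> sqrt (4 * (L * \<epsilon> / \<kappa>))" using l0 by (simp add: real_le_rsqrt)
 also have "... = 2 * sqrt (L * \<epsilon> / \<kappa>)" by (simp only: real_sqrt_mult) simp
 finally have jH: "of_int j \<le> 8 * real D^2 * sqrt (L * \<epsilon> / \<kappa>)" unfolding l0_def using D by (simp add: field_simps)
 \<comment> \<open>The middle point serves as \<open>u\<close>. As \<open>v\<close> one takes the
   outer point on the side away from the tangent point \<open>g1 ?A\<close>, which is what the
   condition \<open>side\<close> asks for.\<close>
 have tang: "\<bar>f1 x2 - ?A\<bar> \<le> 2*\<epsilon>/l0 \<and> \<bar>g ?A + ?B\<bar> \<le> \<epsilon> + (2*\<epsilon>/l0)^2 * L/\<kappa>"
 proof (cases "g1 ?A \<le> x2")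
  case True
  then show ?thesis using legendre_pair_near_tangent[OF lp pos(1,2) l0 _ close(2,3)] gaps x by auto
 next
  case False
  then show ?thesis using legendre_pair_near_tangent[OF lp pos(1,2) l0 _ close(2,1)] gaps x by auto
 qed
 have el: "2*\<epsilon>/l0 = 8 * real D * \<rho> / of_int j" unfolding \<epsilon>_def l0_def using D l by (simp add: field_simps power2_eq_square)
 have j1: "real_of_int j \<ge> 1" using l by linarith
 have slack: "2*\<epsilon>/l0 \<le> 8 * real D * \<rho>" unfolding el using j1 pos D divide_left_mono[OF j1, of "8 * real D * \<rho>"] by simp
 have xr: "s \<le> x2" "x2 \<le> s + R" using n(2) p2(2) by (auto simp: near_pts_def)
 have mono: "f1 x \<le> f1 y" if "x \<le> y" for x y
 proof -
  have "0 \<le> \<kappa> / L * (y - x)" using pos that by simp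
  then show ?thesis using legendre_deriv_ge[OF lp that] by linarith
 qed
 have rng: "f1 s - 8 * real D * \<rho> \<le> ?A" "?A \<le> f1 (s + R) + 8 * real D * \<rho>"
  using tang slack mono[OF xr(1)] mono[OF xr(2)] by linarith+
 have "\<bar>of_int m - of_int j * g ?A\<bar> = of_int j * \<bar>g ?A + ?B\<bar>"
 proof -
  have "of_int m - of_int j * g ?A = - (of_int j * (g ?A + ?B))" using l by (simp add: field_simps)
  then show ?thesis using l by (simp add: abs_mult)
 qed
 also have "... \<le> of_int j * (\<epsilon> + (2*\<epsilon>/l0)^2 * L/\<kappa>)" using tang l by (intro mult_left_mono) auto
 also have "... \<le> 128 * L * \<rho>^2 * real D^2 / (\<kappa> * of_int j)"
 proof -
  \<comment> \<open>The bound on j makes the first summand comparable with the second: each is at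
    most 64 L \<rho>^2 D^2/(\<kappa> j), whence the constant 128 in
    \<open>dual_lines\<close>.\<close>
  have "(of_int j)^2 \<le> (8 * real D^2 * sqrt (L * \<epsilon> / \<kappa>))^2" using jH l by (intro power_mono) auto
  also have "... = 64 * real D^4 * (L * \<epsilon> / \<kappa>)" using pos D by (simp add: power_mult_distrib \<epsilon>_def flip: power_mult)
  finally have j2: "(of_int j)^2 * \<epsilon> \<le> 64 * real D^4 * (L * \<epsilon> / \<kappa>) * \<epsilon>" using pos D by (intro mult_right_mono) (auto simp: \<epsilon>_def)
  also have "... = 64 * L * \<rho>^2 * real D^2 / \<kappa>" unfolding \<epsilon>_def using D by (simp add: power2_eq_square power4_eq_xxxx field_simps)
  finally have j3: "(of_int j)^2 * \<epsilon> \<le> 64 * L * \<rho>^2 * real D^2 / \<kappa>" .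
  have "(of_int j)^2 * \<epsilon> + (8 * real D * \<rho>)^2 * L / \<kappa> \<le> 128 * L * \<rho>^2 * real D^2 / \<kappa>"
  proof -
   have "(8 * real D * \<rho>)^2 * L / \<kappa> = 64 * L * \<rho>^2 * real D^2 / \<kappa>" by (simp add: power_mult_distrib)
   moreover have "128 * L * \<rho>^2 * real D^2 / \<kappa> = 64 * L * \<rho>^2 * real D^2 / \<kappa> + 64 * L * \<rho>^2 * real D^2 / \<kappa>"
    by (simp add: add_divide_distrib[symmetric])
   ultimately show ?thesis using j3 by linarith
  qed
  then have "((of_int j)^2 * \<epsilon> + (8 * real D * \<rho>)^2 * L / \<kappa>) / of_int j \<le> 128 * L * \<rho>^2 * real D^2 / \<kappa> / of_int j"
   using l by (intro divide_right_mono) auto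
  moreover have "of_int j * (\<epsilon> + (2*\<epsilon>/l0)^2 * L/\<kappa>) = ((of_int j)^2 * \<epsilon> + (8 * real D * \<rho>)^2 * L / \<kappa>) / of_int j"
   unfolding el using l pos by (simp add: field_simps power2_eq_square)
  ultimately show ?thesis by simp
 qed
 finally have "(j, k, m) \<in> dual_lines L \<kappa> f1 g D s R \<rho>"
  unfolding dual_lines_def using l jH rng \<epsilon>_def by auto
 then show ?thesis using on by blast
qed

lemma sum_UN_le:
 fixes w :: "'a \<Rightarrow> real"
 assumes "finite I" "\<And>i. i \<in> I \<Longrightarrow> finite (A i)" "\<And>x. w x \<ge> 0"
 shows "sum w (\<Union>i\<in>I. A i) \<le> (\<Sum>i\<in>I. sum w (A i))"
 using assms(1,2)
proof (induction I rule: finite_induct)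
 case (insert i I)
 have "sum w (A i \<union> (\<Union>i\<in>I. A i)) \<le> sum w (A i) + sum w (\<Union>i\<in>I. A i)"
  using sum.union_inter[of "A i" "\<Union>i\<in>I. A i" w] insert sum_nonneg[of "A i \<inter> (\<Union>i\<in>I. A i)" w] assms(3)
  by auto
 then show ?case using insert by auto
qed auto

text \<open>The window is cut into at most R/s0 + 1 arcs of length \<open>s0\<close>. Arcs with at
  most two points cost two each; the points of all other arcs lie on lines of the dual set, each of
  which carries at most 4 H0/j points.\<close>

lemma prim_pts_step:
 assumes lp: "legendre_pair L \<kappa> f f1 g g1" and pos: "\<kappa> > 0" "L \<ge> 1" "D \<ge> 1" "8 * real D * \<rho> < 1" "\<rho> \<ge> 0" "R \<ge> 0" "R \<le> 1"
  and s: "s0 > 0" "L * \<kappa> * real D^3 * s0^3 \<le> 1/3" "16 * real D^2 * \<rho> * s0 \<le> 1/3"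
  and fin: "finite (dual_lines L \<kappa> f1 g D s R \<rho>)" and H0: "H0 = 8 * real D^2 * sqrt (L * (\<rho> / real D) / \<kappa>)"
 shows "real (card (prim_pts f D s R \<rho>)) \<le> 2 * (R / s0 + 1) +
  (\<Sum>l\<in>dual_lines L \<kappa> f1 g D s R \<rho>. 4 * H0 / of_int (fst l))"
proof -
 let ?S = "prim_pts f D s R \<rho>" and ?LL = "dual_lines L \<kappa> f1 g D s R \<rho>"
 have D: "real D > 0" using pos by simp
 have r1: "\<rho> \<le> 1"
 proof -
  have "\<rho> * 1 \<le> \<rho> * (8 * real D)" using pos by (intro mult_left_mono) auto
  then show ?thesis using pos by (simp add: mult.commute)
 qed
 have finS: "finite ?S" by (rule prim_pts_trivial(1)[OF pos(3,7) r1])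
 define idx where "idx p = \<lfloor>(abscissa p - s) / s0\<rfloor>" for p
 define A where "A i = {p \<in> ?S. idx p = i}" for i
 define Lt where "Lt = {i \<in> {0..\<lfloor>R / s0\<rfloor>}. card (A i) \<le> 2}"
 have sub: "?S \<subseteq> (\<Union>i\<in>Lt. A i) \<union> (\<Union>l\<in>?LL. {p \<in> ?S. on_line l p})"
 proof
  fix p assume p: "p \<in> ?S"
  obtain q a b where pq: "p = (q, a, b)" by (cases p)
  have n: "(q, a, b) \<in> near_pts f D s R \<rho>" using p prim_pts_subset unfolding pq by blast
  then have x: "0 \<le> abscissa p - s" "abscissa p - s \<le> R" unfolding pq near_pts_def by auto
  have i: "idx p \<in> {0..\<lfloor>R / s0\<rfloor>}" unfolding idx_def using x s(1) by (auto intro!: floor_mono divide_right_mono)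
  have pA: "p \<in> A (idx p)" unfolding A_def using p by simp
  show "p \<in> (\<Union>i\<in>Lt. A i) \<union> (\<Union>l\<in>?LL. {p \<in> ?S. on_line l p})"
  proof (cases "card (A (idx p)) \<le> 2")
   case True
   then have "idx p \<in> Lt" unfolding Lt_def using i by simp
   then show ?thesis using pA by blast
  next
   case False
   have "\<exists>l \<in> ?LL. \<forall>p \<in> A (idx p). on_line l p"
   proof (rule heavy_arc_line[OF lp pos(1-5) s(2,3)])
    show "A (idx p) \<subseteq> ?S" "finite (A (idx p))" "3 \<le> card (A (idx p))" using False finS by (auto simp: A_def)
   next
    fix u v assume uv: "u \<in> A (idx p)" "v \<in> A (idx p)"
    then have "\<lfloor>(abscissa u - s) / s0\<rfloor> = \<lfloor>(abscissa v - s) / s0\<rfloor>" unfolding A_def idx_def by simp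
    then have "\<bar>(abscissa u - s) / s0 - (abscissa v - s) / s0\<bar> \<le> 1" by linarith
    then have "\<bar>(abscissa u - abscissa v) / s0\<bar> \<le> 1" by (simp add: diff_divide_distrib)
    then show "\<bar>abscissa u - abscissa v\<bar> \<le> s0" using s(1) by (simp add: abs_divide)
   qed
   then show ?thesis using p pA by blast
  qed
 qed
 have "Lt \<subseteq> {0..\<lfloor>R / s0\<rfloor>}" unfolding Lt_def by blast
 then have finLt: "finite Lt" by (rule finite_subset) simp
 have "finite ((\<Union>i\<in>Lt. A i) \<union> (\<Union>l\<in>?LL. {p \<in> ?S. on_line l p}))"
  using finS fin finLt by (auto simp: A_def)
 then have "card ?S \<le> card ((\<Union>i\<in>Lt. A i) \<union> (\<Union>l\<in>?LL. {p \<in> ?S. on_line l p}))"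
  using sub by (rule card_mono)
 also have "... \<le> card (\<Union>i\<in>Lt. A i) + card (\<Union>l\<in>?LL. {p \<in> ?S. on_line l p})" by (rule card_Un_le)
 also have "... \<le> (\<Sum>i\<in>Lt. card (A i)) + (\<Sum>l\<in>?LL. card {p \<in> ?S. on_line l p})"
  by (intro add_mono card_UN_le fin finLt)
 also have "(\<Sum>i\<in>Lt. card (A i)) \<le> card Lt * 2"
 proof -
  have "card (A i) \<le> 2" if "i \<in> Lt" for i using that unfolding Lt_def by simp
  then have "(\<Sum>i\<in>Lt. card (A i)) \<le> (\<Sum>i\<in>Lt. 2)" by (rule sum_mono)
  then show ?thesis by simp
 qed
 finally have "card ?S \<le> card Lt * 2 + (\<Sum>l\<in>?LL. card {p \<in> ?S. on_line l p})" by simp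
 then have 1: "real (card ?S) \<le> real (card Lt * 2 + (\<Sum>l\<in>?LL. card {p \<in> ?S. on_line l p}))"
  by (simp only: of_nat_le_iff)
 have 2: "real (card Lt) \<le> R / s0 + 1"
 proof -
  have "card Lt \<le> card {0..\<lfloor>R / s0\<rfloor>}" by (rule card_mono) (auto simp: Lt_def)
  also have "... = nat (\<lfloor>R / s0\<rfloor> + 1)" by simp
  finally have "real (card Lt) \<le> real (nat (\<lfloor>R / s0\<rfloor> + 1))" by simp
  also have "... \<le> R / s0 + 1" using pos s(1) by simp
  finally show ?thesis .
 qed
 have 3: "(\<Sum>l\<in>?LL. real (card {p \<in> ?S. on_line l p})) \<le> (\<Sum>l\<in>?LL. 4 * H0 / of_int (fst l))"
 proof (rule sum_mono)
  fix l assume l: "l \<in> ?LL"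
  obtain j k m where jkm: "l = (j, k, m)" by (cases l)
  show "real (card {p \<in> ?S. on_line l p}) \<le> 4 * H0 / of_int (fst l)"
   unfolding jkm fst_conv
   by (rule card_on_line_le[OF lp pos(1-5,7) _ _ _ H0]) (use l in \<open>auto simp: jkm dual_lines_def H0\<close>)
 qed
 have "real (card ?S) \<le> 2 * real (card Lt) + (\<Sum>l\<in>?LL. real (card {p \<in> ?S. on_line l p}))"
  using 1 by simp
 also have "... \<le> 2 * (R / s0 + 1) + (\<Sum>l\<in>?LL. 4 * H0 / of_int (fst l))"
  using 2 3 by (intro add_mono mult_left_mono) auto
 finally show ?thesis .
qed

text \<open>The slopes fill an interval of length at most L \<kappa> R + 16 m = (L + 16) m. It is
  cut into windows of length m, the length that the induction prescribes for the dual curve, and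
  heights are sorted dyadically; replacing j by 2^i only enlarges the tolerance.\<close>

lemma dual_lines_cover:
 assumes lp: "legendre_pair L \<kappa> f f1 g g1" and pos: "\<kappa> > 0" "L \<ge> 1" "D \<ge> 1" "\<rho> \<ge> 0"
  and m: "m = min 1 \<kappa>" "R = min 1 (1/\<kappa>)" and Dr: "real D * \<rho> \<le> m"
  and H0: "H0 = 8 * real D^2 * sqrt (L * (\<rho> / real D) / \<kappa>)"
 shows "dual_lines L \<kappa> f1 g D s R \<rho> \<subseteq> (\<Union>(i,t)\<in>{i. 2^i \<le> H0} \<times> {..nat \<lfloor>L\<rfloor> + 16}.
   prim_pts g (2^i) (f1 s - 8 * m + real t * m) m (128 * L * \<rho>^2 * real D^2 / (\<kappa> * 2^i)))"
proof
 fix l assume l: "l \<in> dual_lines L \<kappa> f1 g D s R \<rho>"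
 obtain j k n where jkn: "l = (j, k, n)" by (cases l)
 have d: "1 \<le> j" "of_int j \<le> H0" "gcd j (gcd k n) = 1" "f1 s - 8 * real D * \<rho> \<le> of_int k / of_int j"
   "of_int k / of_int j \<le> f1 (s + R) + 8 * real D * \<rho>"
   "\<bar>of_int n - of_int j * g (of_int k / of_int j)\<bar> \<le> 128 * L * \<rho>^2 * real D^2 / (\<kappa> * of_int j)"
  using l unfolding jkn dual_lines_def H0 by auto
 have mp: "m > 0" "R \<ge> 0" "\<kappa> * R = m" using pos unfolding m by (auto simp: min_def field_simps)
 define y where "y = (of_int k / of_int j :: real)"
 define t where "t = nat \<lfloor>(y - (f1 s - 8 * m)) / m\<rfloor>"
 have y0: "y - (f1 s - 8 * m) \<ge> 0" using d(4) Dr unfolding y_def by linarith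
 have "f1 (s + R) - f1 s \<le> L * \<kappa> * R" using legendre_deriv_le[OF lp, of s "s + R"] mp by simp
 also have "... = L * m" using mp by simp
 finally have y1: "y - (f1 s - 8 * m) \<le> (L + 16) * m" using d(5) Dr unfolding y_def by (simp add: algebra_simps)
 then have "(y - (f1 s - 8 * m)) / m \<le> L + 16" using mp by (simp add: field_simps)
 then have tle: "t \<le> nat \<lfloor>L\<rfloor> + 16" unfolding t_def using pos by linarith
 have t: "real t * m \<le> y - (f1 s - 8 * m)" "y - (f1 s - 8 * m) \<le> real t * m + m"
 proof -
  have "real t \<le> (y - (f1 s - 8 * m)) / m" "(y - (f1 s - 8 * m)) / m \<le> real t + 1" unfolding t_def using y0 mp by (simp_all; linarith)+
  then show "real t * m \<le> y - (f1 s - 8 * m)" "y - (f1 s - 8 * m) \<le> real t * m + m" using mp by (simp_all add: field_simps)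
 qed
 obtain i where i: "2^i \<le> nat j" "nat j < 2^(i+1)"
 proof -
  have "1 \<le> nat j" using d(1) by simp
  from ex_power_ivl1[OF _ this, of 2] show ?thesis using that by auto
 qed
 have i': "2^i \<le> j" "j < 2 * 2^i" 
 proof -
  have "int (2^i) \<le> j" "j < int (2^(i+1))" using i d(1) by linarith+
  then show "2^i \<le> j" "j < 2 * 2^i" by simp_all
 qed
 then have i2: "2^i \<le> real_of_int j" by (metis of_int_le_iff of_int_numeral of_int_power)
 have "128 * L * \<rho>^2 * real D^2 / (\<kappa> * of_int j) \<le> 128 * L * \<rho>^2 * real D^2 / (\<kappa> * 2^i)"
  using i2 pos d(1) by (intro divide_left_mono mult_left_mono) auto
 then have "l \<in> prim_pts g (2^i) (f1 s - 8 * m + real t * m) m (128 * L * \<rho>^2 * real D^2 / (\<kappa> * 2^i))"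
  unfolding jkn prim_pts_def near_pts_def using d i' t y_def by auto
 moreover have "2^i \<le> H0" using i2 d(2) by linarith
 ultimately show "l \<in> (\<Union>(i,t)\<in>{i. 2^i \<le> H0} \<times> {..nat \<lfloor>L\<rfloor> + 16}.
   prim_pts g (2^i) (f1 s - 8 * m + real t * m) m (128 * L * \<rho>^2 * real D^2 / (\<kappa> * 2^i)))"
  using tle by auto
qed

section \<open>Strong induction on the height\<close>

lemma thin_threshold:
 fixes \<eta> L M :: real
 assumes "\<eta> > 0"
 obtains D0 where "D0 \<ge> (1::nat)"
  "\<And>D::nat. D \<ge> D0 \<Longrightarrow> 1024 * L^2 \<le> real D powr \<eta>"
  "\<And>D::nat. D \<ge> D0 \<Longrightarrow> M * (log 2 (real D) + 1) \<le> real D powr (\<eta>/2)"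
proof -
 have "filterlim (\<lambda>D::nat. real D powr \<eta>) at_top at_top" using assms by real_asymp
 then have 1: "eventually (\<lambda>D::nat. 1024 * L^2 \<le> real D powr \<eta>) at_top" by (auto simp: filterlim_at_top)
 have "((\<lambda>D::nat. M * (log 2 (real D) + 1) / real D powr (\<eta>/2)) \<longlongrightarrow> 0) at_top" using assms by real_asymp
 then have "eventually (\<lambda>D::nat. M * (log 2 (real D) + 1) / real D powr (\<eta>/2) < 1) at_top"
  by (rule order_tendstoD) simp
 with 1 eventually_ge_at_top[of "1::nat"]
 have "eventually (\<lambda>D::nat. 1024 * L^2 \<le> real D powr \<eta> \<and> M * (log 2 (real D) + 1) \<le> real D powr (\<eta>/2) \<and> D \<ge> 1) at_top"
  by eventually_elim (auto simp: field_simps)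
 then obtain D0 where D0: "\<And>D. D \<ge> D0 \<Longrightarrow> 1024 * L^2 \<le> real D powr \<eta> \<and> M * (log 2 (real D) + 1) \<le> real D powr (\<eta>/2) \<and> D \<ge> 1"
  unfolding eventually_sequentially by blast
 show ?thesis by (rule that[of D0]) (use D0 in auto)
qed

text \<open>A dual line of height about 2^i carries O(H0/2^i) points, and by induction there are at
  most K 2^i such lines in a window, so each dyadic height contributes O(K H0). There are O(log D)
  heights, and \<open>H0\<close> is smaller than D by the factor D^(\<eta>/2) up to a constant; for
  D \<ge> D0 the lines therefore account for at most K D/2.\<close>

lemma thin_bound:
 assumes L: "L \<ge> (1::real)" and \<eta>: "\<eta> > 0"
 obtains K where "K \<ge> 1" "\<And>D \<kappa> f f1 g g1 s \<rho>. D \<ge> 1 \<Longrightarrow> \<kappa> > 0 \<Longrightarrow> legendre_pair L \<kappa> f f1 g g1 \<Longrightarrow> 0 \<le> \<rho> \<Longrightarrow>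
  \<rho> \<le> min 1 \<kappa> * real D powr (-1-\<eta>) \<Longrightarrow> real (card (prim_pts f D s (min 1 (1/\<kappa>)) \<rho>)) \<le> K * real D"
proof -
 define M where "M = real (nat \<lfloor>L\<rfloor> + 17)"
 obtain D0 where D0: "D0 \<ge> (1::nat)"
  "\<And>D::nat. D \<ge> D0 \<Longrightarrow> 1024 * L^2 \<le> real D powr \<eta>"
  "\<And>D::nat. D \<ge> D0 \<Longrightarrow> 64 * L * M * (log 2 (real D) + 1) \<le> real D powr (\<eta>/2)"
  using thin_threshold[OF \<eta>, where M = "64 * L * M"] by blast
 \<comment> \<open>The entry 400 L makes half of K D exceed the contribution 96 L D + 2 of the light
   arcs, the other half being reserved for the lines. The second entry covers the heights below
   \<open>D0\<close> by the trivial bound.\<close>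
 define K where "K = max (400 * L) (3 * (2 * real D0 + 1))"
 have K: "K \<ge> 400 * L" "K \<ge> 3 * (2 * real D0 + 1)" "K \<ge> 1" using L unfolding K_def by auto
 have claim: "real (card (prim_pts f D s (min 1 (1/\<kappa>)) \<rho>)) \<le> K * real D"
  if "D \<ge> 1" "\<kappa> > 0" "legendre_pair L \<kappa> f f1 g g1" "0 \<le> \<rho>" "\<rho> \<le> min 1 \<kappa> * real D powr (-1-\<eta>)" for D \<kappa> f f1 g g1 s \<rho>
  using that
 proof (induction D arbitrary: \<kappa> f f1 g g1 s \<rho> rule: less_induct)
  case (less D)
  note lp = less.prems(3)
  define m R where "m = min 1 \<kappa>" and "R = min 1 (1/\<kappa>)"
  have mR: "m > 0" "m \<le> 1" "m \<le> \<kappa>" "R > 0" "R \<le> 1" "\<kappa> * R = m"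
   using less.prems(2) unfolding m_def R_def by (auto simp: min_def field_simps)
  have D: "real D \<ge> 1" using less.prems by simp
  have r1: "\<rho> \<le> 1"
  proof -
   have "real D powr (-1-\<eta>) \<le> real D powr 0" using D \<eta> by (intro powr_mono) auto
   then have "m * real D powr (-1-\<eta>) \<le> 1 * 1" using mR D by (intro mult_mono) auto
   then show ?thesis using less.prems(5) by (simp add: m_def)
  qed
  show ?case
  proof (cases "D < D0")
   case True
   have "real (card (prim_pts f D s R \<rho>)) \<le> real (D * (2*D+1) * 3)"
    using prim_pts_trivial(2)[OF less.prems(1) mR(5) r1, of f s] by (simp only: of_nat_le_iff)
   also have "... = (3 * (2 * real D + 1)) * real D" by (simp add: algebra_simps)
   also have "... \<le> K * real D" using K(2) True by (intro mult_right_mono) auto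
   finally show ?thesis by (simp add: R_def)
  next
   case False
   then have DD: "D \<ge> D0" by simp
   define p where "p = real D powr (\<eta>/2)"
   have p0: "p > 0" unfolding p_def using D by simp
   have P: "real D powr \<eta> = p^2" unfolding p_def power2_eq_square by (simp flip: powr_add)
   have pL: "1024 * L^2 \<le> p^2" using D0(2)[OF DD] P by simp
   have pL1: "32 * L \<le> p"
   proof (rule power2_le_imp_le)
    show "(32 * L)^2 \<le> p^2" using pL by (simp add: power_mult_distrib)
   qed (use p0 in simp)
   have L2: "L \<le> L^2" using L by (simp add: power2_eq_square)
   have P1: "p^2 \<ge> 1024" "p^2 \<ge> 1024 * L" using pL L L2 by linarith+
   have "real D powr (-1-\<eta>) = 1 / (real D * p^2)"
    using D P by (simp add: powr_diff powr_minus field_simps)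
   then have rho: "\<rho> \<le> m / (real D * p^2)" using less.prems(5) by (simp add: m_def)
   then have Dr: "real D * \<rho> \<le> m / p^2" using D p0 by (simp add: field_simps)
   have mp: "m / p^2 \<le> m / 1024" using mR P1 by (intro divide_left_mono) auto
   then have Dr': "real D * \<rho> \<le> m" "8 * real D * \<rho> < 1" using Dr mR by linarith+
   define H0 where "H0 = 8 * real D^2 * sqrt (L * (\<rho> / real D) / \<kappa>)"
   have H0: "H0 \<le> 8 * L * real D / p"
   proof -
    have "L * (\<rho> / real D) / \<kappa> \<le> L^2 * ((m / (real D * p^2)) / real D) / \<kappa>"
     using L2 L rho less.prems D by (intro divide_right_mono mult_mono) auto
    also have "... = (L / (real D * p))^2 * (m / \<kappa>)" by (simp add: power2_eq_square field_simps)
    also have "... \<le> (L / (real D * p))^2 * 1" using mR less.prems(2) by (intro mult_left_mono) auto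
    finally have "sqrt (L * (\<rho> / real D) / \<kappa>) \<le> L / (real D * p)"
     using L D p0 by (intro real_le_lsqrt) auto
    then have "H0 \<le> 8 * real D^2 * (L / (real D * p))" unfolding H0_def by (intro mult_left_mono) auto
    also have "... = 8 * L * real D / p" using D by (simp add: power2_eq_square)
    finally show ?thesis .
   qed
   have H0D: "H0 < real D"
   proof -
    have "8 * L * real D / p \<le> 8 * L * real D / (32 * L)" using pL1 p0 L D by (intro divide_left_mono) auto
    also have "... < real D" using L D by simp
    finally show ?thesis using H0 by linarith
   qed
   have H00: "H0 \<ge> 0" unfolding H0_def using L less.prems by simp
   let ?LL = "dual_lines L \<kappa> f1 g D s R \<rho>"
   define I where "I = {i. 2^i \<le> H0}"
   define T where "T = {..nat \<lfloor>L\<rfloor> + 16}"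
   define PP where "PP = (\<lambda>(i::nat, t::nat). prim_pts g (2^i) (f1 s - 8 * m + real t * m) m (128 * L * \<rho>^2 * real D^2 / (\<kappa> * 2^i)))"
   have cover: "?LL \<subseteq> (\<Union>it\<in>I \<times> T. PP it)"
    using dual_lines_cover[OF lp less.prems(2) L less.prems(1,4) m_def R_def Dr'(1) H0_def]
    unfolding I_def T_def PP_def by simp
   have Isub: "I \<subseteq> {..nat \<lfloor>log 2 (real D)\<rfloor>}"
   proof
    fix i assume "i \<in> I"
    then have "2^i \<le> H0" unfolding I_def by simp
    then have "2^i \<le> real D" using H0D by linarith
    then have "log 2 (2^i) \<le> log 2 (real D)" using D by (subst log_le_cancel_iff) auto
    then have "real i \<le> log 2 (real D)" by (simp add: log_nat_power)
    then show "i \<in> {..nat \<lfloor>log 2 (real D)\<rfloor>}" by (simp add: le_nat_floor)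
   qed
   then have finI: "finite I" by (rule finite_subset) simp
   have cardI: "real (card I) \<le> log 2 (real D) + 1"
   proof -
    have "card I \<le> nat \<lfloor>log 2 (real D)\<rfloor> + 1" using card_mono[OF _ Isub] by simp
    moreover have "log 2 (real D) \<ge> 0" using D by simp
    ultimately show ?thesis by linarith
   qed
   \<comment> \<open>The tolerance of the lines is quadratic in \<rho>, and this makes it fit the
     induction hypothesis of the dual curve with the same \<eta>: (D \<rho>)^2 is at most m^2/p^4,
     one factor m/\<kappa> is the dual unit \<open>R\<close>, one factor 1/p^2 absorbs 128 L, and
     the other is at most (2^i)^(-\<eta>).\<close>
   have tau: "128 * L * \<rho>^2 * real D^2 / (\<kappa> * 2^i) \<le> min 1 (1/\<kappa>) * real (2^i) powr (-1-\<eta>)" if "i \<in> I" for i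
   proof -
    have "2^i \<le> H0" using that unfolding I_def by simp
    then have i: "2^i \<le> real D" using H0D by linarith
    have "real (2^i) powr \<eta> \<le> real D powr \<eta>" using i \<eta> by (intro powr_mono2) auto
    then have q: "real (2^i) powr \<eta> \<le> p^2" by (simp add: P)
    have "(real D * \<rho>)^2 \<le> (m / p^2)^2" using Dr less.prems(4) by (intro power_mono) auto
    then have "128 * L * (real D * \<rho>)^2 / (\<kappa> * 2^i) \<le> 128 * L * (m / p^2)^2 / (\<kappa> * 2^i)"
     using L less.prems by (intro divide_right_mono mult_left_mono) auto
    also have "... = (128 * L / p^2) * (m * R) / (p^2 * 2^i)"
     using less.prems(2) p0 by (simp add: mR(6)[symmetric] power2_eq_square field_simps)
    also have "... \<le> 1 * (1 * R) / (real (2^i) powr \<eta> * 2^i)"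
     using P1 mR q p0 L by (intro frac_le mult_mono) auto
    also have "... = R * real (2^i) powr (-1-\<eta>)" by (simp add: powr_diff powr_minus field_simps)
    finally show ?thesis by (simp add: R_def power_mult_distrib mult_ac)
   qed
   have PPc: "real (card (PP (i, t))) \<le> K * 2^i" if "i \<in> I" for i t
   proof -
    have "2^i \<le> H0" using that unfolding I_def by simp
    then have "real (2^i) < real D" using H0D by (simp only: of_nat_power of_nat_numeral)
    then have "2^i < D" by (simp only: of_nat_less_iff)
    then have "real (card (prim_pts g (2^i) (f1 s - 8 * m + real t * m) (min 1 (1/(1/\<kappa>))) (128 * L * \<rho>^2 * real D^2 / (\<kappa> * 2^i)))) \<le> K * real (2^i)"
     using less.IH[OF _ _ _ legendre_pair_sym[OF lp less.prems(2)] _ tau[OF that]] less.prems(2) L by simp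
    then show ?thesis unfolding PP_def m_def by simp
   qed
   have PPf: "finite (PP (i, t))" if "i \<in> I" for i t
   proof -
    have "128 * L * \<rho>^2 * real D^2 / (\<kappa> * 2^i) \<le> 1"
    proof -
     have "real (2^i) powr (-1-\<eta>) \<le> real (2^i) powr 0" using \<eta> by (intro powr_mono) auto
     then have "R * real (2^i) powr (-1-\<eta>) \<le> 1 * 1" using mR by (intro mult_mono) auto
     then show ?thesis using tau[OF that] unfolding R_def by linarith
    qed
    then show ?thesis unfolding PP_def prod.case by (intro prim_pts_trivial(1) mR(2)) auto
   qed
   have finLL: "finite ?LL" using cover by (rule finite_subset) (use finI PPf in \<open>auto simp: T_def\<close>)
   \<comment> \<open>The absolute value makes the weight nonnegative on all triples, so that the sum
     may be enlarged from the dual lines to the sets that cover them.\<close>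
   define w where "w l = 4 * H0 / \<bar>of_int (fst l)\<bar>" for l :: "int \<times> int \<times> int"
   have w0: "w l \<ge> 0" for l unfolding w_def using H00 by simp
   have "(\<Sum>l\<in>?LL. 4 * H0 / of_int (fst l)) = sum w ?LL"
    unfolding w_def by (rule sum.cong) (auto simp: dual_lines_def)
   also have "... \<le> sum w (\<Union>it\<in>I \<times> T. PP it)"
    using cover w0 finI PPf by (intro sum_mono2) (auto simp: T_def)
   also have "... \<le> (\<Sum>it\<in>I \<times> T. sum w (PP it))"
    using finI PPf w0 by (intro sum_UN_le) (auto simp: T_def)
   also have "... \<le> (\<Sum>it\<in>I \<times> T. 4 * H0 * K)"
   proof (rule sum_mono)
    fix it assume "it \<in> I \<times> T"
    then obtain i t where it: "it = (i, t)" "i \<in> I" by auto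
    have "sum w (PP it) \<le> (\<Sum>l\<in>PP it. 4 * H0 / 2^i)"
    proof (rule sum_mono)
     fix l assume "l \<in> PP it"
     then have "int (2^i) \<le> fst l" unfolding it PP_def prim_pts_def near_pts_def by auto
     then have "real_of_int (int (2^i)) \<le> real_of_int (fst l)" by (simp only: of_int_le_iff)
     then have "2^i \<le> real_of_int (fst l)" by (simp only: of_int_of_nat_eq of_nat_power of_nat_numeral of_int_power of_int_numeral)
     then have "2^i \<le> \<bar>real_of_int (fst l)\<bar>" by linarith
     moreover have "(0::real) < 2^i" by simp
     ultimately have "\<bar>real_of_int (fst l)\<bar> * 2^i > 0" by (metis less_le_trans mult_pos_pos)
     then show "w l \<le> 4 * H0 / 2^i" unfolding w_def
      using H00 \<open>2^i \<le> \<bar>real_of_int (fst l)\<bar>\<close> by (intro divide_left_mono) auto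
    qed
    also have "... = real (card (PP it)) * (4 * H0 / 2^i)" by simp
    also have "... \<le> (K * 2^i) * (4 * H0 / 2^i)" using PPc[OF it(2)] H00 unfolding it by (intro mult_right_mono) auto
    also have "... = 4 * H0 * K" by simp
    finally show "sum w (PP it) \<le> 4 * H0 * K" .
   qed
   also have "... = real (card I) * M * (4 * H0 * K)" by (simp add: M_def T_def card_cartesian_product)
   also have "... \<le> (log 2 (real D) + 1) * M * (4 * (8 * L * real D / p) * K)"
    using cardI H0 H00 K(3) by (intro mult_mono) (auto simp: M_def)
   also have "... = (64 * L * M * (log 2 (real D) + 1)) * (K * real D / (2 * p))" by simp
   also have "... \<le> p * (K * real D / (2 * p))"
    using D0(3)[OF DD] K(3) p0 unfolding p_def[symmetric] by (intro mult_right_mono) auto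
   also have "... = K * real D / 2" using p0 by simp
   finally have sumLL: "(\<Sum>l\<in>?LL. 4 * H0 / of_int (fst l)) \<le> K * real D / 2" .
   \<comment> \<open>Of order R/D, so that there are O(D) arcs. Both determinant conditions hold
     because \<kappa> R \<le> 1, R \<le> 1 and 8 D \<rho> < 1.\<close>
   define s0 where "s0 = R / (48 * L * real D)"
   have s0: "s0 > 0" unfolding s0_def using mR L D by simp
   have s1: "L * \<kappa> * real D^3 * s0^3 \<le> 1/3"
   proof -
    have "L * \<kappa> * real D^3 * s0^3 = (\<kappa> * R) * (R * R) / (110592 * (L * L))"
     unfolding s0_def using L D by (simp add: power3_eq_cube field_simps)
    also have "... \<le> 1 * (1 * 1) / (110592 * (1 * 1))"
     using mR L by (intro frac_le mult_mono) auto
    finally show ?thesis by simp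
   qed
   have s2: "16 * real D^2 * \<rho> * s0 \<le> 1/3"
   proof -
    have "16 * real D^2 * \<rho> * s0 = (8 * real D * \<rho>) * R / (24 * L)"
     unfolding s0_def using L D by (simp add: power2_eq_square field_simps)
    also have "... \<le> 1 * 1 / (24 * 1)"
     using mR L Dr' less.prems by (intro frac_le mult_mono) auto
    finally show ?thesis by simp
   qed
   have "real (card (prim_pts f D s R \<rho>)) \<le> 2 * (R / s0 + 1) + (\<Sum>l\<in>?LL. 4 * H0 / of_int (fst l))"
    by (rule prim_pts_step[OF lp less.prems(2) L less.prems(1) Dr'(2) less.prems(4) _ mR(5) s0 s1 s2 finLL H0_def]) (use mR in simp)
   also have "R / s0 = 48 * L * real D" unfolding s0_def using mR L D by simp
   finally have "real (card (prim_pts f D s R \<rho>)) \<le> 96 * L * real D + 2 + K * real D / 2" using sumLL by simp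
   moreover have "2 \<le> 2 * (L * real D)" using L D mult_mono[of 1 L 1 "real D"] by simp
   moreover have "400 * L * real D \<le> K * real D" using K(1) by (intro mult_right_mono) auto
   ultimately show ?thesis by (simp add: R_def)
  qed
 qed
 show ?thesis using that[OF K(3)] claim by blast
qed

section \<open>Imprimitive points and wide neighbourhoods\<close>

lemma near_pts_primitive:
 assumes "(q, a, b) \<in> near_pts f D s R \<rho>" "D \<ge> 1" "\<rho> \<ge> 0"
 obtains t q' a' b' where "t \<in> {1..2*D}" "(q, a, b) = (int t * q', int t * a', int t * b')"
  "(q', a', b') \<in> prim_pts f (max 1 (D div t)) s R \<rho> \<union> prim_pts f (2 * max 1 (D div t)) s R \<rho>"
proof -
 have h: "int D \<le> q" "q < 2 * int D" "s \<le> of_int a / of_int q" "of_int a / of_int q \<le> s + R"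
   "\<bar>of_int b - of_int q * f (of_int a / of_int q)\<bar> \<le> \<rho>" using assms by (auto simp: near_pts_def)
 define g where "g = gcd q (gcd a b)"
 have q0: "q > 0" using h assms by linarith
 then have g0: "g > 0" unfolding g_def by (simp add: gcd_pos_int)
 have "g dvd q" "g dvd a" "g dvd b" unfolding g_def by (meson gcd_dvd1 gcd_dvd2 dvd_trans)+
 then obtain q' a' b' where q': "q = g * q'" "a = g * a'" "b = g * b'" by (auto simp: dvd_def)
 have "g * gcd q' (gcd a' b') = g" using g0 q' g_def by (metis abs_of_pos gcd_mult_distrib_int)
 then have g1: "gcd q' (gcd a' b') = 1" using g0 by simp
 define t where "t = nat g"
 have tg: "int t = g" using g0 unfolding t_def by simp
 have q'0: "q' > 0" using q0 q'(1) g0 by (simp add: zero_less_mult_iff)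
 have "g \<le> q" using zdvd_imp_le[OF \<open>g dvd q\<close> q0] .
 then have t: "t \<in> {1..2*D}" using h g0 tg by auto
 \<comment> \<open>Division by t brings the height between \<open>E\<close> and
   \<open>4 * E\<close>: the floor in \<open>D div t\<close> costs one further dyadic range, and the
   maximum with 1 covers t > D.\<close>
 define E where "E = max 1 (D div t)"
 have gD: "g * int (D div t) \<le> int D" "int D < g * int (D div t) + g"
 proof -
  have "t * (D div t) \<le> D" by simp
  then have "int (t * (D div t)) \<le> int D" by (simp only: of_nat_le_iff)
  then show "g * int (D div t) \<le> int D" using tg by simp
  have "D < t * (D div t) + t" using t by (metis atLeastAtMost_iff less_le_trans zero_less_one add.commute dividend_less_times_div)
  then have "int D < int (t * (D div t) + t)" by (simp only: of_nat_less_iff)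
  then show "int D < g * int (D div t) + g" using tg by simp
 qed
 have E: "int E \<le> q'" "q' < 4 * int E"
 proof -
  have "g * int (D div t) \<le> g * q'" using gD h q' by linarith
  then have 1: "int (D div t) \<le> q'" using g0 by simp
  then show "int E \<le> q'" using q'0 unfolding E_def by (auto simp: max_def)
  have "g * q' < g * (2 * (int (D div t) + 1))" using gD h q' by (simp add: algebra_simps)
  then have "q' < 2 * (int (D div t) + 1)" using g0 by (metis mult_less_cancel_left_pos)
  then show "q' < 4 * int E" unfolding E_def by (auto simp: max_def)
 qed
 have frac: "of_int a' / of_int q' = (of_int a / of_int q :: real)" using q' g0 by simp
 have "\<bar>of_int b - of_int q * f (of_int a / of_int q)\<bar> = of_int g * \<bar>of_int b' - of_int q' * f (of_int a / of_int q)\<bar>"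
 proof -
  have "of_int b - of_int q * f (of_int a / of_int q) = of_int g * (of_int b' - of_int q' * f (of_int a / of_int q))"
   by (subst q'(3), subst q'(1)) (simp add: algebra_simps)
  then show ?thesis using g0 by (simp add: abs_mult)
 qed
 moreover have "1 * \<bar>of_int b' - of_int q' * f (of_int a / of_int q)\<bar> \<le> of_int g * \<bar>of_int b' - of_int q' * f (of_int a / of_int q)\<bar>"
  using g0 by (intro mult_right_mono) auto
 ultimately have "\<bar>of_int b' - of_int q' * f (of_int a' / of_int q')\<bar> \<le> \<rho>" using h(5) frac by simp
 then have "(q', a', b') \<in> prim_pts f E s R \<rho> \<union> prim_pts f (2*E) s R \<rho>"
  using E g1 h frac unfolding prim_pts_def near_pts_def by auto
 then show ?thesis using that[OF t, of q' a' b'] q' tg unfolding E_def by simp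
qed

lemma harm_upper_bound:
 assumes "n > 0"
 shows "(harm n :: real) \<le> ln (real n) + 1"
proof -
 have "harm (Suc (n-1)) - ln (real (Suc (n-1))) \<le> harm (Suc 0) - ln (real (Suc 0))"
  using decseq_harm_diff_ln by (rule decseqD) simp
 then show ?thesis using assms by (simp add: harm_def)
qed

text \<open>Summing the primitive bound over the common factor t gives D times a harmonic sum, hence
  the logarithm. The tolerance is stated at height 2 D because the reduced points are sorted into
  ranges up to that height.\<close>

lemma near_bound:
 assumes L: "L \<ge> (1::real)" and \<eta>: "\<eta> > 0"
 obtains K where "K \<ge> 1" "\<And>D \<kappa> f f1 g g1 s \<rho>. D \<ge> 1 \<Longrightarrow> \<kappa> > 0 \<Longrightarrow> legendre_pair L \<kappa> f f1 g g1 \<Longrightarrow> 0 \<le> \<rho> \<Longrightarrow>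
  \<rho> \<le> min 1 \<kappa> * (2 * real D) powr (-1-\<eta>) \<Longrightarrow>
  real (card (near_pts f D s (min 1 (1/\<kappa>)) \<rho>)) \<le> K * real D * (1 + ln (real D))"
proof -
 obtain K where K: "K \<ge> 1" "\<And>D \<kappa> f f1 g g1 s \<rho>. D \<ge> 1 \<Longrightarrow> \<kappa> > 0 \<Longrightarrow> legendre_pair L \<kappa> f f1 g g1 \<Longrightarrow> 0 \<le> \<rho> \<Longrightarrow>
  \<rho> \<le> min 1 \<kappa> * real D powr (-1-\<eta>) \<Longrightarrow> real (card (prim_pts f D s (min 1 (1/\<kappa>)) \<rho>)) \<le> K * real D"
  using thin_bound[OF assms] by blast
 show ?thesis
 proof (rule that[of "12 * K"])
  show "12 * K \<ge> 1" using K by simp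
  fix D \<kappa> f f1 g g1 s \<rho>
  assume D: "D \<ge> (1::nat)" and \<kappa>: "\<kappa> > 0" and lp: "legendre_pair L \<kappa> f f1 g g1" and \<rho>: "0 \<le> \<rho>" "\<rho> \<le> min 1 \<kappa> * (2 * real D) powr (-1-\<eta>)"
  define R where "R = min 1 (1/\<kappa>)"
  define E where "E t = max 1 (D div t)" for t
  define P where "P t = prim_pts f (E t) s R \<rho> \<union> prim_pts f (2 * E t) s R \<rho>" for t
  define \<phi> where "\<phi> t = (\<lambda>(q, a, b). (int t * q, int t * a, int t * b))" for t
  have sub: "near_pts f D s R \<rho> \<subseteq> (\<Union>t\<in>{1..2*D}. \<phi> t ` P t)"
  proof
   fix p assume p: "p \<in> near_pts f D s R \<rho>"
   obtain q a b where pq: "p = (q, a, b)" by (cases p)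
   from near_pts_primitive[OF p[unfolded pq] D \<rho>(1)]
   obtain t q' a' b' where t: "t \<in> {1..2*D}" "(q, a, b) = (int t * q', int t * a', int t * b')" "(q', a', b') \<in> P t"
    unfolding P_def E_def by blast
   then have "p \<in> \<phi> t ` P t" unfolding pq \<phi>_def by force
   then show "p \<in> (\<Union>t\<in>{1..2*D}. \<phi> t ` P t)" using t by blast
  qed
  have bd: "finite (prim_pts f F s R \<rho>) \<and> real (card (prim_pts f F s R \<rho>)) \<le> K * real F" if F: "1 \<le> F" "F \<le> 2 * D" for F
  proof
   have p: "(2 * real D) powr (-1-\<eta>) \<le> real F powr (-1-\<eta>)" using F \<eta> by (intro powr_mono2') auto
   have p1: "real F powr (-1-\<eta>) \<le> real F powr 0" using F \<eta> by (intro powr_mono) auto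
   have "min 1 \<kappa> * (2 * real D) powr (-1-\<eta>) \<le> min 1 \<kappa> * real F powr (-1-\<eta>)" using p \<kappa> by (intro mult_left_mono) auto
   then have r: "\<rho> \<le> min 1 \<kappa> * real F powr (-1-\<eta>)" using \<rho> by linarith
   also have "... \<le> 1 * 1" using p1 F \<kappa> by (intro mult_mono) auto
   finally have "\<rho> \<le> 1" by simp
   then show "finite (prim_pts f F s R \<rho>)" using F by (intro prim_pts_trivial(1)) (auto simp: R_def)
   show "real (card (prim_pts f F s R \<rho>)) \<le> K * real F" unfolding R_def by (rule K(2)[OF F(1) \<kappa> lp \<rho>(1) r])
  qed
  have E: "1 \<le> E t" "2 * E t \<le> 2 * D" for t unfolding E_def using D by (auto simp: div_le_dividend)
  have P: "finite (P t)" "real (card (P t)) \<le> 3 * K * real (E t)" for t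
  proof -
   have b: "finite (prim_pts f (E t) s R \<rho>)" "real (card (prim_pts f (E t) s R \<rho>)) \<le> K * real (E t)"
    "finite (prim_pts f (2 * E t) s R \<rho>)" "real (card (prim_pts f (2 * E t) s R \<rho>)) \<le> K * real (2 * E t)"
    using bd[of "E t"] bd[of "2 * E t"] E[of t] by auto
   show "finite (P t)" unfolding P_def using b by simp
   have "card (P t) \<le> card (prim_pts f (E t) s R \<rho>) + card (prim_pts f (2 * E t) s R \<rho>)"
    unfolding P_def by (rule card_Un_le)
   then show "real (card (P t)) \<le> 3 * K * real (E t)" using b by simp
  qed
  have "card (near_pts f D s R \<rho>) \<le> card (\<Union>t\<in>{1..2*D}. \<phi> t ` P t)"
   using sub by (rule card_mono[rotated]) (use P in auto)
  also have "... \<le> (\<Sum>t\<in>{1..2*D}. card (\<phi> t ` P t))" by (rule card_UN_le) simp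
  also have "... \<le> (\<Sum>t\<in>{1..2*D}. card (P t))" by (intro sum_mono card_image_le P)
  finally have "real (card (near_pts f D s R \<rho>)) \<le> real (\<Sum>t\<in>{1..2*D}. card (P t))" by (simp only: of_nat_le_iff)
  also have "... = (\<Sum>t\<in>{1..2*D}. real (card (P t)))" by simp
  also have "... \<le> (\<Sum>t\<in>{1..2*D}. 3 * K * (real D * inverse (real t) + 1))"
  proof (rule sum_mono)
   fix t assume t: "t \<in> {1..2*D}"
   have "real (D div t) \<le> real D / real t" using of_nat_div_le_of_nat[of D t] by simp
   then have "real (E t) \<le> real D * inverse (real t) + 1" unfolding E_def by (auto simp: max_def field_simps)
   then have "3 * K * real (E t) \<le> 3 * K * (real D * inverse (real t) + 1)" using K(1) by (intro mult_left_mono) auto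
   then show "real (card (P t)) \<le> 3 * K * (real D * inverse (real t) + 1)" using P(2)[of t] by linarith
  qed
  also have "... = 3 * K * (real D * harm (2*D) + 2 * real D)"
   by (simp add: harm_def sum.distrib flip: sum_distrib_left)
  also have "... \<le> 3 * K * (real D * (ln (real (2*D)) + 1) + 2 * real D)"
   using D K(1) harm_upper_bound[of "2*D"] by (intro mult_left_mono add_mono) auto
  also have "... \<le> 3 * K * (4 * real D * (1 + ln (real D)))"
  proof -
   have "ln (real (2*D)) = ln 2 + ln (real D)" using D by (simp add: ln_mult)
   moreover have "ln (2::real) \<le> 1" using ln_le_minus_one[of 2] by simp
   moreover have "ln (real D) \<ge> 0" using D by simp
   ultimately have "real D * (ln (real (2*D)) + 1) \<le> real D * (2 + 4 * ln (real D))" by (intro mult_left_mono) auto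
   then show ?thesis using K(1) by (intro mult_left_mono) (auto simp: algebra_simps)
  qed
  finally show "real (card (near_pts f D s (min 1 (1/\<kappa>)) \<rho>)) \<le> 12 * K * real D * (1 + ln (real D))"
   by (simp add: R_def mult_ac)
 qed
qed

text \<open>A wide neighbourhood is tiled by O(1 + \<rho>/r) narrow ones around vertical translates
  of the curve, each of which satisfies \<open>near_bound\<close>. Passing from 2 D to D in 1/r
  costs 2^(1+\<eta>) \<le> 4, which is where \<eta> \<le> 1 enters.\<close>

lemma near_bound_fat:
 assumes L: "L \<ge> (1::real)" and \<eta>: "\<eta> > 0" "\<eta> \<le> 1"
 obtains K where "K \<ge> 1" "\<And>D \<kappa> f f1 g g1 s \<rho>. D \<ge> 1 \<Longrightarrow> \<kappa> > 0 \<Longrightarrow> legendre_pair L \<kappa> f f1 g g1 \<Longrightarrow> 0 \<le> \<rho> \<Longrightarrow>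
  finite (near_pts f D s (min 1 (1/\<kappa>)) \<rho>) \<and>
  real (card (near_pts f D s (min 1 (1/\<kappa>)) \<rho>)) \<le> K * (1 + \<rho> / min 1 \<kappa> * real D powr (1+\<eta>)) * real D * (1 + ln (real D))"
proof -
 obtain K where K: "K \<ge> 1" "\<And>D \<kappa> f f1 g g1 s \<rho>. D \<ge> 1 \<Longrightarrow> \<kappa> > 0 \<Longrightarrow> legendre_pair L \<kappa> f f1 g g1 \<Longrightarrow> 0 \<le> \<rho> \<Longrightarrow>
  \<rho> \<le> min 1 \<kappa> * (2 * real D) powr (-1-\<eta>) \<Longrightarrow>
  real (card (near_pts f D s (min 1 (1/\<kappa>)) \<rho>)) \<le> K * real D * (1 + ln (real D))"
  using near_bound[OF L \<eta>(1)] by blast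
 show ?thesis
 proof (rule that[of "16 * K"])
  show "16 * K \<ge> 1" using K by simp
  fix D \<kappa> f f1 g g1 s \<rho>
  assume D: "D \<ge> (1::nat)" and \<kappa>: "\<kappa> > 0" and lp: "legendre_pair L \<kappa> f f1 g g1" and \<rho>: "(0::real) \<le> \<rho>"
  define R where "R = min 1 (1/\<kappa>)"
  define r where "r = min 1 \<kappa> * (2 * real D) powr (-1-\<eta>)"
  have r: "r > 0" unfolding r_def using \<kappa> D by simp
  have r1: "r \<le> 1"
  proof -
   have "(2 * real D) powr (-1-\<eta>) \<le> (2 * real D) powr 0" using D \<eta> by (intro powr_mono) auto
   then have "r \<le> 1 * 1" unfolding r_def using \<kappa> D by (intro mult_mono) auto
   then show ?thesis by simp
  qed
  define N where "N = \<lceil>2 * \<rho> / r\<rceil> + 1"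
  define F where "F i = (\<lambda>x. f x + of_int i * r / (2 * real D))" for i
  have sub: "near_pts f D s R \<rho> \<subseteq> (\<Union>i\<in>{-N..N}. near_pts (F i) D s R r)"
  proof
   fix p assume p: "p \<in> near_pts f D s R \<rho>"
   obtain q a b where pq: "p = (q, a, b)" by (cases p)
   have h: "int D \<le> q" "q < 2 * int D" "s \<le> of_int a / of_int q" "of_int a / of_int q \<le> s + R"
    "\<bar>of_int b - of_int q * f (of_int a / of_int q)\<bar> \<le> \<rho>" using p unfolding pq by (auto simp: near_pts_def)
   \<comment> \<open>A translate by i r/(2 D) moves the ordinate at denominator q by i c, and r/2
     \<le> c \<le> r because D \<le> q \<le> 2 D: the steps are fine enough to leave no hole and
     coarse enough to be few.\<close>
   define c where "c = of_int q * r / (2 * real D)"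
   have qD: "real D \<le> of_int q" "of_int q \<le> 2 * real D" using h by linarith+
   have c: "r / 2 \<le> c" "c \<le> r"
   proof -
    have "real D * r / (2 * real D) \<le> c" unfolding c_def using qD r D by (intro divide_right_mono mult_right_mono) auto
    then show "r / 2 \<le> c" using D by simp
    have "c \<le> 2 * real D * r / (2 * real D)" unfolding c_def using qD r D by (intro divide_right_mono mult_right_mono) auto
    then show "c \<le> r" using D by simp
   qed
   then have c0: "c > 0" using r by linarith
   define z where "z = of_int b - of_int q * f (of_int a / of_int q)"
   define i where "i = \<lfloor>z / c\<rfloor>"
   have i1: "of_int i * c \<le> z" "z < of_int i * c + c"
   proof -
    have "of_int i \<le> z / c" "z / c < of_int i + 1" unfolding i_def by linarith+
    then show "of_int i * c \<le> z" "z < of_int i * c + c" using c0 by (simp_all add: field_simps)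
   qed
   have "\<bar>z / c\<bar> \<le> \<rho> / (r/2)" unfolding abs_divide using h(5) c c0 r \<rho> by (intro frac_le) (auto simp: z_def)
   then have "\<bar>z / c\<bar> \<le> 2 * \<rho> / r" by (simp add: mult.commute)
   then have "- (2 * \<rho> / r) \<le> z / c" "z / c \<le> 2 * \<rho> / r" by linarith+
   then have "i \<in> {-N..N}" unfolding i_def N_def atLeastAtMost_iff by linarith
   moreover have "p \<in> near_pts (F i) D s R r"
   proof -
    have "of_int b - of_int q * F i (of_int a / of_int q) = z - of_int i * c" unfolding F_def z_def c_def by (simp add: algebra_simps)
    then have "\<bar>of_int b - of_int q * F i (of_int a / of_int q)\<bar> \<le> r" using i1 c by linarith
    then show ?thesis unfolding pq near_pts_def using h by simp
   qed
   ultimately show "p \<in> (\<Union>i\<in>{-N..N}. near_pts (F i) D s R r)" by blast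
  qed
  have each: "finite (near_pts (F i) D s R r)" "real (card (near_pts (F i) D s R r)) \<le> K * real D * (1 + ln (real D))" for i
  proof -
   show "finite (near_pts (F i) D s R r)" by (rule near_pts_trivial(1)[OF D _ r1]) (simp add: R_def)
   show "real (card (near_pts (F i) D s R r)) \<le> K * real D * (1 + ln (real D))"
    unfolding R_def F_def by (rule K(2)[OF D \<kappa> legendre_pair_shift[OF lp]]) (use r in \<open>auto simp: r_def\<close>)
  qed
  have finU: "finite (\<Union>i\<in>{-N..N}. near_pts (F i) D s R r)" using each by simp
  have fin: "finite (near_pts f D s R \<rho>)" using sub finU by (rule finite_subset)
  have N0: "2 * \<rho> / r \<ge> 0" using \<rho> r by simp
  have "card (near_pts f D s R \<rho>) \<le> card (\<Union>i\<in>{-N..N}. near_pts (F i) D s R r)" using finU sub by (rule card_mono)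
  also have "... \<le> (\<Sum>i\<in>{-N..N}. card (near_pts (F i) D s R r))" by (rule card_UN_le) simp
  finally have "real (card (near_pts f D s R \<rho>)) \<le> real (\<Sum>i\<in>{-N..N}. card (near_pts (F i) D s R r))" by (simp only: of_nat_le_iff)
  also have "... = (\<Sum>i\<in>{-N..N}. real (card (near_pts (F i) D s R r)))" by simp
  also have "... \<le> (\<Sum>i\<in>{-N..N}. K * real D * (1 + ln (real D)))" by (intro sum_mono each)
  also have "... = real (nat (2 * N + 1)) * (K * real D * (1 + ln (real D)))" by simp
  also have "... \<le> (16 * (1 + \<rho> / min 1 \<kappa> * real D powr (1+\<eta>))) * (K * real D * (1 + ln (real D)))"
  proof (rule mult_right_mono)
   have "real (nat (2 * N + 1)) = of_int (2 * N + 1)" using N0 unfolding N_def by simp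
   also have "... \<le> 4 * \<rho> / r + 5" unfolding N_def by simp linarith
   also have "4 * \<rho> / r = 4 * 2 powr (1+\<eta>) * (\<rho> / min 1 \<kappa> * real D powr (1+\<eta>))"
   proof -
    have "(2 * real D) powr (-1-\<eta>) = 1 / (2 powr (1+\<eta>) * real D powr (1+\<eta>))"
     using D powr_minus_divide[of "2 * real D" "1+\<eta>"] by (simp add: powr_mult)
    then show ?thesis unfolding r_def using \<kappa> by simp
   qed
   also have "... \<le> 4 * 4 * (\<rho> / min 1 \<kappa> * real D powr (1+\<eta>))"
   proof -
    have "(2::real) powr (1+\<eta>) \<le> 2 powr 2" using \<eta> by (intro powr_mono) auto
    then have "(2::real) powr (1+\<eta>) \<le> 4" by simp
    then show ?thesis using \<rho> \<kappa> by (intro mult_right_mono) auto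
   qed
   finally show "real (nat (2 * N + 1)) \<le> 16 * (1 + \<rho> / min 1 \<kappa> * real D powr (1+\<eta>))" by simp
  qed (use K(1) D in simp)
  finally show "finite (near_pts f D s (min 1 (1/\<kappa>)) \<rho>) \<and> real (card (near_pts f D s (min 1 (1/\<kappa>)) \<rho>)) \<le>
    16 * K * (1 + \<rho> / min 1 \<kappa> * real D powr (1+\<eta>)) * real D * (1 + ln (real D))"
   using fin by (simp add: R_def mult_ac)
 qed
qed

section \<open>Existence of the Legendre dual\<close>

lemma has_real_derivative_within_closed_cover:
 fixes F :: "real \<Rightarrow> real"
 assumes "\<And>i. i \<in> I \<Longrightarrow> closed (A i)" "finite I" "(\<Union>i\<in>I. A i) = UNIV"
  "\<And>i. i \<in> I \<Longrightarrow> x \<in> A i \<Longrightarrow> (F has_real_derivative d) (at x within A i)"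
 shows "(F has_real_derivative d) (at x)"
proof -
 have "((\<lambda>y. (F y - F x) / (y - x)) \<longlongrightarrow> d) (at x within (\<Union>i\<in>J. A i))" if "J \<subseteq> I" for J
  using finite_subset[OF that assms(2)] that
 proof (induction J rule: finite_induct)
  case (insert j J)
  have "((\<lambda>y. (F y - F x) / (y - x)) \<longlongrightarrow> d) (at x within A j)"
  proof (cases "x \<in> A j")
   case True
   then show ?thesis using assms(4)[of j] insert by (auto simp: has_field_derivative_iff)
  next
   case False
   then have "trivial_limit (at x within A j)"
    using assms(1)[of j] insert by (intro not_in_closure_trivial_limitI) auto
   then show ?thesis by (simp only: tendsto_bot)
  qed
  then show ?case using insert by (auto simp: at_within_union intro: filterlim_sup)
 qed auto
 from this[of I] show ?thesis using assms(3) by (simp add: has_field_derivative_iff)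
qed

lemma convex_bounds_of_derivative:
 fixes F F1 :: "real \<Rightarrow> real"
 assumes der: "\<And>x. (F has_real_derivative F1 x) (at x)"
  and mono: "\<And>x y. x \<le> y \<Longrightarrow> c * (y - x) \<le> F1 y - F1 x"
 shows "c/2 * (y-x)^2 \<le> F y - F x - F1 x * (y-x)"
proof -
 define h where "h z = F z - F1 x * (z - x) - c/2 * (z-x)^2" for z
 have dh: "(h has_real_derivative (F1 z - F1 x - c * (z - x))) (at z)" for z
  unfolding h_def by (auto intro!: derivative_eq_intros der)
 have "h x \<le> h y"
 proof (cases "x \<le> y")
  case True
  show ?thesis by (rule DERIV_nonneg_imp_nondecreasing[OF True]) (use dh mono[of x] in force)
 next
  case False
  have "F1 z - F1 x - c * (z - x) \<le> 0" if "z \<le> x" for z using mono[OF that] by (simp add: algebra_simps)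
  then show ?thesis using False by (intro DERIV_nonpos_imp_nonincreasing[of y x]) (use dh in force)+
 qed
 then show ?thesis unfolding h_def by simp
qed

text \<open>The dual slope is the inverse of \<open>F1\<close>, and the second-order remainder of
  the dual function is that of \<open>F\<close> between the corresponding points, taken in the
  opposite order. Returning from these points to the slopes costs \<Lambda> once more, whence the
  constant \<Lambda>^2.\<close>

lemma legendre_pair_of_derivative:
 fixes F F1 :: "real \<Rightarrow> real"
 assumes der: "\<And>x. (F has_real_derivative F1 x) (at x)" and \<kappa>: "\<kappa> > 0" and L: "\<Lambda> \<ge> 1"
  and low: "\<And>x y. x \<le> y \<Longrightarrow> \<kappa> * (y - x) \<le> F1 y - F1 x"
  and up: "\<And>x y. x \<le> y \<Longrightarrow> F1 y - F1 x \<le> \<Lambda> * \<kappa> * (y - x)"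
 shows "\<exists>G G1. legendre_pair (\<Lambda>^2) \<kappa> F F1 G G1"
proof -
 have lowF: "\<kappa>/2 * (y-x)^2 \<le> F y - F x - F1 x * (y-x)" for x y
  by (rule convex_bounds_of_derivative[OF der low])
 have upF: "F y - F x - F1 x * (y-x) \<le> \<Lambda>*\<kappa>/2 * (y-x)^2" for x y
 proof -
  have "- (\<Lambda>*\<kappa>)/2 * (y-x)^2 \<le> (\<lambda>x. - F x) y - (\<lambda>x. - F x) x - (\<lambda>x. - F1 x) x * (y-x)"
  proof (rule convex_bounds_of_derivative)
   show "((\<lambda>x. - F x) has_real_derivative - F1 x) (at x)" for x by (auto intro!: derivative_eq_intros der)
   show "- (\<Lambda>*\<kappa>) * (y - x) \<le> - F1 y - - F1 x" if "x \<le> y" for x y using up[OF that] by simp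
  qed
  then show ?thesis by (simp add: algebra_simps)
 qed
 have inj: "inj F1"
 proof -
  have "F1 x < F1 y" if "x < y" for x y
  proof -
   have "\<kappa> * (y - x) > 0" using that \<kappa> by simp
   then show ?thesis using low[of x y] that by linarith
  qed
  then have "strict_mono F1" by (simp add: strict_mono_def)
  then show ?thesis by (rule strict_mono_imp_inj_on)
 qed
 have cont: "isCont F1 x" for x
 proof -
  have "\<bar>F1 y - F1 x\<bar> \<le> \<Lambda> * \<kappa> * \<bar>y - x\<bar>" for y
  proof (cases "x \<le> y")
   case True
   have "0 \<le> \<kappa> * (y - x)" using True \<kappa> by simp
   then show ?thesis using up[OF True] low[OF True] True by linarith
  next
   case False
   then have xy: "y \<le> x" by simp
   have "0 \<le> \<kappa> * (x - y)" using xy \<kappa> by simp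
   then have "\<bar>F1 y - F1 x\<bar> \<le> \<Lambda> * \<kappa> * (x - y)" using up[OF xy] low[OF xy] by linarith
   then show ?thesis using xy by simp
  qed
  then have "\<forall>\<^sub>F y in at x. norm (F1 y - F1 x) \<le> \<Lambda> * \<kappa> * \<bar>y - x\<bar>" by (intro always_eventually) simp
  moreover have "((\<lambda>y. \<Lambda> * \<kappa> * \<bar>y - x\<bar>) \<longlongrightarrow> \<Lambda> * \<kappa> * \<bar>x - x\<bar>) (at x)" by (intro tendsto_intros)
  then have "((\<lambda>y. \<Lambda> * \<kappa> * \<bar>y - x\<bar>) \<longlongrightarrow> 0) (at x)" by simp
  ultimately have "((\<lambda>y. F1 y - F1 x) \<longlongrightarrow> 0) (at x)" by (rule Lim_null_comparison)
  then show ?thesis by (simp add: isCont_def LIM_zero_iff)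
 qed
 have "surj F1"
 proof -
  have "\<exists>x. F1 x = y" for y
  proof -
   define N where "N = (\<bar>y - F1 0\<bar>) / \<kappa>"
   have N: "N \<ge> 0" "\<kappa> * N = \<bar>y - F1 0\<bar>" unfolding N_def using \<kappa> by auto
   have "F1 (-N) \<le> y" "y \<le> F1 N" using low[of "-N" 0] low[of 0 N] N by auto
   from IVT[of F1 "-N" y N, OF this] N cont show ?thesis by auto
  qed
  then show ?thesis by (metis surjI)
 qed
 define G1 where "G1 = inv F1"
 define G where "G y = y * G1 y - F (G1 y)" for y
 have i1: "G1 (F1 x) = x" for x unfolding G1_def using inj by simp
 have i2: "F1 (G1 y) = y" for y unfolding G1_def using \<open>surj F1\<close> by (simp add: surj_f_inv_f)
 have GB: "G y - G z - G1 z * (y - z) = F (G1 z) - F (G1 y) - F1 (G1 y) * (G1 z - G1 y)" for y z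
  unfolding G_def i2 by (simp add: algebra_simps)
 have d1: "\<kappa>^2 * (G1 z - G1 y)^2 \<le> (y - z)^2" and d2: "(y - z)^2 \<le> (\<Lambda>*\<kappa>)^2 * (G1 z - G1 y)^2" for y z
 proof -
  have *: "\<kappa>^2 * (b - a)^2 \<le> (F1 b - F1 a)^2 \<and> (F1 b - F1 a)^2 \<le> (\<Lambda>*\<kappa>)^2 * (b - a)^2" if "a \<le> b" for a b
  proof
   have 0: "0 \<le> \<kappa> * (b - a)" using that \<kappa> by simp
   show "\<kappa>^2 * (b - a)^2 \<le> (F1 b - F1 a)^2" unfolding power_mult_distrib[symmetric]
    by (rule power_mono[OF low[OF that] 0])
   show "(F1 b - F1 a)^2 \<le> (\<Lambda>*\<kappa>)^2 * (b - a)^2" unfolding power_mult_distrib[symmetric]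
    by (rule power_mono[OF up[OF that]]) (use low[OF that] 0 in linarith)
  qed
  show "\<kappa>^2 * (G1 z - G1 y)^2 \<le> (y - z)^2"
   using *[of "G1 y" "G1 z"] *[of "G1 z" "G1 y"] unfolding i2
   by (cases "G1 y \<le> G1 z") (auto simp: power2_commute[of "G1 y"] power2_commute[of z])
  show "(y - z)^2 \<le> (\<Lambda>*\<kappa>)^2 * (G1 z - G1 y)^2"
   using *[of "G1 y" "G1 z"] *[of "G1 z" "G1 y"] unfolding i2
   by (cases "G1 y \<le> G1 z") (auto simp: power2_commute[of "G1 y"] power2_commute[of z])
 qed
 have "\<Lambda>^2 \<ge> \<Lambda>" using L mult_left_mono[of 1 \<Lambda> \<Lambda>] by (simp add: power2_eq_square)
 then have L2: "\<Lambda>^2 \<ge> \<Lambda>" "\<Lambda>^2 \<ge> 1" using L by linarith+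
 have "legendre_pair (\<Lambda>^2) \<kappa> F F1 G G1"
  unfolding legendre_pair_def
 proof (intro conjI allI)
  fix x y
  have "\<kappa> / (2 * \<Lambda>^2) \<le> \<kappa> / 2" using \<kappa> L2 by (intro divide_left_mono) auto
  then have "\<kappa> / (2 * \<Lambda>^2) * (y-x)^2 \<le> \<kappa> / 2 * (y-x)^2" by (intro mult_right_mono) auto
  then show "\<kappa> / (2 * \<Lambda>^2) * (y-x)^2 \<le> F y - F x - F1 x * (y-x)" using lowF[where x=x and y=y] by linarith
  have "\<Lambda> * \<kappa> / 2 * (y-x)^2 \<le> \<Lambda>^2 * \<kappa> / 2 * (y-x)^2" using \<kappa> L2 by (intro mult_right_mono divide_right_mono) auto
  then show "F y - F x - F1 x * (y-x) \<le> \<Lambda>^2 * \<kappa> / 2 * (y-x)^2" using upF[where x=x and y=y] by linarith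
  have "(1/\<kappa>) / (2 * \<Lambda>^2) * (y-x)^2 \<le> (1/\<kappa>) / (2 * \<Lambda>^2) * ((\<Lambda>*\<kappa>)^2 * (G1 x - G1 y)^2)"
   using \<kappa> d2 by (intro mult_left_mono) auto
  also have "... = \<kappa> / 2 * (G1 x - G1 y)^2" using \<kappa> L by (simp add: power2_eq_square field_simps)
  finally show "(1/\<kappa>) / (2 * \<Lambda>^2) * (y-x)^2 \<le> G y - G x - G1 x * (y-x)" using lowF[of "G1 x" "G1 y"] GB by simp
  have "\<Lambda> * \<kappa> / 2 * (G1 x - G1 y)^2 = \<Lambda> / (2*\<kappa>) * (\<kappa>^2 * (G1 x - G1 y)^2)" using \<kappa> by (simp add: power2_eq_square)
  also have "... \<le> \<Lambda>^2 / (2*\<kappa>) * (y-x)^2" using \<kappa> L L2 d1 by (intro mult_mono divide_right_mono) auto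
  finally show "G y - G x - G1 x * (y-x) \<le> \<Lambda>^2 * (1/\<kappa>) / 2 * (y-x)^2" using upF[of "G1 x" "G1 y"] GB by simp
 qed (auto simp: i1 i2 G_def)
 then show ?thesis by blast
qed

text \<open>Parabolas with second derivative \<kappa> are attached at both ends, which preserves the
  two-sided bound on the slope increments. The exponential sums live on an interval, whereas the
  induction works with functions on the whole line.\<close>

lemma legendre_extension:
 fixes f f1 :: "real \<Rightarrow> real"
 assumes ab: "\<alpha> \<le> \<beta>" and der: "\<And>x. x \<in> {\<alpha>..\<beta>} \<Longrightarrow> (f has_real_derivative f1 x) (at x)"
  and \<kappa>: "\<kappa> > 0" and L: "\<Lambda> \<ge> 1"
  and low: "\<And>x y. \<alpha> \<le> x \<Longrightarrow> x \<le> y \<Longrightarrow> y \<le> \<beta> \<Longrightarrow> \<kappa> * (y - x) \<le> f1 y - f1 x"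
  and up: "\<And>x y. \<alpha> \<le> x \<Longrightarrow> x \<le> y \<Longrightarrow> y \<le> \<beta> \<Longrightarrow> f1 y - f1 x \<le> \<Lambda> * \<kappa> * (y - x)"
 shows "\<exists>F F1 G G1. legendre_pair (\<Lambda>^2) \<kappa> F F1 G G1 \<and> (\<forall>x\<in>{\<alpha>..\<beta>}. F x = f x \<and> F1 x = f1 x)"
proof -
 define c where "c x = max \<alpha> (min x \<beta>)" for x :: real
 define F where "F x = f (c x) + f1 (c x) * (x - c x) + \<kappa>/2 * (x - c x)^2" for x
 define F1 where "F1 x = f1 (c x) + \<kappa> * (x - c x)" for x
 have c: "c x \<in> {\<alpha>..\<beta>}" for x using ab unfolding c_def by auto
 have c1: "c x \<le> c y" "x - c x \<le> y - c y" if "x \<le> y" for x y using that ab unfolding c_def by auto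
 have cin: "c x = x" if "x \<in> {\<alpha>..\<beta>}" for x using that unfolding c_def by auto
 have q: "((\<lambda>x. f t + f1 t * (x - t) + \<kappa>/2 * (x - t)^2) has_real_derivative f1 t + \<kappa> * (x - t)) (at x within A)" for t x A
  by (auto intro!: derivative_eq_intros)
 have dF: "(F has_real_derivative F1 x) (at x)" for x
 proof (rule has_real_derivative_within_closed_cover[where I = "{0::nat,1,2}" and A = "\<lambda>i. if i = 0 then {..\<alpha>} else if i = 1 then {\<alpha>..\<beta>} else {\<beta>..}"])
  fix i :: nat assume i: "i \<in> {0,1,2}" "x \<in> (if i = 0 then {..\<alpha>} else if i = 1 then {\<alpha>..\<beta>} else {\<beta>..})"
  consider "i = 0" "x \<le> \<alpha>" | "i = 1" "x \<in> {\<alpha>..\<beta>}" | "i = 2" "x \<ge> \<beta>" using i by auto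
  then show "(F has_real_derivative F1 x) (at x within (if i = 0 then {..\<alpha>} else if i = 1 then {\<alpha>..\<beta>} else {\<beta>..}))"
  proof cases
   case 1
   have e: "F1 x = f1 \<alpha> + \<kappa> * (x - \<alpha>)" using 1 ab unfolding F1_def c_def by simp
   have "(F has_real_derivative F1 x) (at x within {..\<alpha>})" unfolding e
    by (rule has_field_derivative_transform_within[OF q[of \<alpha> x "{..\<alpha>}"] zero_less_one]) (use 1 ab in \<open>auto simp: F_def c_def\<close>)
   then show ?thesis using 1 by simp
  next
   case 2
   have e: "F1 x = f1 x" using 2 cin unfolding F1_def by simp
   have "(F has_real_derivative F1 x) (at x within {\<alpha>..\<beta>})" unfolding e
    by (rule has_field_derivative_transform_within[OF has_field_derivative_at_within[OF der[OF 2(2)]] zero_less_one]) (use 2 cin in \<open>auto simp: F_def\<close>)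
   then show ?thesis using 2 by simp
  next
   case 3
   have e: "F1 x = f1 \<beta> + \<kappa> * (x - \<beta>)" using 3 ab unfolding F1_def c_def by simp
   have "(F has_real_derivative F1 x) (at x within {\<beta>..})" unfolding e
    by (rule has_field_derivative_transform_within[OF q[of \<beta> x "{\<beta>..}"] zero_less_one]) (use 3 ab in \<open>auto simp: F_def c_def\<close>)
   then show ?thesis using 3 by simp
  qed
 qed (use ab in auto)
 have lowF: "\<kappa> * (y - x) \<le> F1 y - F1 x" if "x \<le> y" for x y
  using low[of "c x" "c y"] c c1[OF that] unfolding F1_def by (auto simp: algebra_simps)
 have upF: "F1 y - F1 x \<le> \<Lambda> * \<kappa> * (y - x)" if "x \<le> y" for x y
 proof -
  have "1 * (\<kappa> * ((y - c y) - (x - c x))) \<le> \<Lambda> * (\<kappa> * ((y - c y) - (x - c x)))"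
   using L \<kappa> c1[OF that] by (intro mult_right_mono) auto
  then show ?thesis using up[of "c x" "c y"] c c1[OF that] unfolding F1_def by (auto simp: algebra_simps)
 qed
 obtain G G1 where "legendre_pair (\<Lambda>^2) \<kappa> F F1 G G1"
  using legendre_pair_of_derivative[OF dF \<kappa> L lowF upF] by blast
 moreover have "\<forall>x\<in>{\<alpha>..\<beta>}. F x = f x \<and> F1 x = f1 x" using cin unfolding F_def F1_def by simp
 ultimately show ?thesis by blast
qed

subsection \<open>Exponential sums\<close>

lemma int_dist_le: "int_dist x \<le> \<bar>x - of_int k\<bar>"
 unfolding int_dist_def by (rule cINF_lower) (auto intro!: bdd_belowI[of _ 0])

lemma int_dist_round: "int_dist x = \<bar>x - of_int (round x)\<bar>"
proof (rule antisym)
 show "\<bar>x - of_int (round x)\<bar> \<le> int_dist x"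
  unfolding int_dist_def by (rule cINF_greatest) (auto simp: round_diff_minimal abs_minus_commute)
qed (rule int_dist_le)

lemma int_dist_nonneg: "int_dist x \<ge> 0"
 unfolding int_dist_round by simp

lemma int_dist_le_half: "int_dist x \<le> 1/2"
 unfolding int_dist_round using of_int_round_abs_le[of x] by (simp add: abs_minus_commute)

lemma int_dist_add_int: "int_dist (x + of_int k) = int_dist x"
proof -
 have *: "int_dist (x + of_int k) \<le> int_dist x" for x k
  using int_dist_le[of "x + of_int k" "round x + k"] by (simp add: int_dist_round[of x])
 show ?thesis using *[of x k] *[of "x + of_int k" "-k"] by simp
qed

lemma int_dist_minus: "int_dist (- x) = int_dist x"
proof -
 have *: "int_dist (- x) \<le> int_dist x" for x
  using int_dist_le[of "- x" "- round x"] by (simp add: int_dist_round[of x] abs_minus_commute)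
 show ?thesis using *[of x] *[of "- x"] by simp
qed

lemma int_dist_lipschitz: "int_dist y \<le> int_dist x + \<bar>y - x\<bar>"
 using int_dist_le[of y "round x"] unfolding int_dist_round[of x] by linarith

lemma int_dist_eq_abs: "\<bar>x\<bar> \<le> 1/2 \<Longrightarrow> int_dist x = \<bar>x\<bar>"
proof -
 assume x: "\<bar>x\<bar> \<le> 1/2"
 have "\<bar>x\<bar> \<le> \<bar>x - of_int (round x)\<bar>"
 proof (cases "round x = 0")
  case False
  then have "\<bar>of_int (round x) :: real\<bar> \<ge> 1" by linarith
  then show ?thesis using x by linarith
 qed simp
 then show ?thesis using int_dist_le[of x 0] by (simp add: int_dist_round)
qed

lemma sin_pi_ge:
 assumes "0 \<le> v" "v \<le> 1/2"
 shows "2 * v \<le> sin (pi * v)"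
proof -
 have "convex_on {0..1/2} (\<lambda>v. - sin (pi * v))"
 proof (rule f''_ge0_imp_convex)
  fix x :: real assume x: "x \<in> {0..1/2}"
  show "((\<lambda>v. - sin (pi * v)) has_real_derivative (- pi * cos (pi * x))) (at x)"
   by (auto intro!: derivative_eq_intros)
  show "((\<lambda>x. - pi * cos (pi * x)) has_real_derivative (pi * pi * sin (pi * x))) (at x)"
   by (auto intro!: derivative_eq_intros)
  have "pi * x \<le> pi * 1" using x by (intro mult_left_mono) auto
  then show "pi * pi * sin (pi * x) \<ge> 0" using x by (intro mult_nonneg_nonneg sin_ge_zero) auto
 qed simp
 from convex_onD[OF this, of "2 * v" 0 "1/2"] assms show ?thesis by simp
qed

section \<open>Additive characters, the Dirichlet kernel and its derivative\<close>

definition circ :: "real \<Rightarrow> complex" where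
 "circ x = cis (2 * pi * x)"

lemma norm_circ [simp]: "norm (circ x) = 1"
 unfolding circ_def by simp

lemma circ_add: "circ (x + y) = circ x * circ y"
 unfolding circ_def by (simp add: cis_mult distrib_left)

lemma circ_power: "circ x ^ n = circ (real n * x)"
 unfolding circ_def using Complex.DeMoivre[of "2 * pi * x" n] by (simp add: mult_ac)

lemma circ_int [simp]: "circ (of_int k) = 1"
 unfolding circ_def by (rule cis_multiple_2pi) simp

lemma circ_0 [simp]: "circ 0 = 1"
 by (simp add: circ_def)

lemma cnj_circ: "cnj (circ x) = circ (- x)"
 unfolding circ_def by (simp add: cis_cnj)

lemma norm_one_minus_circ_eq: "norm (1 - circ v) = 2 * \<bar>sin (pi * v)\<bar>"
proof -
 have "(norm (1 - circ v))^2 = (1 - cos (2*pi * v))^2 + (sin (2*pi * v))^2"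
  by (simp add: cmod_power2 circ_def)
 also have "... = 2 - 2 * cos (2 * (pi * v))"
  using sin_cos_squared_add[of "2*pi * v"] by (simp add: power2_eq_square algebra_simps)
 also have "... = (2 * \<bar>sin (pi * v)\<bar>)^2" by (simp add: cos_double_sin power_mult_distrib)
 finally show ?thesis by (rule power2_eq_imp_eq) auto
qed

lemma norm_circ_diff: "norm (circ x - circ y) \<le> 2 * pi * \<bar>x - y\<bar>"
proof -
 have "circ x - circ y = - circ y * (1 - circ (x - y))"
  using circ_add[of y "x - y"] by (simp add: algebra_simps)
 then have "norm (circ x - circ y) = norm (1 - circ (x - y))" by (simp add: norm_mult)
 also have "... \<le> 2 * \<bar>pi * (x - y)\<bar>" unfolding norm_one_minus_circ_eq by (simp add: abs_sin_x_le_abs_x del: abs_mult)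
 finally show ?thesis by (simp add: abs_mult)
qed

lemma norm_one_minus_circ: "norm (1 - circ x) \<ge> 4 * int_dist x"
proof -
 define v where "v = x - of_int (round x)"
 have "circ x = circ v * circ (of_int (round x))" unfolding circ_add[symmetric] v_def by simp
 then have e: "circ x = circ v" by simp
 have v: "\<bar>v\<bar> = int_dist x" "\<bar>v\<bar> \<le> 1/2" using int_dist_le_half[of x] unfolding v_def int_dist_round by simp_all
 have "2 * \<bar>v\<bar> \<le> sin (pi * \<bar>v\<bar>)" by (rule sin_pi_ge) (use v in auto)
 moreover have "sin (pi * \<bar>v\<bar>) \<le> \<bar>sin (pi * v)\<bar>" by (cases "v \<ge> 0") auto
 ultimately show ?thesis unfolding e v(1)[symmetric] norm_one_minus_circ_eq by linarith
qed

definition dker :: "nat \<Rightarrow> real \<Rightarrow> complex" where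
 "dker n u = (\<Sum>q=1..n. circ (real q * u))"

text \<open>Up to the factor 2 pi i this is the derivative of the Dirichlet kernel
  \<open>dker\<close>; the weight q is the Jacobian of the substitution a = q x in Poisson
  summation.\<close>

definition gker :: "nat \<Rightarrow> real \<Rightarrow> complex" where
 "gker n u = (\<Sum>q=1..n. of_nat q * circ (real q * u))"

lemma norm_sum_circ_le:
 assumes "int_dist u > 0"
 shows "norm (\<Sum>q=m..n. circ (real q * u)) \<le> 1 / (2 * int_dist u)"
proof (cases "m \<le> n")
 case True
 have "(1 - circ u) * (\<Sum>q=m..n. circ u ^ q) = circ u ^ m - circ u ^ Suc n" by (rule sum_gp_multiplied[OF True])
 then have "norm (1 - circ u) * norm (\<Sum>q=m..n. circ u ^ q) = norm (circ u ^ m - circ u ^ Suc n)"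
  by (metis norm_mult)
 also have "... \<le> norm (circ u ^ m) + norm (circ u ^ Suc n)" by (rule norm_triangle_ineq4)
 also have "... = 2" by (simp add: norm_power norm_mult)
 finally have *: "norm (1 - circ u) * norm (\<Sum>q=m..n. circ u ^ q) \<le> 2" .
 have "4 * int_dist u * norm (\<Sum>q=m..n. circ u ^ q) \<le> norm (1 - circ u) * norm (\<Sum>q=m..n. circ u ^ q)"
  by (intro mult_right_mono norm_one_minus_circ) simp
 then have "4 * int_dist u * norm (\<Sum>q=m..n. circ u ^ q) \<le> 2" using * by linarith
 then show ?thesis using assms by (simp add: circ_power field_simps)
qed (use assms in auto)

lemma norm_dker_le: "norm (dker n u) \<le> real n"
 unfolding dker_def using norm_sum[of "\<lambda>q. circ (real q * u)" "{1..n}"] by simp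

lemma norm_dker_le_int_dist: "int_dist u > 0 \<Longrightarrow> norm (dker n u) \<le> 1 / (2 * int_dist u)"
 unfolding dker_def by (rule norm_sum_circ_le)

lemma norm_gker_le: "norm (gker n u) \<le> real n ^ 2"
proof -
 have "norm (gker n u) \<le> (\<Sum>q=1..n. norm (of_nat q * circ (real q * u)))" unfolding gker_def by (rule norm_sum)
 also have "... \<le> (\<Sum>q=1..n. real n)" by (rule sum_mono) (simp add: norm_mult)
 finally show ?thesis by (simp add: power2_eq_square)
qed

text \<open>Abel summation: the weight q counts the m \<le> q, and the inner geometric sums are
  bounded uniformly in m. Away from the integers this replaces n^2 by n/(2
  \<open>int_dist u\<close>).\<close>

lemma gker_altdef: "gker n u = (\<Sum>m=1..n. \<Sum>q=m..n. circ (real q * u))"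
proof (induction n)
 case (Suc n)
 have "(\<Sum>m=1..Suc n. \<Sum>q=m..Suc n. circ (real q * u))
   = (\<Sum>m=1..Suc n. (\<Sum>q=m..n. circ (real q * u)) + circ (real (Suc n) * u))"
  by (rule sum.cong) auto
 also have "... = (\<Sum>m=1..n. \<Sum>q=m..n. circ (real q * u)) + of_nat (Suc n) * circ (real (Suc n) * u)"
  by (simp add: sum.distrib)
 finally show ?case using Suc by (simp add: gker_def)
qed (simp add: gker_def)

lemma norm_gker_le_int_dist:
 assumes "int_dist u > 0"
 shows "norm (gker n u) \<le> real n / (2 * int_dist u)"
proof -
 have "norm (gker n u) \<le> (\<Sum>m=1..n. norm (\<Sum>q=m..n. circ (real q * u)))"
  unfolding gker_altdef by (rule norm_sum)
 also have "... \<le> (\<Sum>m=1..n. 1 / (2 * int_dist u))" by (intro sum_mono norm_sum_circ_le assms)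
 finally show ?thesis by simp
qed

lemma circ_has_vector_derivative:
 "((\<lambda>u. circ (c * u)) has_vector_derivative (2 * pi * c * \<i>) * circ (c * u)) (at u within S)"
proof -
 have "((\<lambda>z. exp (\<i> * (2 * pi * c * z))) has_field_derivative (2 * pi * c * \<i>) * exp (\<i> * (2 * pi * c * of_real u))) (at (of_real u))"
  by (auto intro!: derivative_eq_intros)
 from has_vector_derivative_real_field[OF this, of S] show ?thesis
  unfolding circ_def cis_conv_exp by (simp add: mult_ac)
qed

lemma circ_continuous [continuous_intros]:
 "continuous_on S f \<Longrightarrow> continuous_on S (\<lambda>x. circ (f x))"
 unfolding circ_def cis_conv_exp by (intro continuous_intros)

lemma dker_continuous [continuous_intros]: "continuous_on S f \<Longrightarrow> continuous_on S (\<lambda>x. dker n (f x))"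
 unfolding dker_def by (intro continuous_intros)

lemma gker_continuous [continuous_intros]: "continuous_on S f \<Longrightarrow> continuous_on S (\<lambda>x. gker n (f x))"
 unfolding gker_def by (intro continuous_intros)

lemma dker_has_vector_derivative:
 "(dker n has_vector_derivative (2 * pi * \<i>) * gker n u) (at u within S)"
proof -
 have "((\<lambda>u. \<Sum>q=1..n. circ (real q * u)) has_vector_derivative (\<Sum>q=1..n. (2 * pi * real q * \<i>) * circ (real q * u))) (at u within S)"
  by (intro has_vector_derivative_sum circ_has_vector_derivative)
 moreover have "(\<Sum>q=1..n. (2 * pi * real q * \<i>) * circ (real q * u)) = (2 * pi * \<i>) * gker n u"
  unfolding gker_def by (simp add: sum_distrib_left mult_ac)
 ultimately show ?thesis unfolding dker_def by simp
qed

lemma norm_square_sum_circ: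
 fixes I :: "nat set"
 assumes "finite I"
 shows "(norm (\<Sum>k\<in>I. circ (real k * u)))^2 = (\<Sum>k\<in>I. \<Sum>l\<in>I. cos (2 * pi * ((real k - real l) * u)))"
proof -
 have "complex_of_real ((norm (\<Sum>k\<in>I. circ (real k * u)))^2) = (\<Sum>k\<in>I. circ (real k * u)) * cnj (\<Sum>k\<in>I. circ (real k * u))"
  by (rule complex_norm_square)
 also have "... = (\<Sum>k\<in>I. \<Sum>l\<in>I. circ (real k * u) * circ (- (real l * u)))"
  by (simp add: sum_product cnj_circ)
 also have "... = (\<Sum>k\<in>I. \<Sum>l\<in>I. circ ((real k - real l) * u))"
  by (simp add: circ_add[symmetric] algebra_simps)
 finally have "Re (complex_of_real ((norm (\<Sum>k\<in>I. circ (real k * u)))^2)) = (\<Sum>k\<in>I. \<Sum>l\<in>I. Re (circ ((real k - real l) * u)))"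
  by (simp only: Re_sum)
 then show ?thesis by (simp add: circ_def)
qed

lemma has_integral_cos_period:
 fixes k l :: nat
 shows "((\<lambda>u. cos (2 * pi * ((real k - real l) * u))) has_integral (if k = l then 1 else 0)) {a..a+1}"
proof (cases "k = l")
 case True
 then show ?thesis using has_integral_const_real[of "1::real" a "a+1"] by simp
next
 case False
 define c where "c = 2 * pi * (real k - real l)"
 have c: "c \<noteq> 0" unfolding c_def using False by simp
 have "((\<lambda>u. cos (c * u)) has_integral (sin (c * (a+1)) / c - sin (c * a) / c)) {a..a+1}"
  by (rule fundamental_theorem_of_calculus)
   (use c in \<open>auto intro!: derivative_eq_intros simp flip: has_real_derivative_iff_has_vector_derivative\<close>)
 moreover have "sin (c * (a+1)) = sin (c * a)"
 proof -
  have "c * (a + 1) = c * a + 2 * pi * of_int (int k - int l)" unfolding c_def by (simp add: algebra_simps)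
  then show ?thesis using sin_add[of "c * a"] sin_int_2pin[of "int k - int l"] cos_int_2pin[of "int k - int l"] by simp
 qed
 ultimately show ?thesis using False unfolding c_def by (simp add: mult_ac)
qed

lemma has_integral_norm_square_period:
 fixes I :: "nat set"
 assumes "finite I"
 shows "((\<lambda>u. (norm (\<Sum>k\<in>I. circ (real k * u)))^2) has_integral real (card I)) {a..a+1}"
proof -
 have "((\<lambda>u. \<Sum>k\<in>I. \<Sum>l\<in>I. cos (2 * pi * ((real k - real l) * u))) has_integral (\<Sum>k\<in>I. \<Sum>l\<in>I. if k = l then 1 else 0)) {a..a+1}"
  by (intro has_integral_sum has_integral_cos_period assms)
 moreover have "(\<Sum>k\<in>I. \<Sum>l\<in>I. if k = l then 1 else (0::real)) = real (card I)"
  using assms by (simp add: sum.delta)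
 ultimately show ?thesis by (simp add: norm_square_sum_circ[OF assms])
qed

section \<open>Derivative tests for oscillatory integrals\<close>

definition phase :: "real \<Rightarrow> real \<Rightarrow> (real \<Rightarrow> real) \<Rightarrow> (real \<Rightarrow> real) \<Rightarrow> (real \<Rightarrow> real) \<Rightarrow> bool" where
 "phase a b \<psi> \<psi>1 \<psi>2 \<longleftrightarrow>
   (\<forall>x\<in>{a..b}. (\<psi> has_real_derivative \<psi>1 x) (at x) \<and> (\<psi>1 has_real_derivative \<psi>2 x) (at x)) \<and>
   continuous_on {a..b} \<psi>2"

lemma phaseD:
 assumes "phase a b \<psi> \<psi>1 \<psi>2" "x \<in> {a..b}"
 shows "(\<psi> has_real_derivative \<psi>1 x) (at x)" "(\<psi>1 has_real_derivative \<psi>2 x) (at x)"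
 using assms unfolding phase_def by auto

lemma phase_subset: "phase a b \<psi> \<psi>1 \<psi>2 \<Longrightarrow> a \<le> c \<Longrightarrow> d \<le> b \<Longrightarrow> phase c d \<psi> \<psi>1 \<psi>2"
 unfolding phase_def by (auto intro: continuous_on_subset)

lemma phase_continuous:
 assumes "phase a b \<psi> \<psi>1 \<psi>2"
 shows "continuous_on {a..b} \<psi>" "continuous_on {a..b} \<psi>1" "continuous_on {a..b} \<psi>2"
proof -
 show "continuous_on {a..b} \<psi>"
  by (rule DERIV_continuous_on) (rule has_field_derivative_at_within, erule phaseD(1)[OF assms])
 show "continuous_on {a..b} \<psi>1"
  by (rule DERIV_continuous_on) (rule has_field_derivative_at_within, erule phaseD(2)[OF assms])
qed (use assms in \<open>auto simp: phase_def\<close>)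

lemma phase_reflect:
 assumes "phase a b \<psi> \<psi>1 \<psi>2"
 shows "phase (-b) (-a) (\<lambda>x. \<psi> (-x)) (\<lambda>x. - \<psi>1 (-x)) (\<lambda>x. \<psi>2 (-x))"
 unfolding phase_def
proof (intro conjI ballI)
 fix x assume "x \<in> {-b..-a}"
 then have x: "-x \<in> {a..b}" by auto
 have m: "(uminus has_real_derivative -1) (at x)" by (auto intro!: derivative_eq_intros)
 show "((\<lambda>x. \<psi> (-x)) has_real_derivative - \<psi>1 (-x)) (at x)"
  using DERIV_chain2[where f = \<psi> and g = uminus, OF phaseD(1)[OF assms x] m] by simp
 have "((\<lambda>x. \<psi>1 (-x)) has_real_derivative \<psi>2 (-x) * -1) (at x)"
  by (rule DERIV_chain2[where f = \<psi>1 and g = uminus, OF phaseD(2)[OF assms x] m])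
 then show "((\<lambda>x. - \<psi>1 (-x)) has_real_derivative \<psi>2 (-x)) (at x)"
  using DERIV_minus by fastforce
next
 show "continuous_on {-b..-a} (\<lambda>x. \<psi>2 (-x))"
  by (rule continuous_on_compose2[OF phase_continuous(3)[OF assms]]) (auto intro!: continuous_intros)
qed

lemma phase_mono_diff:
 assumes "phase a b \<psi> \<psi>1 \<psi>2" "a \<le> x" "x \<le> y" "y \<le> b" "\<And>z. z \<in> {a..b} \<Longrightarrow> m \<le> \<psi>2 z" 
 shows "m * (y - x) \<le> \<psi>1 y - \<psi>1 x"
proof -
 have "\<psi>1 x - m * x \<le> \<psi>1 y - m * y"
 proof (rule DERIV_nonneg_imp_nondecreasing[OF assms(3)])
  fix z assume z: "x \<le> z" "z \<le> y"
  have "((\<lambda>x. \<psi>1 x - m * x) has_real_derivative \<psi>2 z - m) (at z)"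
   using phaseD(2)[OF assms(1), of z] z assms by (auto intro!: derivative_eq_intros)
  moreover have "\<psi>2 z - m \<ge> 0" using assms z by auto
  ultimately show "\<exists>D. ((\<lambda>x. \<psi>1 x - m * x) has_real_derivative D) (at z) \<and> 0 \<le> D" by blast
 qed
 then show ?thesis by (simp add: algebra_simps)
qed

lemma integral_le_antiderivative:
 fixes F :: "real \<Rightarrow> real"
 assumes "a \<le> b" "\<And>x. x \<in> {a..b} \<Longrightarrow> (F has_real_derivative F' x) (at x within {a..b})"
  "h integrable_on {a..b}" "\<And>x. x \<in> {a..b} \<Longrightarrow> h x \<le> F' x"
 shows "integral {a..b} h \<le> F b - F a"
proof -
 have "(F' has_integral (F b - F a)) {a..b}"
  using assms by (intro fundamental_theorem_of_calculus) (auto simp: has_real_derivative_iff_has_vector_derivative)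
 moreover have "(h has_integral integral {a..b} h) {a..b}" using assms by (simp add: integrable_integral)
 ultimately show ?thesis using assms(4) by (meson has_integral_le)
qed

lemma norm_integral_le_antiderivative:
 fixes h :: "real \<Rightarrow> complex"
 assumes "a \<le> b" "\<And>x. x \<in> {a..b} \<Longrightarrow> (F has_real_derivative F' x) (at x within {a..b})"
  "continuous_on {a..b} h" "\<And>x. x \<in> {a..b} \<Longrightarrow> norm (h x) \<le> F' x"
 shows "norm (integral {a..b} h) \<le> F b - F a"
proof -
 have "norm (integral {a..b} h) \<le> integral {a..b} (\<lambda>x. norm (h x))"
  by (rule integral_norm_bound_integral) (auto intro!: integrable_continuous_real continuous_intros assms(3))
 also have "... \<le> F b - F a"
  using assms by (intro integral_le_antiderivative[where F' = F']) (auto intro!: integrable_continuous_real continuous_intros)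
 finally show ?thesis .
qed

lemma norm_integral_le_const:
 fixes h :: "real \<Rightarrow> complex"
 assumes "a \<le> b" "continuous_on {a..b} h" "\<And>x. x \<in> {a..b} \<Longrightarrow> norm (h x) \<le> c"
 shows "norm (integral {a..b} h) \<le> c * (b - a)"
proof -
 have "norm (integral {a..b} h) \<le> (\<lambda>x. c * x) b - (\<lambda>x. c * x) a"
  by (rule norm_integral_le_antiderivative[where F' = "\<lambda>_. c"]) (use assms in \<open>auto intro!: derivative_eq_intros\<close>)
 then show ?thesis by (simp add: right_diff_distrib)
qed

text \<open>The integrand times 2 pi i \<open>\<psi>1\<close> is the derivative of
  \<open>dker n (\<psi> x)\<close>, so one integration by parts trades \<open>gker\<close> for
  \<open>dker\<close>. The remaining integral is controlled through any F whose derivative dominates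
  its integrand; in the applications the choice of F is the whole estimate.\<close>

lemma gker_phase_ibp:
 assumes ph: "phase a b \<psi> \<psi>1 \<psi>2" and ab: "a \<le> b" and nz: "\<And>x. x \<in> {a..b} \<Longrightarrow> \<psi>1 x \<noteq> 0"
  and F: "\<And>x. x \<in> {a..b} \<Longrightarrow> (F has_real_derivative F' x) (at x within {a..b})"
   "\<And>x. x \<in> {a..b} \<Longrightarrow> norm (dker n (\<psi> x)) * \<bar>\<psi>2 x\<bar> / (\<psi>1 x)^2 \<le> F' x"
 shows "norm (integral {a..b} (\<lambda>x. gker n (\<psi> x))) \<le>
  (norm (dker n (\<psi> b)) / \<bar>\<psi>1 b\<bar> + norm (dker n (\<psi> a)) / \<bar>\<psi>1 a\<bar> + (F b - F a)) / (2 * pi)"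
proof -
 note cont = phase_continuous[OF ph]
 define H where "H x = inverse (\<psi>1 x) *\<^sub>R dker n (\<psi> x)" for x
 define c where "c x = (- (\<psi>2 x / (\<psi>1 x)^2)) *\<^sub>R dker n (\<psi> x)" for x
 have dH: "(H has_vector_derivative (2 * pi * \<i>) * gker n (\<psi> x) + c x) (at x within {a..b})" if x: "x \<in> {a..b}" for x
 proof -
  have 1: "((dker n \<circ> \<psi>) has_vector_derivative \<psi>1 x *\<^sub>R ((2 * pi * \<i>) * gker n (\<psi> x))) (at x)"
   using phaseD(1)[OF ph x] by (intro vector_diff_chain_at dker_has_vector_derivative) (simp add: has_real_derivative_iff_has_vector_derivative)
  have 2: "((\<lambda>x. inverse (\<psi>1 x)) has_real_derivative - (\<psi>2 x / (\<psi>1 x)^2)) (at x)"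
   using phaseD(2)[OF ph x] nz[OF x] by (auto intro!: derivative_eq_intros simp: power2_eq_square field_simps)
  from has_vector_derivative_scaleR[OF 2 1]
  have "(H has_vector_derivative inverse (\<psi>1 x) *\<^sub>R (\<psi>1 x *\<^sub>R ((2 * pi * \<i>) * gker n (\<psi> x))) + (- (\<psi>2 x / (\<psi>1 x)^2)) *\<^sub>R dker n (\<psi> x)) (at x)"
   unfolding H_def o_def by simp
  from has_vector_derivative_at_within[OF this, of "{a..b}"] show ?thesis unfolding c_def using nz[OF x] by simp
 qed
 have contc: "continuous_on {a..b} c" unfolding c_def using nz by (intro continuous_intros cont) auto
 have contg: "continuous_on {a..b} (\<lambda>x. gker n (\<psi> x))" by (intro continuous_intros cont)
 have "((\<lambda>x. (2 * pi * \<i>) * gker n (\<psi> x) + c x) has_integral (H b - H a)) {a..b}"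
  using dH by (intro fundamental_theorem_of_calculus ab)
 moreover have "((\<lambda>x. (2 * pi * \<i>) * gker n (\<psi> x) + c x) has_integral ((2 * pi * \<i>) * integral {a..b} (\<lambda>x. gker n (\<psi> x)) + integral {a..b} c)) {a..b}"
  using contc contg by (intro has_integral_add has_integral_mult_right integrable_integral integrable_continuous_real)
 ultimately have e: "(2 * pi * \<i>) * integral {a..b} (\<lambda>x. gker n (\<psi> x)) = H b - H a - integral {a..b} c"
  by (metis add_diff_cancel_right' has_integral_unique)
 have nH: "norm (H x) = norm (dker n (\<psi> x)) / \<bar>\<psi>1 x\<bar>" for x unfolding H_def by (simp add: divide_inverse mult.commute)
 have nc: "norm (integral {a..b} c) \<le> F b - F a"
  by (rule norm_integral_le_antiderivative[OF ab F(1) contc]) (use F(2) in \<open>auto simp: c_def mult.commute abs_divide\<close>)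
 have "2 * pi * norm (integral {a..b} (\<lambda>x. gker n (\<psi> x))) = norm (H b - H a - integral {a..b} c)"
  unfolding e[symmetric] by (simp add: norm_mult)
 also have "... \<le> norm (H b) + norm (H a) + norm (integral {a..b} c)"
  using norm_triangle_ineq4[of "H b - H a" "integral {a..b} c"] norm_triangle_ineq4[of "H b" "H a"] by linarith
 also have "... \<le> norm (dker n (\<psi> b)) / \<bar>\<psi>1 b\<bar> + norm (dker n (\<psi> a)) / \<bar>\<psi>1 a\<bar> + (F b - F a)"
  using nH nc by simp
 finally show ?thesis by (simp add: field_simps)
qed

text \<open>Because \<open>\<psi>2\<close> has constant sign, -\<sigma> n/\<open>\<psi>1\<close> is
  an antiderivative of the majorant, and it is bounded by n/\<nu>. The boundary terms are of the
  same size, and 4/(2 pi) \<le> 1.\<close>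

lemma gker_first_derivative_test:
 assumes ph: "phase a b \<psi> \<psi>1 \<psi>2" and ab: "a \<le> b" and \<nu>: "\<nu> > 0" "\<And>x. x \<in> {a..b} \<Longrightarrow> \<nu> \<le> \<bar>\<psi>1 x\<bar>"
  and \<sigma>: "\<bar>\<sigma>\<bar> = 1" "\<And>x. x \<in> {a..b} \<Longrightarrow> \<sigma> * \<psi>2 x \<ge> 0"
 shows "norm (integral {a..b} (\<lambda>x. gker n (\<psi> x))) \<le> real n / \<nu>"
proof -
 have nz: "\<psi>1 x \<noteq> 0" if "x \<in> {a..b}" for x using \<nu>(1) \<nu>(2)[OF that] by auto
 define F where "F x = - (real n * \<sigma>) / \<psi>1 x" for x
 have dF: "(F has_real_derivative (real n * (\<sigma> * \<psi>2 x) / (\<psi>1 x)^2)) (at x within {a..b})" if "x \<in> {a..b}" for x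
  unfolding F_def using phaseD(2)[OF ph that] nz[OF that]
  by (auto intro!: derivative_eq_intros has_field_derivative_at_within[OF phaseD(2)[OF ph that]] simp: power2_eq_square)
 have Fb: "\<bar>F x\<bar> \<le> real n / \<nu>" if "x \<in> {a..b}" for x
  unfolding F_def using \<sigma>(1) \<nu>(1) \<nu>(2)[OF that] by (simp add: abs_mult) (intro divide_left_mono, auto)
 have bd: "norm (dker n (\<psi> x)) / \<bar>\<psi>1 x\<bar> \<le> real n / \<nu>" if "x \<in> {a..b}" for x
  using \<nu>(1) \<nu>(2)[OF that] by (intro frac_le norm_dker_le) auto
 have "norm (integral {a..b} (\<lambda>x. gker n (\<psi> x))) \<le>
  (norm (dker n (\<psi> b)) / \<bar>\<psi>1 b\<bar> + norm (dker n (\<psi> a)) / \<bar>\<psi>1 a\<bar> + (F b - F a)) / (2 * pi)"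
 proof (rule gker_phase_ibp[OF ph ab nz dF])
  fix x assume x: "x \<in> {a..b}"
  have "\<bar>\<psi>2 x\<bar> = \<sigma> * \<psi>2 x" using \<sigma>(1) \<sigma>(2)[OF x] by (metis abs_mult abs_of_nonneg mult_1)
  moreover have "norm (dker n (\<psi> x)) * (\<sigma> * \<psi>2 x) \<le> real n * (\<sigma> * \<psi>2 x)"
   using \<sigma>(2)[OF x] by (intro mult_right_mono norm_dker_le)
  ultimately show "norm (dker n (\<psi> x)) * \<bar>\<psi>2 x\<bar> / (\<psi>1 x)^2 \<le> real n * (\<sigma> * \<psi>2 x) / (\<psi>1 x)^2"
   by (intro divide_right_mono) auto
 qed
 also have "... \<le> (4 * (real n / \<nu>)) / (2 * pi)"
  using bd[of a] bd[of b] Fb[of a] Fb[of b] ab by (intro divide_right_mono) auto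
 also have "... \<le> real n / \<nu>"
 proof -
  have "(4 * (real n / \<nu>)) / (2 * pi) \<le> (4 * (real n / \<nu>)) / 4"
   using \<nu>(1) pi_ge_two by (intro divide_left_mono) auto
  then show ?thesis by simp
 qed
 finally show ?thesis .
qed

text \<open>A window of radius s = 1/sqrt(n \<mu>) around the point nearest to stationarity balances
  the trivial bound n^2 s with the bound n/(\<mu> s) of the first derivative test outside.\<close>

lemma gker_second_derivative_test:
 assumes ph: "phase a b \<psi> \<psi>1 \<psi>2" and ab: "a \<le> b" and \<mu>: "\<mu> > 0" "\<And>x. x \<in> {a..b} \<Longrightarrow> \<mu> \<le> \<psi>2 x"
  and n: "n \<ge> 1"
 shows "norm (integral {a..b} (\<lambda>x. gker n (\<psi> x))) \<le> 4 * real n * sqrt (real n / \<mu>)"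
proof -
 define r where "r = sqrt (real n / \<mu>)"
 have r: "r > 0" "r^2 = real n / \<mu>" unfolding r_def using n \<mu> by auto
 define s where "s = r / real n"
 have s: "s > 0" unfolding s_def using r n by simp
 have ms: "real n / (\<mu> * s) = real n * r" unfolding s_def using r n \<mu> by (simp add: field_simps power2_eq_square)
 note cont = phase_continuous[OF ph]
 have md: "\<mu> * (y - x) \<le> \<psi>1 y - \<psi>1 x" if "a \<le> x" "x \<le> y" "y \<le> b" for x y
  using phase_mono_diff[OF ph that \<mu>(2)] .
 \<comment> \<open>If \<open>\<psi>1\<close> has no zero in the interval, the endpoint where its
   modulus is smallest takes the place of the stationary point.\<close>
 obtain x0 where x0: "x0 \<in> {a..b}" "\<And>x. x \<in> {a..b} \<Longrightarrow> \<mu> * \<bar>x - x0\<bar> \<le> \<bar>\<psi>1 x\<bar>"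
 proof -
  consider "\<psi>1 a \<ge> 0" | "\<psi>1 b \<le> 0" | "\<psi>1 a \<le> 0" "0 \<le> \<psi>1 b" by linarith
  then show ?thesis
  proof cases
   case 1
   have "\<mu> * \<bar>x - a\<bar> \<le> \<bar>\<psi>1 x\<bar>" if "x \<in> {a..b}" for x using md[of a x] that 1 by auto
   then show ?thesis using that[of a] ab by auto
  next
   case 2
   have "\<mu> * \<bar>x - b\<bar> \<le> \<bar>\<psi>1 x\<bar>" if "x \<in> {a..b}" for x using md[of x b] that 2 by auto
   then show ?thesis using that[of b] ab by auto
  next
   case 3
   obtain x0 where z: "a \<le> x0" "x0 \<le> b" "\<psi>1 x0 = 0" using IVT'[of \<psi>1 a 0 b, OF 3 ab cont(2)] by auto
   have "\<mu> * \<bar>x - x0\<bar> \<le> \<bar>\<psi>1 x\<bar>" if "x \<in> {a..b}" for x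
    using md[of x x0] md[of x0 x] that z by (cases "x \<le> x0") auto
   then show ?thesis using that[of x0] z by auto
  qed
 qed
 define c1 c2 where "c1 = max a (x0 - s)" and "c2 = min b (x0 + s)"
 have c: "a \<le> c1" "c1 \<le> x0" "x0 \<le> c2" "c2 \<le> b" "c2 - c1 \<le> 2 * s" using x0 s unfolding c1_def c2_def by auto
 let ?g = "\<lambda>x. gker n (\<psi> x)"
 have gc: "continuous_on {u..v} ?g" if "a \<le> u" "v \<le> b" for u v
  using that by (intro continuous_intros continuous_on_subset[OF cont(1)]) auto
 have sg: "\<bar>1::real\<bar> = 1" "\<And>x. x \<in> {a..b} \<Longrightarrow> 1 * \<psi>2 x \<ge> 0" using \<mu> by (auto intro: order_trans[OF less_imp_le])
 have far: "\<mu> * s \<le> \<bar>\<psi>1 x\<bar>" if "x \<in> {a..b}" "s \<le> \<bar>x - x0\<bar>" for x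
  using x0(2)[OF that(1)] mult_left_mono[OF that(2), of \<mu>] \<mu> by linarith
 have I1: "norm (integral {a..c1} ?g) \<le> real n * r"
 proof (cases "c1 = a")
  case False
  then have "c1 = x0 - s" unfolding c1_def by auto
  then have "norm (integral {a..c1} ?g) \<le> real n / (\<mu> * s)"
   using c s \<mu> by (intro gker_first_derivative_test[OF phase_subset[OF ph] _ _ _ sg(1)] far sg(2)) auto
  then show ?thesis using ms by simp
 qed (use r in simp)
 have I3: "norm (integral {c2..b} ?g) \<le> real n * r"
 proof (cases "c2 = b")
  case False
  then have "c2 = x0 + s" unfolding c2_def by auto
  then have "norm (integral {c2..b} ?g) \<le> real n / (\<mu> * s)"
   using c s \<mu> by (intro gker_first_derivative_test[OF phase_subset[OF ph] _ _ _ sg(1)] far sg(2)) auto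
  then show ?thesis using ms by simp
 qed (use r in simp)
 have I2: "norm (integral {c1..c2} ?g) \<le> 2 * real n * r"
 proof -
  have "norm (integral {c1..c2} ?g) \<le> real n ^ 2 * (c2 - c1)"
   using c by (intro norm_integral_le_const gc norm_gker_le) auto
  also have "... \<le> real n ^ 2 * (2 * s)" using c by (intro mult_left_mono) auto
  also have "... = 2 * real n * r" unfolding s_def using n by (simp add: power2_eq_square)
  finally show ?thesis .
 qed
 have int: "?g integrable_on {u..v}" if "a \<le> u" "v \<le> b" for u v
  using gc[OF that] by (rule integrable_continuous_real)
 have e: "integral {a..b} ?g = integral {a..c1} ?g + integral {c1..c2} ?g + integral {c2..b} ?g"
  using c by (simp add: Henstock_Kurzweil_Integration.integral_combine int)
 have "norm (integral {a..b} ?g) \<le> norm (integral {a..c1} ?g) + norm (integral {c1..c2} ?g) + norm (integral {c2..b} ?g)"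
  unfolding e using norm_triangle_ineq[of "integral {a..c1} ?g + integral {c1..c2} ?g" "integral {c2..b} ?g"]
   norm_triangle_ineq[of "integral {a..c1} ?g" "integral {c1..c2} ?g"] by linarith
 then show ?thesis using I1 I2 I3 unfolding r_def by linarith
qed

section \<open>Stationary phase with the kernel kept inside\<close>

lemma dker_square_has_integral: "((\<lambda>u. (norm (dker n u))^2) has_integral real n) {a..a+1}"
 unfolding dker_def using has_integral_norm_square_period[of "{1..n}" a] by simp

lemma dker_square_integrable: "(\<lambda>u. (norm (dker n u))^2) integrable_on {a..b}"
 by (intro integrable_continuous_real continuous_intros)

text \<open>Each full period has mass n, and rounding up to whole periods costs at most one
  more.\<close>

lemma dker_square_integral_le:
 assumes "u \<le> y"
 shows "integral {u..y} (\<lambda>u. (norm (dker n u))^2) \<le> real n * (y - u + 1)"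
proof -
 let ?P = "\<lambda>u. (norm (dker n u))^2"
 have N: "integral {u..u + real N} ?P = real n * real N" for N
 proof (induction N)
  case (Suc N)
  have "integral {u..u + real (Suc N)} ?P = integral {u..u + real N} ?P + integral {u + real N..u + real (Suc N)} ?P"
   by (rule Henstock_Kurzweil_Integration.integral_combine[symmetric]) (auto intro: dker_square_integrable)
  also have "integral {u + real N..u + real (Suc N)} ?P = real n"
   using integral_unique[OF dker_square_has_integral[of n "u + real N"]] by (simp add: add_ac)
  finally show ?case using Suc by (simp add: algebra_simps)
 qed simp
 define N where "N = nat \<lceil>y - u\<rceil>"
 have N1: "y - u \<le> real N" "real N \<le> y - u + 1" unfolding N_def using assms by linarith+
 have "integral {u..y} ?P \<le> integral {u..u + real N} ?P"
  using N1 by (intro integral_subset_le dker_square_integrable) auto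
 also have "... \<le> real n * (y - u + 1)" unfolding N using N1 by (intro mult_left_mono) auto
 finally show ?thesis .
qed

text \<open>Away from the stationary point \<open>x0\<close> the kernel \<open>dker n\<close> is estimated in mean square over its periods; the weight in
 the arithmetic-geometric mean inequality is chosen so that no logarithm is lost.\<close>

lemma dker_far_antiderivative:
 assumes ph: "phase a b \<psi> \<psi>1 \<psi>2" and ab: "a \<le> b" "x0 < a" and \<mu>: "\<mu> > 0" and L: "\<Lambda> \<ge> 1" and n: "n \<ge> 1"
  and b1: "\<And>x. x \<in> {a..b} \<Longrightarrow> \<mu> * (x - x0) \<le> \<psi>1 x" "\<And>x. x \<in> {a..b} \<Longrightarrow> \<psi>1 x \<le> \<Lambda> * \<mu> * (x - x0)"
 obtains F F' where "\<And>x. x \<in> {a..b} \<Longrightarrow> (F has_real_derivative F' x) (at x within {a..b})"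
  "\<And>x. x \<in> {a..b} \<Longrightarrow> norm (dker n (\<psi> x)) / (x - x0)^2 \<le> F' x"
  "F b - F a \<le> sqrt (real n) / 2 * ((\<Lambda> + 1) / (a - x0) + 3 / (2 * sqrt \<mu> * (a - x0)^2))"
proof -
 define w where "w = sqrt \<mu>"
 have w: "w > 0" "\<mu> = w^2" unfolding w_def using \<mu> by auto
 define v where "v = sqrt (real n)"
 have v: "v > 0" "real n = v^2" unfolding v_def using n by auto
 define P where "P u = (norm (dker n u))^2" for u
 \<comment> \<open>With \<tau> = x - x0 and z = 1 + w \<tau> this is 1/(w \<tau>^2 z). In the
   inequality 2 N/\<tau>^2 \<le> A + B below, A pairs the square of the kernel with
   \<open>\<psi>1\<close> times W, so that it can be integrated over periods; z interpolates between
   w \<tau> < 1 and w \<tau> > 1.\<close>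
 define W where "W x = 1 / (w * (x - x0)^2 + \<mu> * (x - x0)^3)" for x
 define W' where "W' x = - (2 * w * (x - x0) + 3 * \<mu> * (x - x0)^2) / (w * (x - x0)^2 + \<mu> * (x - x0)^3)^2" for x
 define \<Phi> where "\<Phi> y = integral {\<psi> a..y} P" for y
 \<comment> \<open>Integration by parts of P(\<psi>) \<psi>1 W, written for antiderivatives. The
   integral \<Phi> is compared with its majorant n (\<psi> x - \<psi> a + 1); since W decreases, the
   term with W' has a favourable sign, and the price is n \<psi>1 W, at most n
   \<Lambda>/\<tau>^2.\<close>
 define K where "K x = \<Phi> (\<psi> x) * W x - real n * (\<psi> x - \<psi> a + 1) * W x" for x
 define K' where "K' x = P (\<psi> x) * \<psi>1 x * W x - real n * \<psi>1 x * W x + (\<Phi> (\<psi> x) - real n * (\<psi> x - \<psi> a + 1)) * W' x" for x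
 define F where "F x = K x / (2 * v) + v / 2 * (- (\<Lambda> + 1) / (x - x0) - 1 / (2 * w * (x - x0)^2))" for x
 define F' where "F' x = K' x / (2 * v) + v / 2 * ((\<Lambda> + 1) / (x - x0)^2 + 1 / (w * (x - x0)^3))" for x
 have t: "x - x0 > 0" if "x \<in> {a..b}" for x using that ab by auto
 have den: "w * (x - x0)^2 + \<mu> * (x - x0)^3 > 0" if "x \<in> {a..b}" for x
  using t[OF that] w \<mu> by (intro add_pos_pos mult_pos_pos zero_less_power) auto
 have \<psi>1pos: "\<psi>1 x > 0" if "x \<in> {a..b}" for x
 proof -
  have "\<mu> * (x - x0) > 0" using t[OF that] \<mu> by simp
  then show ?thesis using b1(1)[OF that] by linarith
 qed
 have mono: "\<psi> x \<le> \<psi> y" if "a \<le> x" "x \<le> y" "y \<le> b" for x y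
  using that by (intro DERIV_nonneg_imp_nondecreasing[OF that(2)]) (metis \<psi>1pos phaseD(1)[OF ph] atLeastAtMost_iff less_imp_le order_trans)
 have dW: "(W has_real_derivative W' x) (at x within {a..b})" if "x \<in> {a..b}" for x
 proof -
  have "(W has_real_derivative W' x) (at x)"
   unfolding W_def W'_def using den[OF that]
   by (auto intro!: derivative_eq_intros simp: power2_eq_square power3_eq_cube divide_simps) (simp add: algebra_simps)
  then show ?thesis by (rule has_field_derivative_at_within)
 qed
 have d\<Phi>: "((\<lambda>x. \<Phi> (\<psi> x)) has_real_derivative P (\<psi> x) * \<psi>1 x) (at x within {a..b})" if "x \<in> {a..b}" for x
 proof -
  have cP: "continuous_on {\<psi> a..\<psi> b} P" unfolding P_def by (intro continuous_intros)
  have "(\<Phi> has_real_derivative P (\<psi> x)) (at (\<psi> x) within {\<psi> a..\<psi> b})"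
   unfolding \<Phi>_def by (rule integral_has_real_derivative[OF cP]) (use that mono in auto)
  then have 1: "(\<Phi> has_real_derivative P (\<psi> x)) (at (\<psi> x) within \<psi> ` {a..b})"
   by (rule has_field_derivative_subset) (use mono in auto)
  have "(\<Phi> \<circ> \<psi> has_real_derivative P (\<psi> x) * \<psi>1 x) (at x within {a..b})"
   by (rule DERIV_image_chain[OF 1 has_field_derivative_at_within[OF phaseD(1)[OF ph that]]])
  then show ?thesis by (simp add: o_def)
 qed
 have dK: "(K has_real_derivative K' x) (at x within {a..b})" if "x \<in> {a..b}" for x
  unfolding K_def K'_def
  by (rule derivative_eq_intros d\<Phi>[OF that] dW[OF that] has_field_derivative_at_within[OF phaseD(1)[OF ph that]] refl)+
   (simp add: algebra_simps)
 have dF: "(F has_real_derivative F' x) (at x within {a..b})" if "x \<in> {a..b}" for x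
 proof -
  have 1: "((\<lambda>x. - (\<Lambda> + 1) / (x - x0)) has_real_derivative (\<Lambda> + 1) / (x - x0)^2) (at x within {a..b})"
   using t[OF that] by (auto intro!: derivative_eq_intros simp: power2_eq_square)
  have 2: "((\<lambda>x. 1 / (2 * w * (x - x0)^2)) has_real_derivative - (1 / (w * (x - x0)^3))) (at x within {a..b})"
  proof -
   define \<tau> where "\<tau> = x - x0"
   have \<tau>: "\<tau> > 0" unfolding \<tau>_def using t[OF that] .
   have e: "- (1 / (w * \<tau>^3)) = 1 / (2 * w) * (- (inverse (\<tau>^2) * (2 * \<tau>) * inverse (\<tau>^2)))"
    using \<tau> w by (simp add: field_simps power2_eq_square power3_eq_cube)
   have d: "((\<lambda>x. (x - x0)^2) has_real_derivative 2 * (x - x0)) (at x within {a..b})"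
    by (auto intro!: derivative_eq_intros)
   have "((\<lambda>x. 1 / (2 * w) * inverse ((x - x0)^2)) has_real_derivative
     1 / (2 * w) * (- (inverse ((x - x0)^2) * (2 * (x - x0)) * inverse ((x - x0)^2)))) (at x within {a..b})"
    by (rule DERIV_cmult[OF DERIV_inverse'[OF d]]) (use t[OF that] in simp)
   moreover have "(\<lambda>x. 1 / (2 * w) * inverse ((x - x0)^2)) = (\<lambda>x. 1 / (2 * w * (x - x0)^2))"
    by (rule ext) (simp only: divide_inverse inverse_mult_distrib mult_1_left)
   ultimately show ?thesis using e[unfolded \<tau>_def] by (simp only:)
  qed
  have "((\<lambda>x. v / 2 * (- (\<Lambda> + 1) / (x - x0) - 1 / (2 * w * (x - x0)^2))) has_real_derivative
    v / 2 * ((\<Lambda> + 1) / (x - x0)^2 + 1 / (w * (x - x0)^3))) (at x within {a..b})"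
   using DERIV_cmult[OF DERIV_diff[OF 1 2], of "v/2"] by simp
  from DERIV_add[OF DERIV_cdivide[OF dK[OF that], of "2 * v"] this] show ?thesis
   unfolding F_def F'_def .
 qed
 have bound: "norm (dker n (\<psi> x)) / (x - x0)^2 \<le> F' x" if x: "x \<in> {a..b}" for x
 proof -
  define \<tau> where "\<tau> = x - x0"
  have \<tau>: "\<tau> > 0" unfolding \<tau>_def using t[OF x] .
  define N where "N = norm (dker n (\<psi> x))"
  define z where "z = 1 + w * \<tau>"
  have z: "z > 0" unfolding z_def using \<tau> w by (intro add_pos_pos) auto
  define A where "A = N^2 * w / (v * \<tau> * z)"
  define B where "B = v * z / (w * \<tau>^3)"
  have AB: "2 * (N / \<tau>^2) \<le> A + B"
  proof -
   have pos: "A \<ge> 0" "B \<ge> 0" unfolding A_def B_def N_def using \<tau> v w z by simp_all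
   have "A * B = (N / \<tau>^2)^2"
    unfolding A_def B_def using \<tau> v(1) w(1) z
    by (simp add: field_simps power2_eq_square power3_eq_cube)
   then have "N / \<tau>^2 = sqrt (A * B)" unfolding N_def by (simp add: real_sqrt_abs)
   then show ?thesis using arith_geo_mean_sqrt[OF pos] by simp
  qed
  have W: "W x = 1 / (w * \<tau>^2 * z)" unfolding z_def W_def \<tau>_def w(2) by (simp add: power2_eq_square power3_eq_cube algebra_simps)
  have W0: "W x \<ge> 0" unfolding W using \<tau> w z by simp
  have A: "A \<le> P (\<psi> x) * \<psi>1 x * W x / v"
  proof -
   have "A = N^2 * (\<mu> * \<tau>) * W x / v" unfolding A_def W w(2) using \<tau> v(1) w(1) z
    by (simp add: field_simps power2_eq_square)
   also have "... \<le> N^2 * \<psi>1 x * W x / v"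
    using b1(1)[OF x] W0 v unfolding \<tau>_def by (intro divide_right_mono mult_right_mono mult_left_mono) auto
   finally show ?thesis unfolding P_def N_def .
  qed
  have K: "P (\<psi> x) * \<psi>1 x * W x - real n * \<psi>1 x * W x \<le> K' x"
  proof -
   have "\<Phi> (\<psi> x) \<le> real n * (\<psi> x - \<psi> a + 1)"
    unfolding \<Phi>_def P_def using mono[of a x] x by (intro dker_square_integral_le) auto
   moreover have "W' x \<le> 0"
   proof -
    have "0 \<le> 2 * w * (x - x0) + 3 * \<mu> * (x - x0)^2" using t[OF x] w(1) \<mu> by (intro add_nonneg_nonneg mult_nonneg_nonneg) auto
    then have "(2 * w * (x - x0) + 3 * \<mu> * (x - x0)^2) / (w * (x - x0)^2 + \<mu> * (x - x0)^3)^2 \<ge> 0" by (rule divide_nonneg_nonneg) simp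
    then show ?thesis unfolding W'_def by (simp only: minus_divide_left[symmetric] neg_le_0_iff_le)
   qed
   ultimately have "0 \<le> (\<Phi> (\<psi> x) - real n * (\<psi> x - \<psi> a + 1)) * W' x" by (intro mult_nonpos_nonpos) auto
   then show ?thesis unfolding K'_def by simp
  qed
  have nW: "real n * \<psi>1 x * W x \<le> real n * \<Lambda> / \<tau>^2"
  proof -
   have "\<psi>1 x * W x \<le> (\<Lambda> * \<mu> * \<tau>) * W x" using b1(2)[OF x] W0 unfolding \<tau>_def by (intro mult_right_mono) auto
   also have "... = \<Lambda> * (w / (\<tau> * z))" unfolding W w(2) using \<tau> w(1) by (simp add: power2_eq_square)
   also have "... \<le> \<Lambda> * (w / (\<tau> * (w * \<tau>)))" using \<tau> w(1) z L by (intro mult_left_mono divide_left_mono) (auto simp: z_def)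
   also have "... = \<Lambda> / \<tau>^2" using w by (simp add: power2_eq_square)
   finally have "real n * (\<psi>1 x * W x) \<le> real n * (\<Lambda> / \<tau>^2)" by (intro mult_left_mono) auto
   then show ?thesis by simp
  qed
  have "P (\<psi> x) * \<psi>1 x * W x \<le> K' x + real n * \<Lambda> / \<tau>^2" using K nW by linarith
  then have "P (\<psi> x) * \<psi>1 x * W x / v \<le> (K' x + real n * \<Lambda> / \<tau>^2) / v" using v by (intro divide_right_mono) auto
  also have "... = K' x / v + v * \<Lambda> / \<tau>^2" unfolding v(2) using v by (simp add: add_divide_distrib power2_eq_square)
  finally have "A \<le> K' x / v + v * \<Lambda> / \<tau>^2" using A by linarith
  moreover have "B = v * (1 / (w * \<tau>^3) + 1 / \<tau>^2)" unfolding B_def z_def using \<tau> w(1) by (simp add: field_simps power2_eq_square power3_eq_cube)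
  ultimately have "2 * (N / \<tau>^2) \<le> K' x / v + v * \<Lambda> / \<tau>^2 + v * (1 / (w * \<tau>^3) + 1 / \<tau>^2)" using AB by linarith
  also have "... = 2 * F' x" unfolding F'_def \<tau>_def[symmetric] by (simp add: algebra_simps add_divide_distrib)
  finally show ?thesis unfolding N_def \<tau>_def by simp
 qed
 have "F b - F a \<le> v / 2 * ((\<Lambda> + 1) / (a - x0) + 3 / (2 * w * (a - x0)^2))"
 proof -
  have b: "b \<in> {a..b}" and a: "a \<in> {a..b}" using ab by auto
  have "K b \<le> 0"
  proof -
   have "\<Phi> (\<psi> b) \<le> real n * (\<psi> b - \<psi> a + 1)"
    unfolding \<Phi>_def P_def using mono[of a b] ab by (intro dker_square_integral_le) auto
   moreover have "W b \<ge> 0" unfolding W_def using den[OF b] by simp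
   ultimately show ?thesis unfolding K_def by (simp add: mult_right_mono)
  qed
  moreover have "- K a \<le> real n / (w * (a - x0)^2)"
  proof -
   have "- K a = real n * W a" unfolding K_def \<Phi>_def by simp
   also have "W a \<le> 1 / (w * (a - x0)^2)" unfolding W_def using t[OF a] w \<mu> by (intro divide_left_mono) (auto intro!: mult_pos_pos add_pos_pos)
   finally show ?thesis by (simp add: mult_left_mono)
  qed
  ultimately have "(K b - K a) / (2 * v) \<le> real n / (w * (a - x0)^2) / (2 * v)" using v by (intro divide_right_mono) auto
  also have "... = v / 2 * (1 / (w * (a - x0)^2))" unfolding v(2) using v by (simp add: power2_eq_square)
  finally have 1: "(K b - K a) / (2 * v) \<le> v / 2 * (1 / (w * (a - x0)^2))" .
  have p: "(\<Lambda> + 1) / (b - x0) \<ge> 0" "1 / (2 * w * (b - x0)^2) \<ge> 0" using t[OF b] w(1) L by simp_all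
  have "- (\<Lambda> + 1) / (b - x0) - 1 / (2 * w * (b - x0)^2) \<le> 0" unfolding minus_divide_left[symmetric] using p by linarith
  then have 2: "v / 2 * (- (\<Lambda> + 1) / (b - x0) - 1 / (2 * w * (b - x0)^2)) \<le> 0"
   using v(1) by (intro mult_nonneg_nonpos) auto
  have "- (\<Lambda> + 1) / (a - x0) - 1 / (2 * w * (a - x0)^2) = - ((\<Lambda> + 1) / (a - x0) + 1 / (2 * w * (a - x0)^2))"
   unfolding minus_divide_left[symmetric] by linarith
  then have 3: "v / 2 * (- (\<Lambda> + 1) / (a - x0) - 1 / (2 * w * (a - x0)^2)) = - (v / 2 * ((\<Lambda> + 1) / (a - x0) + 1 / (2 * w * (a - x0)^2)))"
   by (simp only: mult_minus_right)
  have "F b - F a = (K b - K a) / (2 * v) + v / 2 * (- (\<Lambda> + 1) / (b - x0) - 1 / (2 * w * (b - x0)^2))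
    - v / 2 * (- (\<Lambda> + 1) / (a - x0) - 1 / (2 * w * (a - x0)^2))"
   unfolding F_def diff_divide_distrib by linarith
  then have "F b - F a \<le> (K b - K a) / (2 * v) + v / 2 * ((\<Lambda> + 1) / (a - x0) + 1 / (2 * w * (a - x0)^2))"
   using 2 3 by linarith
  also have "... \<le> v / 2 * (1 / (w * (a - x0)^2)) + v / 2 * ((\<Lambda> + 1) / (a - x0) + 1 / (2 * w * (a - x0)^2))" using 1 by simp
  also have "... = v / 2 * ((\<Lambda> + 1) / (a - x0) + 3 / (2 * w * (a - x0)^2))"
   using t[OF a] w by (simp add: field_simps)
  finally show ?thesis .
 qed
 then show ?thesis using that[OF dF bound] unfolding v_def w_def by blast
qed

text \<open>This is min(n, 1/\<rho>), written with a maximum in the denominator so that \<rho> = 0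
  needs no separate case.\<close>

definition cap :: "nat \<Rightarrow> real \<Rightarrow> real" where
 "cap n \<rho> = real n / max 1 (real n * \<rho>)"

text \<open>Three ranges to the right of the stationary point. Up to s the kernel itself is at most
  n/\<rho>; up to t1 the phase has moved by at most \<rho>/2, so \<open>dker\<close> is still at
  most 1/\<rho>; beyond t1 the mean-square estimate replaces the pointwise one. Up to powers of
  \<Lambda> each range gives r/\<rho>, without a logarithm; the far endpoint adds
  n/\<open>\<psi>1 b\<close>.\<close>

lemma gker_stationary_right:
 assumes ph: "phase x0 b \<psi> \<psi>1 \<psi>2" and ab: "x0 \<le> b" and \<mu>: "\<mu> > 0" and L: "\<Lambda> \<ge> 1" and n: "n \<ge> 1"
  and b2: "\<And>x. x \<in> {x0..b} \<Longrightarrow> \<mu> \<le> \<psi>2 x" "\<And>x. x \<in> {x0..b} \<Longrightarrow> \<psi>2 x \<le> \<Lambda> * \<mu>" and st: "\<psi>1 x0 = 0"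
 shows "norm (integral {x0..b} (\<lambda>x. gker n (\<psi> x))) \<le>
  16 * \<Lambda>^3 * sqrt (real n / \<mu>) * cap n (int_dist (\<psi> x0)) + real n / \<psi>1 b"
proof -
 define r where "r = sqrt (real n / \<mu>)"
 have r: "r > 0" "r^2 = real n / \<mu>" unfolding r_def using n \<mu> by auto
 have n0: "real n > 0" using n by simp
 define \<rho> where "\<rho> = int_dist (\<psi> x0)"
 have \<rho>: "\<rho> \<ge> 0" "\<rho> \<le> 1/2" unfolding \<rho>_def using int_dist_nonneg int_dist_le_half by auto
 note cont = phase_continuous[OF ph]
 have L3: "\<Lambda>^3 \<ge> \<Lambda>" "\<Lambda>^3 \<ge> 1" using L power_increasing[of 1 3 \<Lambda>] by auto
 have lo: "\<mu> * (x - x0) \<le> \<psi>1 x" if "x \<in> {x0..b}" for x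
  using phase_mono_diff[OF ph _ _ _ b2(1), of x0 x] that st by auto
 have up: "\<psi>1 x \<le> \<Lambda> * \<mu> * (x - x0)" if "x \<in> {x0..b}" for x
 proof -
  have "phase x0 b (\<lambda>x. - \<psi> x) (\<lambda>x. - \<psi>1 x) (\<lambda>x. - \<psi>2 x)"
   using ph unfolding phase_def by (auto intro!: derivative_eq_intros continuous_intros)
  from phase_mono_diff[OF this, of x0 x "- (\<Lambda> * \<mu>)"] show ?thesis using that st b2(2) by auto
 qed
 have \<psi>1b: "\<psi>1 b \<ge> 0" 
 proof -
  have "0 \<le> \<mu> * (b - x0)" using ab \<mu> by simp
  then show ?thesis using lo[of b] ab by simp
 qed
 show ?thesis
 proof (cases "real n * \<rho> \<le> 4 * \<Lambda>")
  \<comment> \<open>The cap is of order n here, so the second derivative test already has the right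
    size.\<close>
  case True
  have "4 * real n * r \<le> 16 * \<Lambda>^3 * r * cap n \<rho>"
  proof -
   have "max 1 (real n * \<rho>) \<le> 4 * \<Lambda>^3" using True L L3 by auto
   then have "real n / (4 * \<Lambda>^3) \<le> cap n \<rho>" unfolding cap_def using n0 by (intro frac_le) auto
   then have "16 * \<Lambda>^3 * r * (real n / (4 * \<Lambda>^3)) \<le> 16 * \<Lambda>^3 * r * cap n \<rho>" using L r by (intro mult_left_mono) auto
   then show ?thesis using L by (simp add: mult_ac)
  qed
  moreover have "norm (integral {x0..b} (\<lambda>x. gker n (\<psi> x))) \<le> 4 * real n * r"
   unfolding r_def by (rule gker_second_derivative_test[OF ph ab \<mu> b2(1) n])
  moreover have "real n / \<psi>1 b \<ge> 0" using \<psi>1b by simp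
  ultimately show ?thesis unfolding r_def[symmetric] \<rho>_def[symmetric] by linarith
 next
  case False
  then have nr: "real n * \<rho> > 4 * \<Lambda>" by simp
  have \<rho>0: "\<rho> > 0" using nr L \<rho>(1) by (cases "\<rho> = 0") auto
  have capr: "cap n \<rho> = 1 / \<rho>" unfolding cap_def using nr L n0 by (simp add: max_def)
  define s where "s = r / real n"
  have s: "s > 0" "real n * s = r" unfolding s_def using r n0 by auto
  have ms: "1 / (\<mu> * s) = r" unfolding s_def using r n0 \<mu> by (simp add: field_simps power2_eq_square)
  \<comment> \<open>At distance t1 the bound \<Lambda> \<mu> t1^2/2 for the change of the phase
    equals \<rho>/2. The condition n \<rho> > 4 \<Lambda> makes t1 at least s.\<close>
  define t1 where "t1 = sqrt (\<rho> / (\<Lambda> * \<mu>))"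
  have t1: "t1 > 0" "t1^2 = \<rho> / (\<Lambda> * \<mu>)" unfolding t1_def using \<rho>0 \<mu> L by auto
  have st1: "s \<le> t1"
  proof (rule power2_le_imp_le)
   have "s^2 = 1 / (real n * \<mu>)" unfolding s_def power_divide r(2) using n0 \<mu> by (simp add: power2_eq_square)
   also have "... \<le> \<rho> / (\<Lambda> * \<mu>)" using nr L \<mu> n0 by (simp add: field_simps)
   finally show "s^2 \<le> t1^2" unfolding t1(2) .
  qed (use t1 in simp)
  have near: "int_dist (\<psi> x) \<ge> \<rho> / 2" if x: "x \<in> {x0..b}" "x - x0 \<le> t1" for x
  proof -
   have "\<psi> x - \<Lambda> * \<mu> / 2 * (x - x0)^2 \<le> \<psi> x0 - \<Lambda> * \<mu> / 2 * (x0 - x0)^2"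
   proof (rule DERIV_nonpos_imp_nonincreasing[where f = "\<lambda>x. \<psi> x - \<Lambda> * \<mu> / 2 * (x - x0)^2"])
    fix y assume y: "x0 \<le> y" "y \<le> x"
    have "((\<lambda>x. \<psi> x - \<Lambda> * \<mu> / 2 * (x - x0)^2) has_real_derivative \<psi>1 y - \<Lambda> * \<mu> * (y - x0)) (at y)"
     using phaseD(1)[OF ph, of y] y x by (auto intro!: derivative_eq_intros)
    moreover have "\<psi>1 y - \<Lambda> * \<mu> * (y - x0) \<le> 0" using up[of y] y x by simp
    ultimately show "\<exists>D. ((\<lambda>x. \<psi> x - \<Lambda> * \<mu> / 2 * (x - x0)^2) has_real_derivative D) (at y) \<and> D \<le> 0" by blast
   qed (use x in auto)
   then have 1: "\<psi> x - \<psi> x0 \<le> \<Lambda> * \<mu> / 2 * (x - x0)^2" by simp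
   have "(x - x0)^2 \<le> t1^2" using x by (intro power_mono) auto
   then have "\<Lambda> * \<mu> / 2 * (x - x0)^2 \<le> \<Lambda> * \<mu> / 2 * (\<rho> / (\<Lambda> * \<mu>))" unfolding t1(2) using L \<mu> by (intro mult_left_mono) auto
   then have 2: "\<psi> x - \<psi> x0 \<le> \<rho> / 2" using 1 L \<mu> by simp
   have "\<psi> x0 \<le> \<psi> x"
   proof (rule DERIV_nonneg_imp_nondecreasing[where f = \<psi>])
    fix y assume y: "x0 \<le> y" "y \<le> x"
    have "0 \<le> \<mu> * (y - x0)" using y \<mu> by simp
    then show "\<exists>D. (\<psi> has_real_derivative D) (at y) \<and> 0 \<le> D" using phaseD(1)[OF ph, of y] lo[of y] y x by auto
   qed (use x in auto)
   then show ?thesis using 2 int_dist_lipschitz[of "\<psi> x0" "\<psi> x"] unfolding \<rho>_def by linarith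
  qed
  have dn: "norm (dker n (\<psi> x)) \<le> 1 / \<rho>" if x: "x \<in> {x0..b}" "x - x0 \<le> t1" for x
  proof -
   have "norm (dker n (\<psi> x)) \<le> 1 / (2 * int_dist (\<psi> x))" using near[OF x] \<rho>0 by (intro norm_dker_le_int_dist) auto
   also have "... \<le> 1 / \<rho>" using near[OF x] \<rho>0 by (intro frac_le) auto
   finally show ?thesis .
  qed
  let ?g = "\<lambda>x. gker n (\<psi> x)"
  have gc: "continuous_on {u..v} ?g" if "x0 \<le> u" "v \<le> b" for u v
   using that by (intro continuous_intros continuous_on_subset[OF cont(1)]) auto
  define x1 x2 where "x1 = min b (x0 + s)" and "x2 = min b (x0 + t1)"
  have xs: "x0 \<le> x1" "x1 \<le> x2" "x2 \<le> b" using ab s t1 st1 unfolding x1_def x2_def by auto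
  have I1: "norm (integral {x0..x1} ?g) \<le> r / \<rho>"
  proof -
   have "norm (integral {x0..x1} ?g) \<le> real n / \<rho> * (x1 - x0)"
   proof (rule norm_integral_le_const)
    fix x assume x: "x \<in> {x0..x1}"
    then have x': "x \<in> {x0..b}" "x - x0 \<le> t1" using xs st1 unfolding x1_def by auto
    have "norm (gker n (\<psi> x)) \<le> real n / (2 * int_dist (\<psi> x))" using near[OF x'] \<rho>0 by (intro norm_gker_le_int_dist) auto
    also have "... \<le> real n / \<rho>" using near[OF x'] \<rho>0 by (intro frac_le) auto
    finally show "norm (gker n (\<psi> x)) \<le> real n / \<rho>" .
   qed (use xs gc in auto)
   also have "... \<le> real n / \<rho> * s" using n0 \<rho>0 unfolding x1_def by (intro mult_left_mono) auto
   also have "... = r / \<rho>" using s by simp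
   finally show ?thesis .
  qed
  have edge: "norm (dker n (\<psi> x)) / \<bar>\<psi>1 x\<bar> \<le> r / \<rho>" if x: "x \<in> {x0..b}" "s \<le> x - x0" "x - x0 \<le> t1" for x
  proof -
   have "\<mu> * s \<le> \<bar>\<psi>1 x\<bar>" using lo[OF x(1)] mult_left_mono[OF x(2), of \<mu>] \<mu> by linarith
   then have "norm (dker n (\<psi> x)) / \<bar>\<psi>1 x\<bar> \<le> (1 / \<rho>) / (\<mu> * s)" using dn[OF x(1,3)] \<mu> s \<rho>0 by (intro frac_le) auto
   also have "... = r / \<rho>" unfolding ms[symmetric] by simp
   finally show ?thesis .
  qed
  have pi6: "A / (2 * pi) \<le> A / 6" if "A \<ge> 0" for A
   using that pi_gt3 by (intro frac_le) auto
  have quot: "norm (dker n (\<psi> x)) * \<bar>\<psi>2 x\<bar> / (\<psi>1 x)^2 \<le> \<Lambda> / \<mu> * (norm (dker n (\<psi> x)) / (x - x0)^2)" if x: "x \<in> {x0..b}" "x > x0" for x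
  proof -
   have "(\<mu> * (x - x0))^2 \<le> (\<psi>1 x)^2" using lo[OF x(1)] x \<mu> by (intro power_mono) auto
   then have "norm (dker n (\<psi> x)) * \<bar>\<psi>2 x\<bar> / (\<psi>1 x)^2 \<le> norm (dker n (\<psi> x)) * (\<Lambda> * \<mu>) / (\<mu> * (x - x0))^2"
    using b2[OF x(1)] x \<mu> by (intro frac_le mult_left_mono) auto
   also have "... = \<Lambda> / \<mu> * (norm (dker n (\<psi> x)) / (x - x0)^2)" using \<mu> by (simp add: power_mult_distrib power2_eq_square mult_ac)
   finally show ?thesis .
  qed
  have nz: "\<psi>1 x \<noteq> 0" if x: "x \<in> {x0..b}" "x > x0" for x
  proof -
   have "\<mu> * (x - x0) > 0" using x \<mu> by simp
   then show ?thesis using lo[OF x(1)] by linarith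
  qed
  have I2: "norm (integral {x1..x2} ?g) \<le> (2 + \<Lambda>) * r / \<rho>"
  proof (cases "x1 = b")
   case True
   then show ?thesis using xs r \<rho>0 L by simp
  next
   case False
   then have x1: "x1 = x0 + s" unfolding x1_def by auto
   define F where "F x = - (\<Lambda> / (\<mu> * \<rho>)) / (x - x0)" for x
   have "norm (integral {x1..x2} ?g) \<le>
     (norm (dker n (\<psi> x2)) / \<bar>\<psi>1 x2\<bar> + norm (dker n (\<psi> x1)) / \<bar>\<psi>1 x1\<bar> + (F x2 - F x1)) / (2 * pi)"
   proof (rule gker_phase_ibp[OF phase_subset[OF ph xs(1,3)] xs(2)])
    fix x assume x: "x \<in> {x1..x2}"
    then have x': "x \<in> {x0..b}" "x > x0" "x - x0 \<le> t1" using xs s x1 unfolding x2_def by auto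
    show "\<psi>1 x \<noteq> 0" using nz[OF x'(1,2)] .
    show "(F has_real_derivative (\<Lambda> / (\<mu> * \<rho>)) / (x - x0)^2) (at x within {x1..x2})"
     unfolding F_def using x' \<mu> \<rho>0 by (auto intro!: derivative_eq_intros simp: power2_eq_square)
    have "\<Lambda> / \<mu> * (norm (dker n (\<psi> x)) / (x - x0)^2) \<le> \<Lambda> / \<mu> * ((1 / \<rho>) / (x - x0)^2)"
     using dn[OF x'(1,3)] L \<mu> by (intro mult_left_mono divide_right_mono) auto
    then show "norm (dker n (\<psi> x)) * \<bar>\<psi>2 x\<bar> / (\<psi>1 x)^2 \<le> (\<Lambda> / (\<mu> * \<rho>)) / (x - x0)^2"
     using quot[OF x'(1,2)] by simp
   qed
   also have "... \<le> (r / \<rho> + r / \<rho> + \<Lambda> * r / \<rho>) / (2 * pi)"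
   proof (intro divide_right_mono add_mono)
    show "norm (dker n (\<psi> x2)) / \<bar>\<psi>1 x2\<bar> \<le> r / \<rho>" using xs x1 by (intro edge) (auto simp: x2_def)
    show "norm (dker n (\<psi> x1)) / \<bar>\<psi>1 x1\<bar> \<le> r / \<rho>" using xs x1 st1 by (intro edge) auto
    have "F x2 \<le> 0" unfolding F_def using xs x1 s L \<mu> \<rho>0 by (intro divide_nonpos_pos) auto
    moreover have "- F x1 = \<Lambda> / \<rho> * (1 / (\<mu> * s))" unfolding F_def x1 by simp
    ultimately show "F x2 - F x1 \<le> \<Lambda> * r / \<rho>" unfolding ms by simp
   qed simp
   also have "... \<le> (r / \<rho> + r / \<rho> + \<Lambda> * r / \<rho>) / 1"
    using r \<rho>0 L pi_gt3 by (intro frac_le) auto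
   finally show ?thesis by (simp add: add_divide_distrib algebra_simps)
  qed
  have I3: "norm (integral {x2..b} ?g) \<le> (1 + 2 * \<Lambda>^3) * r / \<rho> + real n / \<psi>1 b"
  proof (cases "x2 = b")
   case True
   then show ?thesis using r \<rho>0 L \<psi>1b by simp
  next
   case False
   then have x2: "x2 = x0 + t1" unfolding x2_def by auto
   have x20: "x0 < x2" using x2 t1 by simp
   obtain F F' where F: "\<And>x. x \<in> {x2..b} \<Longrightarrow> (F has_real_derivative F' x) (at x within {x2..b})"
     "\<And>x. x \<in> {x2..b} \<Longrightarrow> norm (dker n (\<psi> x)) / (x - x0)^2 \<le> F' x"
     "F b - F x2 \<le> sqrt (real n) / 2 * ((\<Lambda> + 1) / (x2 - x0) + 3 / (2 * sqrt \<mu> * (x2 - x0)^2))"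
   proof (rule dker_far_antiderivative[OF phase_subset[OF ph _ order_refl] xs(3) x20 \<mu> L n])
    show "x0 \<le> x2" using xs by simp
   qed (use lo up xs in auto)
   have "norm (integral {x2..b} ?g) \<le>
     (norm (dker n (\<psi> b)) / \<bar>\<psi>1 b\<bar> + norm (dker n (\<psi> x2)) / \<bar>\<psi>1 x2\<bar> + (\<Lambda> / \<mu> * F b - \<Lambda> / \<mu> * F x2)) / (2 * pi)"
   proof (rule gker_phase_ibp[OF phase_subset[OF ph _ order_refl] xs(3)])
    show "x0 \<le> x2" using xs by simp
    fix x assume x: "x \<in> {x2..b}"
    then have x': "x \<in> {x0..b}" "x > x0" using xs x20 by auto
    show "\<psi>1 x \<noteq> 0" using nz[OF x'] .
    show "((\<lambda>x. \<Lambda> / \<mu> * F x) has_real_derivative \<Lambda> / \<mu> * F' x) (at x within {x2..b})"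
     by (rule DERIV_cmult[OF F(1)[OF x]])
    have "\<Lambda> / \<mu> * (norm (dker n (\<psi> x)) / (x - x0)^2) \<le> \<Lambda> / \<mu> * F' x"
     using F(2)[OF x] L \<mu> by (intro mult_left_mono) auto
    then show "norm (dker n (\<psi> x)) * \<bar>\<psi>2 x\<bar> / (\<psi>1 x)^2 \<le> \<Lambda> / \<mu> * F' x"
     using quot[OF x'] by linarith
   qed
   also have "... \<le> (real n / \<psi>1 b + r / \<rho> + 2 * \<Lambda>^3 * r / \<rho>) / (2 * pi)"
   proof (intro divide_right_mono add_mono)
    show "norm (dker n (\<psi> b)) / \<bar>\<psi>1 b\<bar> \<le> real n / \<psi>1 b"
     using \<psi>1b by (simp add: divide_right_mono norm_dker_le)
    show "norm (dker n (\<psi> x2)) / \<bar>\<psi>1 x2\<bar> \<le> r / \<rho>" using xs x2 st1 by (intro edge) auto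
    define w where "w = sqrt \<mu>"
    have w: "w > 0" "\<mu> = w * w" unfolding w_def using \<mu> by auto
    define v where "v = sqrt (real n)"
    have v: "v > 0" unfolding v_def using n0 by simp
    have rvw: "r = v / w" unfolding r_def v_def w_def by (simp add: real_sqrt_divide)
    have it: "1 / t1^2 = \<Lambda> * \<mu> / \<rho>" unfolding t1(2) by simp
    have it1: "1 / t1 \<le> \<Lambda> * w / \<rho>"
    proof (rule power2_le_imp_le)
     have "(1 / t1)^2 = \<Lambda> * \<mu> / \<rho> * 1" using it by (simp add: power_divide)
     also have "... \<le> \<Lambda> * \<mu> / \<rho> * (\<Lambda> / \<rho>)"
     proof (rule mult_left_mono)
      have "\<rho> \<le> \<Lambda>" using \<rho>(2) L by linarith
      then show "1 \<le> \<Lambda> / \<rho>" using \<rho>0 by simp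
     qed (use L \<mu> \<rho>0 in simp)
     also have "... = (\<Lambda> * w / \<rho>)^2" unfolding w(2) by (simp add: power2_eq_square)
     finally show "(1 / t1)^2 \<le> (\<Lambda> * w / \<rho>)^2" .
    qed (use L w \<rho>0 in simp)
    have "(\<Lambda> + 1) / t1 + 3 / (2 * w * t1^2) = (\<Lambda> + 1) * (1 / t1) + 3 / (2 * w) * (1 / t1^2)" by simp
    also have "... \<le> (\<Lambda> + 1) * (\<Lambda> * w / \<rho>) + 3 / (2 * w) * (\<Lambda> * \<mu> / \<rho>)"
     using it1 it L w(1) by (intro add_mono mult_left_mono) auto
    also have "... = (\<Lambda> * \<Lambda> + 5/2 * \<Lambda>) * (w / \<rho>)" unfolding w(2) using w(1) \<rho>0 by (simp add: field_simps)
    also have "... \<le> (4 * \<Lambda>^2) * (w / \<rho>)"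
    proof (rule mult_right_mono)
     have "\<Lambda> \<le> \<Lambda>^2" using L mult_left_mono[of 1 \<Lambda> \<Lambda>] by (simp add: power2_eq_square)
     moreover have "\<Lambda> * \<Lambda> = \<Lambda>^2" by (simp add: power2_eq_square)
     moreover have "0 \<le> \<Lambda>^2" by simp
     ultimately show "\<Lambda> * \<Lambda> + 5/2 * \<Lambda> \<le> 4 * \<Lambda>^2" by linarith
    qed (use w \<rho>0 in simp)
    finally have q: "(\<Lambda> + 1) / t1 + 3 / (2 * w * t1^2) \<le> 4 * \<Lambda>^2 * (w / \<rho>)" .
    have "F b - F x2 \<le> v / 2 * ((\<Lambda> + 1) / t1 + 3 / (2 * w * t1^2))" using F(3) unfolding x2 v_def w_def by simp
    also have "... \<le> v / 2 * (4 * \<Lambda>^2 * (w / \<rho>))" using q v by (intro mult_left_mono) auto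
    finally have "\<Lambda> / \<mu> * (F b - F x2) \<le> \<Lambda> / \<mu> * (v / 2 * (4 * \<Lambda>^2 * (w / \<rho>)))" using L \<mu> by (intro mult_left_mono) auto
    also have "... = 2 * \<Lambda>^3 * r / \<rho>" unfolding rvw w(2) using w(1) \<rho>0 by (simp add: field_simps power2_eq_square power3_eq_cube)
    finally show "\<Lambda> / \<mu> * F b - \<Lambda> / \<mu> * F x2 \<le> 2 * \<Lambda>^3 * r / \<rho>" by (simp add: right_diff_distrib)
   qed simp
   also have "... \<le> (real n / \<psi>1 b + r / \<rho> + 2 * \<Lambda>^3 * r / \<rho>) / 1"
    using r \<rho>0 L \<psi>1b pi_gt3 by (intro frac_le) auto
   finally show ?thesis by (simp add: add_divide_distrib algebra_simps)
  qed
  have int: "?g integrable_on {u..v}" if "x0 \<le> u" "v \<le> b" for u v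
   using gc[OF that] by (rule integrable_continuous_real)
  have e: "integral {x0..b} ?g = integral {x0..x1} ?g + integral {x1..x2} ?g + integral {x2..b} ?g"
   using xs by (simp add: Henstock_Kurzweil_Integration.integral_combine int)
  have "norm (integral {x0..b} ?g) \<le> norm (integral {x0..x1} ?g) + norm (integral {x1..x2} ?g) + norm (integral {x2..b} ?g)"
   unfolding e using norm_triangle_ineq[of "integral {x0..x1} ?g + integral {x1..x2} ?g" "integral {x2..b} ?g"]
    norm_triangle_ineq[of "integral {x0..x1} ?g" "integral {x1..x2} ?g"] by linarith
  also have "... \<le> r / \<rho> + (2 + \<Lambda>) * r / \<rho> + ((1 + 2 * \<Lambda>^3) * r / \<rho> + real n / \<psi>1 b)"
   using I1 I2 I3 by linarith
  also have "... = (4 + \<Lambda> + 2 * \<Lambda>^3) * (r / \<rho>) + real n / \<psi>1 b" by (simp add: add_divide_distrib distrib_right)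
  also have "(4 + \<Lambda> + 2 * \<Lambda>^3) * (r / \<rho>) \<le> (16 * \<Lambda>^3) * (r / \<rho>)"
   using L3 r \<rho>0 by (intro mult_right_mono) auto
  finally show ?thesis unfolding r_def[symmetric] \<rho>_def[symmetric] capr by simp
 qed
qed

lemma gker_stationary:
 assumes ph: "phase a b \<psi> \<psi>1 \<psi>2" and x0: "x0 \<in> {a..b}" and \<mu>: "\<mu> > 0" and L: "\<Lambda> \<ge> 1" and n: "n \<ge> 1"
  and b2: "\<And>x. x \<in> {a..b} \<Longrightarrow> \<mu> \<le> \<psi>2 x" "\<And>x. x \<in> {a..b} \<Longrightarrow> \<psi>2 x \<le> \<Lambda> * \<mu>" and st: "\<psi>1 x0 = 0"
 shows "norm (integral {a..b} (\<lambda>x. gker n (\<psi> x))) \<le>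
  32 * \<Lambda>^3 * sqrt (real n / \<mu>) * cap n (int_dist (\<psi> x0)) + real n / \<psi>1 b + real n / (- \<psi>1 a)"
proof -
 let ?g = "\<lambda>x. gker n (\<psi> x)"
 have R: "norm (integral {x0..b} ?g) \<le> 16 * \<Lambda>^3 * sqrt (real n / \<mu>) * cap n (int_dist (\<psi> x0)) + real n / \<psi>1 b"
  using x0 by (intro gker_stationary_right[OF phase_subset[OF ph] _ \<mu> L n b2 st]) auto
 have "norm (integral {-x0..-a} (\<lambda>x. gker n (\<psi> (-x)))) \<le>
   16 * \<Lambda>^3 * sqrt (real n / \<mu>) * cap n (int_dist (\<psi> (-(-x0)))) + real n / (- \<psi>1 (-(-a)))"
  using x0 st by (intro gker_stationary_right[OF phase_subset[OF phase_reflect[OF ph]] _ \<mu> L n b2]) auto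
 moreover have "integral {-x0..-a} (\<lambda>x. ?g (-x)) = integral {a..x0} ?g" by (rule Henstock_Kurzweil_Integration.integral_reflect_real)
 ultimately have Lf: "norm (integral {a..x0} ?g) \<le> 16 * \<Lambda>^3 * sqrt (real n / \<mu>) * cap n (int_dist (\<psi> x0)) + real n / (- \<psi>1 a)"
  by simp
 have "?g integrable_on {a..b}"
  by (intro integrable_continuous_real continuous_intros phase_continuous(1)[OF ph])
 then have e: "integral {a..b} ?g = integral {a..x0} ?g + integral {x0..b} ?g"
  using x0 by (intro Henstock_Kurzweil_Integration.integral_combine[symmetric]) auto
 show ?thesis unfolding e using norm_triangle_ineq[of "integral {a..x0} ?g" "integral {x0..b} ?g"] R Lf by linarith
qed

subsection \<open>Fejer kernels and Poisson summation\<close>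

definition fejer :: "nat \<Rightarrow> real \<Rightarrow> real" where
 "fejer m x = (norm (\<Sum>k<m. circ (real k * x)))^2 / real m"

lemma fejer_nonneg: "fejer m x \<ge> 0"
 unfolding fejer_def by simp

lemma fejer_continuous [continuous_intros]: "continuous_on S f \<Longrightarrow> continuous_on S (\<lambda>x. fejer m (f x))"
 unfolding fejer_def divide_inverse by (intro continuous_intros)

lemma fejer_has_integral: "m \<ge> 1 \<Longrightarrow> (fejer m has_integral 1) {a..a+1}"
 using has_integral_divide[OF has_integral_norm_square_period[of "{..<m}" a], of "real m"]
 unfolding fejer_def by simp

lemma fejer_integrable: "fejer m integrable_on {a..b}"
 by (intro integrable_continuous_real continuous_intros)

lemma circ_add_int: "circ (x + of_int k) = circ x"
 by (simp add: circ_add)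

lemma fejer_add_int: "fejer m (x + of_int k) = fejer m x"
proof -
 have "circ (real l * (x + of_int k)) = circ (real l * x)" for l
  using circ_add_int[of "real l * x" "int l * k"] by (simp add: algebra_simps)
 then show ?thesis unfolding fejer_def by simp
qed

lemma fejer_expand: "complex_of_real (fejer m x) = (\<Sum>k<m. \<Sum>l<m. circ ((real k - real l) * x)) / of_nat m"
proof -
 have "complex_of_real ((norm (\<Sum>k<m. circ (real k * x)))^2) = (\<Sum>k<m. circ (real k * x)) * cnj (\<Sum>k<m. circ (real k * x))"
  by (rule complex_norm_square)
 also have "... = (\<Sum>k<m. \<Sum>l<m. circ ((real k - real l) * x))"
  by (simp add: sum_product cnj_circ circ_add[symmetric] algebra_simps)
 finally show ?thesis unfolding fejer_def by (simp only: of_real_divide of_real_of_nat_eq)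
qed

lemma fejer_le_int_dist:
 assumes "m \<ge> 1" "int_dist x > 0"
 shows "fejer m x \<le> 1 / (4 * real m * (int_dist x)^2)"
proof -
 have "{..<m} = {0..m-1}" using assms by auto
 then have "norm (\<Sum>k<m. circ (real k * x)) \<le> 1 / (2 * int_dist x)" using norm_sum_circ_le[OF assms(2)] by metis
 then have "(norm (\<Sum>k<m. circ (real k * x)))^2 \<le> (1 / (2 * int_dist x))^2" by (intro power_mono) auto
 then have "fejer m x \<le> (1 / (2 * int_dist x))^2 / real m" unfolding fejer_def by (intro divide_right_mono) auto
 then show ?thesis by (simp add: power_divide power_mult_distrib mult_ac)
qed

lemma fejer_integral_le:
 assumes "m \<ge> 1" "a \<le> b" "b \<le> a + real N"
 shows "integral {a..b} (fejer m) \<le> real N"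
proof -
 have N: "integral {a..a + real N} (fejer m) = real N" for N
 proof (induction N)
  case (Suc N)
  have "integral {a..a + real (Suc N)} (fejer m) = integral {a..a + real N} (fejer m) + integral {a + real N..a + real (Suc N)} (fejer m)"
   by (rule Henstock_Kurzweil_Integration.integral_combine[symmetric]) (auto intro: fejer_integrable)
  also have "integral {a + real N..a + real (Suc N)} (fejer m) = 1"
   using integral_unique[OF fejer_has_integral[OF assms(1), of "a + real N"]] by (simp add: add_ac)
  finally show ?case using Suc by simp
 qed simp
 have "integral {a..b} (fejer m) \<le> integral {a..a + real N} (fejer m)"
  using assms by (intro integral_subset_le fejer_integrable) (auto simp: fejer_nonneg)
 then show ?thesis by (simp add: N)
qed

lemma norm_fejer_integral_le:
 fixes g :: "real \<Rightarrow> complex"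
 assumes "m \<ge> 1" "a \<le> b" "b \<le> a + real N" "continuous_on {a..b} g" "\<And>x. x \<in> {a..b} \<Longrightarrow> norm (g x) \<le> 1"
 shows "norm (integral {a..b} (\<lambda>x. fejer m x *\<^sub>R g x)) \<le> real N"
proof -
 have "norm (integral {a..b} (\<lambda>x. fejer m x *\<^sub>R g x)) \<le> integral {a..b} (fejer m)"
 proof (rule integral_norm_bound_integral)
  show "(\<lambda>x. fejer m x *\<^sub>R g x) integrable_on {a..b}"
   by (intro integrable_continuous_real continuous_intros assms)
  fix x assume "x \<in> {a..b}"
  then show "norm (fejer m x *\<^sub>R g x) \<le> fejer m x"
   using assms(5)[of x] mult_left_mono[of "norm (g x)" 1 "fejer m x"] fejer_nonneg[of m x] by simp
 qed (rule fejer_integrable)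
 then show ?thesis using fejer_integral_le[OF assms(1-3)] by linarith
qed

text \<open>On the unit interval around c the kernel has mass 1 and is at most 1/(4 m t^2) at
  distance t from c. Splitting at t = e = 1/sqrt m bounds its first absolute moment by 5/4 e, and
  the Lipschitz constant multiplies this.\<close>

lemma fejer_block:
 fixes g :: "real \<Rightarrow> complex" and c :: int
 assumes m: "m \<ge> 1" and g: "continuous_on {of_int c - 1/2..of_int c + 1/2} g" and M: "M \<ge> 0"
  "\<And>x. x \<in> {of_int c - 1/2..of_int c + 1/2} \<Longrightarrow> norm (g x - g (of_int c)) \<le> M * \<bar>x - of_int c\<bar>"
 shows "norm (g (of_int c) - integral {of_int c - 1/2..of_int c + 1/2} (\<lambda>x. fejer m x *\<^sub>R g x)) \<le> 2 * M / sqrt (real m)"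
proof -
 define I where "I = {of_int c - 1/2..of_int c + (1/2::real)}"
 have I: "(fejer m has_integral 1) I" using fejer_has_integral[OF m, of "of_int c - 1/2"] unfolding I_def by (simp add: add.commute)
 define e where "e = 1 / sqrt (real m)"
 have e: "e > 0" "e^2 = 1 / real m" unfolding e_def using m by (auto simp: power_divide)
 have "((\<lambda>x. fejer m x *\<^sub>R g (of_int c)) has_integral g (of_int c)) I"
  using has_integral_scaleR_left[OF I, of "g (of_int c)"] by simp
 moreover have "((\<lambda>x. fejer m x *\<^sub>R g x) has_integral integral I (\<lambda>x. fejer m x *\<^sub>R g x)) I"
  unfolding I_def by (intro integrable_integral integrable_continuous_real continuous_intros g)
 ultimately have 1: "((\<lambda>x. fejer m x *\<^sub>R g (of_int c) - fejer m x *\<^sub>R g x) has_integral (g (of_int c) - integral I (\<lambda>x. fejer m x *\<^sub>R g x))) I"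
  by (rule has_integral_diff)
 have "((\<lambda>x::real. 1 / (4 * real m * e)) has_integral 1 / (4 * real m * e)) I"
  using has_integral_const_real[of "1 / (4 * real m * e)" "of_int c - 1/2" "of_int c + 1/2"] unfolding I_def by simp
 then have 2: "((\<lambda>x. M * (e * fejer m x + 1 / (4 * real m * e))) has_integral M * (e * 1 + 1 / (4 * real m * e))) I"
  by (intro has_integral_mult_right has_integral_add I)
 have "norm (integral I (\<lambda>x. fejer m x *\<^sub>R g (of_int c) - fejer m x *\<^sub>R g x)) \<le> integral I (\<lambda>x. M * (e * fejer m x + 1 / (4 * real m * e)))"
 proof (rule integral_norm_bound_integral)
  fix x assume x: "x \<in> I"
  define t where "t = x - of_int c"
  have "fejer m x = fejer m t" unfolding t_def using fejer_add_int[of m "x - of_int c" c] by simp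
  have "of_int c - 1/2 \<le> x" "x \<le> of_int c + 1/2" using x unfolding I_def by auto
  then have t: "\<bar>t\<bar> \<le> 1/2" unfolding t_def by linarith
  have "\<bar>t\<bar> * fejer m x \<le> e * fejer m x + 1 / (4 * real m * e)"
  proof (cases "\<bar>t\<bar> \<le> e")
   case True
   then have "\<bar>t\<bar> * fejer m x \<le> e * fejer m x" by (intro mult_right_mono fejer_nonneg)
   then show ?thesis using e m by (simp add: add_increasing2)
  next
   case False
   then have t0: "\<bar>t\<bar> > 0" "\<bar>t\<bar> > e" using e by auto
   have "fejer m t \<le> 1 / (4 * real m * \<bar>t\<bar>^2)"
    using fejer_le_int_dist[OF m, of t] int_dist_eq_abs[OF t] t0 by simp
   then have "\<bar>t\<bar> * fejer m t \<le> \<bar>t\<bar> * (1 / (4 * real m * \<bar>t\<bar>^2))" by (intro mult_left_mono) auto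
   also have "... = 1 / (4 * real m * \<bar>t\<bar>)"
   proof -
    have "u * (1 / (4 * real m * u^2)) = 1 / (4 * real m * u)" if "u > 0" for u :: real
     using that by (simp add: power2_eq_square)
    from this[OF t0(1)] show ?thesis .
   qed
   also have "... \<le> 1 / (4 * real m * e)" using t0 e m by (intro divide_left_mono mult_left_mono) auto
   finally show ?thesis using \<open>fejer m x = fejer m t\<close> e fejer_nonneg[of m x] by (simp add: add_increasing)
  qed
  then have "M * (\<bar>t\<bar> * fejer m x) \<le> M * (e * fejer m x + 1 / (4 * real m * e))" using M(1) by (rule mult_left_mono)
  moreover have "norm (fejer m x *\<^sub>R g (of_int c) - fejer m x *\<^sub>R g x) \<le> fejer m x * (M * \<bar>t\<bar>)"
  proof -
   have "norm (fejer m x *\<^sub>R g (of_int c) - fejer m x *\<^sub>R g x) = fejer m x * norm (g x - g (of_int c))"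
    by (simp add: scaleR_diff_right[symmetric] norm_minus_commute fejer_nonneg)
   also have "... \<le> fejer m x * (M * \<bar>t\<bar>)" using M(2)[of x] x fejer_nonneg[of m x] unfolding I_def t_def by (intro mult_left_mono) auto
   finally show ?thesis .
  qed
  ultimately show "norm (fejer m x *\<^sub>R g (of_int c) - fejer m x *\<^sub>R g x) \<le> M * (e * fejer m x + 1 / (4 * real m * e))"
   by (simp add: mult_ac)
 qed (use 1 2 in \<open>auto simp: has_integral_iff\<close>)
 then have "norm (g (of_int c) - integral I (\<lambda>x. fejer m x *\<^sub>R g x)) \<le> M * (e + 1 / (4 * real m * e))"
  unfolding integral_unique[OF 1] integral_unique[OF 2] by simp
 also have "e + 1 / (4 * real m * e) = 5/4 * e"
 proof -
  have "1 / real m = e * e" using e(2) by (simp add: power2_eq_square)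
  then have "1 / (4 * real m * e) = (e * e) / (4 * e)" by (metis divide_divide_eq_left divide_divide_eq_left' mult.commute mult.assoc)
  then show ?thesis using e(1) by simp
 qed
 also have "M * (5/4 * e) \<le> M * (2 * e)" using M(1) e by (intro mult_left_mono) auto
 also have "M * (2 * e) = 2 * M / sqrt (real m)" unfolding e_def by simp
 finally show ?thesis unfolding I_def .
qed

lemma fejer_blocks:
 fixes g :: "real \<Rightarrow> complex" and p :: int and n :: nat
 assumes m: "m \<ge> 1" and g: "continuous_on {of_int p - 1/2..of_int p + real n - 1/2} g" and M: "M \<ge> 0"
  "\<And>x y. x \<in> {of_int p - 1/2..of_int p + real n - 1/2} \<Longrightarrow> y \<in> {of_int p - 1/2..of_int p + real n - 1/2} \<Longrightarrow> norm (g x - g y) \<le> M * \<bar>x - y\<bar>"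
 shows "norm ((\<Sum>a\<in>{p..<p + int n}. g (of_int a)) - integral {of_int p - 1/2..of_int p + real n - 1/2} (\<lambda>x. fejer m x *\<^sub>R g x))
   \<le> real n * (2 * M / sqrt (real m))"
 using g M(2)
proof (induction n)
 case (Suc n)
 let ?c = "p + int n"
 let ?f = "\<lambda>x. fejer m x *\<^sub>R g x"
 have sub: "{of_int p - 1/2..of_int p + real n - 1/2} \<subseteq> {of_int p - 1/2..of_int p + real (Suc n) - (1/2::real)}" by auto
 have IH: "norm ((\<Sum>a\<in>{p..<p + int n}. g (of_int a)) - integral {of_int p - 1/2..of_int p + real n - 1/2} ?f) \<le> real n * (2 * M / sqrt (real m))"
  by (rule Suc.IH[OF continuous_on_subset[OF Suc.prems(1) sub]]) (use sub Suc.prems(2) in blast)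
 have c: "norm (g (of_int ?c) - integral {of_int ?c - 1/2..of_int ?c + 1/2} ?f) \<le> 2 * M / sqrt (real m)"
  by (rule fejer_block[OF m continuous_on_subset[OF Suc.prems(1)] M(1) Suc.prems(2)]) auto
 have e1: "(\<Sum>a\<in>{p..<p + int (Suc n)}. g (of_int a)) = (\<Sum>a\<in>{p..<p + int n}. g (of_int a)) + g (of_int ?c)"
 proof -
  have "{p..<p + int (Suc n)} = insert ?c {p..<p + int n}" by auto
  then show ?thesis by (simp add: add.commute)
 qed
 have "?f integrable_on {of_int p - 1/2..of_int p + real (Suc n) - 1/2}"
  by (intro integrable_continuous_real continuous_intros Suc.prems(1))
 then have e2: "integral {of_int p - 1/2..of_int p + real (Suc n) - 1/2} ?f
   = integral {of_int p - 1/2..of_int p + real n - 1/2} ?f + integral {of_int p + real n - 1/2..of_int p + real (Suc n) - 1/2} ?f"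
  by (intro Henstock_Kurzweil_Integration.integral_combine[symmetric]) auto
 have e3: "{of_int p + real n - 1/2..of_int p + real (Suc n) - 1/2} = {of_int ?c - 1/2..of_int ?c + (1/2::real)}" by simp
 have "norm ((\<Sum>a\<in>{p..<p + int (Suc n)}. g (of_int a)) - integral {of_int p - 1/2..of_int p + real (Suc n) - 1/2} ?f)
   = norm (((\<Sum>a\<in>{p..<p + int n}. g (of_int a)) - integral {of_int p - 1/2..of_int p + real n - 1/2} ?f)
    + (g (of_int ?c) - integral {of_int ?c - 1/2..of_int ?c + 1/2} ?f))"
  unfolding e1 e2 e3 by (simp add: algebra_simps)
 also have "... \<le> real n * (2 * M / sqrt (real m)) + 2 * M / sqrt (real m)"
  by (rule order_trans[OF norm_triangle_ineq add_mono[OF IH c]])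
 finally show ?case by (simp add: algebra_simps add_divide_distrib)
qed simp

text \<open>Whole unit blocks centred at integers are compared one by one; each end leaves over at
  most one integer and one incomplete block. The constant 5 comes from the case without a whole
  block: at most three integers, and an integral of at most 2.\<close>

lemma fejer_sum_integral:
 fixes g :: "real \<Rightarrow> complex"
 assumes m: "m \<ge> 1" and AB: "A \<le> B" and g: "continuous_on {A..B} g" and M: "M \<ge> 0"
  "\<And>x y. x \<in> {A..B} \<Longrightarrow> y \<in> {A..B} \<Longrightarrow> norm (g x - g y) \<le> M * \<bar>x - y\<bar>"
  and g1: "\<And>x. norm (g x) \<le> 1"
 shows "norm ((\<Sum>a\<in>{\<lceil>A\<rceil>..\<lfloor>B\<rfloor>}. g (of_int a)) - integral {A..B} (\<lambda>x. fejer m x *\<^sub>R g x))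
   \<le> 5 + (B - A + 1) * (2 * M / sqrt (real m))"
proof -
 let ?f = "\<lambda>x. fejer m x *\<^sub>R g x"
 define p r where "p = \<lceil>A + 1/2\<rceil>" and "r = \<lfloor>B - 1/2\<rfloor>"
 have p: "A + 1/2 \<le> of_int p" "of_int p < A + 3/2" and r: "of_int r \<le> B - 1/2" "B - 1/2 < of_int r + 1"
  unfolding p_def r_def by linarith+
 have e0: "0 \<le> (B - A + 1) * (2 * M / sqrt (real m))" using AB M by simp
 have sum1: "norm (\<Sum>a\<in>S. g (of_int a)) \<le> real (card S)" for S :: "int set"
  using sum_norm_le[of S "\<lambda>a. g (of_int a)" "\<lambda>_. 1"] g1 by simp
 show ?thesis
 proof (cases "r < p")
  case True
  then have "of_int r + 1 \<le> real_of_int p" by linarith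
  then have len: "B < A + 2" using p r by linarith
  have "norm (\<Sum>a\<in>{\<lceil>A\<rceil>..\<lfloor>B\<rfloor>}. g (of_int a)) \<le> 3"
  proof -
   have "card {\<lceil>A\<rceil>..\<lfloor>B\<rfloor>} \<le> 3" using len by simp linarith
   then show ?thesis using sum1[of "{\<lceil>A\<rceil>..\<lfloor>B\<rfloor>}"] by linarith
  qed
  moreover have "norm (integral {A..B} ?f) \<le> real 2"
   using len by (intro norm_fejer_integral_le m AB g g1) auto
  ultimately show ?thesis using e0 norm_triangle_ineq4[of "\<Sum>a\<in>{\<lceil>A\<rceil>..\<lfloor>B\<rfloor>}. g (of_int a)" "integral {A..B} ?f"] by simp
 next
  case False
  define n where "n = nat (r - p + 1)"
  have n: "int n = r - p + 1" unfolding n_def using False by simp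
  have pn: "of_int p + real n - 1/2 = of_int r + (1/2::real)" 
  proof -
   have "real n = of_int (int n)" by simp
   then show ?thesis unfolding n by simp
  qed
  define S1 S2 where "S1 = {\<lceil>A\<rceil>..<p}" and "S2 = {r+1..\<lfloor>B\<rfloor>}"
  have "p \<le> r + 1" using False by simp
  have cA: "\<lceil>A\<rceil> \<le> p" and cB: "r \<le> \<lfloor>B\<rfloor>" using p r by linarith+
  have split: "{\<lceil>A\<rceil>..\<lfloor>B\<rfloor>} = S1 \<union> {p..<p + int n} \<union> S2" unfolding S1_def S2_def n using cA cB False by auto
  have d: "S1 \<inter> {p..<p + int n} = {}" "(S1 \<union> {p..<p + int n}) \<inter> S2 = {}" unfolding S1_def S2_def n using False by auto
  have s: "(\<Sum>a\<in>{\<lceil>A\<rceil>..\<lfloor>B\<rfloor>}. g (of_int a)) = (\<Sum>a\<in>S1. g (of_int a)) + (\<Sum>a\<in>{p..<p + int n}. g (of_int a)) + (\<Sum>a\<in>S2. g (of_int a))"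
   unfolding split using d by (subst sum.union_disjoint, (auto simp: S1_def S2_def)[3], subst sum.union_disjoint, (auto simp: S1_def)[3]) simp
  have c1: "norm (\<Sum>a\<in>S1. g (of_int a)) \<le> 1"
  proof -
   have "card S1 \<le> 1" unfolding S1_def using p by simp linarith
   then show ?thesis using sum1[of S1] by linarith
  qed
  have c2: "norm (\<Sum>a\<in>S2. g (of_int a)) \<le> 1"
  proof -
   have "card S2 \<le> 1" unfolding S2_def using r by simp linarith
   then show ?thesis using sum1[of S2] by linarith
  qed
  have sub: "{of_int p - 1/2..of_int p + real n - 1/2} \<subseteq> {A..B}" unfolding pn using p r by auto
  have blk: "norm ((\<Sum>a\<in>{p..<p + int n}. g (of_int a)) - integral {of_int p - 1/2..of_int p + real n - 1/2} ?f) \<le> real n * (2 * M / sqrt (real m))"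
   by (rule fejer_blocks[OF m continuous_on_subset[OF g sub] M(1)]) (use sub M(2) in blast)
  have "real n \<le> B - A + 1" using pn p r by linarith
  then have blk': "real n * (2 * M / sqrt (real m)) \<le> (B - A + 1) * (2 * M / sqrt (real m))" using M by (intro mult_right_mono) auto
  define a1 b1 where "a1 = of_int p - (1/2::real)" and "b1 = of_int p + real n - (1/2::real)"
  have ab: "A \<le> a1" "a1 \<le> A + 1" "a1 \<le> b1" "b1 \<le> B" "B \<le> b1 + 1" unfolding a1_def b1_def pn using p r False by linarith+
  have i: "norm (integral {A..a1} ?f) \<le> real 1" "norm (integral {b1..B} ?f) \<le> real 1"
   using ab by (intro norm_fejer_integral_le m g1 continuous_on_subset[OF g]; auto)+
  have int: "?f integrable_on {u..v}" if "A \<le> u" "v \<le> B" for u v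
   using that by (intro integrable_continuous_real continuous_intros continuous_on_subset[OF g]) auto
  have e: "integral {A..B} ?f = integral {A..a1} ?f + integral {a1..b1} ?f + integral {b1..B} ?f"
   using ab by (simp add: Henstock_Kurzweil_Integration.integral_combine int)
  let ?X = "(\<Sum>a\<in>{p..<p + int n}. g (of_int a)) - integral {a1..b1} ?f"
  have e4: "(\<Sum>a\<in>{\<lceil>A\<rceil>..\<lfloor>B\<rfloor>}. g (of_int a)) - integral {A..B} ?f
   = (\<Sum>a\<in>S1. g (of_int a)) + (\<Sum>a\<in>S2. g (of_int a)) + ?X - integral {A..a1} ?f - integral {b1..B} ?f"
   unfolding s e by simp
  have "norm ((\<Sum>a\<in>{\<lceil>A\<rceil>..\<lfloor>B\<rfloor>}. g (of_int a)) - integral {A..B} ?f)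
   \<le> norm (\<Sum>a\<in>S1. g (of_int a)) + norm (\<Sum>a\<in>S2. g (of_int a)) + norm ?X + norm (integral {A..a1} ?f) + norm (integral {b1..B} ?f)"
   unfolding e4 using norm_triangle_ineq4[of "(\<Sum>a\<in>S1. g (of_int a)) + (\<Sum>a\<in>S2. g (of_int a)) + ?X - integral {A..a1} ?f" "integral {b1..B} ?f"]
    norm_triangle_ineq4[of "(\<Sum>a\<in>S1. g (of_int a)) + (\<Sum>a\<in>S2. g (of_int a)) + ?X" "integral {A..a1} ?f"]
    norm_triangle_ineq[of "(\<Sum>a\<in>S1. g (of_int a)) + (\<Sum>a\<in>S2. g (of_int a))" ?X]
    norm_triangle_ineq[of "\<Sum>a\<in>S1. g (of_int a)" "\<Sum>a\<in>S2. g (of_int a)"] by linarith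
  then show ?thesis using c1 c2 blk blk' i unfolding a1_def b1_def by simp
 qed
qed

section \<open>Poisson summation against the Fejer kernel\<close>

lemma sum_diff_regroup_le:
 fixes F :: "int \<Rightarrow> real"
 assumes "\<And>i. F i \<ge> 0"
 shows "(\<Sum>k<m. \<Sum>l<m. F (int k - int l)) \<le> real m * (\<Sum>i\<in>{-int m<..<int m}. F i)"
proof -
 have "(\<Sum>l<m. F (int k - int l)) \<le> (\<Sum>i\<in>{-int m<..<int m}. F i)" if "k < m" for k
 proof -
  have "(\<Sum>l<m. F (int k - int l)) = sum F ((\<lambda>l. int k - int l) ` {..<m})"
   by (subst sum.reindex) (auto simp: inj_on_def)
  also have "... \<le> sum F {-int m<..<int m}" by (rule sum_mono2) (use that assms in auto)
  finally show ?thesis .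
 qed
 then have "(\<Sum>k<m. \<Sum>l<m. F (int k - int l)) \<le> (\<Sum>k<m. \<Sum>i\<in>{-int m<..<int m}. F i)"
  by (intro sum_mono) auto
 then show ?thesis by simp
qed

text \<open>The substitution y = q x turns the frequency i in y into q i x, so that the phase is q
  times h(x) + i x and depends on q through this factor only; this is what allows the summation over
  q under the integral. Cesaro means of order m stand for the infinite Poisson series.\<close>

lemma poisson_single:
 fixes h :: "real \<Rightarrow> real"
 assumes q: "q \<ge> (1::nat)" and ab: "\<alpha> \<le> \<beta>" and m: "m \<ge> 1" and H: "H \<ge> 0"
  and h: "continuous_on {\<alpha>..\<beta>} h" "\<And>x y. x \<in> {\<alpha>..\<beta>} \<Longrightarrow> y \<in> {\<alpha>..\<beta>} \<Longrightarrow> \<bar>h x - h y\<bar> \<le> H * \<bar>x - y\<bar>"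
 shows "norm ((\<Sum>a\<in>{\<lceil>\<alpha> * q\<rceil>..\<lfloor>\<beta> * q\<rfloor>}. circ (real q * h (of_int a / real q)))
   - (\<Sum>k<m. \<Sum>l<m. integral {\<alpha>..\<beta>} (\<lambda>x. of_nat q * circ (real q * (h x + of_int (int k - int l) * x)))) / of_nat m)
   \<le> 5 + (real q * (\<beta> - \<alpha>) + 1) * (4 * pi * H / sqrt (real m))"
proof -
 have q0: "real q > 0" using q by simp
 define g where "g y = circ (real q * h (y / real q))" for y
 have dom: "y / real q \<in> {\<alpha>..\<beta>}" if "y \<in> {\<alpha> * q..\<beta> * q}" for y
  using that q0 by (auto simp: field_simps)
 have gc: "continuous_on {\<alpha> * q..\<beta> * q} g" unfolding g_def
 proof (intro continuous_intros continuous_on_compose2[OF h(1)])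
  show "(\<lambda>y. y / real q) ` {\<alpha> * q..\<beta> * q} \<subseteq> {\<alpha>..\<beta>}" using dom by blast
 qed (use q0 in auto)
 have gl: "norm (g x - g y) \<le> (2 * pi * H) * \<bar>x - y\<bar>" if "x \<in> {\<alpha> * q..\<beta> * q}" "y \<in> {\<alpha> * q..\<beta> * q}" for x y
 proof -
  have "norm (g x - g y) \<le> 2 * pi * \<bar>real q * h (x / q) - real q * h (y / q)\<bar>" unfolding g_def by (rule norm_circ_diff)
  also have "\<bar>real q * h (x / q) - real q * h (y / q)\<bar> = real q * \<bar>h (x / q) - h (y / q)\<bar>"
   using q0 by (simp add: abs_mult flip: right_diff_distrib)
  also have "... \<le> real q * (H * \<bar>x / q - y / q\<bar>)" using q0 h(2)[OF dom[OF that(1)] dom[OF that(2)]] by (intro mult_left_mono) auto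
  also have "\<bar>x / q - y / q\<bar> = \<bar>x - y\<bar> / real q" using q0 by (simp add: abs_divide flip: diff_divide_distrib)
  finally show ?thesis using q0 by (simp add: mult_left_mono mult_ac)
 qed
 have main: "norm ((\<Sum>a\<in>{\<lceil>\<alpha> * q\<rceil>..\<lfloor>\<beta> * q\<rfloor>}. g (of_int a)) - integral {\<alpha> * q..\<beta> * q} (\<lambda>x. fejer m x *\<^sub>R g x))
   \<le> 5 + (\<beta> * q - \<alpha> * q + 1) * (2 * (2 * pi * H) / sqrt (real m))"
  using ab q0 H gl by (intro fejer_sum_integral m gc) (auto simp: g_def)
 have "integral {\<alpha> * q..\<beta> * q} (\<lambda>x. fejer m x *\<^sub>R g x)
   = (\<Sum>k<m. \<Sum>l<m. integral {\<alpha>..\<beta>} (\<lambda>x. of_nat q * circ (real q * (h x + of_int (int k - int l) * x)))) / of_nat m"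
 proof -
  define i where "i = integral {\<alpha> * q..\<beta> * q} (\<lambda>x. fejer m x *\<^sub>R g x)"
  have "((\<lambda>x. fejer m x *\<^sub>R g x) has_integral i) {\<alpha> * q..\<beta> * q}"
   unfolding i_def by (intro integrable_integral integrable_continuous_real continuous_intros gc)
  from has_integral_stretch_real[OF this, of "real q"] q0
  have "((\<lambda>x. fejer m (real q * x) *\<^sub>R g (real q * x)) has_integral (1 / real q) *\<^sub>R i) ((\<lambda>x. x / real q) ` {\<alpha> * q..\<beta> * q})" by simp
  also have "(\<lambda>x. x / real q) ` {\<alpha> * q..\<beta> * q} = {\<alpha>..\<beta>}"
  proof (intro equalityI subsetI)
   fix x assume "x \<in> {\<alpha>..\<beta>}"
   then have "x = (x * q) / real q" "x * q \<in> {\<alpha> * q..\<beta> * q}" using q0 by auto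
   then show "x \<in> (\<lambda>x. x / real q) ` {\<alpha> * q..\<beta> * q}" by blast
  qed (use dom in auto)
  finally have "((\<lambda>x. of_nat q * (fejer m (real q * x) *\<^sub>R g (real q * x))) has_integral of_nat q * ((1 / real q) *\<^sub>R i)) {\<alpha>..\<beta>}"
   by (rule has_integral_mult_right)
  moreover have "of_nat q * ((1 / real q) *\<^sub>R i) = i" using q0 by (simp add: scaleR_conv_of_real)
  moreover have "of_nat q * (fejer m (real q * x) *\<^sub>R g (real q * x))
    = (\<Sum>k<m. \<Sum>l<m. of_nat q * circ (real q * (h x + of_int (int k - int l) * x))) / of_nat m" for x
  proof -
   have "fejer m (real q * x) *\<^sub>R g (real q * x) = (\<Sum>k<m. \<Sum>l<m. circ ((real k - real l) * (real q * x)) * circ (real q * h x)) / of_nat m"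
    unfolding scaleR_conv_of_real fejer_expand g_def using q0 by (simp add: sum_distrib_right)
   also have "... = (\<Sum>k<m. \<Sum>l<m. circ (real q * (h x + of_int (int k - int l) * x))) / of_nat m"
    by (simp add: circ_add[symmetric] algebra_simps)
   finally show ?thesis by (simp add: sum_distrib_left)
  qed
  ultimately have "((\<lambda>x. (\<Sum>k<m. \<Sum>l<m. of_nat q * circ (real q * (h x + of_int (int k - int l) * x))) / of_nat m) has_integral i) {\<alpha>..\<beta>}"
   by simp
  moreover have "((\<lambda>x. (\<Sum>k<m. \<Sum>l<m. of_nat q * circ (real q * (h x + of_int (int k - int l) * x))) / of_nat m) has_integral
   (\<Sum>k<m. \<Sum>l<m. integral {\<alpha>..\<beta>} (\<lambda>x. of_nat q * circ (real q * (h x + of_int (int k - int l) * x)))) / of_nat m) {\<alpha>..\<beta>}"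
   by (intro has_integral_divide has_integral_sum finite_lessThan integrable_integral integrable_continuous_real continuous_intros h(1))
  ultimately show ?thesis unfolding i_def by (rule has_integral_unique)
 qed
 then show ?thesis using main unfolding g_def by (simp add: right_diff_distrib mult_ac)
qed

lemma poisson_sum:
 fixes h :: "real \<Rightarrow> real"
 assumes ab: "\<alpha> \<le> \<beta>" and m: "m \<ge> 1" and H: "H \<ge> 0"
  and h: "continuous_on {\<alpha>..\<beta>} h" "\<And>x y. x \<in> {\<alpha>..\<beta>} \<Longrightarrow> y \<in> {\<alpha>..\<beta>} \<Longrightarrow> \<bar>h x - h y\<bar> \<le> H * \<bar>x - y\<bar>"
 shows "norm (\<Sum>q=1..Q. \<Sum>a\<in>{\<lceil>\<alpha> * real q\<rceil>..\<lfloor>\<beta> * real q\<rfloor>}. circ (real q * h (of_int a / real q)))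
   \<le> (\<Sum>i\<in>{-int m<..<int m}. norm (integral {\<alpha>..\<beta>} (\<lambda>x. gker Q (h x + of_int i * x))))
    + real Q * (5 + (real Q * (\<beta> - \<alpha>) + 1) * (4 * pi * H / sqrt (real m)))"
proof -
 define E where "E = 5 + (real Q * (\<beta> - \<alpha>) + 1) * (4 * pi * H / sqrt (real m))"
 define S where "S q = (\<Sum>a\<in>{\<lceil>\<alpha> * real q\<rceil>..\<lfloor>\<beta> * real q\<rfloor>}. circ (real q * h (of_int a / real q)))" for q
 define T where "T q = (\<Sum>k<m. \<Sum>l<m. integral {\<alpha>..\<beta>} (\<lambda>x. of_nat q * circ (real q * (h x + of_int (int k - int l) * x)))) / of_nat m" for q
 define I where "I i = integral {\<alpha>..\<beta>} (\<lambda>x. gker Q (h x + of_int i * x))" for i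
 have st: "norm (S q - T q) \<le> E" if "q \<in> {1..Q}" for q
 proof -
  have "norm (S q - T q) \<le> 5 + (real q * (\<beta> - \<alpha>) + 1) * (4 * pi * H / sqrt (real m))"
   unfolding S_def T_def using that by (intro poisson_single ab m H h) auto
  also have "... \<le> E" unfolding E_def using that ab H by (intro add_left_mono mult_right_mono add_right_mono) auto
  finally show ?thesis .
 qed
 have "(\<Sum>q=1..Q. T q) = (\<Sum>k<m. \<Sum>l<m. I (int k - int l)) / of_nat m"
 proof -
  have "(\<Sum>q=1..Q. integral {\<alpha>..\<beta>} (\<lambda>x. of_nat q * circ (real q * (h x + of_int i * x)))) = I i" for i
  proof -
   have "I i = integral {\<alpha>..\<beta>} (\<lambda>x. \<Sum>q=1..Q. of_nat q * circ (real q * (h x + of_int i * x)))"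
    unfolding I_def gker_def ..
   also have "... = (\<Sum>q=1..Q. integral {\<alpha>..\<beta>} (\<lambda>x. of_nat q * circ (real q * (h x + of_int i * x))))"
    by (intro integral_sum finite_atLeastAtMost integrable_continuous_real continuous_intros h(1))
   finally show ?thesis by simp
  qed
  note e = this
  have "(\<Sum>q=1..Q. T q) = (\<Sum>q=1..Q. \<Sum>k<m. \<Sum>l<m. integral {\<alpha>..\<beta>} (\<lambda>x. of_nat q * circ (real q * (h x + of_int (int k - int l) * x)))) / of_nat m"
   unfolding T_def by (simp only: sum_divide_distrib)
  also have "(\<Sum>q=1..Q. \<Sum>k<m. \<Sum>l<m. integral {\<alpha>..\<beta>} (\<lambda>x. of_nat q * circ (real q * (h x + of_int (int k - int l) * x))))
   = (\<Sum>k<m. \<Sum>q=1..Q. \<Sum>l<m. integral {\<alpha>..\<beta>} (\<lambda>x. of_nat q * circ (real q * (h x + of_int (int k - int l) * x))))"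
   by (rule sum.swap)
  also have "... = (\<Sum>k<m. \<Sum>l<m. \<Sum>q=1..Q. integral {\<alpha>..\<beta>} (\<lambda>x. of_nat q * circ (real q * (h x + of_int (int k - int l) * x))))"
   by (rule sum.cong[OF refl], rule sum.swap)
  finally show ?thesis unfolding e .
 qed
 then have "norm (\<Sum>q=1..Q. T q) = norm (\<Sum>k<m. \<Sum>l<m. I (int k - int l)) / real m"
  by (simp add: norm_divide)
 also have "... \<le> (\<Sum>k<m. \<Sum>l<m. norm (I (int k - int l))) / real m"
  by (intro divide_right_mono order_trans[OF norm_sum sum_mono[OF norm_sum]]) auto
 also have "... \<le> (real m * (\<Sum>i\<in>{-int m<..<int m}. norm (I i))) / real m"
  by (intro divide_right_mono sum_diff_regroup_le) auto
 finally have nT: "norm (\<Sum>q=1..Q. T q) \<le> (\<Sum>i\<in>{-int m<..<int m}. norm (I i))" using m by simp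
 have "norm ((\<Sum>q=1..Q. S q) - (\<Sum>q=1..Q. T q)) = norm (\<Sum>q=1..Q. S q - T q)" by (simp add: sum_subtractf)
 also have "... \<le> (\<Sum>q=1..Q. E)" by (intro sum_norm_le st)
 finally have "norm ((\<Sum>q=1..Q. S q) - (\<Sum>q=1..Q. T q)) \<le> real Q * E" by simp
 then have "norm (\<Sum>q=1..Q. S q) \<le> (\<Sum>i\<in>{-int m<..<int m}. norm (I i)) + real Q * E"
  using nT norm_triangle_sub[of "\<Sum>q=1..Q. S q" "\<Sum>q=1..Q. T q"] by linarith
 then show ?thesis unfolding S_def I_def E_def .
qed

section \<open>Summation over the Poisson frequencies\<close>

lemma sum_inverse_distance_le:
 fixes A :: real and S :: "int set"
 assumes "\<And>k. k \<in> S \<Longrightarrow> \<bar>of_int k - A\<bar> \<ge> 1 \<and> \<bar>of_int k - A\<bar> < real N + 1"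
 shows "(\<Sum>k\<in>S. 1 / \<bar>of_int k - A\<bar>) \<le> 2 * harm N"
proof -
 have one: "(\<Sum>k\<in>T. 1 / \<bar>of_int k - A\<bar>) \<le> harm N" if T: "T \<subseteq> S" "(\<forall>k\<in>T. of_int k > A) \<or> (\<forall>k\<in>T. of_int k < A)" for T
 proof -
  define \<phi> where "\<phi> k = nat \<lfloor>\<bar>of_int k - A\<bar>\<rfloor>" for k :: int
  have inj: "inj_on \<phi> T"
  proof (rule inj_onI)
   fix k l assume kl: "k \<in> T" "l \<in> T" "\<phi> k = \<phi> l"
   moreover have "0 \<le> \<lfloor>\<bar>of_int k - A\<bar>\<rfloor>" "0 \<le> \<lfloor>\<bar>of_int l - A\<bar>\<rfloor>" by simp_all
   ultimately have "\<lfloor>\<bar>of_int k - A\<bar>\<rfloor> = \<lfloor>\<bar>of_int l - A\<bar>\<rfloor>" unfolding \<phi>_def by (metis eq_nat_nat_iff)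
   then have "\<bar>\<bar>of_int k - A\<bar> - \<bar>of_int l - A\<bar>\<bar> < 1" by linarith
   moreover have "(of_int k > A \<and> of_int l > A) \<or> (of_int k < A \<and> of_int l < A)" using T(2) kl by blast
   ultimately have "\<bar>of_int k - of_int l :: real\<bar> < 1" by linarith
   then show "k = l" by linarith
  qed
  have b: "\<phi> k \<in> {1..N} \<and> real (\<phi> k) \<le> \<bar>of_int k - A\<bar>" if "k \<in> T" for k
  proof -
   have "\<bar>of_int k - A\<bar> \<ge> 1" "\<bar>of_int k - A\<bar> < real N + 1" using assms T(1) that by blast+
   then show ?thesis unfolding \<phi>_def by simp linarith
  qed
  have "(\<Sum>k\<in>T. 1 / \<bar>of_int k - A\<bar>) \<le> (\<Sum>k\<in>T. inverse (real (\<phi> k)))"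
  proof (rule sum_mono)
   fix k assume "k \<in> T"
   then show "1 / \<bar>of_int k - A\<bar> \<le> inverse (real (\<phi> k))" using b[of k] by (simp add: inverse_eq_divide frac_le)
  qed
  also have "... = sum (\<lambda>i. inverse (real i)) (\<phi> ` T)" using sum.reindex[OF inj, of "\<lambda>i. inverse (real i)"] by simp
  also have "... \<le> sum (\<lambda>i. inverse (real i)) {1..N}" using b by (intro sum_mono2) auto
  finally show ?thesis by (simp add: harm_def)
 qed
 show ?thesis
 proof (cases "finite S")
  case True
  have "S = {k\<in>S. of_int k > A} \<union> {k\<in>S. of_int k < A}"
  proof -
   have "of_int k \<noteq> A" if "k \<in> S" for k using assms[OF that] by auto
   then show ?thesis by force
  qed
  then have "(\<Sum>k\<in>S. 1 / \<bar>of_int k - A\<bar>) = (\<Sum>k\<in>{k\<in>S. of_int k > A}. 1 / \<bar>of_int k - A\<bar>) + (\<Sum>k\<in>{k\<in>S. of_int k < A}. 1 / \<bar>of_int k - A\<bar>)"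
   by (subst sum.union_disjoint[symmetric]) (use True in auto)
  then show ?thesis using one[of "{k\<in>S. of_int k > A}"] one[of "{k\<in>S. of_int k < A}"] by auto
 qed (simp add: harm_nonneg)
qed

lemma cap_nonneg: "cap n \<rho> \<ge> 0"
 unfolding cap_def by simp

lemma card_int_near_le: "card {k::int. \<bar>of_int k - A\<bar> < (1::real)} \<le> 2" "finite {k::int. \<bar>of_int k - A\<bar> < (1::real)}"
proof -
 have sub: "{k::int. \<bar>of_int k - A\<bar> < 1} \<subseteq> {\<lfloor>A\<rfloor>, \<lfloor>A\<rfloor> + 1}"
 proof
  fix k :: int assume "k \<in> {k. \<bar>of_int k - A\<bar> < 1}"
  then have "\<bar>of_int k - A\<bar> < 1" by simp
  then have "k = \<lfloor>A\<rfloor> \<or> k = \<lfloor>A\<rfloor> + 1" by linarith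
  then show "k \<in> {\<lfloor>A\<rfloor>, \<lfloor>A\<rfloor> + 1}" by simp
 qed
 then show "finite {k::int. \<bar>of_int k - A\<bar> < 1}" by (rule finite_subset) simp
 show "card {k::int. \<bar>of_int k - A\<bar> < 1} \<le> 2" using card_mono[OF _ sub] by simp
qed

lemma phase_minus_linear: "phase a b h h1 h2 \<Longrightarrow> phase a b (\<lambda>x. h x - c * x) (\<lambda>x. h1 x - c) h2"
 unfolding phase_def by (auto intro!: derivative_eq_intros)

text \<open>The position of k relative to the range of \<open>h1\<close> decides: outside it the
  first derivative test applies, well inside it stationary phase, and within distance 1 of an end
  value the second derivative test, which concerns at most four k. All contributions appear together
  in one bound so that it can be summed over k at once.\<close>

lemma gker_integral_bound:
 fixes k :: int
 assumes ph: "phase \<alpha> \<beta> h h1 h2" and ab: "\<alpha> \<le> \<beta>" and \<mu>: "\<mu> > 0" and L: "\<Lambda> \<ge> 1" and Q: "Q \<ge> 1"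
  and b2: "\<And>x. x \<in> {\<alpha>..\<beta>} \<Longrightarrow> \<mu> \<le> h2 x" "\<And>x. x \<in> {\<alpha>..\<beta>} \<Longrightarrow> h2 x \<le> \<Lambda> * \<mu>"
  and xs: "\<And>k. k \<in> {\<lceil>h1 \<alpha>\<rceil>..\<lfloor>h1 \<beta>\<rfloor>} \<Longrightarrow> xs k \<in> {\<alpha>..\<beta>} \<and> h1 (xs k) = of_int k"
 shows "norm (integral {\<alpha>..\<beta>} (\<lambda>x. gker Q (h x - of_int k * x))) \<le>
  real Q * (if \<bar>of_int k - h1 \<alpha>\<bar> \<ge> 1 then 1 / \<bar>of_int k - h1 \<alpha>\<bar> else 0) +
  real Q * (if \<bar>of_int k - h1 \<beta>\<bar> \<ge> 1 then 1 / \<bar>of_int k - h1 \<beta>\<bar> else 0) +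
  4 * real Q * sqrt (real Q / \<mu>) * ((if \<bar>of_int k - h1 \<alpha>\<bar> < 1 then 1 else 0) + (if \<bar>of_int k - h1 \<beta>\<bar> < 1 then 1 else 0)) +
  32 * \<Lambda>^3 * sqrt (real Q / \<mu>) * (if k \<in> {\<lceil>h1 \<alpha>\<rceil>..\<lfloor>h1 \<beta>\<rfloor>} then cap Q (int_dist (h (xs k) - of_int k * xs k)) else 0)"
  (is "?T \<le> ?UA + ?UB + ?V + ?W")
proof -
 let ?\<psi> = "\<lambda>x. h x - of_int k * x" and ?\<psi>1 = "\<lambda>x. h1 x - of_int k"
 have ps: "phase \<alpha> \<beta> ?\<psi> ?\<psi>1 h2" by (rule phase_minus_linear[OF ph])
 have mono: "h1 x \<le> h1 y" if "\<alpha> \<le> x" "x \<le> y" "y \<le> \<beta>" for x y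
 proof -
  have "0 \<le> \<mu> * (y - x)" using \<mu> that by simp
  then show ?thesis using phase_mono_diff[OF ph that b2(1)] by simp
 qed
 have nn: "?UA \<ge> 0" "?UB \<ge> 0" "?V \<ge> 0" "?W \<ge> 0" using L \<mu> by (auto intro!: mult_nonneg_nonneg cap_nonneg)
 have h2p: "\<And>x. x \<in> {\<alpha>..\<beta>} \<Longrightarrow> 1 * h2 x \<ge> 0" using b2(1) \<mu> by (metis less_le_trans less_imp_le mult_1)
 consider "\<bar>of_int k - h1 \<alpha>\<bar> < 1 \<or> \<bar>of_int k - h1 \<beta>\<bar> < 1" | "of_int k \<le> h1 \<alpha> - 1" | "of_int k \<ge> h1 \<beta> + 1"
  | "h1 \<alpha> + 1 \<le> of_int k" "of_int k \<le> h1 \<beta> - 1" using mono[of \<alpha> \<beta>] ab by linarith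
 then show ?thesis
 proof cases
  case 1
  have "?T \<le> 4 * real Q * sqrt (real Q / \<mu>)" by (rule gker_second_derivative_test[OF ps ab \<mu> b2(1) Q])
  also have "... \<le> ?V" using 1 \<mu> by auto
  finally show ?thesis using nn by linarith
 next
  case 2
  have "?T \<le> real Q / (h1 \<alpha> - of_int k)"
  proof (rule gker_first_derivative_test[OF ps ab, where \<sigma> = 1])
   fix x assume "x \<in> {\<alpha>..\<beta>}"
   then show "h1 \<alpha> - of_int k \<le> \<bar>h1 x - of_int k\<bar>" using mono[of \<alpha> x] by auto
  qed (use 2 h2p in auto)
  also have "... \<le> ?UA" using 2 by (simp add: abs_if)
  finally show ?thesis using nn by linarith
 next
  case 3
  have "?T \<le> real Q / (of_int k - h1 \<beta>)"
  proof (rule gker_first_derivative_test[OF ps ab, where \<sigma> = 1])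
   fix x assume "x \<in> {\<alpha>..\<beta>}"
   then show "of_int k - h1 \<beta> \<le> \<bar>h1 x - of_int k\<bar>" using mono[of x \<beta>] by auto
  qed (use 3 h2p in auto)
  also have "... \<le> ?UB" using 3 by (simp add: abs_if)
  finally show ?thesis using nn by linarith
 next
  case 4
  then have K: "k \<in> {\<lceil>h1 \<alpha>\<rceil>..\<lfloor>h1 \<beta>\<rfloor>}" by (simp add: ceiling_le_iff le_floor_iff)
  have "?T \<le> 32 * \<Lambda>^3 * sqrt (real Q / \<mu>) * cap Q (int_dist (?\<psi> (xs k))) + real Q / ?\<psi>1 \<beta> + real Q / (- ?\<psi>1 \<alpha>)"
   using xs[OF K] by (intro gker_stationary[OF ps _ \<mu> L Q b2]) auto
  also have "real Q / ?\<psi>1 \<beta> = ?UB" using 4 by (simp add: abs_if)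
  also have "real Q / (- ?\<psi>1 \<alpha>) = ?UA" using 4 by (simp add: abs_if)
  also have "32 * \<Lambda>^3 * sqrt (real Q / \<mu>) * cap Q (int_dist (?\<psi> (xs k))) = ?W" using K by simp
  finally show ?thesis using nn by linarith
 qed
qed

lemma gker_integral_sum_bound:
 assumes ph: "phase \<alpha> \<beta> h h1 h2" and ab: "\<alpha> \<le> \<beta>" and \<mu>: "\<mu> > 0" and L: "\<Lambda> \<ge> 1" and Q: "Q \<ge> 1"
  and b2: "\<And>x. x \<in> {\<alpha>..\<beta>} \<Longrightarrow> \<mu> \<le> h2 x" "\<And>x. x \<in> {\<alpha>..\<beta>} \<Longrightarrow> h2 x \<le> \<Lambda> * \<mu>"
  and xs: "\<And>k. k \<in> {\<lceil>h1 \<alpha>\<rceil>..\<lfloor>h1 \<beta>\<rfloor>} \<Longrightarrow> xs k \<in> {\<alpha>..\<beta>} \<and> h1 (xs k) = of_int k"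
  and N: "real m + \<bar>h1 \<alpha>\<bar> \<le> real N" "real m + \<bar>h1 \<beta>\<bar> \<le> real N"
 shows "(\<Sum>i\<in>{-int m<..<int m}. norm (integral {\<alpha>..\<beta>} (\<lambda>x. gker Q (h x + of_int i * x)))) \<le>
  4 * real Q * harm N + 16 * real Q * sqrt (real Q / \<mu>) +
  32 * \<Lambda>^3 * sqrt (real Q / \<mu>) * (\<Sum>k\<in>{\<lceil>h1 \<alpha>\<rceil>..\<lfloor>h1 \<beta>\<rfloor>}. cap Q (int_dist (h (xs k) - of_int k * xs k)))"
proof -
 let ?M = "{-int m<..<int m}" and ?K = "{\<lceil>h1 \<alpha>\<rceil>..\<lfloor>h1 \<beta>\<rfloor>}"
 define u where "u A k = (if \<bar>of_int k - A\<bar> \<ge> 1 then 1 / \<bar>of_int k - A\<bar> else (0::real))" for A :: real and k :: int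
 define v where "v A k = (if \<bar>of_int k - A\<bar> < 1 then 1 else (0::real))" for A :: real and k :: int
 define w where "w k = (if k \<in> ?K then cap Q (int_dist (h (xs k) - of_int k * xs k)) else 0)" for k
 have su: "(\<Sum>k\<in>?M. u A k) \<le> 2 * harm N" if "real m + \<bar>A\<bar> \<le> real N" for A
 proof -
  have "(\<Sum>k\<in>?M. u A k) = (\<Sum>k\<in>{k\<in>?M. \<bar>of_int k - A\<bar> \<ge> 1}. 1 / \<bar>of_int k - A\<bar>)"
   unfolding u_def by (simp add: sum.If_cases Int_def)
  also have "... \<le> 2 * harm N"
  proof (rule sum_inverse_distance_le)
   fix k assume k: "k \<in> {k\<in>?M. \<bar>of_int k - A\<bar> \<ge> 1}"
   then have "\<bar>k\<bar> < int m" by auto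
   then have "\<bar>of_int k :: real\<bar> < real m" by linarith
   then have "\<bar>of_int k - A\<bar> < real N + 1" using that by linarith
   then show "1 \<le> \<bar>of_int k - A\<bar> \<and> \<bar>of_int k - A\<bar> < real N + 1" using k by simp
  qed
  finally show ?thesis .
 qed
 have sv: "(\<Sum>k\<in>?M. v A k) \<le> 2" for A
 proof -
  have "(\<Sum>k\<in>?M. v A k) = real (card (?M \<inter> {k. \<bar>of_int k - A\<bar> < 1}))"
   unfolding v_def by (simp add: sum.If_cases)
  also have "card (?M \<inter> {k. \<bar>of_int k - A\<bar> < 1}) \<le> card {k::int. \<bar>of_int k - A\<bar> < 1}"
   by (intro card_mono card_int_near_le) auto
  finally show ?thesis using card_int_near_le(1)[of A] by linarith
 qed
 have sw: "(\<Sum>k\<in>?M. w k) \<le> (\<Sum>k\<in>?K. cap Q (int_dist (h (xs k) - of_int k * xs k)))"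
 proof -
  have "(\<Sum>k\<in>?M. w k) = (\<Sum>k\<in>?M \<inter> ?K. cap Q (int_dist (h (xs k) - of_int k * xs k)))"
   unfolding w_def by (simp add: sum.If_cases Int_def)
  also have "... \<le> (\<Sum>k\<in>?K. cap Q (int_dist (h (xs k) - of_int k * xs k)))"
   by (intro sum_mono2) (auto simp: cap_nonneg)
  finally show ?thesis .
 qed
 have "(\<Sum>i\<in>?M. norm (integral {\<alpha>..\<beta>} (\<lambda>x. gker Q (h x + of_int i * x))))
   = (\<Sum>k\<in>?M. norm (integral {\<alpha>..\<beta>} (\<lambda>x. gker Q (h x - of_int k * x))))"
  by (rule sum.reindex_bij_witness[where i = uminus and j = uminus]) auto
 also have "... \<le> (\<Sum>k\<in>?M. real Q * u (h1 \<alpha>) k + real Q * u (h1 \<beta>) k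
   + 4 * real Q * sqrt (real Q / \<mu>) * (v (h1 \<alpha>) k + v (h1 \<beta>) k) + 32 * \<Lambda>^3 * sqrt (real Q / \<mu>) * w k)"
  unfolding u_def v_def w_def by (intro sum_mono gker_integral_bound[OF ph ab \<mu> L Q b2 xs])
 also have "... = real Q * (\<Sum>k\<in>?M. u (h1 \<alpha>) k) + real Q * (\<Sum>k\<in>?M. u (h1 \<beta>) k)
   + 4 * real Q * sqrt (real Q / \<mu>) * ((\<Sum>k\<in>?M. v (h1 \<alpha>) k) + (\<Sum>k\<in>?M. v (h1 \<beta>) k)) + 32 * \<Lambda>^3 * sqrt (real Q / \<mu>) * (\<Sum>k\<in>?M. w k)"
  by (simp only: sum.distrib sum_distrib_left[symmetric])
 also have "... \<le> real Q * (2 * harm N) + real Q * (2 * harm N) + 4 * real Q * sqrt (real Q / \<mu>) * (2 + 2)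
   + 32 * \<Lambda>^3 * sqrt (real Q / \<mu>) * (\<Sum>k\<in>?K. cap Q (int_dist (h (xs k) - of_int k * xs k)))"
  using L \<mu> su[OF N(1)] su[OF N(2)] sv[of "h1 \<alpha>"] sv[of "h1 \<beta>"] sw by (intro add_mono mult_left_mono) auto
 finally show ?thesis by (simp add: mult_ac)
qed

subsection \<open>Exponential sums over rational points\<close>

text \<open>At the stationary point j f(x) - k x equals -j G(k/j) with G the Legendre dual, so a
  small distance to the integers says that (j, k, nearest integer) is a rational point near the dual
  curve. The curvature of G is of order 1/\<kappa> \<ge> 1: its windows have length \<kappa> and its
  tolerance is measured in units of 1. The slopes span at most \<Lambda> \<kappa>, hence
  O(\<Lambda>) windows.\<close>

lemma dual_count:
 assumes L: "\<Lambda> \<ge> (1::real)" and \<eta>: "0 < \<eta>" "\<eta> \<le> 1"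
 obtains K where "K \<ge> 1"
  "\<And>\<kappa> \<alpha> \<beta> f f1 f2 xs X r. 0 < \<kappa> \<Longrightarrow> \<kappa> \<le> 1 \<Longrightarrow> \<alpha> \<le> \<beta> \<Longrightarrow> \<beta> \<le> \<alpha> + 1 \<Longrightarrow> phase \<alpha> \<beta> f f1 f2 \<Longrightarrow>
   (\<And>x. x \<in> {\<alpha>..\<beta>} \<Longrightarrow> \<kappa> \<le> f2 x \<and> f2 x \<le> \<Lambda> * \<kappa>) \<Longrightarrow> (X::nat) \<ge> 1 \<Longrightarrow> r \<ge> 0 \<Longrightarrow>
   (\<And>j k. j \<in> {X..<2*X} \<Longrightarrow> k \<in> {\<lceil>real j * f1 \<alpha>\<rceil>..\<lfloor>real j * f1 \<beta>\<rfloor>} \<Longrightarrow> xs j k \<in> {\<alpha>..\<beta>} \<and> real j * f1 (xs j k) = of_int k) \<Longrightarrow>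
   real (card {(j,k). j \<in> {X..<2*X} \<and> k \<in> {\<lceil>real j * f1 \<alpha>\<rceil>..\<lfloor>real j * f1 \<beta>\<rfloor>} \<and> int_dist (real j * f (xs j k) - of_int k * xs j k) \<le> r})
    \<le> K * (1 + r * real X powr (1 + \<eta>)) * real X * (1 + ln (real X))"
proof -
 have L2: "\<Lambda>^2 \<ge> 1" using L by simp
 obtain K where K: "K \<ge> 1" "\<And>D \<kappa> f f1 g g1 s \<rho>. D \<ge> 1 \<Longrightarrow> \<kappa> > 0 \<Longrightarrow> legendre_pair (\<Lambda>^2) \<kappa> f f1 g g1 \<Longrightarrow> 0 \<le> \<rho> \<Longrightarrow>
  finite (near_pts f D s (min 1 (1/\<kappa>)) \<rho>) \<and>
  real (card (near_pts f D s (min 1 (1/\<kappa>)) \<rho>)) \<le> K * (1 + \<rho> / min 1 \<kappa> * real D powr (1+\<eta>)) * real D * (1 + ln (real D))"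
  using near_bound_fat[OF L2 \<eta>] by blast
 define M where "M = real (nat \<lfloor>\<Lambda>\<rfloor> + 1)"
 have M: "M \<ge> 1" unfolding M_def by simp
 show ?thesis
 proof (rule that[of "M * K"])
  show "M * K \<ge> 1" using M K(1) mult_mono[of 1 M 1 K] by simp
  fix \<kappa> \<alpha> \<beta> f f1 f2 xs r and X :: nat
  assume \<kappa>: "0 < \<kappa>" "\<kappa> \<le> (1::real)" and ab: "\<alpha> \<le> \<beta>" "\<beta> \<le> \<alpha> + 1" and ph: "phase \<alpha> \<beta> f f1 f2"
   and b2: "\<And>x. x \<in> {\<alpha>..\<beta>} \<Longrightarrow> \<kappa> \<le> f2 x \<and> f2 x \<le> \<Lambda> * \<kappa>" and X: "X \<ge> 1" and r: "(r::real) \<ge> 0"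
   and xs: "\<And>j k. j \<in> {X..<2*X} \<Longrightarrow> k \<in> {\<lceil>real j * f1 \<alpha>\<rceil>..\<lfloor>real j * f1 \<beta>\<rfloor>} \<Longrightarrow> xs j k \<in> {\<alpha>..\<beta>} \<and> real j * f1 (xs j k) = of_int k"
  have low: "\<kappa> * (y - x) \<le> f1 y - f1 x" if "\<alpha> \<le> x" "x \<le> y" "y \<le> \<beta>" for x y
   using phase_mono_diff[OF ph that] b2 by blast
  have up: "f1 y - f1 x \<le> \<Lambda> * \<kappa> * (y - x)" if "\<alpha> \<le> x" "x \<le> y" "y \<le> \<beta>" for x y
  proof -
   have "phase \<alpha> \<beta> (\<lambda>x. - f x) (\<lambda>x. - f1 x) (\<lambda>x. - f2 x)"
    using ph unfolding phase_def by (auto intro!: derivative_eq_intros continuous_intros)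
   from phase_mono_diff[OF this that, of "- (\<Lambda> * \<kappa>)"] show ?thesis using b2 by auto
  qed
  obtain F F1 G G1 where lp: "legendre_pair (\<Lambda>^2) \<kappa> F F1 G G1" and FE: "\<And>x. x \<in> {\<alpha>..\<beta>} \<Longrightarrow> F x = f x \<and> F1 x = f1 x"
   using legendre_extension[OF ab(1) phaseD(1)[OF ph] \<kappa>(1) L low up] by blast
  have lpG: "legendre_pair (\<Lambda>^2) (1/\<kappa>) G G1 F F1" by (rule legendre_pair_sym[OF lp \<kappa>(1)])
  define N where "N t = near_pts G X (f1 \<alpha> + real t * \<kappa>) \<kappa> r" for t :: nat
  have m1: "min 1 (1/(1/\<kappa>)) = \<kappa>" "min 1 (1/\<kappa>) = 1" using \<kappa> by (auto simp: min_def)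
  have Nb: "finite (N t)" "real (card (N t)) \<le> K * (1 + r * real X powr (1+\<eta>)) * real X * (1 + ln (real X))" for t
   using K(2)[OF X _ lpG r, of "f1 \<alpha> + real t * \<kappa>"] \<kappa> unfolding N_def m1 by auto
  define S where "S = {(j,k). j \<in> {X..<2*X} \<and> k \<in> {\<lceil>real j * f1 \<alpha>\<rceil>..\<lfloor>real j * f1 \<beta>\<rfloor>} \<and> int_dist (real j * f (xs j k) - of_int k * xs j k) \<le> r}"
  define \<phi> where "\<phi> = (\<lambda>(j::nat, k::int). (int j, k, round (real j * G (of_int k / real j))))"
  have inj: "inj_on \<phi> S" unfolding \<phi>_def inj_on_def by auto
  have sub: "\<phi> ` S \<subseteq> (\<Union>t\<in>{..nat \<lfloor>\<Lambda>\<rfloor>}. N t)"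
  proof
   fix p assume "p \<in> \<phi> ` S"
   then obtain j k where jk: "(j,k) \<in> S" "p = \<phi> (j,k)" by auto
   have j: "X \<le> j" "j < 2 * X" and k: "k \<in> {\<lceil>real j * f1 \<alpha>\<rceil>..\<lfloor>real j * f1 \<beta>\<rfloor>}" and rr: "int_dist (real j * f (xs j k) - of_int k * xs j k) \<le> r"
    using jk unfolding S_def by auto
   have j0: "real j > 0" using j X by simp
   have x: "xs j k \<in> {\<alpha>..\<beta>}" "real j * f1 (xs j k) = of_int k" using xs[OF _ k] j by auto
   define y where "y = of_int k / real j"
   have y: "f1 (xs j k) = y" unfolding y_def using x(2) j0 by (simp add: field_simps)
   have "F (xs j k) + G (F1 (xs j k)) = xs j k * F1 (xs j k)" using lp unfolding legendre_pair_def by blast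
   then have Gy: "G y = xs j k * y - f (xs j k)" using FE[OF x(1)] y by simp
   have jG: "real j * G y = - (real j * f (xs j k) - of_int k * xs j k)" 
   proof -
    have "of_int k = real j * y" unfolding y_def using j0 by simp
    then show ?thesis unfolding Gy by (simp add: algebra_simps)
   qed
   have rd: "\<bar>of_int (round (real j * G y)) - real j * G y\<bar> \<le> r"
    using rr int_dist_round[of "real j * G y"] unfolding jG int_dist_minus by (simp add: abs_minus_commute)
   have "real j * f1 \<alpha> \<le> of_int k" "of_int k \<le> real j * f1 \<beta>" using k by (auto simp: ceiling_le_iff le_floor_iff)
   then have y1: "f1 \<alpha> \<le> y" "y \<le> f1 \<beta>" unfolding y_def using j0 by (simp_all add: field_simps)
   have "f1 \<beta> - f1 \<alpha> \<le> \<Lambda> * \<kappa> * 1" 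
   proof -
    have "\<Lambda> * \<kappa> * (\<beta> - \<alpha>) \<le> \<Lambda> * \<kappa> * 1" using ab \<kappa> L by (intro mult_left_mono) auto
    then show ?thesis using up[of \<alpha> \<beta>] ab by linarith
   qed
   then have y2: "(y - f1 \<alpha>) / \<kappa> \<le> \<Lambda>" using y1 \<kappa> by (simp add: field_simps)
   define t where "t = nat \<lfloor>(y - f1 \<alpha>) / \<kappa>\<rfloor>"
   have y0: "(y - f1 \<alpha>) / \<kappa> \<ge> 0" using y1 \<kappa> by simp
   have t: "real t \<le> (y - f1 \<alpha>) / \<kappa>" "(y - f1 \<alpha>) / \<kappa> \<le> real t + 1" unfolding t_def using y0 by (simp_all; linarith)+
   have "t \<le> nat \<lfloor>\<Lambda>\<rfloor>" unfolding t_def using y2 by (intro nat_mono floor_mono)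
   moreover have "p \<in> N t"
    unfolding jk(2) \<phi>_def N_def near_pts_def using j t rd \<kappa> unfolding y_def by (auto simp: field_simps)
   ultimately show "p \<in> (\<Union>t\<in>{..nat \<lfloor>\<Lambda>\<rfloor>}. N t)" by blast
  qed
  have "card S \<le> card (\<Union>t\<in>{..nat \<lfloor>\<Lambda>\<rfloor>}. N t)"
   by (rule card_inj_on_le[OF inj sub]) (use Nb in auto)
  also have "... \<le> (\<Sum>t\<in>{..nat \<lfloor>\<Lambda>\<rfloor>}. card (N t))" by (rule card_UN_le) simp
  finally have "real (card S) \<le> real (\<Sum>t\<in>{..nat \<lfloor>\<Lambda>\<rfloor>}. card (N t))" by (simp only: of_nat_le_iff)
  also have "... = (\<Sum>t\<in>{..nat \<lfloor>\<Lambda>\<rfloor>}. real (card (N t)))" by simp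
  also have "... \<le> (\<Sum>t\<in>{..nat \<lfloor>\<Lambda>\<rfloor>}. K * (1 + r * real X powr (1+\<eta>)) * real X * (1 + ln (real X)))" by (intro sum_mono Nb)
  also have "... = M * K * (1 + r * real X powr (1+\<eta>)) * real X * (1 + ln (real X))" by (simp add: M_def)
  finally show "real (card {(j,k). j \<in> {X..<2*X} \<and> k \<in> {\<lceil>real j * f1 \<alpha>\<rceil>..\<lfloor>real j * f1 \<beta>\<rfloor>} \<and> int_dist (real j * f (xs j k) - of_int k * xs j k) \<le> r})
    \<le> M * K * (1 + r * real X powr (1 + \<eta>)) * real X * (1 + ln (real X))"
   unfolding S_def .
 qed
qed

text \<open>The layer of the least i with Q \<rho> \<le> 2^i alone dominates the cap: by minimality
  1/\<rho> is less than 2 Q/2^i when i > 0.\<close>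

lemma cap_layers:
 assumes "\<rho> \<ge> 0" "\<rho> \<le> 1" "real Q \<le> 2^n"
 shows "cap Q \<rho> \<le> (\<Sum>i\<le>n. 2 * real Q / 2^i * (if \<rho> \<le> 2^i / real Q then 1 else 0))"
proof (cases "Q = 0")
 case True
 then show ?thesis by (simp add: cap_def)
next
 case False
 then have Q: "real Q > 0" by simp
 define P where "P i \<longleftrightarrow> real Q * \<rho> \<le> 2^i" for i :: nat
 have "real Q * \<rho> \<le> real Q * 1" using assms by (intro mult_left_mono) auto
 then have Pn: "P n" unfolding P_def using assms(3) by linarith
 define i where "i = (LEAST i. P i)"
 have i: "P i" "i \<le> n" unfolding i_def using Pn LeastI Least_le by metis+
 have c: "cap Q \<rho> \<le> 2 * real Q / 2^i"
 proof (cases i)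
  case 0
  have "cap Q \<rho> \<le> real Q / 1" unfolding cap_def by (intro frac_le) auto
  then show ?thesis using 0 by simp
 next
  case (Suc i')
  then have "\<not> P i'" unfolding i_def by (metis lessI not_less_Least)
  then have "2^i' < real Q * \<rho>" unfolding P_def by simp
  then have "cap Q \<rho> \<le> real Q / 2^i'" unfolding cap_def by (intro frac_le) auto
  then show ?thesis unfolding Suc by simp
 qed
 have "2 * real Q / 2^i = 2 * real Q / 2^i * (if \<rho> \<le> 2^i / real Q then 1 else 0)"
  using i(1) Q unfolding P_def by (simp add: field_simps)
 also have "... \<le> (\<Sum>i\<le>n. 2 * real Q / 2^i * (if \<rho> \<le> 2^i / real Q then 1 else 0))"
  using i(2) by (intro member_le_sum) auto
 finally show ?thesis using c by linarith
qed

text \<open>The layers have weight 2 Q/2^i and threshold 2^i/Q. The constant part a of the count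
  sums geometrically, while the linear part contributes the same amount 2 b in every layer and so
  costs a logarithm.\<close>

lemma sum_cap_le:
 fixes \<rho> :: "'a \<Rightarrow> real"
 assumes fin: "finite S" and \<rho>: "\<And>p. p \<in> S \<Longrightarrow> 0 \<le> \<rho> p \<and> \<rho> p \<le> 1" and Q: "Q \<ge> 1"
  and A: "\<And>r. r \<ge> 0 \<Longrightarrow> real (card {p \<in> S. \<rho> p \<le> r}) \<le> a + b * r" and ab: "a \<ge> 0" "b \<ge> 0"
 shows "(\<Sum>p\<in>S. cap Q (\<rho> p)) \<le> 4 * real Q * a + 6 * (1 + ln (real Q)) * b"
proof -
 define n where "n = nat \<lceil>log 2 (real Q)\<rceil>"
 have n1: "real Q \<le> 2^n"
 proof -
  have "log 2 (real Q) \<le> real n" unfolding n_def by linarith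
  then have "2 powr (log 2 (real Q)) \<le> 2 powr (real n)" by (intro powr_mono) auto
  then show ?thesis using Q by (simp add: powr_realpow)
 qed
 have ln2: "ln (2::real) \<ge> 1/2" using ln_le_minus_one[of "1/2"] by (simp add: ln_div)
 have n2: "real n + 1 \<le> 3 * (1 + ln (real Q))"
 proof -
  have l0: "ln (real Q) \<ge> 0" using Q by simp
  have "log 2 (real Q) = ln (real Q) / ln 2" by (simp add: log_def)
  also have "... \<le> ln (real Q) / (1/2)" using ln2 l0 by (intro divide_left_mono) auto
  finally have "log 2 (real Q) \<le> 2 * ln (real Q)" by simp
  moreover have "real n \<le> log 2 (real Q) + 1" unfolding n_def using Q by simp
  ultimately have "real n + 1 \<le> 2 + 2 * ln (real Q)" by linarith
  also have "... \<le> 3 * (1 + ln (real Q))" using l0 by (simp add: algebra_simps)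
  finally show ?thesis .
 qed
 have "(\<Sum>p\<in>S. cap Q (\<rho> p)) \<le> (\<Sum>p\<in>S. \<Sum>i\<le>n. 2 * real Q / 2^i * (if \<rho> p \<le> 2^i / real Q then 1 else 0))"
  using \<rho> n1 by (intro sum_mono cap_layers) auto
 also have "... = (\<Sum>i\<le>n. \<Sum>p\<in>S. 2 * real Q / 2^i * (if \<rho> p \<le> 2^i / real Q then 1 else 0))" by (rule sum.swap)
 also have "... = (\<Sum>i\<le>n. 2 * real Q / 2^i * real (card {p\<in>S. \<rho> p \<le> 2^i / real Q}))"
 proof (rule sum.cong[OF refl])
  fix i
  have "(\<Sum>p\<in>S. if \<rho> p \<le> 2^i / real Q then 1 else 0) = real (card {p\<in>S. \<rho> p \<le> 2^i / real Q})"
   using fin by (simp add: sum.If_cases Int_def)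
  then show "(\<Sum>p\<in>S. 2 * real Q / 2^i * (if \<rho> p \<le> 2^i / real Q then 1 else 0)) = 2 * real Q / 2^i * real (card {p\<in>S. \<rho> p \<le> 2^i / real Q})"
   by (simp only: sum_distrib_left[symmetric])
 qed
 also have "... \<le> (\<Sum>i\<le>n. 2 * real Q / 2^i * (a + b * (2^i / real Q)))"
  by (intro sum_mono mult_left_mono A) auto
 also have "... = (\<Sum>i\<le>n. 2 * real Q * a * (1/2)^i + 2 * b)"
  using Q by (intro sum.cong) (auto simp: field_simps power_divide)
 also have "... = 2 * real Q * a * (\<Sum>i\<le>n. (1/2)^i) + (real n + 1) * (2 * b)"
  by (simp add: sum.distrib sum_distrib_left)
 also have "... \<le> 2 * real Q * a * 2 + (3 * (1 + ln (real Q))) * (2 * b)"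
 proof (intro add_mono mult_left_mono mult_right_mono n2)
  have "(\<Sum>i\<le>n. (1/2::real)^i) = 2 - (1/2)^n" by (induction n) (auto simp: field_simps)
  then show "(\<Sum>i\<le>n. (1/2::real)^i) \<le> 2" by simp
 qed (use ab in auto)
 also have "... = 4 * real Q * a + 6 * (1 + ln (real Q)) * b" by algebra
 finally show ?thesis .
qed

section \<open>Block estimates on a piece of constant curvature order\<close>

definition esum :: "(real \<Rightarrow> real) \<Rightarrow> real set \<Rightarrow> nat \<Rightarrow> real \<Rightarrow> complex" where
 "esum f I Q j = (\<Sum>q=1..Q. \<Sum>a | of_int a / real q \<in> I. circ (real q * (j * f (of_int a / real q))))"

abbreviation esum_block :: "(real \<Rightarrow> real) \<Rightarrow> real set \<Rightarrow> nat \<Rightarrow> nat \<Rightarrow> real" where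
 "esum_block f I Q X \<equiv> (\<Sum>j\<in>{X..<2*X}. norm (esum f I Q (real j)))"

abbreviation piece_error :: "real \<Rightarrow> real \<Rightarrow> nat \<Rightarrow> nat \<Rightarrow> real" where
 "piece_error \<eta> \<kappa> Q X \<equiv> (real X * real Q * (1 + ln (real Q)) + real Q * sqrt (real Q / \<kappa>) * sqrt (real X) * (1 + ln (real X)) * (1 + real X powr (1+\<eta>) * (1 + ln (real Q)) / real Q))"

lemma int_quotient_in_interval:
 assumes "q \<ge> (1::nat)"
 shows "{a::int. of_int a / real q \<in> {\<alpha>..\<beta>}} = {\<lceil>\<alpha> * real q\<rceil>..\<lfloor>\<beta> * real q\<rfloor>}"
 using assms by (auto simp: field_simps ceiling_le_iff le_floor_iff)

text \<open>The order Q^4 makes the error of the Fejer comparison bounded for each denominator: the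
  Lipschitz constant is at most 2 Q B up to the factor 2 pi, there are at most 2 Q unit blocks, and
  1/sqrt m = Q^(-2).\<close>

lemma esum_poisson:
 assumes B: "B \<ge> 0" and ab: "\<alpha> \<le> \<beta>" "\<beta> \<le> \<alpha> + 1" and ph: "phase \<alpha> \<beta> f f1 f2"
  and b1: "\<And>x. x \<in> {\<alpha>..\<beta>} \<Longrightarrow> \<bar>f1 x\<bar> \<le> B" and Q: "Q \<ge> 2" and j: "1 \<le> j" "j \<le> 2 * Q"
 shows "norm (esum f {\<alpha>..\<beta>} Q (real j)) \<le>
  (\<Sum>i\<in>{-int (Q^4)<..<int (Q^4)}. norm (integral {\<alpha>..\<beta>} (\<lambda>x. gker Q (real j * f x + of_int i * x)))) + real Q * (5 + 64 * B)"
proof -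
 have j0: "real j > 0" using j by simp
 have Q0: "real Q \<ge> 2" "real Q > 0" using Q by auto
 have jQ: "real j \<le> 2 * real Q" using j by linarith
 define m where "m = Q^4"
 have m: "m \<ge> 1" unfolding m_def using Q by simp
 have sm: "sqrt (real m) = real Q ^ 2" unfolding m_def using real_sqrt_abs[of "real Q ^ 2"] by (simp flip: power_mult)
 have phj: "phase \<alpha> \<beta> (\<lambda>x. real j * f x) (\<lambda>x. real j * f1 x) (\<lambda>x. real j * f2 x)"
  using ph unfolding phase_def by (auto intro!: derivative_eq_intros continuous_intros)
 have lip: "\<bar>real j * f x - real j * f y\<bar> \<le> (real j * B) * \<bar>x - y\<bar>" if "x \<in> {\<alpha>..\<beta>}" "y \<in> {\<alpha>..\<beta>}" for x y
 proof -
  have "norm (f x - f y) \<le> B * norm (x - y)"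
  proof (rule field_differentiable_bound[of "{\<alpha>..\<beta>}"])
   fix z assume "z \<in> {\<alpha>..\<beta>}"
   then show "(f has_real_derivative f1 z) (at z within {\<alpha>..\<beta>})" "norm (f1 z) \<le> B"
    using has_field_derivative_at_within[OF phaseD(1)[OF ph]] b1 by auto
  qed (use that in auto)
  then have "real j * \<bar>f x - f y\<bar> \<le> real j * (B * \<bar>x - y\<bar>)" using j0 by (intro mult_left_mono) auto
  then show ?thesis by (simp add: abs_mult mult_ac flip: right_diff_distrib)
 qed
 have "norm (\<Sum>q=1..Q. \<Sum>a\<in>{\<lceil>\<alpha> * real q\<rceil>..\<lfloor>\<beta> * real q\<rfloor>}. circ (real q * (real j * f (of_int a / real q))))
   \<le> (\<Sum>i\<in>{-int m<..<int m}. norm (integral {\<alpha>..\<beta>} (\<lambda>x. gker Q (real j * f x + of_int i * x))))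
    + real Q * (5 + (real Q * (\<beta> - \<alpha>) + 1) * (4 * pi * (real j * B) / sqrt (real m)))"
  by (rule poisson_sum[OF ab(1) m _ phase_continuous(1)[OF phj] lip]) (use j0 B in auto)
 also have "real Q * (5 + (real Q * (\<beta> - \<alpha>) + 1) * (4 * pi * (real j * B) / sqrt (real m))) \<le> real Q * (5 + 64 * B)"
 proof (intro mult_left_mono add_left_mono)
  have "(real Q * (\<beta> - \<alpha>) + 1) * (4 * pi * (real j * B) / sqrt (real m)) \<le> (2 * real Q) * (4 * 4 * (2 * real Q * B) / real Q ^ 2)"
  proof (intro mult_mono)
   have "real Q * (\<beta> - \<alpha>) \<le> real Q * 1" using ab Q0 by (intro mult_left_mono) auto
   then show "real Q * (\<beta> - \<alpha>) + 1 \<le> 2 * real Q" using Q0 by linarith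
   show "4 * pi * (real j * B) / sqrt (real m) \<le> 4 * 4 * (2 * real Q * B) / real Q ^ 2"
    unfolding sm using jQ B pi_less_4 by (intro divide_right_mono mult_mono) auto
  qed (use j0 B Q0 in auto)
  also have "... = 64 * B" using Q0 by (simp add: power2_eq_square field_simps)
  finally show "(real Q * (\<beta> - \<alpha>) + 1) * (4 * pi * (real j * B) / sqrt (real m)) \<le> 64 * B" .
 qed (use Q0 in auto)
 finally show ?thesis
  unfolding esum_def m_def using int_quotient_in_interval[of _ \<alpha> \<beta>] by simp
qed

text \<open>Frequencies without a stationary point give harmonic sums and those at the ends the term
  with 16. Only the last sum, over the stationary values, gains from averaging over j.\<close>

lemma piece_bound_single:
 assumes L: "\<Lambda> \<ge> (1::real)" and B: "B \<ge> 0" and ab: "\<alpha> \<le> \<beta>" "\<beta> \<le> \<alpha> + 1" and ph: "phase \<alpha> \<beta> f f1 f2" and \<kappa>: "0 < \<kappa>"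
  and b2: "\<And>x. x \<in> {\<alpha>..\<beta>} \<Longrightarrow> \<kappa> \<le> f2 x \<and> f2 x \<le> \<Lambda> * \<kappa>" and b1: "\<And>x. x \<in> {\<alpha>..\<beta>} \<Longrightarrow> \<bar>f1 x\<bar> \<le> B"
  and Q: "Q \<ge> 2" and j: "1 \<le> j" "j \<le> 2 * Q"
  and xs: "\<And>k. k \<in> {\<lceil>real j * f1 \<alpha>\<rceil>..\<lfloor>real j * f1 \<beta>\<rfloor>} \<Longrightarrow> xs k \<in> {\<alpha>..\<beta>} \<and> real j * f1 (xs k) = of_int k"
 shows "norm (esum f {\<alpha>..\<beta>} Q (real j)) \<le> (4 * (4 + 2 * B) + 5 + 64 * B) * (real Q * (1 + ln (real Q)))
   + 16 * real Q * sqrt (real Q / (real j * \<kappa>))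
   + 32 * \<Lambda>^3 * sqrt (real Q / (real j * \<kappa>)) * (\<Sum>k\<in>{\<lceil>real j * f1 \<alpha>\<rceil>..\<lfloor>real j * f1 \<beta>\<rfloor>}. cap Q (int_dist (real j * f (xs k) - of_int k * xs k)))"
proof -
 have j0: "real j > 0" using j by simp
 have Q0: "real Q \<ge> 2" "real Q > 0" using Q by auto
 have jQ: "real j \<le> 2 * real Q" using j by linarith
 define m where "m = Q^4"
 have m: "m \<ge> 1" unfolding m_def using Q by simp
 have phj: "phase \<alpha> \<beta> (\<lambda>x. real j * f x) (\<lambda>x. real j * f1 x) (\<lambda>x. real j * f2 x)"
  using ph unfolding phase_def by (auto intro!: derivative_eq_intros continuous_intros)
 have 1: "norm (esum f {\<alpha>..\<beta>} Q (real j)) \<le> (\<Sum>i\<in>{-int m<..<int m}. norm (integral {\<alpha>..\<beta>} (\<lambda>x. gker Q (real j * f x + of_int i * x))))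
    + real Q * (5 + 64 * B)"
  unfolding m_def by (rule esum_poisson[OF B ab ph b1 Q j])
 \<comment> \<open>Bounds the distance of every frequency from the end slopes j f1, which are at
   most 2 Q B; its harmonic number is still O(1 + log Q).\<close>
 define N where "N = m + nat \<lceil>2 * real Q * B\<rceil>"
 have Nj: "real m + \<bar>real j * f1 x\<bar> \<le> real N" if "x \<in> {\<alpha>..\<beta>}" for x
 proof -
  have "\<bar>real j * f1 x\<bar> \<le> (2 * real Q) * B" unfolding abs_mult using b1[OF that] jQ B by (intro mult_mono) auto
  then show ?thesis unfolding N_def by linarith
 qed
 have harmN: "harm N \<le> (4 + 2 * B) * (1 + ln (real Q))"
 proof -
  have Q4: "real m \<ge> real Q" "real m \<ge> 1" unfolding m_def using Q0 power_increasing[of 1 4 "real Q"] by auto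
  have lQ: "ln (real Q) \<ge> 0" using Q0 by simp
  have "real N \<le> real m + 2 * real Q * B + 1" unfolding N_def using Q0 B by (simp add: mult_nonneg_nonneg)
  also have "... \<le> real m + 2 * real m * B + real m" using Q4 B by (intro add_mono mult_mono) auto
  finally have "real N \<le> real m * (2 + 2 * B)" by (simp add: algebra_simps)
  moreover have "N > 0" unfolding N_def using m by simp
  ultimately have "ln (real N) \<le> ln (real m * (2 + 2 * B))" by simp
  also have "... = 4 * ln (real Q) + ln (2 + 2 * B)" unfolding m_def using Q0 B by (simp add: ln_mult ln_realpow)
  also have "ln (2 + 2 * B) \<le> 1 + 2 * B" using ln_le_minus_one[of "2 + 2 * B"] B by simp
  finally have "harm N \<le> 2 + 2 * B + 4 * ln (real Q)" using harm_upper_bound[OF \<open>N > 0\<close>] by linarith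
  also have "... \<le> (4 + 2 * B) * (1 + ln (real Q))" using lQ B by (simp add: algebra_simps)
  finally show ?thesis .
 qed
 have 2: "(\<Sum>i\<in>{-int m<..<int m}. norm (integral {\<alpha>..\<beta>} (\<lambda>x. gker Q (real j * f x + of_int i * x)))) \<le>
  4 * real Q * harm N + 16 * real Q * sqrt (real Q / (real j * \<kappa>)) +
  32 * \<Lambda>^3 * sqrt (real Q / (real j * \<kappa>)) * (\<Sum>k\<in>{\<lceil>real j * f1 \<alpha>\<rceil>..\<lfloor>real j * f1 \<beta>\<rfloor>}. cap Q (int_dist (real j * f (xs k) - of_int k * xs k)))"
 proof (rule gker_integral_sum_bound[OF phj ab(1) _ L _ _ _ xs])
  show "0 < real j * \<kappa>" "1 \<le> Q" using j0 \<kappa> Q by auto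
  show "real j * \<kappa> \<le> real j * f2 x" if "x \<in> {\<alpha>..\<beta>}" for x using b2[OF that] j0 by simp
  show "real j * f2 x \<le> \<Lambda> * (real j * \<kappa>)" if "x \<in> {\<alpha>..\<beta>}" for x using b2[OF that] j0 by (simp add: mult.left_commute)
  show "real m + \<bar>real j * f1 \<alpha>\<bar> \<le> real N" "real m + \<bar>real j * f1 \<beta>\<bar> \<le> real N" using Nj ab by auto
 qed
 have "4 * real Q * harm N \<le> 4 * real Q * ((4 + 2 * B) * (1 + ln (real Q)))" using harmN by (intro mult_left_mono) auto
 moreover have "real Q * (5 + 64 * B) * 1 \<le> real Q * (5 + 64 * B) * (1 + ln (real Q))" using Q0 B by (intro mult_left_mono) auto
 ultimately have "4 * real Q * harm N + real Q * (5 + 64 * B) \<le> (4 * (4 + 2 * B) + 5 + 64 * B) * (real Q * (1 + ln (real Q)))"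
  by (simp add: algebra_simps)
 then show ?thesis using 1 2 by linarith
qed

text \<open>Over a block j ~ X the stationary values become the pairs of \<open>dual_count\<close>.
  The part of the count that does not depend on the distance, O(X (1 + log X)), gives the main term;
  the part linear in the distance gives the correction X^(1+\<eta>) (1 + log Q)/Q.\<close>

lemma piece_bound:
 assumes L: "\<Lambda> \<ge> (1::real)" and B: "B \<ge> 0" and \<eta>: "0 < \<eta>" "\<eta> \<le> 1"
 obtains C where "C \<ge> 0" "\<And>\<kappa> \<alpha> \<beta> f f1 f2 Q X. 0 < \<kappa> \<Longrightarrow> \<kappa> \<le> 1 \<Longrightarrow> \<alpha> \<le> \<beta> \<Longrightarrow> \<beta> \<le> \<alpha> + 1 \<Longrightarrow> phase \<alpha> \<beta> f f1 f2 \<Longrightarrow>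
   (\<And>x. x \<in> {\<alpha>..\<beta>} \<Longrightarrow> \<kappa> \<le> f2 x \<and> f2 x \<le> \<Lambda> * \<kappa>) \<Longrightarrow> (\<And>x. x \<in> {\<alpha>..\<beta>} \<Longrightarrow> \<bar>f1 x\<bar> \<le> B) \<Longrightarrow> Q \<ge> 2 \<Longrightarrow> 1 \<le> X \<Longrightarrow> X \<le> Q \<Longrightarrow>
   esum_block f {\<alpha>..\<beta>} Q X \<le>
    C * piece_error \<eta> \<kappa> Q X"
proof -
 obtain K where K: "K \<ge> 1"
  "\<And>\<kappa> \<alpha> \<beta> f f1 f2 xs X r. 0 < \<kappa> \<Longrightarrow> \<kappa> \<le> 1 \<Longrightarrow> \<alpha> \<le> \<beta> \<Longrightarrow> \<beta> \<le> \<alpha> + 1 \<Longrightarrow> phase \<alpha> \<beta> f f1 f2 \<Longrightarrow>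
   (\<And>x. x \<in> {\<alpha>..\<beta>} \<Longrightarrow> \<kappa> \<le> f2 x \<and> f2 x \<le> \<Lambda> * \<kappa>) \<Longrightarrow> (X::nat) \<ge> 1 \<Longrightarrow> r \<ge> 0 \<Longrightarrow>
   (\<And>j k. j \<in> {X..<2*X} \<Longrightarrow> k \<in> {\<lceil>real j * f1 \<alpha>\<rceil>..\<lfloor>real j * f1 \<beta>\<rfloor>} \<Longrightarrow> xs j k \<in> {\<alpha>..\<beta>} \<and> real j * f1 (xs j k) = of_int k) \<Longrightarrow>
   real (card {(j,k). j \<in> {X..<2*X} \<and> k \<in> {\<lceil>real j * f1 \<alpha>\<rceil>..\<lfloor>real j * f1 \<beta>\<rfloor>} \<and> int_dist (real j * f (xs j k) - of_int k * xs j k) \<le> r})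
    \<le> K * (1 + r * real X powr (1 + \<eta>)) * real X * (1 + ln (real X))"
  using dual_count[OF L \<eta>] by blast
 define C1 where "C1 = 4 * (4 + 2 * B) + 5 + 64 * B"
 define C2 where "C2 = 192 * \<Lambda>^3 * K"
 have C: "C1 \<ge> 0" "C2 \<ge> 0" unfolding C1_def C2_def using B L K(1) by auto
 show ?thesis
 proof (rule that[of "C1 + 16 + C2"])
  show "C1 + 16 + C2 \<ge> 0" using C by simp
  fix \<kappa> \<alpha> \<beta> f f1 f2 and Q X :: nat
  assume \<kappa>: "0 < \<kappa>" "\<kappa> \<le> (1::real)" and ab: "\<alpha> \<le> \<beta>" "\<beta> \<le> \<alpha> + 1" and ph: "phase \<alpha> \<beta> f f1 f2"
   and b2: "\<And>x. x \<in> {\<alpha>..\<beta>} \<Longrightarrow> \<kappa> \<le> f2 x \<and> f2 x \<le> \<Lambda> * \<kappa>" and b1: "\<And>x. x \<in> {\<alpha>..\<beta>} \<Longrightarrow> \<bar>f1 x\<bar> \<le> B"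
   and Q: "Q \<ge> 2" and X: "1 \<le> X" "X \<le> Q"
  define KK where "KK j = {\<lceil>real j * f1 \<alpha>\<rceil>..\<lfloor>real j * f1 \<beta>\<rfloor>}" for j :: nat
  define xs where "xs j k = (SOME x. x \<in> {\<alpha>..\<beta>} \<and> real j * f1 x = of_int k)" for j :: nat and k :: int
  have xs: "xs j k \<in> {\<alpha>..\<beta>} \<and> real j * f1 (xs j k) = of_int k" if "j \<in> {X..<2*X}" "k \<in> {\<lceil>real j * f1 \<alpha>\<rceil>..\<lfloor>real j * f1 \<beta>\<rfloor>}" for j k
  proof -
   have "continuous_on {\<alpha>..\<beta>} (\<lambda>x. real j * f1 x)" by (intro continuous_intros phase_continuous(2)[OF ph])
   then have "\<exists>x\<ge>\<alpha>. x \<le> \<beta> \<and> real j * f1 x = of_int k"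
    using that ab by (intro IVT') (auto simp: ceiling_le_iff le_floor_iff)
   then have "\<exists>x. x \<in> {\<alpha>..\<beta>} \<and> real j * f1 x = of_int k" by auto
   then show ?thesis unfolding xs_def by (rule someI_ex)
  qed
  define \<rho> where "\<rho> = (\<lambda>(j::nat,k::int). int_dist (real j * f (xs j k) - of_int k * xs j k))"
  define S where "S = Sigma {X..<2*X} KK"
  have finS: "finite S" unfolding S_def KK_def by auto
  have sumcap: "(\<Sum>p\<in>S. cap Q (\<rho> p)) \<le> 4 * real Q * (K * real X * (1 + ln (real X))) + 6 * (1 + ln (real Q)) * (K * real X powr (1+\<eta>) * real X * (1 + ln (real X)))"
  proof (rule sum_cap_le[OF finS])
   show "0 \<le> \<rho> p \<and> \<rho> p \<le> 1" for p
   proof -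
    have "int_dist y \<le> 1" for y using int_dist_le_half[of y] by linarith
    then show ?thesis unfolding \<rho>_def using int_dist_nonneg by (auto split: prod.split)
   qed
   show "1 \<le> Q" using Q by simp
   fix r :: real assume r: "r \<ge> 0"
   have "{p \<in> S. \<rho> p \<le> r} = {(j,k). j \<in> {X..<2*X} \<and> k \<in> {\<lceil>real j * f1 \<alpha>\<rceil>..\<lfloor>real j * f1 \<beta>\<rfloor>} \<and> int_dist (real j * f (xs j k) - of_int k * xs j k) \<le> r}"
    unfolding S_def \<rho>_def KK_def by auto
   then have "real (card {p \<in> S. \<rho> p \<le> r}) \<le> K * (1 + r * real X powr (1 + \<eta>)) * real X * (1 + ln (real X))"
    using K(2)[OF \<kappa> ab ph b2 X(1) r xs] by simp
   then show "real (card {p \<in> S. \<rho> p \<le> r}) \<le> K * real X * (1 + ln (real X)) + K * real X powr (1+\<eta>) * real X * (1 + ln (real X)) * r"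
    by (simp add: algebra_simps)
  qed (use K(1) X in auto)
  define R where "R = sqrt (real Q / (real X * \<kappa>))"
  have X0: "real X > 0" and Q0: "real Q > 0" using X Q by auto
  have R0: "R \<ge> 0" unfolding R_def using \<kappa> by simp
  have RX: "R * real X = sqrt (real Q / \<kappa>) * sqrt (real X)"
  proof -
   have "R = sqrt (real Q / \<kappa>) / sqrt (real X)" unfolding R_def by (simp add: real_sqrt_divide[symmetric] mult.commute)
   moreover have "real X = sqrt (real X) * sqrt (real X)" by simp
   ultimately show ?thesis using X0 by (metis nonzero_eq_divide_eq mult.assoc real_sqrt_eq_zero_cancel_iff less_irrefl)
  qed
  have "esum_block f {\<alpha>..\<beta>} Q X \<le>
    (\<Sum>j\<in>{X..<2*X}. C1 * (real Q * (1 + ln (real Q))) + 16 * real Q * R + 32 * \<Lambda>^3 * R * (\<Sum>k\<in>KK j. cap Q (\<rho> (j,k))))"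
  proof (rule sum_mono)
   fix j assume j: "j \<in> {X..<2*X}"
   have "norm (esum f {\<alpha>..\<beta>} Q (real j)) \<le> C1 * (real Q * (1 + ln (real Q)))
     + 16 * real Q * sqrt (real Q / (real j * \<kappa>)) + 32 * \<Lambda>^3 * sqrt (real Q / (real j * \<kappa>)) * (\<Sum>k\<in>KK j. cap Q (\<rho> (j,k)))"
    unfolding C1_def KK_def \<rho>_def prod.case
    using j X by (intro piece_bound_single[OF L B ab ph \<kappa>(1) b2 b1 Q _ _ xs]) auto
   also have "... \<le> C1 * (real Q * (1 + ln (real Q))) + 16 * real Q * R + 32 * \<Lambda>^3 * R * (\<Sum>k\<in>KK j. cap Q (\<rho> (j,k)))"
   proof -
    have "real Q / (real j * \<kappa>) \<le> real Q / (real X * \<kappa>)" using j X0 \<kappa> by (intro frac_le mult_right_mono) auto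
    then have "sqrt (real Q / (real j * \<kappa>)) \<le> R" unfolding R_def by simp
    then show ?thesis using L by (intro add_mono mult_left_mono mult_right_mono order_refl sum_nonneg cap_nonneg) auto
   qed
   finally show "norm (esum f {\<alpha>..\<beta>} Q (real j)) \<le> C1 * (real Q * (1 + ln (real Q))) + 16 * real Q * R + 32 * \<Lambda>^3 * R * (\<Sum>k\<in>KK j. cap Q (\<rho> (j,k)))" .
  qed
  also have "... = real X * (C1 * (real Q * (1 + ln (real Q)))) + real X * (16 * real Q * R) + 32 * \<Lambda>^3 * R * (\<Sum>p\<in>S. cap Q (\<rho> p))"
  proof -
   have "(\<Sum>p\<in>S. cap Q (\<rho> p)) = (\<Sum>j\<in>{X..<2*X}. \<Sum>k\<in>KK j. cap Q (\<rho> (j,k)))"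
    unfolding S_def KK_def by (subst sum.Sigma) auto
   then show ?thesis by (simp add: sum.distrib sum_distrib_left distrib_left)
  qed
  also have "... \<le> real X * (C1 * (real Q * (1 + ln (real Q)))) + real X * (16 * real Q * R)
    + 32 * \<Lambda>^3 * R * (4 * real Q * (K * real X * (1 + ln (real X))) + 6 * (1 + ln (real Q)) * (K * real X powr (1+\<eta>) * real X * (1 + ln (real X))))"
   using sumcap L R0 by (intro add_left_mono mult_left_mono) auto
  also have "... \<le> C1 * (real X * real Q * (1 + ln (real Q))) + 16 * (R * real X * real Q)
    + C2 * (R * real X * real Q * (1 + ln (real X)) * (1 + real X powr (1+\<eta>) * (1 + ln (real Q)) / real Q))"
  proof -
   have "32 * \<Lambda>^3 * R * (4 * real Q * (K * real X * (1 + ln (real X))) + 6 * (1 + ln (real Q)) * (K * real X powr (1+\<eta>) * real X * (1 + ln (real X))))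
    = (32 * \<Lambda>^3 * R * K * real X * (1 + ln (real X)) * real Q) * (4 + 6 * (real X powr (1+\<eta>) * (1 + ln (real Q)) / real Q))"
    using Q0 by (simp add: field_simps)
   also have "... \<le> (32 * \<Lambda>^3 * R * K * real X * (1 + ln (real X)) * real Q) * (6 + 6 * (real X powr (1+\<eta>) * (1 + ln (real Q)) / real Q))"
    using L R0 K(1) X by (intro mult_left_mono) auto
   also have "... = C2 * (R * real X * real Q * (1 + ln (real X)) * (1 + real X powr (1+\<eta>) * (1 + ln (real Q)) / real Q))"
   proof -
    have "(32 * a * b * c * d * e * g) * (6 + 6 * t) = (192 * a * c) * (b * d * g * e * (1 + t))" for a b c d e g t :: real
     by algebra
    then show ?thesis unfolding C2_def .
   qed
   finally show ?thesis by (simp add: mult_ac)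
  qed
  also have "... = C1 * (real X * real Q * (1 + ln (real Q))) + 16 * (real Q * sqrt (real Q / \<kappa>) * sqrt (real X))
    + C2 * (real Q * sqrt (real Q / \<kappa>) * sqrt (real X) * (1 + ln (real X)) * (1 + real X powr (1+\<eta>) * (1 + ln (real Q)) / real Q))"
   unfolding RX by (simp add: mult_ac)
  also have "... \<le> (C1 + 16 + C2) * piece_error \<eta> \<kappa> Q X"
  proof -
   define u where "u = real X * real Q * (1 + ln (real Q))"
   define v where "v = real Q * sqrt (real Q / \<kappa>) * sqrt (real X)"
   define z where "z = (1 + ln (real X)) * (1 + real X powr (1+\<eta>) * (1 + ln (real Q)) / real Q)"
   have u: "u \<ge> 0" and v: "v \<ge> 0" unfolding u_def v_def using Q0 X \<kappa> Q by auto
   have "1 * 1 \<le> z" unfolding z_def using X Q by (intro mult_mono) auto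
   then have "v * 1 \<le> v * z" using v by (intro mult_left_mono) auto
   then have vz: "v \<le> v * z" by simp
   have "0 \<le> C2 * u" "0 \<le> C1 * (v * z)" using C u v vz by (auto intro!: mult_nonneg_nonneg order_trans[OF v vz])
   moreover have "(C1 + 16 + C2) * (u + v * z) = C1 * u + 16 * u + C2 * u + C1 * (v * z) + 16 * (v * z) + C2 * (v * z)"
    by (simp only: distrib_left distrib_right)
   ultimately have "C1 * u + 16 * v + C2 * (v * z) \<le> (C1 + 16 + C2) * (u + v * z)" using u vz by linarith
   then show ?thesis unfolding u_def v_def z_def by (simp add: mult.assoc)
  qed
  finally show "esum_block f {\<alpha>..\<beta>} Q X \<le>
    (C1 + 16 + C2) * piece_error \<eta> \<kappa> Q X" .
 qed
qed

section \<open>Smoothing of the counting indicator\<close>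

lemma fejer_minus: "fejer m (- x) = fejer m x"
proof -
 have "(\<Sum>k<m. circ (real k * - x)) = cnj (\<Sum>k<m. circ (real k * x))" by (simp add: cnj_circ)
 then show ?thesis unfolding fejer_def by (simp only: complex_mod_cnj)
qed

text \<open>The geometric sum is a quotient: since |m y| \<le> 1/2 its numerator is at least 4 |m
  y|, and its denominator is at most 8 |y|.\<close>

lemma fejer_ge:
 assumes m: "m \<ge> 1" and y: "\<bar>y\<bar> \<le> 1 / (2 * real m)"
 shows "fejer m y \<ge> real m / 4"
proof -
 define s where "s = (\<Sum>k<m. circ (real k * y))"
 have ns: "norm s \<ge> real m / 2"
 proof (cases "y = 0")
  case True
  then have "s = of_nat m" unfolding s_def by simp
  then show ?thesis by simp
 next
  case False
  have "{..<m} = {0..m-1}" using m by auto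
  then have "s = (\<Sum>k=0..m-1. circ y ^ k)" unfolding s_def by (simp add: circ_power)
  then have "(1 - circ y) * s = circ y ^ 0 - circ y ^ Suc (m - 1)" by (simp only: sum_gp_multiplied[OF le0])
  then have "(1 - circ y) * s = 1 - circ (real m * y)" using m by (simp only: circ_power) simp
  then have e: "norm (1 - circ y) * norm s = norm (1 - circ (real m * y))" by (metis norm_mult)
  have my: "\<bar>real m * y\<bar> \<le> 1/2" using y m by (simp add: abs_mult field_simps)
  have "4 * \<bar>real m * y\<bar> \<le> norm (1 - circ (real m * y))"
   using norm_one_minus_circ[of "real m * y"] int_dist_eq_abs[OF my] by simp
  moreover have "norm (1 - circ y) \<le> 8 * \<bar>y\<bar>"
  proof -
   have "norm (circ 0 - circ y) \<le> 2 * pi * \<bar>0 - y\<bar>" by (rule norm_circ_diff)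
   also have "... \<le> 8 * \<bar>y\<bar>" using pi_less_4 by (simp add: mult_right_mono)
   finally show ?thesis by simp
  qed
  then have "norm (1 - circ y) * norm s \<le> 8 * \<bar>y\<bar> * norm s" by (intro mult_right_mono) auto
  ultimately have "4 * \<bar>real m * y\<bar> \<le> 8 * \<bar>y\<bar> * norm s" using e by linarith
  then have "\<bar>y\<bar> * (4 * real m) \<le> \<bar>y\<bar> * (8 * norm s)" by (simp add: abs_mult mult_ac)
  then have "4 * real m \<le> 8 * norm s" using False by simp
  then show ?thesis by simp
 qed
 have "(real m / 2)^2 \<le> (norm s)^2" using ns by (intro power_mono) auto
 then have "(real m / 2)^2 / real m \<le> fejer m y" unfolding fejer_def s_def by (intro divide_right_mono) auto
 then show ?thesis using m by (simp add: power2_eq_square)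
qed

lemma fejer_tail:
 assumes m: "m \<ge> 1" and y: "0 < y" "y \<le> 1/2"
 shows "integral {y..1-y} (fejer m) \<le> 1 / (2 * real m * y)"
proof -
 have c: "4 * real m > 0" using m by simp
 have "integral {y..1/2} (fejer m) \<le> - (1 / (4 * real m)) / (1/2) - (- (1 / (4 * real m)) / y)"
 proof (rule integral_le_antiderivative[where F = "\<lambda>u. - (1 / (4 * real m)) / u" and F' = "\<lambda>u. (1 / (4 * real m)) / u^2"])
  fix u assume u: "u \<in> {y..1/2}"
  then show "((\<lambda>u. - (1 / (4 * real m)) / u) has_real_derivative (1 / (4 * real m)) / u^2) (at u within {y..1/2})"
   using y c by (auto intro!: derivative_eq_intros simp: power2_eq_square)
  have "int_dist u = u" using int_dist_eq_abs[of u] u y by auto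
  then show "fejer m u \<le> (1 / (4 * real m)) / u^2" using fejer_le_int_dist[OF m, of u] u y by simp
 qed (use y in \<open>auto intro: fejer_integrable\<close>)
 moreover have "integral {1/2..1-y} (fejer m) \<le> (1 / (4 * real m)) / (1 - (1 - y)) - (1 / (4 * real m)) / (1 - 1/2)"
 proof (rule integral_le_antiderivative[where F = "\<lambda>u. (1 / (4 * real m)) / (1 - u)" and F' = "\<lambda>u. (1 / (4 * real m)) / (1 - u)^2"])
  fix u assume u: "u \<in> {1/2..1-y}"
  then show "((\<lambda>u. (1 / (4 * real m)) / (1 - u)) has_real_derivative (1 / (4 * real m)) / (1 - u)^2) (at u within {1/2..1-y})"
   using y c by (auto intro!: derivative_eq_intros simp: power2_eq_square)
  have "int_dist (u - 1) = \<bar>u - 1\<bar>" using u y by (intro int_dist_eq_abs) auto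
  then have "int_dist u = 1 - u" using int_dist_add_int[of "u - 1" 1] u y by auto
  then show "fejer m u \<le> (1 / (4 * real m)) / (1 - u)^2" using fejer_le_int_dist[OF m, of u] u y by simp
 qed (use y in \<open>auto intro: fejer_integrable\<close>)
 moreover have "integral {y..1-y} (fejer m) = integral {y..1/2} (fejer m) + integral {1/2..1-y} (fejer m)"
  using y by (intro Henstock_Kurzweil_Integration.integral_combine[symmetric] fejer_integrable) auto
 moreover have "- (1 / (4 * real m)) / (1/2) - (- (1 / (4 * real m)) / y) + ((1 / (4 * real m)) / (1 - (1 - y)) - (1 / (4 * real m)) / (1 - 1/2)) \<le> 1 / (2 * real m * y)"
  using y c by (simp add: field_simps)
 ultimately show ?thesis by linarith
qed

text \<open>The smoothing error decays like 1/(2^n |y|) away from an endpoint. Fejer kernels of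
  dyadic orders majorise it, because the one of order 2^i is at least 2^i/4 for |y| \<le> 1/(2 2^i),
  and the largest such i has the right size. A majorant made of Fejer kernels leads back to the same
  exponential sums.\<close>

lemma min_inverse_dist_le_fejer:
 assumes y: "\<bar>y\<bar> \<le> 1/2" and t: "0 \<le> t" "t \<le> 1" "y \<noteq> 0 \<Longrightarrow> t \<le> 1 / (2 * 2^n * \<bar>y\<bar>)"
 shows "t \<le> 8 / 2^n * (\<Sum>i\<le>n. fejer (2^i) y)"
proof -
 define P where "P i \<longleftrightarrow> \<bar>y\<bar> \<le> 1 / (2 * 2^i)" for i :: nat
 define i where "i = Max {i. i \<le> n \<and> P i}"
 have fin: "finite {i. i \<le> n \<and> P i}" by simp
 have "0 \<in> {i. i \<le> n \<and> P i}" using y unfolding P_def by simp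
 then have "i \<in> {i. i \<le> n \<and> P i}" unfolding i_def using Max_in[OF fin] by blast
 then have i: "i \<le> n" "P i" by auto
 have mx: "k \<le> i" if "k \<le> n" "P k" for k unfolding i_def using Max_ge[OF fin] that by blast
 have f: "fejer (2^i) y \<ge> 2^i / 4" using fejer_ge[of "2^i" y] i(2) unfolding P_def by simp
 have "t \<le> 8 / 2^n * (2^i / 4)"
 proof (cases "i = n")
  case True
  then show ?thesis using t by simp
 next
  case False
  then have "\<not> P (Suc i)" using mx[of "Suc i"] i(1) by auto
  then have y2: "1 / (4 * 2^i) < \<bar>y\<bar>" unfolding P_def by simp
  then have "y \<noteq> 0" by auto
  then have "t \<le> 1 / (2 * 2^n * \<bar>y\<bar>)" by (rule t(3))
  also have "... \<le> 1 / (2 * 2^n * (1 / (4 * 2^i)))" using y2 by (intro frac_le mult_left_mono) auto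
  also have "... = 8 / 2^n * (2^i / 4)" by simp
  finally show ?thesis .
 qed
 also have "... \<le> 8 / 2^n * fejer (2^i) y" using f by (intro mult_left_mono) auto
 also have "... \<le> 8 / 2^n * (\<Sum>i\<le>n. fejer (2^i) y)"
  using i(1) by (intro mult_left_mono member_le_sum) (auto simp: fejer_nonneg)
 finally show ?thesis .
qed

text \<open>For 0 \<le> x \<le> 1/2 the error is the mass of the kernel on the wrong side of the
  endpoint \<delta>, and this mass is contained in a tail of the kind bounded by
  \<open>fejer_tail\<close>.\<close>

lemma indicator_minus_fejer_aux:
 assumes \<delta>: "0 < \<delta>" "\<delta> < 1/2" and x: "0 \<le> x" "x \<le> 1/2"
 shows "\<bar>(if int_dist x < \<delta> then 1 else 0) - integral {x-\<delta>..x+\<delta>} (fejer (2^n))\<bar> \<le> 8 / 2^n * (\<Sum>i\<le>n. fejer (2^i) (x - \<delta>))"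
proof (rule min_inverse_dist_le_fejer)
 let ?m = "2^n :: nat"
 let ?h = "integral {x-\<delta>..x+\<delta>} (fejer ?m)"
 have m: "?m \<ge> 1" by simp
 have d: "int_dist x = x" using int_dist_eq_abs[of x] x by auto
 have h0: "?h \<ge> 0" by (intro integral_nonneg fejer_integrable fejer_nonneg)
 have h1: "?h \<le> 1" using fejer_integral_le[OF m, of "x - \<delta>" "x + \<delta>" 1] \<delta> by simp
 show "\<bar>(if int_dist x < \<delta> then 1 else 0) - ?h\<bar> \<le> 1" using h0 h1 by auto
 show "\<bar>x - \<delta>\<bar> \<le> 1/2" using \<delta> x by linarith
 assume ne: "x - \<delta> \<noteq> 0"
 show "\<bar>(if int_dist x < \<delta> then 1 else 0) - ?h\<bar> \<le> 1 / (2 * 2^n * \<bar>x - \<delta>\<bar>)"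
 proof (cases "x < \<delta>")
  case True
  have "integral {x-\<delta>..x-\<delta> + 1} (fejer ?m) = 1" using fejer_has_integral[OF m] by (rule integral_unique)
  moreover have "integral {x-\<delta>..x-\<delta> + 1} (fejer ?m) = ?h + integral {x+\<delta>..x-\<delta> + 1} (fejer ?m)"
   using \<delta> by (intro Henstock_Kurzweil_Integration.integral_combine[symmetric] fejer_integrable) auto
  moreover have "integral {x+\<delta>..x-\<delta> + 1} (fejer ?m) \<le> integral {\<delta>-x..1-(\<delta>-x)} (fejer ?m)"
   using x \<delta> by (intro integral_subset_le fejer_integrable) (auto simp: fejer_nonneg)
  moreover have "integral {\<delta>-x..1-(\<delta>-x)} (fejer ?m) \<le> 1 / (2 * real ?m * (\<delta>-x))"
   using True \<delta> x by (intro fejer_tail[OF m]) auto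
  ultimately show ?thesis using True d h1 by simp
 next
  case False
  then have "x > \<delta>" using ne by simp
  have "?h \<le> integral {x-\<delta>..1-(x-\<delta>)} (fejer ?m)"
   using x \<delta> by (intro integral_subset_le fejer_integrable) (auto simp: fejer_nonneg)
  also have "... \<le> 1 / (2 * real ?m * (x-\<delta>))"
   using \<open>x > \<delta>\<close> \<delta> x by (intro fejer_tail[OF m]) auto
  finally show ?thesis using False d h0 \<open>x > \<delta>\<close> by simp
 qed
qed simp

lemma fejer_integral_shift: "integral {x + of_int k - \<delta>..x + of_int k + \<delta>} (fejer m) = integral {x-\<delta>..x+\<delta>} (fejer m)"
proof -
 have "integral {x-\<delta>..x+\<delta>} (\<lambda>u. fejer m (u + of_int k)) = integral {x - \<delta> + of_int k..x + \<delta> + of_int k} (fejer m)"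
 proof -
  have "continuous_on {x - \<delta> + of_int k..x + \<delta> + of_int k} (fejer m)"
   by (intro continuous_intros)
  from integral_shift[OF this] show ?thesis by (simp add: o_def)
 qed
 then show ?thesis by (simp add: fejer_add_int algebra_simps)
qed

lemma indicator_minus_fejer:
 assumes \<delta>: "0 < \<delta>" "\<delta> < 1/2"
 shows "\<bar>(if int_dist x < \<delta> then 1 else 0) - integral {x-\<delta>..x+\<delta>} (fejer (2^n))\<bar>
  \<le> 8 / 2^n * (\<Sum>i\<le>n. fejer (2^i) (x - \<delta>) + fejer (2^i) (x + \<delta>))"
proof -
 define k where "k = round x"
 define v where "v = x - of_int k"
 have xv: "x = v + of_int k" unfolding v_def by simp
 have v: "\<bar>v\<bar> \<le> 1/2" using of_int_round_abs_le[of x] unfolding v_def k_def by (simp add: abs_minus_commute)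
 have shift: "int_dist x = int_dist v" "integral {x-\<delta>..x+\<delta>} (fejer (2^n)) = integral {v-\<delta>..v+\<delta>} (fejer (2^n))"
  "\<And>m. fejer m (x - \<delta>) = fejer m (v - \<delta>)" "\<And>m. fejer m (x + \<delta>) = fejer m (v + \<delta>)"
  unfolding xv using int_dist_add_int[of v k] fejer_integral_shift[of v k] fejer_add_int[of _ "v - \<delta>" k] fejer_add_int[of _ "v + \<delta>" k]
  by (simp_all add: algebra_simps)
 have nn: "0 \<le> 8 / 2^n * (\<Sum>i\<le>n. fejer (2^i) (v - \<delta>))" "0 \<le> 8 / 2^n * (\<Sum>i\<le>n. fejer (2^i) (v + \<delta>))"
  by (intro mult_nonneg_nonneg sum_nonneg fejer_nonneg; simp)+
 show ?thesis
 proof (cases "v \<ge> 0")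
  case True
  have "\<bar>(if int_dist v < \<delta> then 1 else 0) - integral {v-\<delta>..v+\<delta>} (fejer (2^n))\<bar> \<le> 8 / 2^n * (\<Sum>i\<le>n. fejer (2^i) (v - \<delta>))"
   using True v by (intro indicator_minus_fejer_aux \<delta>) auto
  then show ?thesis unfolding shift using nn by (simp add: sum.distrib distrib_left)
 next
  case False
  have "\<bar>(if int_dist (-v) < \<delta> then 1 else 0) - integral {-v-\<delta>..-v+\<delta>} (fejer (2^n))\<bar> \<le> 8 / 2^n * (\<Sum>i\<le>n. fejer (2^i) (-v - \<delta>))"
   using False v by (intro indicator_minus_fejer_aux \<delta>) auto
  moreover have "integral {-v-\<delta>..-v+\<delta>} (fejer (2^n)) = integral {v-\<delta>..v+\<delta>} (fejer (2^n))"
   using Henstock_Kurzweil_Integration.integral_reflect_real[of "v + \<delta>" "v - \<delta>" "fejer (2^n)"] by (simp add: fejer_minus)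
  moreover have "fejer m (-v - \<delta>) = fejer m (v + \<delta>)" for m using fejer_minus[of m "v + \<delta>"] by simp
  ultimately show ?thesis unfolding shift using nn by (simp add: int_dist_minus sum.distrib distrib_left)
 qed
qed

lemma circ_has_integral_window:
 fixes j :: int
 assumes "\<delta> \<ge> 0"
 shows "((\<lambda>u. circ (of_int j * u)) has_integral circ (of_int j * x) * of_real (if j = 0 then 2 * \<delta> else sin (2 * pi * of_int j * \<delta>) / (pi * of_int j))) {x-\<delta>..x+\<delta>}"
proof (cases "j = 0")
 case True
 then show ?thesis using has_integral_const_real[of "1::complex" "x-\<delta>" "x+\<delta>"] assms by (simp add: scaleR_conv_of_real)
next
 case False
 define c where "c = 2 * pi * of_int j * \<i>"
 have c: "c \<noteq> 0" unfolding c_def using False by simp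
 have "((\<lambda>u. circ (of_int j * u)) has_integral (circ (of_int j * (x+\<delta>)) / c - circ (of_int j * (x-\<delta>)) / c)) {x-\<delta>..x+\<delta>}"
 proof (rule fundamental_theorem_of_calculus)
  fix u
  have "((\<lambda>u. circ (of_int j * u)) has_vector_derivative (2 * pi * of_int j * \<i>) * circ (of_int j * u)) (at u within {x-\<delta>..x+\<delta>})"
   using circ_has_vector_derivative[of "of_int j" u] by simp
  from has_vector_derivative_divide[OF this, of c] show "((\<lambda>u. circ (of_int j * u) / c) has_vector_derivative circ (of_int j * u)) (at u within {x-\<delta>..x+\<delta>})"
   using c unfolding c_def by simp
 qed (use assms in simp)
 moreover have "circ (of_int j * (x+\<delta>)) / c - circ (of_int j * (x-\<delta>)) / c = circ (of_int j * x) * of_real (sin (2 * pi * of_int j * \<delta>) / (pi * of_int j))"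
 proof -
  define w where "w = of_int j * \<delta>"
  have "circ (of_int j * (x+\<delta>)) - circ (of_int j * (x-\<delta>)) = circ (of_int j * x) * (circ w - circ (- w))"
   using circ_add[of "of_int j * x" w] circ_add[of "of_int j * x" "- w"] unfolding w_def by (simp add: algebra_simps)
  also have "circ w - circ (- w) = 2 * \<i> * of_real (sin (2 * pi * w))" unfolding circ_def by (simp add: complex_eq_iff)
  finally have "(circ (of_int j * (x+\<delta>)) - circ (of_int j * (x-\<delta>))) / c = circ (of_int j * x) * (2 * \<i> * of_real (sin (2 * pi * w))) / c" by simp
  also have "... = circ (of_int j * x) * of_real (sin (2 * pi * w) / (pi * of_int j))" unfolding c_def using False by (simp add: field_simps)
  finally show ?thesis unfolding w_def by (simp add: diff_divide_distrib mult_ac)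
 qed
 ultimately show ?thesis using False by simp
qed

lemma sum_symmetric_int:
 fixes F :: "int \<Rightarrow> real"
 assumes "m \<ge> (1::nat)" "\<And>i. F (- i) = F i"
 shows "(\<Sum>i\<in>{-int m<..<int m}. F i) = F 0 + 2 * (\<Sum>j\<in>{1..<m}. F (int j))"
proof -
 have s1: "(\<Sum>i\<in>{0<..<int m}. F i) = (\<Sum>j\<in>{1..<m}. F (int j))"
  by (rule sum.reindex_bij_witness[where i = int and j = nat]) auto
 have s2: "(\<Sum>i\<in>{-int m<..<0}. F i) = (\<Sum>i\<in>{0<..<int m}. F i)"
  by (rule sum.reindex_bij_witness[where i = uminus and j = uminus]) (auto simp: assms(2))
 have "{-int m<..<int m} = {-int m<..<0} \<union> {0} \<union> {0<..<int m}" using assms(1) by auto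
 then have "(\<Sum>i\<in>{-int m<..<int m}. F i) = (\<Sum>i\<in>{-int m<..<0} \<union> {0}. F i) + (\<Sum>i\<in>{0<..<int m}. F i)"
  by (simp only:) (rule sum.union_disjoint; auto)
 also have "(\<Sum>i\<in>{-int m<..<0} \<union> {0}. F i) = (\<Sum>i\<in>{-int m<..<0}. F i) + F 0"
  by (subst sum.union_disjoint) auto
 finally show ?thesis using s1 s2 by simp
qed

lemma norm_double_sum_le:
 fixes c :: "int \<Rightarrow> complex"
 assumes m: "m \<ge> (1::nat)" and F: "\<And>i. norm (c i) \<le> F i" "\<And>i. F (- i) = F i"
 shows "norm ((\<Sum>k<m. \<Sum>l<m. c (int k - int l)) / of_nat m) \<le> F 0 + 2 * (\<Sum>j\<in>{1..<m}. F (int j))"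
proof -
 have F0: "F i \<ge> 0" for i using F(1)[of i] norm_ge_zero order_trans by blast
 have "norm ((\<Sum>k<m. \<Sum>l<m. c (int k - int l)) / of_nat m) \<le> (\<Sum>k<m. \<Sum>l<m. F (int k - int l)) / real m"
  unfolding norm_divide norm_of_nat by (intro divide_right_mono sum_norm_le F) auto
 also have "... \<le> (real m * (\<Sum>i\<in>{-int m<..<int m}. F i)) / real m"
  by (intro divide_right_mono sum_diff_regroup_le F0) auto
 also have "... = F 0 + 2 * (\<Sum>j\<in>{1..<m}. F (int j))" using m sum_symmetric_int[of m F] F(2) by simp
 finally show ?thesis .
qed

text \<open>An inequality of Erdos-Turan type. The smoothed window has Fourier coefficients of size
  at most min(2\<delta>, 1/j), and its zero frequency gives the main term. The smoothing error
  consists of Fejer kernels centred at the two endpoints of the window; these translations only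
  multiply the sums E by numbers of modulus 1.\<close>

lemma smoothing:
 fixes y :: "'a \<Rightarrow> real" and E :: "real \<Rightarrow> complex"
 assumes fin: "finite S" and \<delta>: "0 < \<delta>" "\<delta> < 1/2" and E: "\<And>j. E j = (\<Sum>p\<in>S. circ (j * y p))"
 shows "\<bar>real (card {p\<in>S. int_dist (y p) < \<delta>}) - 2 * \<delta> * real (card S)\<bar> \<le>
  2 * (\<Sum>j\<in>{1..<2^n}. min (2 * \<delta>) (1 / real j) * norm (E (real j))) +
  16 / 2^n * (\<Sum>i\<le>n. real (card S) + 2 * (\<Sum>j\<in>{1..<2^i}. norm (E (real j))))"
proof -
 have E0: "E 0 = of_nat (card S)" unfolding E by simp
 have Em: "norm (E (- j)) = norm (E j)" for j
 proof -
  have "E (- j) = cnj (E j)" unfolding E by (simp add: cnj_circ)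
  then show ?thesis by simp
 qed
 have fe: "(\<Sum>p\<in>S. fejer m (y p + s)) \<le> real (card S) + 2 * (\<Sum>j\<in>{1..<m}. norm (E (real j)))" if m: "m \<ge> 1" for m s
 proof -
  have "complex_of_real (\<Sum>p\<in>S. fejer m (y p + s)) = (\<Sum>p\<in>S. \<Sum>k<m. \<Sum>l<m. circ ((real k - real l) * (y p + s))) / of_nat m"
   by (simp only: of_real_sum fejer_expand sum_divide_distrib)
  also have "(\<Sum>p\<in>S. \<Sum>k<m. \<Sum>l<m. circ ((real k - real l) * (y p + s))) = (\<Sum>k<m. \<Sum>p\<in>S. \<Sum>l<m. circ ((real k - real l) * (y p + s)))"
   by (rule sum.swap)
  also have "... = (\<Sum>k<m. \<Sum>l<m. \<Sum>p\<in>S. circ ((real k - real l) * (y p + s)))"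
   by (rule sum.cong[OF refl], rule sum.swap)
  also have "... = (\<Sum>k<m. \<Sum>l<m. circ (of_int (int k - int l) * s) * E (of_int (int k - int l)))"
   unfolding E by (simp add: sum_distrib_left circ_add[symmetric] algebra_simps)
  finally have e: "complex_of_real (\<Sum>p\<in>S. fejer m (y p + s)) = (\<Sum>k<m. \<Sum>l<m. circ (of_int (int k - int l) * s) * E (of_int (int k - int l))) / of_nat m" .
  have "(\<Sum>p\<in>S. fejer m (y p + s)) = norm (complex_of_real (\<Sum>p\<in>S. fejer m (y p + s)))"
  proof -
   have "0 \<le> (\<Sum>p\<in>S. fejer m (y p + s))" by (intro sum_nonneg fejer_nonneg)
   then show ?thesis unfolding norm_of_real by simp
  qed
  also have "... \<le> norm (E (of_int 0)) + 2 * (\<Sum>j\<in>{1..<m}. norm (E (of_int (int j))))"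
   unfolding e by (rule norm_double_sum_le[OF m, where c = "\<lambda>i. circ (of_int i * s) * E (of_int i)" and F = "\<lambda>i. norm (E (of_int i))"])
    (simp_all add: norm_mult Em)
  finally show ?thesis by (simp add: E0)
 qed
 define h where "h x = integral {x-\<delta>..x+\<delta>} (fejer (2^n))" for x
 have J: "(2::nat)^n \<ge> 1" by simp
 define c where "c j = (if j = 0 then 2 * \<delta> else sin (2 * pi * of_int j * \<delta>) / (pi * of_int j))" for j :: int
 have hx: "complex_of_real (h x) = (\<Sum>k<2^n. \<Sum>l<2^n. circ (of_int (int k - int l) * x) * of_real (c (int k - int l))) / of_nat (2^n)" for x
 proof -
  have "((\<lambda>u. complex_of_real (fejer (2^n) u)) has_integral complex_of_real (h x)) {x-\<delta>..x+\<delta>}"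
   unfolding h_def by (intro has_integral_of_real integrable_integral fejer_integrable)
  moreover have "((\<lambda>u. complex_of_real (fejer (2^n) u)) has_integral
    (\<Sum>k<2^n. \<Sum>l<2^n. circ (of_int (int k - int l) * x) * of_real (c (int k - int l))) / of_nat (2^n)) {x-\<delta>..x+\<delta>}"
  proof -
   have "((\<lambda>u. (\<Sum>k<2^n. \<Sum>l<2^n. circ (of_int (int k - int l) * u)) / of_nat (2^n)) has_integral
    (\<Sum>k<2^n. \<Sum>l<2^n. circ (of_int (int k - int l) * x) * of_real (c (int k - int l))) / of_nat (2^n)) {x-\<delta>..x+\<delta>}"
    unfolding c_def using \<delta> by (intro has_integral_divide has_integral_sum finite_lessThan circ_has_integral_window) auto
   then show ?thesis unfolding fejer_expand by simp
  qed
  ultimately show ?thesis by (rule has_integral_unique)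
 qed
 have hs: "\<bar>(\<Sum>p\<in>S. h (y p)) - 2 * \<delta> * real (card S)\<bar> \<le> 2 * (\<Sum>j\<in>{1..<2^n}. min (2 * \<delta>) (1 / real j) * norm (E (real j)))"
 proof -
  define d where "d i = (if i = 0 then 0 else of_real (c i) * E (of_int i))" for i :: int
  define F where "F i = (if i = 0 then 0 else min (2 * \<delta>) (1 / \<bar>of_int i\<bar>) * norm (E (of_int i)))" for i :: int
  have "complex_of_real (\<Sum>p\<in>S. h (y p)) = (\<Sum>p\<in>S. \<Sum>k<2^n. \<Sum>l<2^n. circ (of_int (int k - int l) * y p) * of_real (c (int k - int l))) / of_nat (2^n)"
   by (simp only: of_real_sum hx sum_divide_distrib)
  also have "(\<Sum>p\<in>S. \<Sum>k<2^n. \<Sum>l<2^n. circ (of_int (int k - int l) * y p) * of_real (c (int k - int l)))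
    = (\<Sum>k<2^n. \<Sum>p\<in>S. \<Sum>l<2^n. circ (of_int (int k - int l) * y p) * of_real (c (int k - int l)))"
   by (rule sum.swap)
  also have "... = (\<Sum>k<2^n. \<Sum>l<2^n. \<Sum>p\<in>S. circ (of_int (int k - int l) * y p) * of_real (c (int k - int l)))"
   by (rule sum.cong[OF refl], rule sum.swap)
  also have "... = (\<Sum>k<2^n. \<Sum>l<2^n. of_real (c (int k - int l)) * E (of_int (int k - int l)))"
   unfolding E by (simp only: sum_distrib_left mult.commute)
  finally have e1: "complex_of_real (\<Sum>p\<in>S. h (y p)) = (\<Sum>k<2^n. \<Sum>l<2^n. of_real (c (int k - int l)) * E (of_int (int k - int l))) / of_nat (2^n)" .
  have e2: "complex_of_real (2 * \<delta> * real (card S)) = (\<Sum>k<(2::nat)^n. \<Sum>l<(2::nat)^n. if k = l then complex_of_real (2 * \<delta> * real (card S)) else 0) / of_nat (2^n)"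
   by (simp add: sum.delta)
  have e3: "of_real (c (int k - int l)) * E (of_int (int k - int l)) - (if k = l then complex_of_real (2 * \<delta> * real (card S)) else 0) = d (int k - int l)" for k l :: nat
   unfolding d_def by (auto simp: c_def E0)
  have e4: "complex_of_real ((\<Sum>p\<in>S. h (y p)) - 2 * \<delta> * real (card S)) = (\<Sum>k<2^n. \<Sum>l<2^n. d (int k - int l)) / of_nat (2^n)"
  proof -
   have "complex_of_real ((\<Sum>p\<in>S. h (y p)) - 2 * \<delta> * real (card S)) =
    (\<Sum>k<2^n. \<Sum>l<2^n. of_real (c (int k - int l)) * E (of_int (int k - int l))) / of_nat (2^n)
    - (\<Sum>k<(2::nat)^n. \<Sum>l<(2::nat)^n. if k = l then complex_of_real (2 * \<delta> * real (card S)) else 0) / of_nat (2^n)"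
    by (simp only: of_real_diff e1 e2[symmetric])
   also have "... = (\<Sum>k<2^n. \<Sum>l<2^n. d (int k - int l)) / of_nat (2^n)"
    by (simp only: e3[symmetric] sum_subtractf diff_divide_distrib)
   finally show ?thesis .
  qed
  have "\<bar>(\<Sum>p\<in>S. h (y p)) - 2 * \<delta> * real (card S)\<bar> = norm (complex_of_real ((\<Sum>p\<in>S. h (y p)) - 2 * \<delta> * real (card S)))"
   by (rule norm_of_real[symmetric])
  also have "... \<le> F 0 + 2 * (\<Sum>j\<in>{1..<2^n}. F (int j))"
   unfolding e4
  proof (rule norm_double_sum_le[OF J])
   fix i :: int
   show "F (- i) = F i" unfolding F_def using Em[of "of_int i"] by simp
   have "\<bar>c i\<bar> \<le> min (2 * \<delta>) (1 / \<bar>of_int i\<bar>)" if "i \<noteq> 0"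
   proof -
    have i: "\<bar>of_int i :: real\<bar> > 0" using that by simp
    have ci: "\<bar>c i\<bar> = \<bar>sin (2 * pi * of_int i * \<delta>)\<bar> / (pi * \<bar>of_int i\<bar>)" unfolding c_def using that by (simp add: abs_mult)
    have "\<bar>c i\<bar> \<le> \<bar>2 * pi * of_int i * \<delta>\<bar> / (pi * \<bar>of_int i\<bar>)" unfolding ci by (intro divide_right_mono abs_sin_x_le_abs_x) auto
    also have "... = 2 * \<delta>" using i \<delta> by (simp add: abs_mult)
    finally have 1: "\<bar>c i\<bar> \<le> 2 * \<delta>" .
    have "\<bar>c i\<bar> \<le> 1 / (1 * \<bar>of_int i\<bar>)" unfolding ci using i pi_gt3 by (intro frac_le mult_right_mono) auto
    then show ?thesis using 1 by simp
   qed
   then show "norm (d i) \<le> F i" unfolding d_def F_def by (auto simp: norm_mult intro: mult_right_mono)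
  qed
  also have "F 0 = 0" by (simp add: F_def)
  also have "(\<Sum>j\<in>{1..<2^n}. F (int j)) = (\<Sum>j\<in>{1..<2^n}. min (2 * \<delta>) (1 / real j) * norm (E (real j)))"
   by (rule sum.cong) (auto simp: F_def)
  finally show ?thesis by simp
 qed
 define ind where "ind x = (if int_dist x < \<delta> then 1 else (0::real))" for x
 have card: "real (card {p\<in>S. int_dist (y p) < \<delta>}) = (\<Sum>p\<in>S. ind (y p))"
  unfolding ind_def using fin by (simp add: sum.If_cases Int_def)
 have "\<bar>(\<Sum>p\<in>S. ind (y p)) - (\<Sum>p\<in>S. h (y p))\<bar> \<le> (\<Sum>p\<in>S. \<bar>ind (y p) - h (y p)\<bar>)"
  unfolding sum_subtractf[symmetric] by (rule sum_abs)
 also have "... \<le> (\<Sum>p\<in>S. 8 / 2^n * (\<Sum>i\<le>n. fejer (2^i) (y p - \<delta>) + fejer (2^i) (y p + \<delta>)))"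
  unfolding ind_def h_def by (intro sum_mono indicator_minus_fejer \<delta>)
 also have "... = 8 / 2^n * (\<Sum>p\<in>S. \<Sum>i\<le>n. fejer (2^i) (y p - \<delta>) + fejer (2^i) (y p + \<delta>))"
  by (simp only: sum_distrib_left)
 also have "(\<Sum>p\<in>S. \<Sum>i\<le>n. fejer (2^i) (y p - \<delta>) + fejer (2^i) (y p + \<delta>)) = (\<Sum>i\<le>n. \<Sum>p\<in>S. fejer (2^i) (y p - \<delta>) + fejer (2^i) (y p + \<delta>))"
  by (rule sum.swap)
 also have "... \<le> (\<Sum>i\<le>n. 2 * (real (card S) + 2 * (\<Sum>j\<in>{1..<2^i}. norm (E (real j)))))"
 proof (rule sum_mono)
  fix i
  have "(1::nat) \<le> 2^i" by simp
  from fe[OF this, of "- \<delta>"] fe[OF this, of \<delta>]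
  show "(\<Sum>p\<in>S. fejer (2^i) (y p - \<delta>) + fejer (2^i) (y p + \<delta>)) \<le> 2 * (real (card S) + 2 * (\<Sum>j\<in>{1..<2^i}. norm (E (real j))))"
   by (simp add: sum.distrib)
 qed
 finally have "\<bar>(\<Sum>p\<in>S. ind (y p)) - (\<Sum>p\<in>S. h (y p))\<bar> \<le> 8 / 2^n * (\<Sum>i\<le>n. 2 * (real (card S) + 2 * (\<Sum>j\<in>{1..<2^i}. norm (E (real j)))))"
  by (simp add: divide_right_mono)
 also have "... = 16 / 2^n * (\<Sum>i\<le>n. real (card S) + 2 * (\<Sum>j\<in>{1..<2^i}. norm (E (real j))))"
  by (simp only: sum_distrib_left[symmetric])
 finally show ?thesis using hs unfolding card by linarith
qed

section \<open>Symmetries, subdivision and the core\<close>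

lemma esum_uminus: "norm (esum (\<lambda>x. - f x) I Q j) = norm (esum f I Q j)"
proof -
 have "esum (\<lambda>x. - f x) I Q j = cnj (esum f I Q j)" unfolding esum_def by (simp add: cnj_circ)
 then show ?thesis by simp
qed

lemma esum_reflect: "esum (\<lambda>x. f (- x)) {-\<beta>..-\<alpha>} Q j = esum f {\<alpha>..\<beta>} Q j"
 unfolding esum_def
proof (rule sum.cong[OF refl])
 fix q
 show "(\<Sum>a | of_int a / real q \<in> {-\<beta>..-\<alpha>}. circ (real q * (j * f (- (of_int a / real q))))) = (\<Sum>a | of_int a / real q \<in> {\<alpha>..\<beta>}. circ (real q * (j * f (of_int a / real q))))"
  by (rule sum.reindex_bij_witness[where i = uminus and j = uminus]) auto
qed

text \<open>Only fractions equal to the cutting point are counted twice, at most one for each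
  denominator.\<close>

lemma esum_split:
 assumes c: "\<alpha> \<le> c" "c \<le> \<beta>"
 shows "norm (esum f {\<alpha>..\<beta>} Q j) \<le> norm (esum f {\<alpha>..c} Q j) + norm (esum f {c..\<beta>} Q j) + real Q"
proof -
 define A where "A u v q = {a::int. of_int a / real q \<in> {u..v}}" for u v q
 define t where "t q a = circ (real q * (j * f (of_int a / real q)))" for q and a :: int
 have "norm (esum f {\<alpha>..\<beta>} Q j - esum f {\<alpha>..c} Q j - esum f {c..\<beta>} Q j) = norm (\<Sum>q=1..Q. - (\<Sum>a\<in>A c c q. t q a))"
 proof -
  have "(\<Sum>a\<in>A \<alpha> \<beta> q. t q a) - (\<Sum>a\<in>A \<alpha> c q. t q a) - (\<Sum>a\<in>A c \<beta> q. t q a) = - (\<Sum>a\<in>A c c q. t q a)" if "q \<in> {1..Q}" for q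
  proof -
   have fin: "finite (A u v q)" for u v unfolding A_def using int_quotient_in_interval[of q u v] that by simp
   have e: "A \<alpha> \<beta> q = A \<alpha> c q \<union> A c \<beta> q" "A c c q = A \<alpha> c q \<inter> A c \<beta> q" unfolding A_def using c by auto
   show ?thesis unfolding e using sum.union_inter[OF fin fin, of "t q" \<alpha> c c \<beta>] by (simp add: algebra_simps)
  qed
  then show ?thesis unfolding esum_def A_def[symmetric] t_def[symmetric] sum_subtractf[symmetric]
   by (intro arg_cong[where f = norm] sum.cong) auto
 qed
 also have "... \<le> (\<Sum>q=1..Q. 1)"
 proof (rule sum_norm_le)
  fix q assume q: "q \<in> {1..Q}"
  have "A c c q \<subseteq> {\<lfloor>c * real q\<rfloor>}" unfolding A_def using q by (auto simp: field_simps) (metis floor_of_int)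
  then have "card (A c c q) \<le> card {\<lfloor>c * real q\<rfloor>}" by (intro card_mono) auto
  moreover have "norm (\<Sum>a\<in>A c c q. t q a) \<le> real (card (A c c q)) * 1"
   by (intro sum_norm_bound) (simp add: t_def norm_circ)
  ultimately show "norm (- (\<Sum>a\<in>A c c q. t q a)) \<le> 1" by simp
 qed
 finally have "norm (esum f {\<alpha>..\<beta>} Q j - esum f {\<alpha>..c} Q j - esum f {c..\<beta>} Q j) \<le> real Q" by simp
 moreover have "norm (esum f {\<alpha>..\<beta>} Q j) \<le> norm (esum f {\<alpha>..\<beta>} Q j - esum f {\<alpha>..c} Q j - esum f {c..\<beta>} Q j) + norm (esum f {\<alpha>..c} Q j + esum f {c..\<beta>} Q j)"
  using norm_triangle_ineq[of "esum f {\<alpha>..\<beta>} Q j - esum f {\<alpha>..c} Q j - esum f {c..\<beta>} Q j" "esum f {\<alpha>..c} Q j + esum f {c..\<beta>} Q j"]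
  by (simp add: algebra_simps)
 moreover have "norm (esum f {\<alpha>..c} Q j + esum f {c..\<beta>} Q j) \<le> norm (esum f {\<alpha>..c} Q j) + norm (esum f {c..\<beta>} Q j)"
  by (rule norm_triangle_ineq)
 ultimately show ?thesis by linarith
qed

text \<open>The slopes j f1 stay below 1/2 in modulus, so only frequency 0 can be nearly stationary;
  all others are at distance at least |i|/2 and sum to O(Q log Q). For frequency 0 the kernel is
  bounded trivially up to \<gamma> and by the first derivative test beyond.\<close>

lemma core_bound:
 assumes ab: "\<alpha> \<le> \<gamma>" "\<gamma> \<le> \<beta>" "\<beta> \<le> \<alpha> + 1" and ph: "phase \<alpha> \<beta> f f1 f2"
  and b2: "\<And>x. x \<in> {\<alpha>..\<beta>} \<Longrightarrow> 0 \<le> f2 x" and b1: "\<And>x. x \<in> {\<alpha>..\<beta>} \<Longrightarrow> real j * \<bar>f1 x\<bar> \<le> 1/2"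
  and \<nu>: "\<nu> > 0" "\<And>x. x \<in> {\<gamma>..\<beta>} \<Longrightarrow> \<gamma> < \<beta> \<Longrightarrow> \<nu> \<le> real j * \<bar>f1 x\<bar>"
  and Q: "Q \<ge> 2" and j: "1 \<le> j" "j \<le> 2 * Q"
 shows "norm (esum f {\<alpha>..\<beta>} Q (real j)) \<le> real Q ^ 2 * (\<gamma> - \<alpha>) + real Q / \<nu> + 53 * (real Q * (1 + ln (real Q)))"
proof -
 define m where "m = Q^4"
 have m: "m \<ge> 1" unfolding m_def using Q by simp
 have Q0: "real Q \<ge> 2" using Q by simp
 have ab': "\<alpha> \<le> \<beta>" using ab by simp
 have b1': "\<bar>f1 x\<bar> \<le> 1/2" if "x \<in> {\<alpha>..\<beta>}" for x
 proof -
  have "1 * \<bar>f1 x\<bar> \<le> real j * \<bar>f1 x\<bar>" using j by (intro mult_right_mono) auto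
  then show ?thesis using b1[OF that] by linarith
 qed
 define g where "g i = norm (integral {\<alpha>..\<beta>} (\<lambda>x. gker Q (real j * f x + of_int i * x)))" for i :: int
 have ps: "norm (esum f {\<alpha>..\<beta>} Q (real j)) \<le> (\<Sum>i\<in>{-int m<..<int m}. g i) + real Q * (5 + 64 * (1/2))"
  unfolding m_def g_def by (rule esum_poisson[OF _ ab' ab(3) ph b1' Q j]) simp_all
 have phi: "phase \<alpha> \<beta> (\<lambda>x. real j * f x + of_int i * x) (\<lambda>x. real j * f1 x + of_int i) (\<lambda>x. real j * f2 x)" for i :: int
  using ph unfolding phase_def by (auto intro!: derivative_eq_intros continuous_intros)
 have gi: "g i \<le> 2 * real Q / \<bar>of_int i\<bar>" if "i \<noteq> 0" for i
 proof -
  have i1: "\<bar>of_int i :: real\<bar> \<ge> 1" using that by linarith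
  have "g i \<le> real Q / (\<bar>of_int i\<bar> / 2)" unfolding g_def
  proof (rule gker_first_derivative_test[OF phi ab', where \<sigma> = 1])
   fix x assume x: "x \<in> {\<alpha>..\<beta>}"
   have "\<bar>real j * f1 x\<bar> \<le> 1/2" using b1[OF x] by (simp add: abs_mult)
   then show "\<bar>of_int i\<bar> / 2 \<le> \<bar>real j * f1 x + of_int i\<bar>" using i1 by linarith
   show "0 \<le> 1 * (real j * f2 x)" using b2[OF x] by simp
  qed (use i1 in auto)
  then show ?thesis by (simp add: mult.commute)
 qed
 define G where "G i = (if i = 0 then g 0 else 2 * real Q / \<bar>of_int i\<bar>)" for i :: int
 have "(\<Sum>i\<in>{-int m<..<int m}. g i) \<le> (\<Sum>i\<in>{-int m<..<int m}. G i)"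
  unfolding G_def by (intro sum_mono) (use gi in auto)
 also have "... = G 0 + 2 * (\<Sum>i\<in>{1..<m}. G (int i))" by (rule sum_symmetric_int[OF m]) (simp add: G_def)
 also have "(\<Sum>i\<in>{1..<m}. G (int i)) = 2 * real Q * (\<Sum>i\<in>{1..<m}. 1 / real i)"
  unfolding sum_distrib_left G_def by (intro sum.cong) auto
 also have "(\<Sum>i\<in>{1..<m}. 1 / real i) \<le> harm m"
  unfolding harm_def inverse_eq_divide by (intro sum_mono2) auto
 finally have s: "(\<Sum>i\<in>{-int m<..<int m}. g i) \<le> g 0 + 4 * real Q * harm m" using Q0 by (simp add: G_def mult_left_mono)
 have "harm m \<le> ln (real m) + 1" using harm_upper_bound[of m] m by simp
 also have "ln (real m) = 4 * ln (real Q)" unfolding m_def using Q0 by (simp add: ln_realpow)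
 finally have h: "4 * real Q * harm m \<le> 4 * real Q * (4 * ln (real Q) + 1)" using Q0 by (intro mult_left_mono) auto
 have lQ: "ln (real Q) \<ge> 0" using Q0 by simp
 have "real Q * ln (real Q) \<ge> 0" using lQ by simp
 then have tot: "4 * real Q * harm m + real Q * (5 + 64 * (1/2)) \<le> 53 * (real Q * (1 + ln (real Q)))"
 proof -
  define y where "y = real Q * ln (real Q)"
  have "4 * real Q * (4 * ln (real Q) + 1) = 16 * y + 4 * real Q" "53 * (real Q * (1 + ln (real Q))) = 53 * real Q + 53 * y" "real Q * (5 + 64 * (1 / 2)) = 37 * real Q" "y \<ge> 0"
   unfolding y_def using lQ by (auto simp: algebra_simps)
  then show ?thesis using h Q0 by linarith
 qed
 have g0: "g 0 \<le> real Q ^ 2 * (\<gamma> - \<alpha>) + real Q / \<nu>"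
 proof -
  have cont: "continuous_on {\<alpha>..\<beta>} (\<lambda>x. gker Q (real j * f x))"
   by (intro gker_continuous continuous_intros phase_continuous(1)[OF ph])
  have "integral {\<alpha>..\<beta>} (\<lambda>x. gker Q (real j * f x)) = integral {\<alpha>..\<gamma>} (\<lambda>x. gker Q (real j * f x)) + integral {\<gamma>..\<beta>} (\<lambda>x. gker Q (real j * f x))"
   using ab by (intro Henstock_Kurzweil_Integration.integral_combine[symmetric] integrable_continuous_interval cont) auto
  moreover have "norm (integral {\<alpha>..\<gamma>} (\<lambda>x. gker Q (real j * f x))) \<le> real Q ^ 2 * (\<gamma> - \<alpha>)"
   using ab by (intro integral_bound norm_gker_le continuous_on_subset[OF cont]) auto
  moreover have "norm (integral {\<gamma>..\<beta>} (\<lambda>x. gker Q (real j * f x))) \<le> real Q / \<nu>"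
  proof (cases "\<gamma> < \<beta>")
   case True
   have p: "phase \<gamma> \<beta> (\<lambda>x. real j * f x) (\<lambda>x. real j * f1 x) (\<lambda>x. real j * f2 x)"
    using phase_subset[OF phi[of 0] ab(1) order_refl] by simp
   show ?thesis
    by (rule gker_first_derivative_test[OF p ab(2) \<nu>(1), where \<sigma> = 1]) (use \<nu>(2)[OF _ True] b2 ab in \<open>auto simp: abs_mult\<close>)
  next
   case False
   then show ?thesis using ab \<nu>(1) by simp
  qed
  ultimately show ?thesis unfolding g_def
   using norm_triangle_ineq[of "integral {\<alpha>..\<gamma>} (\<lambda>x. gker Q (real j * f x))" "integral {\<gamma>..\<beta>} (\<lambda>x. gker Q (real j * f x))"] by simp
 qed
 show ?thesis using ps s tot g0 by linarith
qed

section \<open>One-sided model of the flat point\<close>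

definition power_phase :: "nat \<Rightarrow> real \<Rightarrow> real \<Rightarrow> real \<Rightarrow> (real \<Rightarrow> real) \<Rightarrow> (real \<Rightarrow> real) \<Rightarrow> (real \<Rightarrow> real) \<Rightarrow> bool" where
 "power_phase d c a e f f1 f2 \<longleftrightarrow> phase a (a + e) f f1 f2 \<and> f1 a = 0 \<and>
   (\<forall>x\<in>{a..a+e}. c * (x - a)^(d-2) \<le> f2 x \<and> f2 x \<le> 3 * c * (x - a)^(d-2))"

text \<open>The bounds for \<open>f2\<close> are integrated from the flat point, where
  \<open>f1\<close> vanishes.\<close>

lemma power_phase_derivative:
 assumes m: "power_phase d c a e f f1 f2" and d: "d \<ge> 2" and x: "x \<in> {a..a+e}" 
 shows "c / (real d - 1) * (x - a)^(d-1) \<le> f1 x" "f1 x \<le> 3 * c / (real d - 1) * (x - a)^(d-1)"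
proof -
 define n where "n = d - 2"
 have dn: "d - 1 = Suc n" "d - 2 = n" "real d - 1 = real n + 1" unfolding n_def using d by auto
 have ph: "phase a (a+e) f f1 f2" and f1a: "f1 a = 0" using m unfolding power_phase_def by auto
 have b: "c * (z - a)^n \<le> f2 z \<and> f2 z \<le> 3 * c * (z - a)^n" if "a \<le> z" "z \<le> x" for z
  using m that x unfolding power_phase_def dn by auto
 have D: "((\<lambda>z. f1 z - k / (real n + 1) * (z - a)^Suc n) has_real_derivative f2 z - k * (z - a)^n) (at z)" if "a \<le> z" "z \<le> x" for z k
 proof -
  have "((\<lambda>z. (z - a)^Suc n) has_real_derivative (real n + 1) * (z - a)^n) (at z)"
   by (rule derivative_eq_intros refl)+ simp
  then have D1: "((\<lambda>z. k / (real n + 1) * (z - a)^Suc n) has_real_derivative k / (real n + 1) * ((real n + 1) * (z - a)^n)) (at z)"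
   by (rule DERIV_cmult)
  have "(f1 has_real_derivative f2 z) (at z)" using phaseD(2)[OF ph, of z] that x by simp
  from DERIV_diff[OF this D1] show ?thesis by (simp add: add_nonneg_eq_0_iff)
 qed
 have "f1 a - c / (real n + 1) * (a - a)^Suc n \<le> f1 x - c / (real n + 1) * (x - a)^Suc n"
  by (rule DERIV_nonneg_imp_nondecreasing) (use x D[of _ c] b in force)+
 then show "c / (real d - 1) * (x - a)^(d-1) \<le> f1 x" unfolding dn f1a by simp
 have "f1 a - 3 * c / (real n + 1) * (a - a)^Suc n \<ge> f1 x - 3 * c / (real n + 1) * (x - a)^Suc n"
  by (rule DERIV_nonpos_imp_nonincreasing) (use x D[of _ "3 * c"] b in force)+
 then show "f1 x \<le> 3 * c / (real d - 1) * (x - a)^(d-1)" unfolding dn f1a by simp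
qed


text \<open>The radius s = (Q X)^(-1/d) balances the two parts of the core estimate, Q^2 s = Q/(X
  s^(d-1)). The condition on r keeps j times the slope at most 1/2 for all j < 2 Q.\<close>

lemma core_sum_bound:
 assumes m: "power_phase d c a e f f1 f2" and d: "d \<ge> 2" and c: "c > 0" and e: "e \<le> 1/2"
  and r: "r \<ge> 0" "real Q * (6 * c * r^(d-1)) \<le> 1/2"
  and ab: "a \<le> \<alpha>" "\<alpha> \<le> \<beta>" "\<beta> \<le> a + e" "\<beta> \<le> a + r" and Q: "Q \<ge> 2" and X: "1 \<le> X" "X \<le> Q"
 shows "esum_block f {\<alpha>..\<beta>} Q X \<le>
  (1 + (real d - 1) / c) * (real Q powr (2 - 1 / real d) * real X powr (1 - 1 / real d)) + 53 * (real X * (real Q * (1 + ln (real Q))))"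
proof -
 have ph: "phase a (a + e) f f1 f2" using m unfolding power_phase_def by auto
 have ph': "phase \<alpha> \<beta> f f1 f2" by (rule phase_subset[OF ph ab(1) ab(3)])
 have sub: "x \<in> {a..a+e}" if "x \<in> {\<alpha>..\<beta>}" for x using that ab by auto
 have d1: "real d - 1 \<ge> 1" using d by linarith
 have X0: "real X > 0" and Q0: "real Q > 0" "real Q \<ge> 2" using X Q by auto
 define s where "s = (real Q * real X) powr (- 1 / real d)"
 have s0: "s > 0" unfolding s_def using X0 Q0 by simp
 define \<nu> where "\<nu> = real X * (c / (real d - 1) * s^(d-1))"
 have \<nu>0: "\<nu> > 0" unfolding \<nu>_def using X0 c d1 s0 by simp
 define \<gamma> where "\<gamma> = max \<alpha> (min \<beta> (a + s))"
 have \<gamma>: "\<alpha> \<le> \<gamma>" "\<gamma> \<le> \<beta>" "\<gamma> - \<alpha> \<le> s" unfolding \<gamma>_def using ab s0 by auto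
 define M where "M = real Q powr (2 - 1 / real d) * real X powr (- 1 / real d)"
 have QXs: "s = real Q powr (- 1 / real d) * real X powr (- 1 / real d)" unfolding s_def using X0 Q0 by (simp add: powr_mult)
 have Q2s: "real Q ^ 2 * s = M"
 proof -
  have "real Q ^ 2 = real Q powr 2" using Q0 by (simp add: powr_numeral)
  then have "real Q ^ 2 * real Q powr (- 1 / real d) = real Q powr (2 - 1 / real d)"
   using powr_add[of "real Q" 2 "- 1 / real d"] by simp
  then show ?thesis unfolding QXs M_def by (simp only: mult.assoc[symmetric])
 qed
 have Q\<nu>: "real Q / \<nu> = (real d - 1) / c * M"
 proof -
  have sd: "s ^ (d-1) * s = inverse (real Q * real X)"
  proof -
   have "s ^ (d-1) * s = s ^ d" using d by (metis Suc_diff_1 less_le_trans pos2 power_Suc2)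
   also have "... = s powr (real d)" using s0 by (simp add: powr_realpow)
   also have "... = (real Q * real X) powr (-1)" unfolding s_def powr_powr using d by simp
   finally show ?thesis using X0 Q0 by (simp add: powr_minus)
  qed
  have "real Q / \<nu> = (real d - 1) / c * (real Q / (real X * s^(d-1)))" unfolding \<nu>_def using d1 c by (simp add: field_simps)
  also have "real Q / (real X * s^(d-1)) = real Q ^ 2 * s"
  proof -
   have "real Q ^ 2 * s * (real X * s^(d-1)) = real Q ^ 2 * real X * (s^(d-1) * s)" by (simp add: mult_ac)
   also have "... = real Q" unfolding sd using X0 Q0 by (simp add: power2_eq_square field_simps)
   finally show ?thesis using X0 s0 by (simp add: divide_eq_eq)
  qed
  finally show ?thesis unfolding Q2s .
 qed
 have "norm (esum f {\<alpha>..\<beta>} Q (real j)) \<le> (1 + (real d - 1) / c) * M + 53 * (real Q * (1 + ln (real Q)))" if j: "j \<in> {X..<2*X}" for j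
 proof -
  have f1: "0 \<le> f1 x" "f1 x \<le> 3 * c * r^(d-1)" if x: "x \<in> {\<alpha>..\<beta>}" for x
  proof -
   have xa: "0 \<le> x - a" "x - a \<le> r" using x ab by auto
   have "0 \<le> c / (real d - 1) * (x - a)^(d-1)" using c d1 xa by (intro mult_nonneg_nonneg) auto
   then show "0 \<le> f1 x" using power_phase_derivative(1)[OF m d sub[OF x]] by linarith
   have "3 * c / (real d - 1) * (x - a)^(d-1) \<le> (3 * c / 1) * r^(d-1)"
    using c d1 xa r by (intro mult_mono frac_le power_mono) auto
   then show "f1 x \<le> 3 * c * r^(d-1)" using power_phase_derivative(2)[OF m d sub[OF x]] by simp
  qed
  have "norm (esum f {\<alpha>..\<beta>} Q (real j)) \<le> real Q ^ 2 * (\<gamma> - \<alpha>) + real Q / \<nu> + 53 * (real Q * (1 + ln (real Q)))"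
  proof (rule core_bound[OF \<gamma>(1,2) _ ph' _ _ \<nu>0 _ Q])
   show "\<beta> \<le> \<alpha> + 1" using ab e by simp
   show "1 \<le> j" "j \<le> 2 * Q" using j X by auto
   fix x assume x: "x \<in> {\<alpha>..\<beta>}"
   have "0 \<le> c * (x - a)^(d-2)" using c x ab by (intro mult_nonneg_nonneg) auto
   moreover have "c * (x - a)^(d-2) \<le> f2 x" using m sub[OF x] unfolding power_phase_def by blast
   ultimately show "0 \<le> f2 x" by linarith
   have "real j * \<bar>f1 x\<bar> \<le> (2 * real Q) * (3 * c * r^(d-1))"
    using f1[OF x] j X by (intro mult_mono) auto
   then show "real j * \<bar>f1 x\<bar> \<le> 1/2" using r(2) by (simp add: mult_ac)
  next
   fix x assume x: "x \<in> {\<gamma>..\<beta>}" and lt: "\<gamma> < \<beta>"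
   have xi: "x \<in> {\<alpha>..\<beta>}" using x \<gamma> by auto
   have "a + s \<le> x" using x lt unfolding \<gamma>_def by (auto simp: min_def max_def split: if_splits)
   then have "s ^ (d-1) \<le> (x - a)^(d-1)" using s0 by (intro power_mono) auto
   then have "c / (real d - 1) * s^(d-1) \<le> c / (real d - 1) * (x - a)^(d-1)" using c d1 by (intro mult_left_mono) auto
   also have "... \<le> \<bar>f1 x\<bar>" using power_phase_derivative(1)[OF m d sub[OF xi]] by linarith
   finally show "\<nu> \<le> real j * \<bar>f1 x\<bar>" unfolding \<nu>_def using j c d1 s0 by (intro mult_mono) auto
  qed
  moreover have "real Q ^ 2 * (\<gamma> - \<alpha>) \<le> M" using \<gamma>(3) unfolding Q2s[symmetric] by (intro mult_left_mono) auto
  ultimately show ?thesis unfolding Q\<nu> by (simp add: algebra_simps)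
 qed
 then have "esum_block f {\<alpha>..\<beta>} Q X \<le> (\<Sum>j\<in>{X..<2*X}. (1 + (real d - 1) / c) * M + 53 * (real Q * (1 + ln (real Q))))"
  by (rule sum_mono)
 also have "... = (1 + (real d - 1) / c) * (real X * M) + 53 * (real X * (real Q * (1 + ln (real Q))))" by (simp add: algebra_simps)
 also have "real X * M = real Q powr (2 - 1 / real d) * real X powr (1 - 1 / real d)"
 proof -
  have "real X * real X powr (- 1 / real d) = real X powr (1 - 1 / real d)"
   using powr_add[of "real X" 1 "- 1 / real d"] X0 by simp
  then show ?thesis unfolding M_def by (simp add: mult.left_commute)
 qed
 finally show ?thesis .
qed

text \<open>Z is subadditive up to W under cutting, and the outermost dyadic ring is peeled off at
  each step. The interval is arbitrary, so it may miss the core or some rings; the case distinction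
  allows for this.\<close>

lemma sum_dyadic_le:
 fixes Z :: "real \<Rightarrow> real \<Rightarrow> real"
 assumes r: "r > 0" and M: "M0 \<ge> 0" "\<And>i. G i \<ge> 0" "W \<ge> 0"
  and split: "\<And>\<alpha> \<beta> c. \<alpha> \<le> c \<Longrightarrow> c \<le> \<beta> \<Longrightarrow> Z \<alpha> \<beta> \<le> Z \<alpha> c + Z c \<beta> + W"
  and core: "\<And>\<alpha> \<beta>. a \<le> \<alpha> \<Longrightarrow> \<alpha> \<le> \<beta> \<Longrightarrow> \<beta> \<le> a + e \<Longrightarrow> \<beta> \<le> a + r \<Longrightarrow> Z \<alpha> \<beta> \<le> M0"
  and piece: "\<And>i \<alpha> \<beta>. a + r * 2^i \<le> \<alpha> \<Longrightarrow> \<alpha> \<le> \<beta> \<Longrightarrow> \<beta> \<le> a + e \<Longrightarrow> \<beta> \<le> a + r * 2^Suc i \<Longrightarrow> Z \<alpha> \<beta> \<le> G i"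
  and ab: "a \<le> \<alpha>" "\<alpha> \<le> \<beta>" "\<beta> \<le> a + e" "\<beta> \<le> a + r * 2^t"
 shows "Z \<alpha> \<beta> \<le> M0 + (\<Sum>i<t. G i + W)"
 using ab
proof (induction t arbitrary: \<alpha> \<beta>)
 case 0
 then show ?case using core by simp
next
 case (Suc t)
 have S: "(\<Sum>i<t. G i + W) \<ge> 0" using M by (intro sum_nonneg) auto
 define c where "c = a + r * 2^t"
 have G: "G t \<ge> 0" by (rule M)
 consider "\<beta> \<le> c" | "c \<le> \<alpha>" | "\<alpha> \<le> c" "c \<le> \<beta>" by linarith
 then show ?case
 proof cases
  case 1
  then show ?thesis using Suc.IH[of \<alpha> \<beta>] Suc.prems G M(3) unfolding c_def by simp
 next
  case 2
  then show ?thesis using piece[of t \<alpha> \<beta>] Suc.prems S M(1,3) unfolding c_def by simp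
 next
  case 3
  have "Z \<alpha> c \<le> M0 + (\<Sum>i<t. G i + W)" using Suc.IH[of \<alpha> c] Suc.prems 3 unfolding c_def by simp
  moreover have "Z c \<beta> \<le> G t" using piece[of t c \<beta>] Suc.prems 3 unfolding c_def by simp
  ultimately show ?thesis using split[OF 3] by simp
 qed
qed


text \<open>In order: the contribution without stationary points together with the losses from
  cutting, the stationary phase of the piece next to the core, and the core itself.\<close>

definition dyadic_bound :: "nat \<Rightarrow> real \<Rightarrow> nat \<Rightarrow> nat \<Rightarrow> real" where
 "dyadic_bound d \<eta> Q X = real X * real Q * (1 + ln (real Q))^2
   + real Q powr (2 - 1 / (2 * (real d - 1))) * (sqrt (real X) * (1 + ln (real X)) * (1 + real X powr (1+\<eta>) * (1 + ln (real Q)) / real Q))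
   + real Q powr (2 - 1 / real d) * real X powr (1 - 1 / real d)"

abbreviation dyadic_estimate :: "nat \<Rightarrow> (real \<Rightarrow> real) \<Rightarrow> real \<Rightarrow> real \<Rightarrow> real \<Rightarrow> bool" where
 "dyadic_estimate d f a e \<eta> \<equiv> \<exists>C\<ge>0. \<forall>\<alpha> \<beta> Q X. a - e \<le> \<alpha> \<longrightarrow> \<alpha> \<le> \<beta> \<longrightarrow> \<beta> \<le> a + e \<longrightarrow> Q \<ge> 2 \<longrightarrow> 1 \<le> X \<longrightarrow> X \<le> Q \<longrightarrow>
   esum_block f {\<alpha>..\<beta>} Q X \<le> C * dyadic_bound d \<eta> Q X"

text \<open>For d = 2 the second derivative has constant order up to the centre, so a single piece
  suffices; dyadic rings would all contribute equally and lose a logarithm.\<close>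

lemma one_sided_bound_2:
 assumes c: "c > 0" and e: "0 < e" "e \<le> 1/2" and \<eta>: "0 < \<eta>" "\<eta> \<le> 1"
 obtains C where "C \<ge> 0" "\<And>a f f1 f2 \<alpha> \<beta> Q X. power_phase 2 c a e f f1 f2 \<Longrightarrow> a \<le> \<alpha> \<Longrightarrow> \<alpha> \<le> \<beta> \<Longrightarrow> \<beta> \<le> a + e \<Longrightarrow> Q \<ge> 2 \<Longrightarrow> 1 \<le> X \<Longrightarrow> X \<le> Q \<Longrightarrow>
   esum_block f {\<alpha>..\<beta>} Q X \<le> C * dyadic_bound 2 \<eta> Q X"
proof -
 define \<kappa> where "\<kappa> = min 1 c"
 define \<Lambda> where "\<Lambda> = 3 * c / \<kappa>"
 have \<kappa>: "0 < \<kappa>" "\<kappa> \<le> 1" "\<kappa> \<le> c" unfolding \<kappa>_def using c by auto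
 have L: "\<Lambda> \<ge> 1" "\<Lambda> * \<kappa> = 3 * c" unfolding \<Lambda>_def using \<kappa> c by (auto simp: field_simps)
 have B: "3 * c \<ge> 0" using c by simp
 obtain C where C: "C \<ge> 0" "\<And>\<kappa> \<alpha> \<beta> f f1 f2 Q X. 0 < \<kappa> \<Longrightarrow> \<kappa> \<le> 1 \<Longrightarrow> \<alpha> \<le> \<beta> \<Longrightarrow> \<beta> \<le> \<alpha> + 1 \<Longrightarrow> phase \<alpha> \<beta> f f1 f2 \<Longrightarrow>
   (\<And>x. x \<in> {\<alpha>..\<beta>} \<Longrightarrow> \<kappa> \<le> f2 x \<and> f2 x \<le> \<Lambda> * \<kappa>) \<Longrightarrow> (\<And>x. x \<in> {\<alpha>..\<beta>} \<Longrightarrow> \<bar>f1 x\<bar> \<le> 3 * c) \<Longrightarrow> Q \<ge> 2 \<Longrightarrow> 1 \<le> X \<Longrightarrow> X \<le> Q \<Longrightarrow>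
   esum_block f {\<alpha>..\<beta>} Q X \<le>
    C * piece_error \<eta> \<kappa> Q X"
  using piece_bound[OF L(1) B \<eta>] by blast
 show ?thesis
 proof (rule that[of "C * (1 / sqrt \<kappa>)"])
  show "C * (1 / sqrt \<kappa>) \<ge> 0" using C(1) \<kappa> by simp
  fix a f f1 f2 \<alpha> \<beta> and Q X :: nat
  assume m: "power_phase 2 c a e f f1 f2" and ab: "a \<le> \<alpha>" "\<alpha> \<le> \<beta>" "\<beta> \<le> a + e" and Q: "Q \<ge> 2" and X: "1 \<le> X" "X \<le> Q"
  have ph: "phase \<alpha> \<beta> f f1 f2" using m phase_subset[OF _ ab(1) ab(3)] unfolding power_phase_def by blast
  have b2: "\<kappa> \<le> f2 x \<and> f2 x \<le> \<Lambda> * \<kappa>" if "x \<in> {\<alpha>..\<beta>}" for x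
  proof -
   have "c \<le> f2 x \<and> f2 x \<le> 3 * c" using m that ab unfolding power_phase_def by auto
   then show ?thesis using \<kappa> L(2) by simp
  qed
  have b1: "\<bar>f1 x\<bar> \<le> 3 * c" if "x \<in> {\<alpha>..\<beta>}" for x
  proof -
   have x: "x \<in> {a..a+e}" using that ab by auto
   have "c * (x - a) \<ge> 0" "3 * c * (x - a) \<le> 3 * c * 1" using c x e by (auto intro!: mult_left_mono)
   then show ?thesis using power_phase_derivative[OF m _ x] by simp
  qed
  define \<Phi> where "\<Phi> = sqrt (real X) * (1 + ln (real X)) * (1 + real X powr (1+\<eta>) * (1 + ln (real Q)) / real Q)"
  have l: "ln (real Q) \<ge> 0" "ln (real X) \<ge> 0" using Q X by auto
  have Phi0: "\<Phi> \<ge> 0" unfolding \<Phi>_def using l by auto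
  have "esum_block f {\<alpha>..\<beta>} Q X \<le> C * piece_error \<eta> \<kappa> Q X"
   by (rule C(2)[OF \<kappa>(1,2) ab(2) _ ph b2 b1 Q X]) (use ab e in auto)
  also have "... = C * (real X * real Q * (1 + ln (real Q)) + real Q * sqrt (real Q / \<kappa>) * \<Phi>)" unfolding \<Phi>_def by (simp only: mult.assoc)
  also have "... \<le> C * (1 / sqrt \<kappa> * dyadic_bound 2 \<eta> Q X)"
  proof (intro mult_left_mono C(1))
   have "1 / sqrt \<kappa> \<ge> 1" using \<kappa> by simp
   moreover have "real X * real Q * (1 + ln (real Q)) * 1 \<le> real X * real Q * (1 + ln (real Q)) * (1 + ln (real Q))"
    using l by (intro mult_left_mono) auto
   ultimately have "1 * (real X * real Q * (1 + ln (real Q))) \<le> 1 / sqrt \<kappa> * (real X * real Q * (1 + ln (real Q))^2)"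
    using l \<kappa> by (intro mult_mono) (auto simp: power2_eq_square)
   moreover have "real Q * sqrt (real Q / \<kappa>) = 1 / sqrt \<kappa> * real Q powr (2 - 1 / (2 * (real 2 - 1)))"
   proof -
    have "real Q * real Q powr (1/2) = real Q powr (3/2)" using powr_add[of "real Q" 1 "1/2"] Q by simp
    then show ?thesis using Q by (simp add: real_sqrt_divide powr_half_sqrt)
   qed
   moreover have "0 \<le> 1 / sqrt \<kappa> * (real Q powr (2 - 1 / real 2) * real X powr (1 - 1 / real 2))" using \<kappa> by simp
   moreover have "dyadic_bound 2 \<eta> Q X = real X * real Q * (1 + ln (real Q))^2 + real Q powr (2 - 1 / (2 * (real 2 - 1))) * \<Phi>
     + real Q powr (2 - 1 / real 2) * real X powr (1 - 1 / real 2)" unfolding dyadic_bound_def \<Phi>_def ..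
   ultimately show "real X * real Q * (1 + ln (real Q)) + real Q * sqrt (real Q / \<kappa>) * \<Phi> \<le> 1 / sqrt \<kappa> * dyadic_bound 2 \<eta> Q X"
    by (simp add: distrib_left mult.assoc)
  qed
  finally show "esum_block f {\<alpha>..\<beta>} Q X \<le> C * (1 / sqrt \<kappa>) * dyadic_bound 2 \<eta> Q X" by (simp only: mult.assoc)
 qed
qed


text \<open>The ring at distance r 2^i has curvature of order (r 2^i)^(d-2), and Q sqrt(Q/\<kappa>
  i) decreases geometrically in i because d \<ge> 3. The first ring, with r of order Q^(-1/(d-1)),
  gives the exponent 3/2 + (d-2)/(2(d-1)) = 2 - 1/(2(d-1)).\<close>

lemma one_sided_bound_3:
 assumes d: "d \<ge> 3" and c: "c > 0" and e: "0 < e" "e \<le> 1/2" and \<eta>: "0 < \<eta>" "\<eta> \<le> 1"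
 obtains C where "C \<ge> 0" "\<And>a f f1 f2 \<alpha> \<beta> Q X. power_phase d c a e f f1 f2 \<Longrightarrow> a \<le> \<alpha> \<Longrightarrow> \<alpha> \<le> \<beta> \<Longrightarrow> \<beta> \<le> a + e \<Longrightarrow> Q \<ge> 2 \<Longrightarrow> 1 \<le> X \<Longrightarrow> X \<le> Q \<Longrightarrow>
   esum_block f {\<alpha>..\<beta>} Q X \<le> C * dyadic_bound d \<eta> Q X"
proof -
 define c0 where "c0 = min 1 c"
 define \<Lambda> where "\<Lambda> = 3 * c * 2^(d-2) / c0"
 \<comment> \<open>Small enough that 6 c c1 \<le> 1/2, the slope condition of the core; since c1
   \<le> 1, the power c1^(d-1) is at most c1.\<close>
 define c1 where "c1 = min 1 (1 / (12 * c))"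
 have c0: "0 < c0" "c0 \<le> 1" "c0 \<le> c" unfolding c0_def using c by auto
 have c1: "0 < c1" "c1 \<le> 1" "12 * c * c1 \<le> 1" unfolding c1_def using c by (auto simp: min_def field_simps)
 have two: "(1::real) \<le> 2^(d-2)" by simp
 have L: "\<Lambda> \<ge> 1" "\<Lambda> * c0 = 3 * c * 2^(d-2)"
 proof -
  have "3 * c * 1 \<le> 3 * c * 2^(d-2)" using two c by (intro mult_left_mono) auto
  then have "1 * c0 \<le> 3 * c * 2^(d-2)" using c0 c by linarith
  then show "\<Lambda> \<ge> 1" unfolding \<Lambda>_def using c0 by (simp add: field_simps)
  show "\<Lambda> * c0 = 3 * c * 2^(d-2)" unfolding \<Lambda>_def using c0 by simp
 qed
 have d1: "real d - 1 \<ge> 2" using d by linarith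
 have B: "3 * c \<ge> 0" using c by simp
 obtain C where C: "C \<ge> 0" "\<And>\<kappa> \<alpha> \<beta> f f1 f2 Q X. 0 < \<kappa> \<Longrightarrow> \<kappa> \<le> 1 \<Longrightarrow> \<alpha> \<le> \<beta> \<Longrightarrow> \<beta> \<le> \<alpha> + 1 \<Longrightarrow> phase \<alpha> \<beta> f f1 f2 \<Longrightarrow>
   (\<And>x. x \<in> {\<alpha>..\<beta>} \<Longrightarrow> \<kappa> \<le> f2 x \<and> f2 x \<le> \<Lambda> * \<kappa>) \<Longrightarrow> (\<And>x. x \<in> {\<alpha>..\<beta>} \<Longrightarrow> \<bar>f1 x\<bar> \<le> 3 * c) \<Longrightarrow> Q \<ge> 2 \<Longrightarrow> 1 \<le> X \<Longrightarrow> X \<le> Q \<Longrightarrow>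
   esum_block f {\<alpha>..\<beta>} Q X \<le>
    C * piece_error \<eta> \<kappa> Q X"
  using piece_bound[OF L(1) B \<eta>] by blast
 define kT where "kT = 3 + 2 * ln (1 / c1)"
 define kV where "kV = 4 / sqrt (c0 * c1^(d-2))"
 define k3 where "k3 = 1 + (real d - 1) / c"
 have lc1: "ln (1 / c1) \<ge> 0" using c1 by simp
 have k: "kT \<ge> 0" "kV \<ge> 0" "k3 \<ge> 0" unfolding kT_def kV_def k3_def using lc1 c0 c1 c d1 by auto
 show ?thesis
 proof (rule that[of "(53 + kT * (C + 1)) + C * kV + k3"])
  show "(53 + kT * (C + 1)) + C * kV + k3 \<ge> 0" using C(1) k by simp
  fix a f f1 f2 \<alpha> \<beta> and Q X :: nat
  assume m: "power_phase d c a e f f1 f2" and ab: "a \<le> \<alpha>" "\<alpha> \<le> \<beta>" "\<beta> \<le> a + e" and Q: "Q \<ge> 2" and X: "1 \<le> X" "X \<le> Q"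
  have Q0: "real Q > 0" "real Q \<ge> 2" and X0: "real X > 0" using Q X by auto
  have l: "ln (real Q) \<ge> 0" "ln (real X) \<ge> 0" using Q X by auto
  define \<Phi> where "\<Phi> = sqrt (real X) * (1 + ln (real X)) * (1 + real X powr (1+\<eta>) * (1 + ln (real Q)) / real Q)"
  have Phi0: "\<Phi> \<ge> 0" unfolding \<Phi>_def using l by auto
  define r where "r = c1 * real Q powr (- 1 / (real d - 1))"
  have r0: "r > 0" unfolding r_def using c1 Q0 by simp
  define Z where "Z u v = esum_block f {u..v} Q X" for u v
  define M0 where "M0 = k3 * (real Q powr (2 - 1 / real d) * real X powr (1 - 1 / real d)) + 53 * (real X * (real Q * (1 + ln (real Q))))"
  define \<kappa> where "\<kappa> i = c0 * (r * 2^i)^(d-2)" for i :: nat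
  define G where "G i = C * (real X * real Q * (1 + ln (real Q)) + real Q * sqrt (real Q / \<kappa> i) * \<Phi>)" for i
  define W where "W = real X * real Q"
  \<comment> \<open>Enough doublings to carry r beyond 1, hence beyond e: r is at least
    c1/Q.\<close>
  define T where "T = nat \<lceil>log 2 (real Q / c1)\<rceil>"
  have \<kappa>0: "\<kappa> i > 0" for i unfolding \<kappa>_def using c0 r0 by simp
  have Qc: "real Q / c1 \<ge> 1" using c1 Q0 by (simp add: field_simps)
  have T1: "real Q / c1 \<le> 2^T"
  proof -
   have "log 2 (real Q / c1) \<le> real T" unfolding T_def by linarith
   then have "2 powr (log 2 (real Q / c1)) \<le> 2 powr (real T)" by (intro powr_mono) auto
   then show ?thesis using Qc by (simp add: powr_realpow)
  qed
  have rT: "1 \<le> r * 2^T"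
  proof -
   have "- 1 / (real d - 1) \<ge> -1" using d1 by (simp add: field_simps)
   then have "real Q powr (-1) \<le> real Q powr (- 1 / (real d - 1))" using Q0 by (intro powr_mono) auto
   then have "c1 * (1 / real Q) \<le> r" unfolding r_def using c1 Q0 by (intro mult_left_mono) (auto simp: powr_minus_divide)
   then have "(c1 * (1 / real Q)) * (real Q / c1) \<le> r * 2^T" using T1 r0 Qc by (intro mult_mono) auto
   then show ?thesis using c1 Q0 by simp
  qed
  have T2: "real T \<le> kT * (1 + ln (real Q))"
  proof -
   have ln2: "ln (2::real) \<ge> 1/2" using ln_le_minus_one[of "1/2"] by (simp add: ln_div)
   have "log 2 (real Q / c1) = ln (real Q / c1) / ln 2" by (simp add: log_def)
   also have "... \<le> ln (real Q / c1) / (1/2)" using ln2 Qc by (intro frac_le) auto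
   also have "ln (real Q / c1) = ln (real Q) + ln (1 / c1)" using Q0 c1 by (simp add: ln_div)
   finally have "log 2 (real Q / c1) \<le> 2 * ln (real Q) + 2 * ln (1 / c1)" by simp
   moreover have "real T \<le> log 2 (real Q / c1) + 1" unfolding T_def using Qc by simp
   moreover have "2 * ln (1 / c1) * ln (real Q) \<ge> 0" using lc1 l by simp
   moreover have "kT * (1 + ln (real Q)) = 3 + 3 * ln (real Q) + 2 * ln (1 / c1) + 2 * ln (1 / c1) * ln (real Q)" unfolding kT_def by algebra
   ultimately show ?thesis using l by linarith
  qed
  have "Z \<alpha> \<beta> \<le> M0 + (\<Sum>i<T. G i + W)"
  proof (rule sum_dyadic_le[where Z = Z and a = a and e = e and r = r])
   show "0 \<le> M0" unfolding M0_def using k l by simp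
   show "0 \<le> G i" for i unfolding G_def using C(1) l Phi0 \<kappa>0[of i] by simp
   show "0 \<le> W" unfolding W_def by simp
   show "\<beta> \<le> a + r * 2^T" using ab e rT by linarith
  next
   fix \<alpha> \<beta> z :: real assume "\<alpha> \<le> z" "z \<le> \<beta>"
   then have "Z \<alpha> \<beta> \<le> (\<Sum>j\<in>{X..<2*X}. norm (esum f {\<alpha>..z} Q (real j)) + norm (esum f {z..\<beta>} Q (real j)) + real Q)"
    unfolding Z_def by (intro sum_mono esum_split)
   then show "Z \<alpha> \<beta> \<le> Z \<alpha> z + Z z \<beta> + W" unfolding Z_def W_def by (simp add: sum.distrib)
  next
   fix \<alpha> \<beta> assume a: "a \<le> \<alpha>" "\<alpha> \<le> \<beta>" "\<beta> \<le> a + e" "\<beta> \<le> a + r"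
   show "Z \<alpha> \<beta> \<le> M0" unfolding Z_def M0_def k3_def
   proof (rule core_sum_bound[OF m _ c e(2) _ _ a Q X])
    have "r^(d-1) = c1^(d-1) * (real Q powr (- 1 / (real d - 1)))^(d-1)" unfolding r_def by (rule power_mult_distrib)
    also have "(real Q powr (- 1 / (real d - 1)))^(d-1) = 1 / real Q"
    proof -
     have "real (d-1) = real d - 1" using d by simp
     then have "(real Q powr (- 1 / (real d - 1)))^(d-1) = real Q powr (- 1 / (real d - 1) * (real d - 1))"
      using Q0 by (metis powr_powr powr_realpow powr_gt_zero less_numeral_extra(3))
     also have "- 1 / (real d - 1) * (real d - 1) = -1" using d1 by simp
     finally show ?thesis using Q0 by (simp add: powr_minus_divide)
    qed
    finally have "real Q * (6 * c * r^(d-1)) = 6 * c * c1^(d-1)" using Q0 by simp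
    also have "... \<le> 6 * c * c1" using c c1 d power_decreasing[of 1 "d-1" c1] by (intro mult_left_mono) auto
    finally show "real Q * (6 * c * r^(d-1)) \<le> 1/2" using c1 by simp
   qed (use d r0 in auto)
  next
   fix i \<alpha> \<beta> assume a: "a + r * 2^i \<le> \<alpha>" "\<alpha> \<le> \<beta>" "\<beta> \<le> a + e" "\<beta> \<le> a + r * 2^Suc i"
   have ri: "0 < r * 2^i" "r * 2^i \<le> 1" using a e r0 by (auto simp: zero_less_mult_iff)
   have a': "a \<le> \<alpha>" using a ri by linarith
   have ph: "phase \<alpha> \<beta> f f1 f2" using m phase_subset[OF _ a' a(3)] unfolding power_phase_def by blast
   have \<kappa>1: "\<kappa> i \<le> 1" unfolding \<kappa>_def
    by (rule mult_le_one[OF c0(2) _ power_le_one]) (use ri in \<open>auto simp del: zero_le_mult_iff\<close>)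
   have b2: "\<kappa> i \<le> f2 x \<and> f2 x \<le> \<Lambda> * \<kappa> i" if x: "x \<in> {\<alpha>..\<beta>}" for x
   proof -
    have "x \<in> {a..a+e}" using x a a' by auto
    then have 1: "c * (x - a)^(d-2) \<le> f2 x" "f2 x \<le> 3 * c * (x - a)^(d-2)" using m unfolding power_phase_def by auto
    have "\<kappa> i \<le> c * (x - a)^(d-2)" unfolding \<kappa>_def using c0 c ri x a by (intro mult_mono power_mono) auto
    moreover have "3 * c * (x - a)^(d-2) \<le> 3 * c * (2 * (r * 2^i))^(d-2)" using c ri x a a' by (intro mult_left_mono power_mono) auto
    moreover have "3 * c * (2 * (r * 2^i))^(d-2) = \<Lambda> * \<kappa> i" 
     unfolding \<kappa>_def mult.assoc[symmetric] L(2) by (simp add: power_mult_distrib mult_ac)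
    ultimately show ?thesis using 1 by linarith
   qed
   have b1: "\<bar>f1 x\<bar> \<le> 3 * c" if "x \<in> {\<alpha>..\<beta>}" for x
   proof -
    have x: "x \<in> {a..a+e}" and d2: "d \<ge> 2" using that a a' d by auto
    have xa: "0 \<le> x - a" "x - a \<le> 1" using x e by auto
    have "c / (real d - 1) * (x - a)^(d-1) \<ge> 0" using c d1 xa by (intro mult_nonneg_nonneg) auto
    moreover have "3 * c / (real d - 1) * (x - a)^(d-1) \<le> 3 * c / 1 * 1"
     using c d1 xa by (intro mult_mono frac_le power_le_one) auto
    ultimately show ?thesis using power_phase_derivative[OF m d2 x] by simp
   qed
   have "Z \<alpha> \<beta> \<le> C * (real X * real Q * (1 + ln (real Q)) + real Q * sqrt (real Q / \<kappa> i) * sqrt (real X) * (1 + ln (real X)) * (1 + real X powr (1+\<eta>) * (1 + ln (real Q)) / real Q))"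
    unfolding Z_def by (rule C(2)[OF \<kappa>0 \<kappa>1 a(2) _ ph b2 b1 Q X]) (use a' a e in auto)
   then show "Z \<alpha> \<beta> \<le> G i" unfolding G_def \<Phi>_def by (simp only: mult.assoc)
  qed (use ab r0 in auto)
  also have "(\<Sum>i<T. G i + W) = real T * (C * (real X * real Q * (1 + ln (real Q))) + W) + C * ((\<Sum>i<T. real Q * sqrt (real Q / \<kappa> i)) * \<Phi>)"
   unfolding G_def by (simp add: sum.distrib distrib_left sum_distrib_left sum_distrib_right)
  also have "... \<le> kT * (C + 1) * (real X * real Q * (1 + ln (real Q))^2) + C * kV * (real Q powr (2 - 1 / (2 * (real d - 1))) * \<Phi>)"
  proof (rule add_mono)
   have "W * 1 \<le> W * (1 + ln (real Q))" unfolding W_def using l by (intro mult_left_mono) auto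
   then have "C * (real X * real Q * (1 + ln (real Q))) + W \<le> (C + 1) * (W * (1 + ln (real Q)))" unfolding W_def by (simp add: algebra_simps)
   then have "real T * (C * (real X * real Q * (1 + ln (real Q))) + W) \<le> (kT * (1 + ln (real Q))) * ((C + 1) * (W * (1 + ln (real Q))))"
    using T2 C(1) k l unfolding W_def by (intro mult_mono) auto
   then show "real T * (C * (real X * real Q * (1 + ln (real Q))) + W) \<le> kT * (C + 1) * (real X * real Q * (1 + ln (real Q))^2)"
    unfolding W_def by (simp add: power2_eq_square mult_ac)
   \<comment> \<open>The ratio 3/4 is a rational bound for 2^(-1/2): (4/3)^2 = 16/9 < 2 \<le>
     2^(d-2).\<close>
   have sq: "real Q * sqrt (real Q / \<kappa> i) \<le> real Q * (sqrt (real Q) / sqrt (c0 * r^(d-2))) * (3/4)^i" for i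
   proof -
    have "((4/3)^i)^2 = ((4/3)^2 :: real)^i" by (simp only: power_mult[symmetric] mult.commute)
    also have "(4/3)^2 = (16/9 :: real)" by (simp add: power2_eq_square)
    also have "(16/9::real)^i \<le> 2^i" by (intro power_mono) auto
    also have "... \<le> (2^i)^(d-2)" using d power_increasing[of 1 "d-2" "2^i::real"] by simp
    finally have "c0 * r^(d-2) * ((4/3)^i)^2 \<le> c0 * r^(d-2) * (2^i)^(d-2)" using c0 r0 by (intro mult_left_mono) auto
    also have "... = \<kappa> i" unfolding \<kappa>_def by (simp add: power_mult_distrib)
    finally have "sqrt (c0 * r^(d-2) * ((4/3)^i)^2) \<le> sqrt (\<kappa> i)" by simp
    then have "sqrt (c0 * r^(d-2)) * (4/3)^i \<le> sqrt (\<kappa> i)" by (simp add: real_sqrt_mult)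
    then have "sqrt (real Q) / sqrt (\<kappa> i) \<le> sqrt (real Q) / (sqrt (c0 * r^(d-2)) * (4/3)^i)" using c0 r0 by (intro frac_le) auto
    then have "real Q * (sqrt (real Q) / sqrt (\<kappa> i)) \<le> real Q * (sqrt (real Q) / (sqrt (c0 * r^(d-2)) * (4/3)^i))" by (intro mult_left_mono) auto
    then show ?thesis by (simp add: real_sqrt_divide power_divide)
   qed
   have "(\<Sum>i<T. real Q * sqrt (real Q / \<kappa> i)) \<le> (\<Sum>i<T. real Q * (sqrt (real Q) / sqrt (c0 * r^(d-2))) * (3/4)^i)" by (intro sum_mono sq)
   also have "... = real Q * (sqrt (real Q) / sqrt (c0 * r^(d-2))) * (\<Sum>i<T. (3/4)^i)" by (simp only: sum_distrib_left)
   also have "... \<le> real Q * (sqrt (real Q) / sqrt (c0 * r^(d-2))) * 4"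
   proof (rule mult_left_mono)
    have "(\<Sum>i<T. (3/4::real)^i) = 4 - 4 * (3/4)^T" by (induction T) auto
    then show "(\<Sum>i<T. (3/4::real)^i) \<le> 4" by simp
   qed (use c0 r0 in auto)
   also have "... = kV * real Q powr (2 - 1 / (2 * (real d - 1)))"
   proof -
    have rd: "real (d - 2) = real d - 2" using d by linarith
    have "r^(d-2) = c1^(d-2) * (real Q powr (- 1 / (real d - 1)))^(d-2)" unfolding r_def by (rule power_mult_distrib)
    also have "(real Q powr (- 1 / (real d - 1)))^(d-2) = real Q powr (- 1 / (real d - 1) * (real d - 2))"
     using Q0 rd by (metis powr_powr powr_realpow powr_gt_zero less_numeral_extra(3))
    finally have "sqrt (c0 * r^(d-2)) = sqrt (c0 * c1^(d-2)) * sqrt (real Q powr (- 1 / (real d - 1) * (real d - 2)))"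
     by (simp add: real_sqrt_mult mult.assoc)
    also have "sqrt (real Q powr (- 1 / (real d - 1) * (real d - 2))) = real Q powr (- 1 / (real d - 1) * (real d - 2) / 2)"
     by (simp add: powr_half_sqrt[symmetric] powr_powr)
    finally have s: "sqrt (c0 * r^(d-2)) = sqrt (c0 * c1^(d-2)) * real Q powr (- 1 / (real d - 1) * (real d - 2) / 2)" .
    have "real Q * real Q powr (1/2) / real Q powr (- 1 / (real d - 1) * (real d - 2) / 2) = real Q powr (1 + 1/2 - (- 1 / (real d - 1) * (real d - 2) / 2))"
     unfolding powr_diff powr_add using Q0 by simp
    also have "1 + 1/2 - (- 1 / (real d - 1) * (real d - 2) / 2) = 2 - 1 / (2 * (real d - 1))" using d1 by (simp add: field_simps)
    finally have p: "real Q * sqrt (real Q) / real Q powr (- 1 / (real d - 1) * (real d - 2) / 2) = real Q powr (2 - 1 / (2 * (real d - 1)))"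
     by (simp add: powr_half_sqrt)
    show ?thesis unfolding s p[symmetric] kV_def by simp
   qed
   finally have "(\<Sum>i<T. real Q * sqrt (real Q / \<kappa> i)) * \<Phi> \<le> kV * real Q powr (2 - 1 / (2 * (real d - 1))) * \<Phi>" using Phi0 by (rule mult_right_mono)
   then show "C * ((\<Sum>i<T. real Q * sqrt (real Q / \<kappa> i)) * \<Phi>) \<le> C * kV * (real Q powr (2 - 1 / (2 * (real d - 1))) * \<Phi>)"
    using C(1) mult_left_mono[of _ _ C] by (simp add: mult.assoc)
  qed
  finally have Zb: "Z \<alpha> \<beta> \<le> M0 + (kT * (C + 1) * (real X * real Q * (1 + ln (real Q))^2) + C * kV * (real Q powr (2 - 1 / (2 * (real d - 1))) * \<Phi>))" by simp
  define u where "u = real X * real Q * (1 + ln (real Q))^2"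
  define v where "v = real Q powr (2 - 1 / (2 * (real d - 1))) * \<Phi>"
  define w where "w = real Q powr (2 - 1 / real d) * real X powr (1 - 1 / real d)"
  have uvw: "u \<ge> 0" "v \<ge> 0" "w \<ge> 0" unfolding u_def v_def w_def using Phi0 by auto
  have "real X * real Q * ((1 + ln (real Q)) * 1) \<le> u" unfolding u_def power2_eq_square using l by (intro mult_left_mono) auto
  then have "real X * (real Q * (1 + ln (real Q))) \<le> u" by (simp only: mult.assoc mult_1_right)
  then have "M0 \<le> k3 * w + 53 * u" unfolding M0_def w_def by linarith
  then have "Z \<alpha> \<beta> \<le> k3 * w + 53 * u + (kT * (C + 1) * u + C * kV * v)" using Zb unfolding u_def v_def by linarith
  also have "... \<le> ((53 + kT * (C + 1)) + C * kV + k3) * (u + v + w)"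
  proof -
   have "0 \<le> kT * (C + 1) * (v + w)" "0 \<le> C * kV * (u + w)" "0 \<le> k3 * (u + v)" using k C(1) uvw by auto
   then show ?thesis using uvw by (simp add: distrib_left distrib_right)
  qed
  finally show "esum_block f {\<alpha>..\<beta>} Q X \<le> ((53 + kT * (C + 1)) + C * kV + k3) * dyadic_bound d \<eta> Q X"
   unfolding Z_def dyadic_bound_def u_def v_def w_def \<Phi>_def .
 qed
qed


lemma one_sided_bound:
 assumes d: "d \<ge> 2" and c: "c > 0" and e: "0 < e" "e \<le> 1/2" and \<eta>: "0 < \<eta>" "\<eta> \<le> 1"
 obtains C where "C \<ge> 0" "\<And>a f f1 f2 \<alpha> \<beta> Q X. power_phase d c a e f f1 f2 \<Longrightarrow> a \<le> \<alpha> \<Longrightarrow> \<alpha> \<le> \<beta> \<Longrightarrow> \<beta> \<le> a + e \<Longrightarrow> Q \<ge> 2 \<Longrightarrow> 1 \<le> X \<Longrightarrow> X \<le> Q \<Longrightarrow>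
   esum_block f {\<alpha>..\<beta>} Q X \<le> C * dyadic_bound d \<eta> Q X"
proof (cases "d = 2")
 case True
 then show ?thesis using one_sided_bound_2[OF c e \<eta>] that by blast
next
 case False
 then have "d \<ge> 3" using d by simp
 then show ?thesis using one_sided_bound_3[OF _ c e \<eta>] that by blast
qed

subsection \<open>Dyadic summation\<close>

lemma sum_power_inj_le:
 fixes q :: real
 assumes "finite A" "inj_on g A" "0 \<le> q" "q < 1"
 shows "(\<Sum>i\<in>A. q ^ g i) \<le> 1 / (1 - q)"
proof -
 have "(\<Sum>i\<in>A. q ^ g i) = (\<Sum>k\<in>g ` A. q ^ k)" using assms by (simp add: sum.reindex)
 also have "... \<le> (\<Sum>k. q ^ k)" using assms by (intro sum_le_suminf) (auto intro: summable_geometric)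
 also have "... = 1 / (1 - q)" using assms by (intro suminf_geometric) auto
 finally show ?thesis .
qed

text \<open>Coefficient of the block j ~ 2^i in the smoothing inequality. The first summand bounds
  the Fourier coefficients of the window; the second counts the Fejer orders 2^l with i < l \<le> n
  in whose sums the block occurs.\<close>

definition dyadic_weight :: "real \<Rightarrow> nat \<Rightarrow> nat \<Rightarrow> real" where
 "dyadic_weight \<delta> n i = min (2 * \<delta>) (1 / 2^i) + (real n - real i) / 2^n"

text \<open>Bernoulli's inequality pays for the linear factor with a worse ratio, 7/6 times 3/4 =
  7/8.\<close>

lemma linear_times_geometric_le: "real k * (3/4)^k \<le> 6 * (7/8)^k"
proof -
 have "1 + real k * (1/6) \<le> (1 + 1/6)^k" by (rule Bernoulli_inequality) simp
 then have "real k \<le> 6 * (7/6)^k" by simp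
 then have "real k * (3/4)^k \<le> 6 * (7/6)^k * (3/4)^k" by (intro mult_right_mono) auto
 also have "... = 6 * ((7/6) * (3/4))^k" by (simp only: power_mult_distrib mult.assoc)
 finally show ?thesis by simp
qed

lemma sum_linear_times_geometric_le: "(\<Sum>i<n. real (n - i) * (3/4)^(n-i)) \<le> 48"
proof -
 have "(\<Sum>i<n. real (n - i) * (3/4)^(n-i)) \<le> (\<Sum>i<n. 6 * (7/8)^(n-i))" by (intro sum_mono linear_times_geometric_le)
 also have "... = 6 * (\<Sum>i<n. (7/8)^(n-i))" by (simp only: sum_distrib_left)
 also have "... \<le> 6 * (1 / (1 - 7/8))" by (intro mult_left_mono sum_power_inj_le) (auto simp: inj_on_def)
 finally show ?thesis by simp
qed

lemma two_powr_neg_half_le: "a \<ge> 1/2 \<Longrightarrow> 2 powr (- (real k * a)) \<le> (3/4)^k"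
proof -
 assume a: "a \<ge> 1/2"
 have "sqrt 2 \<ge> (4/3::real)" by (rule real_le_rsqrt) (simp add: power2_eq_square)
 then have "inverse (sqrt 2) \<le> inverse (4/3::real)" by (intro le_imp_inverse_le) auto
 then have h: "2 powr (-(1/2)) \<le> (3/4::real)" by (simp add: powr_minus powr_half_sqrt)
 have "2 powr (- (real k * a)) \<le> 2 powr (-(1/2) * real k)" using mult_left_mono[OF a, of "real k"] by (intro powr_mono) auto
 also have "... = (2 powr (-(1/2)))^k" by (simp only: powr_powr[symmetric] powr_realpow powr_gt_zero)
 also have "... \<le> (3/4)^k" using h by (intro power_mono) auto
 finally show ?thesis .
qed

lemma dyadic_threshold:
 fixes \<delta> :: real
 assumes "0 < \<delta>" "\<delta> < 1/2"
 obtains m :: nat where "2 * \<delta> \<le> 1 / 2^m" "1 / 2^Suc m < 2 * \<delta>"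
proof -
 define P where "P k \<longleftrightarrow> 1 / 2^k < 2 * \<delta>" for k :: nat
 obtain k where "(1/2)^k < 2 * \<delta>" using real_arch_pow_inv[of "2 * \<delta>" "1/2"] assms by auto
 then have ex: "P k" unfolding P_def by (simp add: power_one_over)
 define k0 where "k0 = (LEAST k. P k)"
 have k0: "P k0" unfolding k0_def using ex by (rule LeastI)
 have "\<not> P 0" unfolding P_def using assms by simp
 then obtain m where m: "k0 = Suc m" using k0 by (cases k0) auto
 then have "\<not> P m" unfolding k0_def using not_less_Least[of m P] by simp
 then show ?thesis using that[of m] k0 m unfolding P_def by simp
qed

text \<open>Every block contributes O(1), so a sum linear in X loses the number of blocks, that is,
  one logarithm of Q. The other two weighted sums below avoid this.\<close>

lemma sum_dyadic_weight_linear: "(\<Sum>i<n. dyadic_weight \<delta> n i * 2^i) \<le> real n + 48"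
proof -
 have "(\<Sum>i<n. dyadic_weight \<delta> n i * 2^i) \<le> (\<Sum>i<n. 1 + real (n - i) * (3/4)^(n-i))"
 proof (rule sum_mono)
  fix i assume "i \<in> {..<n}"
  then have i: "i < n" by simp
  have "min (2 * \<delta>) (1 / 2^i) * 2^i \<le> 1 / 2^i * 2^i" by (intro mult_right_mono) auto
  moreover have "(real n - real i) / 2^n * 2^i \<le> real (n - i) * (3/4)^(n-i)"
  proof -
   have "(2::real)^n = 2^(n-i) * 2^i" using i by (simp add: power_add[symmetric])
   then have "(real n - real i) / 2^n * 2^i = real (n - i) * (1/2)^(n-i)" using i by (simp add: of_nat_diff power_one_over)
   also have "... \<le> real (n - i) * (3/4)^(n-i)" by (intro mult_left_mono power_mono) auto
   finally show ?thesis .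
  qed
  ultimately show "dyadic_weight \<delta> n i * 2^i \<le> 1 + real (n - i) * (3/4)^(n-i)" unfolding dyadic_weight_def distrib_right by simp
 qed
 also have "... \<le> real n + 48" using sum_linear_times_geometric_le[of n] by (simp add: sum.distrib)
 finally show ?thesis .
qed

text \<open>The terms peak where 2^i is about 1/(2\<delta>): below, 2\<delta> 2^(i(1-b)) grows,
  above, 2^(-ib) decays, both geometrically. The Fejer part peaks at i near n, where 2^(-n) \<le>
  2\<delta> keeps it under the same bound.\<close>

lemma sum_dyadic_weight_powr:
 assumes b: "0 < b" "b \<le> 1/2" and \<delta>: "0 < \<delta>" "\<delta> < 1/2" and n: "1 / 2^n \<le> 2 * \<delta>"
 shows "(\<Sum>i<n. dyadic_weight \<delta> n i * (2^i) powr (1 - b)) \<le> (52 + 1 / (1 - 2 powr (-b))) * (2 * \<delta>) powr b"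
proof -
 obtain m where m: "2 * \<delta> \<le> 1 / 2^m" "1 / 2^Suc m < 2 * \<delta>" using dyadic_threshold[OF \<delta>] by blast
 have pw: "(2^i) powr a = 2 powr (real i * a)" for i a by (simp add: powr_powr[symmetric] powr_realpow)
 have ipw: "(1 / 2^i) powr a = 2 powr (- (real i * a))" for i a by (simp add: powr_divide pw powr_minus_divide)
 define D where "D = (2 * \<delta>) powr b"
 have D0: "D \<ge> 0" unfolding D_def by simp
 define A where "A i = (if i \<le> m then (3/4::real)^(m-i) else 0)" for i
 define B where "B i = (if i \<le> m then 0 else (2 powr (-b))^(i - Suc m))" for i
 have q: "0 \<le> 2 powr (-b)" "2 powr (-b) < (1::real)" using powr_less_mono[of "-b" 0 2] b by auto
 have t: "dyadic_weight \<delta> n i * (2^i) powr (1 - b) \<le> D * (A i + B i + real (n - i) * (3/4)^(n-i))" if i: "i < n" for i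
 proof -
  have 1: "min (2 * \<delta>) (1 / 2^i) * (2^i) powr (1 - b) \<le> D * (A i + B i)"
  proof (cases "i \<le> m")
   case True
   have "min (2 * \<delta>) (1 / 2^i) * (2^i) powr (1 - b) \<le> 2 * \<delta> * (2^i) powr (1 - b)" by (intro mult_right_mono) auto
   also have "2 * \<delta> * (2^i) powr (1 - b) = D * (2 * \<delta>) powr (1 - b) * (2^i) powr (1 - b)" unfolding D_def using \<delta> by (simp add: powr_add[symmetric])
   also have "D * (2 * \<delta>) powr (1 - b) * (2^i) powr (1 - b) \<le> D * (1 / 2^m) powr (1 - b) * (2^i) powr (1 - b)"
    using m(1) \<delta> b D0 by (intro mult_right_mono mult_left_mono powr_mono2) auto
   also have "... = D * 2 powr (- (real (m - i) * (1 - b)))"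
    unfolding ipw pw using True by (simp add: powr_add[symmetric] of_nat_diff algebra_simps)
   also have "... \<le> D * (3/4)^(m-i)" using b D0 by (intro mult_left_mono two_powr_neg_half_le) auto
   finally show ?thesis unfolding A_def B_def using True by simp
  next
   case False
   have "min (2 * \<delta>) (1 / 2^i) * (2^i) powr (1 - b) \<le> 1 / 2^i * (2^i) powr (1 - b)" by (intro mult_right_mono) auto
   also have "... = (1 / 2^i) powr b" unfolding ipw using powr_diff[of "2^i::real" 1 b] by (simp add: pw powr_minus_divide)
   also have "(1 / 2^i) powr b = (1 / 2^Suc m * (1 / 2^(i - Suc m))) powr b" using False by (simp add: power_add[symmetric] del: power_Suc)
   also have "(1 / 2^Suc m * (1 / 2^(i - Suc m))) powr b = (1 / 2^Suc m) powr b * (1 / 2^(i - Suc m)) powr b"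
    by (rule powr_mult; simp)
   also have "... \<le> D * (1 / 2^(i - Suc m)) powr b" unfolding D_def using m(2) b by (intro mult_right_mono powr_mono2) auto
   also have "(1 / 2^(i - Suc m)) powr b = (2 powr (-b))^(i - Suc m)" unfolding ipw 
    by (simp add: powr_realpow[symmetric] powr_powr mult.commute)
   finally show ?thesis unfolding A_def B_def using False by simp
  qed
  have "(real n - real i) / 2^n * (2^i) powr (1 - b) = real (n - i) * ((1 / 2^n) powr b * ((1 / 2^n) powr (1 - b) * (2^i) powr (1 - b)))"
  proof -
   have e: "(1 / 2^n) powr b * (1 / 2^n) powr (1 - b) = 1 / (2::real)^n" by (simp add: powr_add[symmetric])
   have "real (n - i) * ((1 / 2^n) powr b * ((1 / 2^n) powr (1 - b) * (2^i) powr (1 - b)))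
    = real (n - i) * ((1 / 2^n) powr b * (1 / 2^n) powr (1 - b)) * (2^i) powr (1 - b)" by (simp only: mult.assoc)
   also have "... = (real n - real i) / 2^n * (2^i) powr (1 - b)" unfolding e using i by (simp add: of_nat_diff)
   finally show ?thesis by simp
  qed
  also have "(1 / 2^n) powr (1 - b) * (2^i) powr (1 - b) = 2 powr (- (real (n - i) * (1 - b)))"
   unfolding ipw pw using i by (simp add: powr_add[symmetric] of_nat_diff algebra_simps)
  also have "real (n - i) * ((1 / 2^n) powr b * 2 powr (- (real (n - i) * (1 - b)))) \<le> real (n - i) * (D * (3/4)^(n-i))"
   using n b unfolding D_def by (intro mult_left_mono mult_mono powr_mono2 two_powr_neg_half_le) auto
  finally show ?thesis using 1 unfolding dyadic_weight_def by (simp add: algebra_simps)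
 qed
 have "(\<Sum>i<n. dyadic_weight \<delta> n i * (2^i) powr (1 - b)) \<le> (\<Sum>i<n. D * (A i + B i + real (n - i) * (3/4)^(n-i)))"
  by (intro sum_mono t) auto
 also have "... = D * ((\<Sum>i<n. A i) + (\<Sum>i<n. B i) + (\<Sum>i<n. real (n - i) * (3/4)^(n-i)))"
  by (simp add: sum_distrib_left[symmetric] sum.distrib)
 also have "... \<le> D * (4 + 1 / (1 - 2 powr (-b)) + 48)"
 proof (intro mult_left_mono add_mono sum_linear_times_geometric_le D0)
  have "(\<Sum>i<n. A i) = (\<Sum>i\<in>{i\<in>{..<n}. i \<le> m}. (3/4)^(m-i))" unfolding A_def by (simp add: sum.If_cases Int_def)
  also have "... \<le> 1 / (1 - 3/4)" by (intro sum_power_inj_le) (auto simp: inj_on_def)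
  finally show "(\<Sum>i<n. A i) \<le> 4" by simp
  have "(\<Sum>i<n. B i) = (\<Sum>i\<in>{i\<in>{..<n}. \<not> i \<le> m}. (2 powr (-b))^(i - Suc m))" unfolding B_def by (simp add: sum.If_cases Int_def)
  also have "... \<le> 1 / (1 - 2 powr (-b))" by (intro sum_power_inj_le q) (auto simp: inj_on_def)
  finally show "(\<Sum>i<n. B i) \<le> 1 / (1 - 2 powr (-b))" .
 qed
 finally show ?thesis unfolding D_def by (simp add: algebra_simps)
qed

text \<open>A quarter power of t/(2\<delta>) is sacrificed to the logarithm and another quarter is
  kept, so that dyadic sums over t \<le> 2\<delta> converge and no second logarithm appears. Since
  \<delta> < 1/2, constants are absorbed in log(1/\<delta>).\<close>

lemma sqrt_log_le:
 assumes \<delta>: "0 < \<delta>" "\<delta> < 1/2" and t: "0 < t" "t \<le> 2 * \<delta>"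
 shows "sqrt t * (1 + ln (1 / t)) \<le> 11 * (sqrt (2 * \<delta>) * ln (1 / \<delta>)) * (t / (2 * \<delta>)) powr (1/4)"
proof -
 define v where "v = t / (2 * \<delta>)"
 have v: "0 < v" "v \<le> 1" "t = 2 * \<delta> * v" unfolding v_def using \<delta> t by auto
 have ln2: "ln (2::real) \<ge> 1/2" using ln_le_minus_one[of "1/2"] by (simp add: ln_div)
 have ld: "ln (1 / \<delta>) \<ge> 1/2"
 proof -
  have "ln 2 \<le> ln (1 / \<delta>)" using \<delta> by (subst ln_le_cancel_iff) (auto simp: field_simps)
  then show ?thesis using ln2 by linarith
 qed
 define w where "w = v powr (- (1/4))"
 have w: "w \<ge> 1" unfolding w_def using v powr_mono_both[of "-(1/4)" 0 v 1] by (simp add: powr_minus one_le_inverse powr_le1)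
 have "ln (1 / v) \<le> 4 * w"
 proof -
  have "ln w = - (1/4) * ln v" unfolding w_def using v by (simp add: ln_powr)
  then have "ln (1 / v) = 4 * ln w" using v by (simp add: ln_div)
  also have "... \<le> 4 * (w - 1)" using ln_le_minus_one[of w] w by simp
  finally show ?thesis by simp
 qed
 also have "4 * w = 8 * w * (1/2)" by simp
 also have "... \<le> 8 * w * ln (1 / \<delta>)" using ld w by (intro mult_left_mono) auto
 finally have l1: "ln (1 / v) \<le> 8 * w * ln (1 / \<delta>)" .
 have l2: "1 + ln (1 / (2 * \<delta>)) \<le> 3 * w * ln (1 / \<delta>)"
 proof -
  have "ln (1 / (2 * \<delta>)) \<le> ln (1 / \<delta>)" using \<delta> by (subst ln_le_cancel_iff) (auto simp: field_simps)
  then have "1 + ln (1 / (2 * \<delta>)) \<le> 3 * ln (1 / \<delta>)" using ld by linarith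
  also have "... \<le> 3 * w * ln (1 / \<delta>)" using ld w by (intro mult_right_mono) auto
  finally show ?thesis .
 qed
 have "ln (1 / t) = ln (1 / (2 * \<delta>)) + ln (1 / v)" unfolding v(3) using \<delta> v(1) by (simp add: ln_div ln_mult)
 then have "1 + ln (1 / t) \<le> 11 * w * ln (1 / \<delta>)" using l1 l2 by (simp add: algebra_simps)
 then have "sqrt t * (1 + ln (1 / t)) \<le> sqrt t * (11 * w * ln (1 / \<delta>))" using t by (intro mult_left_mono) auto
 also have "... = 11 * (sqrt (2 * \<delta>) * ln (1 / \<delta>)) * (sqrt v * w)" unfolding v(3) by (simp add: real_sqrt_mult)
 also have "sqrt v * w = v powr (1/4)" unfolding w_def using v(1) by (simp add: powr_half_sqrt[symmetric] powr_add[symmetric])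
 finally show ?thesis unfolding v_def .
qed

text \<open>The same peak as for the power b = 1/2; there log 2^i is about log(1/\<delta>), and this
  is the origin of the logarithm in the theorem.\<close>

lemma sum_dyadic_weight_log:
 obtains K where "K \<ge> 0" "\<And>\<delta> n. 0 < \<delta> \<Longrightarrow> \<delta> < 1/2 \<Longrightarrow> 1 / 2^n \<le> 2 * \<delta> \<Longrightarrow>
  (\<Sum>i<n. dyadic_weight \<delta> n i * (sqrt (2^i) * (1 + ln (2^i)))) \<le> K * (sqrt (2 * \<delta>) * ln (1 / \<delta>))"
proof -
 define q where "q = 2 powr (-(1/4::real))"
 have q: "0 \<le> q" "q < 1" unfolding q_def using powr_less_mono[of "-(1/4)" 0 "2::real"] by auto
 have sp: "sqrt (2^i) = 2 powr (real i * (1/2))" for i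
 proof -
  have "sqrt (2^i) = (2 powr real i) powr (1/2)" by (simp add: powr_half_sqrt powr_realpow)
  then show ?thesis by (simp only: powr_powr)
 qed
 have sq: "sqrt (1 / 2^k) * sqrt (2^i) = 2 powr (- (real (k - i) * (1/2)))" if "i \<le> k" for i k
 proof -
  have "sqrt (1 / 2^k) = 2 powr (- (real k * (1/2)))" unfolding real_sqrt_divide sp by (simp add: powr_minus_divide)
  then have "sqrt (1 / 2^k) * sqrt (2^i) = 2 powr (- (real k * (1/2)) + real i * (1/2))" unfolding sp by (simp only: powr_add)
  also have "- (real k * (1/2)) + real i * (1/2) = - (real (k - i) * (1/2))" using that by (simp add: of_nat_diff field_simps)
  finally show ?thesis .
 qed
 show ?thesis
 proof (rule that[of "4 * 11 + 11 * (1 / (1 - q)) + 11 * 48"])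
  show "0 \<le> 4 * 11 + 11 * (1 / (1 - q)) + 11 * 48" using q by simp
  fix \<delta> :: real and n assume \<delta>: "0 < \<delta>" "\<delta> < 1/2" and n: "1 / 2^n \<le> 2 * \<delta>"
  obtain m where m: "2 * \<delta> \<le> 1 / 2^m" "1 / 2^Suc m < 2 * \<delta>" using dyadic_threshold[OF \<delta>] by blast
  define D where "D = sqrt (2 * \<delta>) * ln (1 / \<delta>)"
  have D0: "D \<ge> 0" unfolding D_def using \<delta> by simp
  have base: "sqrt (1 / 2^i) * (1 + ln (2^i)) \<le> 11 * D * (1 / 2^i / (2 * \<delta>)) powr (1/4)" if "1 / 2^i \<le> 2 * \<delta>" for i
   using sqrt_log_le[OF \<delta> _ that] unfolding D_def by simp
  have base1: "sqrt (1 / 2^i) * (1 + ln (2^i)) \<le> 11 * D" if "1 / 2^i \<le> 2 * \<delta>" for i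
  proof -
   have "(1 / 2^i / (2 * \<delta>)) powr (1/4) \<le> 1" using that \<delta> by (intro powr_le1) (auto simp: field_simps)
   then have "11 * D * (1 / 2^i / (2 * \<delta>)) powr (1/4) \<le> 11 * D * 1" using D0 by (intro mult_left_mono) auto
   then show ?thesis using base[OF that] by linarith
  qed
  have top: "sqrt (2 * \<delta>) * (1 + ln (1 / (2 * \<delta>))) \<le> 11 * D" using sqrt_log_le[OF \<delta>, of "2 * \<delta>"] \<delta> unfolding D_def by simp
  define A where "A i = (if i \<le> m then (3/4::real)^(m-i) else 0)" for i
  define B where "B i = (if i \<le> m then 0 else q^(i - Suc m))" for i
  have t: "dyadic_weight \<delta> n i * (sqrt (2^i) * (1 + ln (2^i))) \<le> 11 * D * (A i + B i + real (n - i) * (3/4)^(n-i))" if i: "i < n" for i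
  proof -
   define l where "l = 1 + ln (2^i::real)"
   have l: "l \<ge> 0" unfolding l_def by simp
   have 1: "min (2 * \<delta>) (1 / 2^i) * (sqrt (2^i) * l) \<le> 11 * D * (A i + B i)"
   proof (cases "i \<le> m")
    case True
    have "(2::real)^i \<le> 2^m" using True by (intro power_increasing) auto
    also have "2^m \<le> 1 / (2 * \<delta>)" using m(1) \<delta> by (simp add: field_simps)
    finally have "ln (2^i) \<le> ln (1 / (2 * \<delta>))" using \<delta> by (subst ln_le_cancel_iff) auto
    then have l': "l \<le> 1 + ln (1 / (2 * \<delta>))" unfolding l_def by simp
    have "sqrt (2 * \<delta>) * sqrt (2^i) \<le> sqrt (1 / 2^m) * sqrt (2^i)" using m(1) by (intro mult_right_mono) auto
    also have "... = 2 powr (- (real (m - i) * (1/2)))" using True by (rule sq)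
    also have "... \<le> (3/4)^(m-i)" by (rule two_powr_neg_half_le) simp
    finally have s: "sqrt (2 * \<delta>) * sqrt (2^i) \<le> (3/4)^(m-i)" .
    have "min (2 * \<delta>) (1 / 2^i) * (sqrt (2^i) * l) \<le> 2 * \<delta> * (sqrt (2^i) * l)" using l by (intro mult_right_mono) auto
    also have "... = (sqrt (2 * \<delta>) * l) * (sqrt (2 * \<delta>) * sqrt (2^i))" using \<delta> real_sqrt_mult_self[of "2 * \<delta>"] by (simp add: mult_ac)
    also have "... \<le> (11 * D) * (3/4)^(m-i)"
    proof (rule mult_mono[OF _ s])
     have "sqrt (2 * \<delta>) * l \<le> sqrt (2 * \<delta>) * (1 + ln (1 / (2 * \<delta>)))" using l' \<delta> by (intro mult_left_mono) auto
     then show "sqrt (2 * \<delta>) * l \<le> 11 * D" using top by linarith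
    qed (use D0 \<delta> in auto)
    finally show ?thesis unfolding A_def B_def using True by simp
   next
    case False
    have im: "1 / 2^i = 1 / 2^Suc m * (1 / (2::real)^(i - Suc m))" using False by (simp add: power_add[symmetric] del: power_Suc)
    have "1 / 2^Suc m * (1 / (2::real)^(i - Suc m)) \<le> 2 * \<delta> * (1 / 2^(i - Suc m))" using m(2) by (intro mult_right_mono) auto
    then have i2: "1 / 2^i \<le> 2 * \<delta> * (1 / 2^(i - Suc m))" using im by simp
    have "1 / (2::real)^(i - Suc m) \<le> 1" by simp
    then have "2 * \<delta> * (1 / 2^(i - Suc m)) \<le> 2 * \<delta> * 1" using \<delta> by (intro mult_left_mono) auto
    then have i1: "1 / 2^i \<le> 2 * \<delta>" using i2 by linarith
    have "min (2 * \<delta>) (1 / 2^i) * (sqrt (2^i) * l) \<le> 1 / 2^i * (sqrt (2^i) * l)" using l by (intro mult_right_mono) auto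
    also have "... = sqrt (1 / 2^i) * l"
    proof -
     have "1 / 2^i * sqrt (2^i) = sqrt (1 / (2::real)^i)" by (simp add: real_sqrt_divide real_div_sqrt field_simps)
     then show ?thesis by (simp only: mult.assoc[symmetric])
    qed
    also have "... \<le> 11 * D * (1 / 2^i / (2 * \<delta>)) powr (1/4)" using base[OF i1] unfolding l_def .
    also have "... \<le> 11 * D * (1 / 2^(i - Suc m)) powr (1/4)"
     using i2 \<delta> D0 by (intro mult_left_mono powr_mono2) (auto simp: field_simps)
    also have "(1 / 2^(i - Suc m)) powr (1/4) = q^(i - Suc m)"
     unfolding q_def by (simp add: powr_divide powr_minus_divide power_one_over powr_realpow[symmetric] powr_powr mult.commute)
    finally show ?thesis unfolding A_def B_def using False by simp
   qed
   have "(real n - real i) / 2^n * (sqrt (2^i) * l) \<le> 11 * D * (real (n - i) * (3/4)^(n-i))"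
   proof -
    have "(2::real)^i \<le> 2^n" using i by (intro power_increasing) auto
    then have "ln (2^i::real) \<le> ln (2^n)" by (subst ln_le_cancel_iff) auto
    then have "l \<le> 1 + ln (2^n)" unfolding l_def by simp
    then have "sqrt (1 / 2^n) * l \<le> sqrt (1 / 2^n) * (1 + ln (2^n))" by (intro mult_left_mono) auto
    then have a: "sqrt (1 / 2^n) * l \<le> 11 * D" using base1[OF n] by linarith
    have s: "sqrt (1 / 2^n) * sqrt (2^i) \<le> (3/4)^(n-i)"
    proof -
     have "sqrt (1 / 2^n) * sqrt (2^i) = 2 powr (- (real (n - i) * (1/2)))" using i by (intro sq) simp
     also have "... \<le> (3/4)^(n-i)" by (rule two_powr_neg_half_le) simp
     finally show ?thesis .
    qed
    have "1 / 2^n = sqrt (1 / 2^n) * sqrt (1 / (2::real)^n)" by simp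
    then have "(real n - real i) / 2^n * (sqrt (2^i) * l) = real (n - i) * ((sqrt (1 / 2^n) * l) * (sqrt (1 / 2^n) * sqrt (2^i)))"
     using i by (simp add: of_nat_diff field_simps)
    also have "... \<le> real (n - i) * ((11 * D) * (3/4)^(n-i))"
     using D0 l by (intro mult_left_mono mult_mono[OF a s]) auto
    finally show ?thesis by (simp add: mult_ac)
   qed
   then show ?thesis using 1 unfolding dyadic_weight_def l_def[symmetric] by (simp add: algebra_simps)
  qed
  have "(\<Sum>i<n. dyadic_weight \<delta> n i * (sqrt (2^i) * (1 + ln (2^i)))) \<le> (\<Sum>i<n. 11 * D * (A i + B i + real (n - i) * (3/4)^(n-i)))"
   by (intro sum_mono t) auto
  also have "... = 11 * D * ((\<Sum>i<n. A i) + (\<Sum>i<n. B i) + (\<Sum>i<n. real (n - i) * (3/4)^(n-i)))"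
   by (simp only: sum_distrib_left[symmetric] sum.distrib)
  also have "... \<le> 11 * D * (4 + 1 / (1 - q) + 48)"
  proof (intro mult_left_mono add_mono sum_linear_times_geometric_le)
   have "(\<Sum>i<n. A i) = (\<Sum>i\<in>{i\<in>{..<n}. i \<le> m}. (3/4)^(m-i))" unfolding A_def by (simp add: sum.If_cases Int_def)
   also have "... \<le> 1 / (1 - 3/4)" by (intro sum_power_inj_le) (auto simp: inj_on_def)
   finally show "(\<Sum>i<n. A i) \<le> 4" by simp
   have "(\<Sum>i<n. B i) = (\<Sum>i\<in>{i\<in>{..<n}. \<not> i \<le> m}. q^(i - Suc m))" unfolding B_def by (simp add: sum.If_cases Int_def)
   also have "... \<le> 1 / (1 - q)" by (intro sum_power_inj_le q) (auto simp: inj_on_def)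
   finally show "(\<Sum>i<n. B i) \<le> 1 / (1 - q)" .
  qed (use D0 in auto)
  finally show "(\<Sum>i<n. dyadic_weight \<delta> n i * (sqrt (2^i) * (1 + ln (2^i)))) \<le> (4 * 11 + 11 * (1 / (1 - q)) + 11 * 48) * (sqrt (2 * \<delta>) * ln (1 / \<delta>))"
   unfolding D_def by (simp only: algebra_simps)
 qed
qed

section \<open>From the type condition to the one-sided model\<close>

lemma C_k_on_DERIV:
 assumes "C_k_on k f U" "j < k" "x \<in> U"
 shows "((deriv ^^ j) f has_real_derivative (deriv ^^ Suc j) f x) (at x)"
 using assms unfolding C_k_on_def by (simp add: DERIV_deriv_iff_real_differentiable)

text \<open>Taylor's formula of order d - 2 for the second derivative: the lower coefficients are
  derivatives of order 2 to d - 1 at the flat point and vanish. Positive order and x \<noteq> a are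
  conditions of the formula, so the other cases are treated apart.\<close>

lemma second_derivative_near_type_point:
 assumes d: "d \<ge> 2" and U: "{a-e..a+e} \<subseteq> U" "e \<ge> 0" and C: "C_k_on (d + 1) f U" and T: "curve_of_type d f a"
  and x: "x \<in> {a-e..a+e}"
 obtains t where "t \<in> {a-e..a+e}" "(deriv ^^ 2) f x = (deriv ^^ d) f t / fact (d - 2) * (x - a)^(d-2)"
proof (cases "d = 2 \<or> x = a")
 case True
 show ?thesis
 proof (cases "d = 2")
  case True
  then show ?thesis using that[of x] x by simp
 next
  case False
  then have "(deriv ^^ 2) f a = 0" using T d unfolding curve_of_type_def by auto
  then show ?thesis using that[of a] \<open>d = 2 \<or> x = a\<close> False d U by simp
 qed
next
 case False
 define n where "n = d - 2"
 have n: "n > 0" "d = n + 2" unfolding n_def using d False by auto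
 define g where "g m = (deriv ^^ (m + 2)) f" for m
 have "\<exists>t. (if x < a then x < t \<and> t < a else a < t \<and> t < x) \<and>
   (deriv ^^ 2) f x = (\<Sum>m<n. g m a / fact m * (x - a)^m) + g n t / fact n * (x - a)^n"
 proof (rule Taylor[of n g "(deriv ^^ 2) f" "a - e" "a + e"])
  show "\<forall>m t. m < n \<and> a - e \<le> t \<and> t \<le> a + e \<longrightarrow> (g m has_real_derivative g (Suc m) t) (at t)"
  proof (intro allI impI)
   fix m t assume mt: "m < n \<and> a - e \<le> t \<and> t \<le> a + e"
   then have "m + 2 < d + 1" "t \<in> U" using U(1) n(2) by auto
   from C_k_on_DERIV[OF C this] show "(g m has_real_derivative g (Suc m) t) (at t)" unfolding g_def by simp
  qed
 qed (use n x False U in \<open>auto simp: g_def numeral_2_eq_2\<close>)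
 then obtain t where t: "if x < a then x < t \<and> t < a else a < t \<and> t < x"
  "(deriv ^^ 2) f x = (\<Sum>m<n. g m a / fact m * (x - a)^m) + g n t / fact n * (x - a)^n" by blast
 have "(\<Sum>m<n. g m a / fact m * (x - a)^m) = 0"
  using T n unfolding g_def curve_of_type_def by (intro sum.neutral) auto
 then show ?thesis using that[of t] t x U(2) n unfolding g_def by (auto split: if_splits)
qed

text \<open>Right of the flat point \<sigma> f, and left of it the reflection of \<tau> f, satisfies
  the one-sided model with the same c: a change of sign conjugates the sums, and reflection permutes
  the fractions. The radius e is chosen before \<eta>, as the order of quantifiers in the theorem
  requires.\<close>

lemma dyadic_sum_bound:
 assumes d: "d \<ge> 2" and U: "open U" "a \<in> U" and C: "C_k_on (d + 1) f U" and T: "curve_of_type d f a"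
 obtains e where "e > 0" "e \<le> 1/2" "{a-e..a+e} \<subseteq> U"
  "\<And>\<eta>. 0 < \<eta> \<Longrightarrow> \<eta> \<le> 1 \<Longrightarrow> dyadic_estimate d f a e \<eta>"
proof -
 define D where "D = (deriv ^^ d) f a"
 have D: "D \<noteq> 0" using T unfolding D_def curve_of_type_def by simp
 define \<sigma> where "\<sigma> = sgn D"
 have s: "\<sigma> = 1 \<or> \<sigma> = -1" "\<sigma> * D = \<bar>D\<bar>" unfolding \<sigma>_def using D by (auto simp: sgn_if)
 have "continuous_on U ((deriv ^^ d) f)" using C unfolding C_k_on_def by auto
 then have "isCont ((deriv ^^ d) f) a" using U by (simp add: continuous_on_eq_continuous_at)
 then obtain e1 where e1: "e1 > 0" "\<And>x. \<bar>x - a\<bar> < e1 \<Longrightarrow> \<bar>(deriv ^^ d) f x - D\<bar> < \<bar>D\<bar> / 2"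
 proof -
  have "\<bar>D\<bar> / 2 > 0" using D by simp
  then obtain s where "s > 0" "\<forall>x. dist x a < s \<longrightarrow> dist ((deriv ^^ d) f x) ((deriv ^^ d) f a) < \<bar>D\<bar> / 2"
   using \<open>isCont ((deriv ^^ d) f) a\<close> unfolding continuous_at_eps_delta by blast
  then show ?thesis using that[of s] unfolding dist_real_def D_def by blast
 qed
 obtain e2 where e2: "e2 > 0" "cball a e2 \<subseteq> U" using U open_contains_cball by blast
 \<comment> \<open>Within this radius the d-th derivative differs from its value at a by less than
   half of it, which gives the bounds c and 3 c.\<close>
 define e where "e = min (e1 / 2) (min e2 (1/2))"
 have e: "e > 0" "e \<le> 1/2" "e < e1" "e \<le> e2" unfolding e_def using e1 e2 by auto
 have sub: "{a-e..a+e} \<subseteq> U" using e2(2) e by (auto simp: cball_def dist_real_def subset_eq abs_le_iff)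
 define c where "c = \<bar>D\<bar> / (2 * fact (d - 2))"
 have c: "c > 0" unfolding c_def using D by simp
 define f1 where "f1 = deriv f"
 define f2 where "f2 = (deriv ^^ 2) f"
 have f2b: "\<exists>w. c \<le> w \<and> w \<le> 3 * c \<and> \<sigma> * f2 x = w * (x - a)^(d-2)" if x: "x \<in> {a-e..a+e}" for x
 proof -
  obtain t where t: "t \<in> {a-e..a+e}" "f2 x = (deriv ^^ d) f t / fact (d - 2) * (x - a)^(d-2)"
   using second_derivative_near_type_point[OF d sub _ C T x] e unfolding f2_def by auto
  have "\<bar>t - a\<bar> < e1" using t e by auto
  then have "\<bar>(deriv ^^ d) f t - D\<bar> < \<bar>D\<bar> / 2" by (rule e1(2))
  moreover have "\<bar>\<sigma>\<bar> = 1" using s(1) by auto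
  ultimately have "\<bar>\<sigma> * ((deriv ^^ d) f t - D)\<bar> < \<bar>D\<bar> / 2" by (simp only: abs_mult mult_1_left)
  moreover have "\<sigma> * (deriv ^^ d) f t = \<bar>D\<bar> + \<sigma> * ((deriv ^^ d) f t - D)" unfolding s(2)[symmetric] by algebra
  ultimately have b: "\<bar>D\<bar> / 2 \<le> \<sigma> * (deriv ^^ d) f t" "\<sigma> * (deriv ^^ d) f t \<le> 3 * \<bar>D\<bar> / 2" by linarith+
  have "c \<le> \<sigma> * (deriv ^^ d) f t / fact (d - 2)"
   using divide_right_mono[OF b(1), of "fact (d-2)"] unfolding c_def by simp
  moreover have "\<sigma> * (deriv ^^ d) f t / fact (d - 2) \<le> 3 * c"
   using divide_right_mono[OF b(2), of "fact (d-2)"] unfolding c_def by simp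
  moreover have "\<sigma> * f2 x = \<sigma> * (deriv ^^ d) f t / fact (d - 2) * (x - a)^(d-2)" unfolding t(2) by simp
  ultimately show ?thesis by blast
 qed
 have DF: "(f has_real_derivative f1 x) (at x)" "(f1 has_real_derivative f2 x) (at x)" if "x \<in> {a-e..a+e}" for x
  using C_k_on_DERIV[OF C, of 0 x] C_k_on_DERIV[OF C, of 1 x] that sub d unfolding f1_def f2_def numeral_2_eq_2 by auto
 have c2: "continuous_on {a-e..a+e} f2"
 proof -
  have "\<forall>j\<le>d+1. continuous_on U ((deriv ^^ j) f)" using C unfolding C_k_on_def by blast
  from this[rule_format, of 2] have "continuous_on U f2" using d unfolding f2_def by simp
  then show ?thesis by (rule continuous_on_subset[OF _ sub])
 qed
 have f1a: "f1 a = 0" 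
 proof -
  have "(deriv ^^ 1) f a = 0" using T d unfolding curve_of_type_def by (elim conjE allE[of _ 1]) simp
  then show ?thesis unfolding f1_def by simp
 qed
 have ph: "phase (a - e) (a + e) (\<lambda>x. k * f x) (\<lambda>x. k * f1 x) (\<lambda>x. k * f2 x)" for k
  unfolding phase_def using c2 by (auto intro!: continuous_intros DERIV_cmult DF)
 have right: "power_phase d c a e (\<lambda>x. \<sigma> * f x) (\<lambda>x. \<sigma> * f1 x) (\<lambda>x. \<sigma> * f2 x)"
  unfolding power_phase_def
 proof (intro conjI ballI)
  show "phase a (a + e) (\<lambda>x. \<sigma> * f x) (\<lambda>x. \<sigma> * f1 x) (\<lambda>x. \<sigma> * f2 x)" by (rule phase_subset[OF ph]) (use e in auto)
  fix x assume x: "x \<in> {a..a+e}"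
  then obtain w where w: "c \<le> w" "w \<le> 3 * c" "\<sigma> * f2 x = w * (x - a)^(d-2)" using f2b[of x] e by auto
  have p: "(x - a)^(d-2) \<ge> 0" using x by simp
  show "c * (x - a)^(d-2) \<le> \<sigma> * f2 x" "\<sigma> * f2 x \<le> 3 * c * (x - a)^(d-2)" unfolding w(3) using w p by (auto intro: mult_right_mono)
 qed (simp add: f1a)
 \<comment> \<open>Reflection multiplies (x - a)^(d-2) by (-1)^(d-2).\<close>
 define \<tau> where "\<tau> = \<sigma> * (-1)^(d-2)"
 have t: "\<tau> = 1 \<or> \<tau> = -1" unfolding \<tau>_def using s by (cases "even (d-2)") auto
 have left: "power_phase d c (-a) e (\<lambda>x. \<tau> * f (-x)) (\<lambda>x. - (\<tau> * f1 (-x))) (\<lambda>x. \<tau> * f2 (-x))"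
  unfolding power_phase_def
 proof (intro conjI ballI)
  have "phase (-(a + e)) (-(a - e)) (\<lambda>x. \<tau> * f (-x)) (\<lambda>x. - (\<tau> * f1 (-x))) (\<lambda>x. \<tau> * f2 (-x))"
   using phase_reflect[OF ph[of \<tau>]] by simp
  then show "phase (-a) (-a + e) (\<lambda>x. \<tau> * f (-x)) (\<lambda>x. - (\<tau> * f1 (-x))) (\<lambda>x. \<tau> * f2 (-x))"
   by (rule phase_subset) (use e in auto)
  fix x assume x: "x \<in> {-a..-a+e}"
  then have "-x \<in> {a-e..a+e}" using e by auto
  then obtain w where w: "c \<le> w" "w \<le> 3 * c" "\<sigma> * f2 (-x) = w * (-x - a)^(d-2)" using f2b by blast
  have p: "(x - -a)^(d-2) \<ge> 0" using x by simp
  have sg: "(-1)^(d-2) * ((-1)^(d-2) :: real) = 1" by (simp add: power_mult_distrib[symmetric])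
  have "-x - a = (-1) * (x - -a)" by simp
  then have m: "(-x - a)^(d-2) = (-1)^(d-2) * (x - -a)^(d-2)" by (simp only: power_mult_distrib)
  have "\<tau> * f2 (-x) = (-1)^(d-2) * (\<sigma> * f2 (-x))" unfolding \<tau>_def by simp
  also have "... = ((-1)^(d-2) * (-1)^(d-2)) * (w * (x - -a)^(d-2))" unfolding w(3) m by (simp only: mult_ac)
  finally have eq: "\<tau> * f2 (-x) = w * (x - -a)^(d-2)" unfolding sg by simp
  show "c * (x - -a)^(d-2) \<le> \<tau> * f2 (-x)" "\<tau> * f2 (-x) \<le> 3 * c * (x - -a)^(d-2)" unfolding eq using w p by (auto intro: mult_right_mono)
 qed (simp add: f1a)
 show ?thesis
 proof (rule that[OF e(1,2) sub])
  fix \<eta> :: real assume \<eta>: "0 < \<eta>" "\<eta> \<le> 1"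
  obtain K where K: "K \<ge> 0" "\<And>a f f1 f2 \<alpha> \<beta> Q X. power_phase d c a e f f1 f2 \<Longrightarrow> a \<le> \<alpha> \<Longrightarrow> \<alpha> \<le> \<beta> \<Longrightarrow> \<beta> \<le> a + e \<Longrightarrow> Q \<ge> 2 \<Longrightarrow> 1 \<le> X \<Longrightarrow> X \<le> Q \<Longrightarrow>
    esum_block f {\<alpha>..\<beta>} Q X \<le> K * dyadic_bound d \<eta> Q X"
   using one_sided_bound[OF d c e(1,2) \<eta>] by blast
  have Kr: "esum_block f {\<alpha>..\<beta>} Q X \<le> K * dyadic_bound d \<eta> Q X"
   if "a \<le> \<alpha>" "\<alpha> \<le> \<beta>" "\<beta> \<le> a + e" "Q \<ge> 2" "1 \<le> X" "X \<le> Q" for \<alpha> \<beta> Q X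
  proof -
   have "norm (esum (\<lambda>x. \<sigma> * f x) {\<alpha>..\<beta>} Q j) = norm (esum f {\<alpha>..\<beta>} Q j)" for j
    using s(1) esum_uminus[of f] by auto
   then show ?thesis using K(2)[OF right that] by simp
  qed
  have Kl: "esum_block f {\<alpha>..\<beta>} Q X \<le> K * dyadic_bound d \<eta> Q X"
   if h: "a - e \<le> \<alpha>" "\<alpha> \<le> \<beta>" "\<beta> \<le> a" and Q: "Q \<ge> 2" "1 \<le> X" "X \<le> Q" for \<alpha> \<beta> Q X
  proof -
   have "norm (esum (\<lambda>x. \<tau> * f (-x)) {-\<beta>..-\<alpha>} Q j) = norm (esum (\<lambda>x. f (-x)) {-\<beta>..-\<alpha>} Q j)" for j
    using t esum_uminus[of "\<lambda>x. f (-x)"] by auto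
   then show ?thesis using K(2)[OF left, of "-\<beta>" "-\<alpha>" Q X] h Q by (simp add: esum_reflect)
  qed
  have B: "real X * real Q \<le> dyadic_bound d \<eta> Q X" "dyadic_bound d \<eta> Q X \<ge> 0" if Q: "Q \<ge> 2" and X: "1 \<le> X" "X \<le> Q" for Q X
  proof -
   have l: "ln (real Q) \<ge> 0" "ln (real X) \<ge> 0" using Q X by auto
   have "1 \<le> (1 + ln (real Q))^2" using l by (intro one_le_power) auto
   then have "real X * real Q * 1 \<le> real X * real Q * (1 + ln (real Q))^2" by (intro mult_left_mono) auto
   moreover have "real Q powr (2 - 1 / (2 * (real d - 1))) * (sqrt (real X) * (1 + ln (real X)) * (1 + real X powr (1+\<eta>) * (1 + ln (real Q)) / real Q)) \<ge> 0"
    using l by auto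
   moreover have "real Q powr (2 - 1 / real d) * real X powr (1 - 1 / real d) \<ge> 0" by simp
   ultimately show "real X * real Q \<le> dyadic_bound d \<eta> Q X" unfolding dyadic_bound_def by linarith
   then show "dyadic_bound d \<eta> Q X \<ge> 0" by (rule order_trans[rotated]) simp
  qed
  have "esum_block f {\<alpha>..\<beta>} Q X \<le> (2 * K + 1) * dyadic_bound d \<eta> Q X"
   if h: "a - e \<le> \<alpha>" "\<alpha> \<le> \<beta>" "\<beta> \<le> a + e" and Q: "Q \<ge> 2" "1 \<le> X" "X \<le> Q" for \<alpha> \<beta> Q X
  proof -
   have nn: "K * dyadic_bound d \<eta> Q X \<ge> 0" "real X * real Q \<le> dyadic_bound d \<eta> Q X" "dyadic_bound d \<eta> Q X \<ge> 0" using B[OF Q] K(1) by auto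
   have nn4: "real X * real Q \<ge> 0" by simp
   consider "a \<le> \<alpha>" | "\<beta> \<le> a" | "\<alpha> \<le> a" "a \<le> \<beta>" by linarith
   then have "esum_block f {\<alpha>..\<beta>} Q X \<le> K * dyadic_bound d \<eta> Q X + K * dyadic_bound d \<eta> Q X + real X * real Q"
   proof cases
    case 1
    then show ?thesis using Kr[OF 1 h(2,3) Q] nn(1) nn4 by linarith
   next
    case 2
    then show ?thesis using Kl[OF h(1,2) 2 Q] nn(1) nn4 by linarith
   next
    case 3
    have "esum_block f {\<alpha>..\<beta>} Q X \<le> (\<Sum>j\<in>{X..<2*X}. norm (esum f {\<alpha>..a} Q (real j)) + norm (esum f {a..\<beta>} Q (real j)) + real Q)"
     by (intro sum_mono esum_split 3)
    also have "... = esum_block f {\<alpha>..a} Q X + esum_block f {a..\<beta>} Q X + real X * real Q"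
     by (simp add: sum.distrib)
    finally show ?thesis using Kl[OF h(1) 3(1) order_refl Q] Kr[OF order_refl 3(2) h(3) Q] by linarith
   qed
   then show ?thesis using nn by (simp add: algebra_simps)
  qed
  then show "dyadic_estimate d f a e \<eta>"
   using K(1) by (intro exI[of _ "2 * K + 1"]) auto
 qed
qed

section \<open>Assembly of the dyadic blocks\<close>

lemma sum_dyadic_blocks:
 fixes F :: "nat \<Rightarrow> real"
 shows "(\<Sum>j\<in>{1..<2^n}. F j) = (\<Sum>i<n. \<Sum>j\<in>{2^i..<2*2^i}. F j)"
proof (induction n)
 case (Suc n)
 have "(\<Sum>j\<in>{1..<2^Suc n}. F j) = (\<Sum>j\<in>{1..<2^n}. F j) + (\<Sum>j\<in>{2^n..<2*2^n}. F j)"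
  by (simp add: sum.atLeastLessThan_concat)
 then show ?case using Suc by simp
qed simp

lemma sum_prefix_sums:
 fixes Z :: "nat \<Rightarrow> real"
 shows "(\<Sum>i\<le>n. \<Sum>l<i. Z l) = (\<Sum>l<n. (real n - real l) * Z l)"
proof (induction n)
 case (Suc n)
 have "(\<Sum>l<n. (real (Suc n) - real l) * Z l) = (\<Sum>l<n. (real n - real l) * Z l) + (\<Sum>l<n. Z l)"
  unfolding sum.distrib[symmetric] by (intro sum.cong) (auto simp: algebra_simps)
 then show ?case using Suc by simp
qed simp

lemma dyadic_assembly:
 fixes E :: "nat \<Rightarrow> real"
 assumes E: "\<And>j. E j \<ge> 0" and \<delta>: "\<delta> > 0"
 shows "2 * (\<Sum>j\<in>{1..<2^n}. min (2 * \<delta>) (1 / real j) * E j) + 16 / 2^n * (\<Sum>i\<le>n. s + 2 * (\<Sum>j\<in>{1..<2^i}. E j))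
  \<le> 32 * (\<Sum>i<n. dyadic_weight \<delta> n i * (\<Sum>j\<in>{2^i..<2*2^i}. E j)) + 16 * (real n + 1) * s / 2^n"
proof -
 define Z where "Z i = (\<Sum>j\<in>{2^i..<2*2^i}. E j)" for i
 have Z0: "Z i \<ge> 0" for i unfolding Z_def by (intro sum_nonneg E)
 define m where "m i = min (2 * \<delta>) (1 / 2^i)" for i :: nat
 have m0: "m i \<ge> 0" for i unfolding m_def using \<delta> by simp
 have "(\<Sum>j\<in>{1..<2^n}. min (2 * \<delta>) (1 / real j) * E j) = (\<Sum>i<n. \<Sum>j\<in>{2^i..<2*2^i}. min (2 * \<delta>) (1 / real j) * E j)"
  by (rule sum_dyadic_blocks)
 also have "... \<le> (\<Sum>i<n. m i * Z i)"
  unfolding Z_def sum_distrib_left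
 proof (intro sum_mono mult_right_mono E)
  fix i j :: nat assume "j \<in> {2^i..<2*2^i}"
  then have "real (2^i) \<le> real j" by (simp only: of_nat_le_iff) simp
  then have "1 / real j \<le> 1 / 2^i" by (intro frac_le) auto
  then show "min (2 * \<delta>) (1 / real j) \<le> m i" unfolding m_def by linarith
 qed
 finally have 1: "(\<Sum>j\<in>{1..<2^n}. min (2 * \<delta>) (1 / real j) * E j) \<le> (\<Sum>i<n. m i * Z i)" .
 have 2: "(\<Sum>i\<le>n. s + 2 * (\<Sum>j\<in>{1..<2^i}. E j)) = (real n + 1) * s + 2 * (\<Sum>l<n. (real n - real l) * Z l)"
  unfolding sum_dyadic_blocks Z_def[symmetric] by (simp add: sum.distrib sum_distrib_left[symmetric] sum_prefix_sums)
 have 3: "32 * (\<Sum>i<n. dyadic_weight \<delta> n i * Z i) = 32 * (\<Sum>i<n. m i * Z i) + 32 / 2^n * (\<Sum>l<n. (real n - real l) * Z l)"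
 proof -
  have "(\<Sum>i<n. dyadic_weight \<delta> n i * Z i) = (\<Sum>i<n. m i * Z i + 1 / 2^n * ((real n - real i) * Z i))"
   unfolding dyadic_weight_def m_def by (intro sum.cong) (auto simp: algebra_simps diff_divide_distrib)
  also have "... = (\<Sum>i<n. m i * Z i) + 1 / 2^n * (\<Sum>l<n. (real n - real l) * Z l)"
   by (simp only: sum.distrib sum_distrib_left)
  finally show ?thesis by simp
 qed
 have "(\<Sum>i<n. m i * Z i) \<ge> 0" using m0 Z0 by (intro sum_nonneg) auto
 moreover have "16 / 2^n * ((real n + 1) * s + 2 * W) = 32 / 2^n * W + 16 * (real n + 1) * s / 2^n" for W
  by (simp add: field_simps)
 ultimately show ?thesis using 1 unfolding 2 Z_def[symmetric] 3 by simp
qed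

lemma cubed_log_le:
 assumes "x \<ge> (1::real)" "\<theta> > 0"
 shows "(1 + ln x)^3 \<le> (1 + 3 / \<theta>)^3 * x powr \<theta>"
proof -
 define y where "y = x powr (\<theta> / 3)"
 have y: "y \<ge> 1" unfolding y_def using assms by (intro ge_one_powr_ge_zero) auto
 have "ln x = 3 / \<theta> * ln y" unfolding y_def using assms by (simp add: ln_powr)
 also have "... \<le> 3 / \<theta> * y" using assms y ln_le_minus_one[of y] by (intro mult_left_mono) auto
 finally have "1 + ln x \<le> (1 + 3 / \<theta>) * y" using y by (simp add: algebra_simps)
 then have "(1 + ln x)^3 \<le> ((1 + 3 / \<theta>) * y)^3" using assms by (intro power_mono) auto
 also have "... = (1 + 3 / \<theta>)^3 * y^3" by (rule power_mult_distrib)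
 also have "y^3 = x powr \<theta>"
 proof -
  have "y^3 = y powr 3" using y by (simp add: powr_numeral)
  then show ?thesis unfolding y_def powr_powr by simp
 qed
 finally show ?thesis .
qed

text \<open>In the off-diagonal part X^(1+\<eta>)/Q of the middle term, X \<le> Q is used in all but
  one factor X. The result is linear in X like the first term, so both lose one logarithm in the
  weighted sum.\<close>

lemma dyadic_bound_le:
 assumes d: "d \<ge> 2" and \<eta>: "\<eta> > 0" and X: "1 \<le> X" "X \<le> Q"
 defines "p \<equiv> 2 - 1 / (2 * (real d - 1))"
 shows "dyadic_bound d \<eta> Q X \<le> (real Q + real Q powr (p - 1/2 + \<eta>)) * (1 + ln (real Q))^2 * real X
  + real Q powr p * (sqrt (real X) * (1 + ln (real X))) + real Q powr (2 - 1 / real d) * real X powr (1 - 1 / real d)"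
proof -
 have Q0: "real Q \<ge> 1" and X0: "real X \<ge> 1" "real X \<le> real Q" using X by auto
 have l: "0 \<le> ln (real X)" "ln (real X) \<le> ln (real Q)" using X0 by auto
 have "real Q powr p * (sqrt (real X) * (1 + ln (real X)) * (real X powr (1+\<eta>) * (1 + ln (real Q)) / real Q))
   = (real Q powr p / real Q) * (sqrt (real X) * real X powr (1 + \<eta>)) * ((1 + ln (real X)) * (1 + ln (real Q)))"
  by (simp add: mult_ac)
 also have "sqrt (real X) * real X powr (1 + \<eta>) = real X * real X powr (1/2 + \<eta>)"
  using X0 by (simp add: powr_half_sqrt[symmetric] powr_add mult_ac)
 also have "(real Q powr p / real Q) * (real X * real X powr (1/2 + \<eta>)) * ((1 + ln (real X)) * (1 + ln (real Q)))
  \<le> (real Q powr p / real Q) * (real X * real Q powr (1/2 + \<eta>)) * ((1 + ln (real Q)) * (1 + ln (real Q)))"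
  using X0 l \<eta> by (intro mult_mono mult_left_mono powr_mono2) auto
 also have "... = (real Q powr p / real Q * real Q powr (1/2 + \<eta>)) * (1 + ln (real Q))^2 * real X" by (simp add: power2_eq_square)
 also have "real Q powr p / real Q * real Q powr (1/2 + \<eta>) = real Q powr (p - 1/2 + \<eta>)"
 proof -
  have "real Q powr p / real Q = real Q powr (p - 1)" using Q0 by (simp add: powr_diff)
  then show ?thesis using powr_add[of "real Q" "p - 1" "1/2 + \<eta>"] by (simp add: algebra_simps)
 qed
 finally have "real Q powr p * (sqrt (real X) * (1 + ln (real X)) * (real X powr (1+\<eta>) * (1 + ln (real Q)) / real Q))
  \<le> real Q powr (p - 1/2 + \<eta>) * (1 + ln (real Q))^2 * real X" .
 then show ?thesis unfolding dyadic_bound_def p_def[symmetric] by (simp add: algebra_simps)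
qed

text \<open>The weighted sums turn the linear part into one more logarithm of Q, the square-root
  part into \<delta>^(1/2) log(1/\<delta>), and the core part, with b = 1/d, into
  \<delta>^(1/d).\<close>

lemma weighted_error:
 assumes d: "d \<ge> 2" and \<eta>: "\<eta> > 0"
 defines "p \<equiv> 2 - 1 / (2 * (real d - 1))"
 obtains C where "C \<ge> 0" "\<And>n Q \<delta> K Z. 2^n \<le> Q \<Longrightarrow> Q < 2^Suc n \<Longrightarrow> 1 / real Q < \<delta> \<Longrightarrow> \<delta> < 1/2 \<Longrightarrow> K \<ge> 0 \<Longrightarrow>
   (\<And>i. i < n \<Longrightarrow> Z i \<le> K * dyadic_bound d \<eta> Q (2^i)) \<Longrightarrow>
   (\<Sum>i<n. dyadic_weight \<delta> n i * Z i) \<le> K * (C * ((real Q + real Q powr (p - 1/2 + \<eta>)) * (1 + ln (real Q))^3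
    + \<delta> powr (1/2) * ln (1 / \<delta>) * real Q powr p + \<delta> powr (1 / real d) * real Q powr (2 - 1 / real d)))"
proof -
 obtain K2 where K2: "K2 \<ge> 0" "\<And>\<delta> n. 0 < \<delta> \<Longrightarrow> \<delta> < 1/2 \<Longrightarrow> 1 / 2^n \<le> 2 * \<delta> \<Longrightarrow>
  (\<Sum>i<n. dyadic_weight \<delta> n i * (sqrt (2^i) * (1 + ln (2^i)))) \<le> K2 * (sqrt (2 * \<delta>) * ln (1 / \<delta>))"
  using sum_dyadic_weight_log by blast
 define b where "b = 1 / real d"
 have b: "0 < b" "b \<le> 1/2" unfolding b_def using d by (auto simp: field_simps)
 define K3 where "K3 = 52 + 1 / (1 - 2 powr (-b))"
 have "2 powr (-b) < (1::real)" using powr_less_mono[of "-b" 0 2] b by auto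
 then have K3: "K3 \<ge> 0" unfolding K3_def by simp
 define C where "C = 50 + K2 * 2 + K3 * 2"
 show ?thesis
 proof (rule that[of C])
  show "C \<ge> 0" unfolding C_def using K2(1) K3 by simp
  fix n Q and \<delta> K :: real and Z :: "nat \<Rightarrow> real"
  assume n: "2^n \<le> Q" "Q < 2^Suc n" and \<delta>: "1 / real Q < \<delta>" "\<delta> < 1/2" and K: "K \<ge> 0" and Z: "\<And>i. i < n \<Longrightarrow> Z i \<le> K * dyadic_bound d \<eta> Q (2^i)"
  have nQ: "2^n \<le> real Q" "real Q < 2 * 2^n"
  proof -
   have "real (2^n) \<le> real Q" "real Q < real (2^Suc n)" using n by (simp_all only: of_nat_le_iff of_nat_less_iff)
   then show "2^n \<le> real Q" "real Q < 2 * 2^n" by simp_all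
  qed
  have Q1: "real Q \<ge> 1" using nQ(1) one_le_power[of "2::real" n] by linarith
  have d0: "\<delta> > 0" using \<delta>(1) Q1 by (smt (verit) divide_pos_pos)
  \<comment> \<open>Here \<delta> > 1/Q enters: as 2^(n+1) > Q, the frequencies up to 2^n reach the
    scale 1/(2\<delta>), which the weighted sums presuppose.\<close>
  have n2: "1 / 2^n \<le> 2 * \<delta>"
  proof -
   have "1 / 2^n \<le> 2 / real Q" using nQ(2) Q1 by (simp add: field_simps)
   then show ?thesis using \<delta>(1) by simp
  qed
  have l: "ln (real Q) \<ge> 0" using Q1 by simp
  have nl: "real n + 48 \<le> 50 * (1 + ln (real Q))"
  proof -
   have ln2: "ln (2::real) \<ge> 1/2" using ln_le_minus_one[of "1/2"] by (simp add: ln_div)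
   have "real n * (1/2) \<le> real n * ln 2" using ln2 by (intro mult_left_mono) auto
   also have "... = ln (2^n)" by (simp add: ln_realpow)
   also have "... \<le> ln (real Q)" using nQ(1) Q1 by simp
   finally have "real n \<le> 2 * ln (real Q)" by simp
   moreover have "50 * (1 + ln (real Q)) = 50 + 50 * ln (real Q)" by simp
   ultimately show ?thesis using l by linarith
  qed
  define A where "A = (real Q + real Q powr (p - 1/2 + \<eta>)) * (1 + ln (real Q))^2"
  have A0: "A \<ge> 0" unfolding A_def using l by simp
  define w where "w i = dyadic_weight \<delta> n i" for i
  have w0: "w i \<ge> 0" if "i < n" for i unfolding w_def dyadic_weight_def using that d0 by simp
  have "(\<Sum>i<n. w i * Z i) \<le> (\<Sum>i<n. w i * (K * (A * 2^i + real Q powr p * (sqrt (2^i) * (1 + ln (2^i))) + real Q powr (2 - b) * (2^i) powr (1 - b))))"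
  proof (intro sum_mono mult_left_mono)
   fix i assume "i \<in> {..<n}"
   then have i: "i < n" by simp
   have "(2::nat)^i \<le> 2^n" using i by (intro power_increasing) auto
   then have X: "1 \<le> (2::nat)^i" "2^i \<le> Q" using order_trans[OF _ n(1)] by auto
   have "dyadic_bound d \<eta> Q (2^i) \<le> A * 2^i + real Q powr p * (sqrt (2^i) * (1 + ln (2^i))) + real Q powr (2 - b) * (2^i) powr (1 - b)"
    using dyadic_bound_le[OF d \<eta> X] unfolding A_def p_def b_def by simp
   then have "K * dyadic_bound d \<eta> Q (2^i) \<le> K * (A * 2^i + real Q powr p * (sqrt (2^i) * (1 + ln (2^i))) + real Q powr (2 - b) * (2^i) powr (1 - b))"
    using K by (rule mult_left_mono)
   then show "Z i \<le> K * (A * 2^i + real Q powr p * (sqrt (2^i) * (1 + ln (2^i))) + real Q powr (2 - b) * (2^i) powr (1 - b))"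
    using Z[OF i] by linarith
  qed (use w0 in auto)
  also have "... = K * (A * (\<Sum>i<n. w i * 2^i) + real Q powr p * (\<Sum>i<n. w i * (sqrt (2^i) * (1 + ln (2^i)))) + real Q powr (2 - b) * (\<Sum>i<n. w i * (2^i) powr (1 - b)))"
   unfolding sum_distrib_left sum.distrib[symmetric] by (intro sum.cong refl) algebra
  also have "... \<le> K * (A * (50 * (1 + ln (real Q))) + real Q powr p * (K2 * (sqrt (2 * \<delta>) * ln (1 / \<delta>))) + real Q powr (2 - b) * (K3 * (2 * \<delta>) powr b))"
   unfolding w_def K3_def
   using order_trans[OF sum_dyadic_weight_linear nl] K2(2)[OF d0 \<delta>(2) n2] sum_dyadic_weight_powr[OF b d0 \<delta>(2) n2]
   by (intro mult_left_mono add_mono K A0) auto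
  also have "... \<le> K * (C * (A * (1 + ln (real Q)) + \<delta> powr (1/2) * ln (1 / \<delta>) * real Q powr p + \<delta> powr b * real Q powr (2 - b)))"
  proof (rule mult_left_mono[OF _ K])
   define u where "u = A * (1 + ln (real Q))"
   define v where "v = \<delta> powr (1/2) * ln (1 / \<delta>) * real Q powr p"
   define z where "z = \<delta> powr b * real Q powr (2 - b)"
   have ld: "ln (1 / \<delta>) \<ge> 0" using d0 \<delta>(2) by (simp add: ln_ge_zero_iff)
   have nn: "u \<ge> 0" "v \<ge> 0" "z \<ge> 0" unfolding u_def v_def z_def using A0 l ld by auto
   have s2: "sqrt 2 \<le> (2::real)" using real_le_lsqrt[of 2 2] by simp
   have "sqrt (2 * \<delta>) * ln (1 / \<delta>) = sqrt 2 * (\<delta> powr (1/2) * ln (1 / \<delta>))" using d0 by (simp add: real_sqrt_mult powr_half_sqrt)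
   also have "... \<le> 2 * (\<delta> powr (1/2) * ln (1 / \<delta>))" using s2 ld by (intro mult_right_mono) auto
   finally have "real Q powr p * (K2 * (sqrt (2 * \<delta>) * ln (1 / \<delta>))) \<le> real Q powr p * (K2 * (2 * (\<delta> powr (1/2) * ln (1 / \<delta>))))"
    using K2(1) by (intro mult_left_mono) auto
   also have "... = K2 * 2 * v" unfolding v_def by (simp add: mult_ac)
   finally have 1: "real Q powr p * (K2 * (sqrt (2 * \<delta>) * ln (1 / \<delta>))) \<le> K2 * 2 * v" .
   have "2 powr b \<le> 2 powr (1::real)" using b by (intro powr_mono) auto
   then have "(2 * \<delta>) powr b \<le> 2 * \<delta> powr b" using d0 by (simp add: powr_mult mult_right_mono)
   then have "real Q powr (2 - b) * (K3 * (2 * \<delta>) powr b) \<le> real Q powr (2 - b) * (K3 * (2 * \<delta> powr b))" using K3 by (intro mult_left_mono) auto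
   also have "... = K3 * 2 * z" unfolding z_def by (simp add: mult_ac)
   finally have 2: "real Q powr (2 - b) * (K3 * (2 * \<delta>) powr b) \<le> K3 * 2 * z" .
   have 3: "A * (50 * (1 + ln (real Q))) = 50 * u" unfolding u_def by simp
   have "0 \<le> K2 * 2 * u" "0 \<le> K2 * 2 * z" "0 \<le> K3 * 2 * u" "0 \<le> K3 * 2 * v" using K2(1) K3 nn by auto
   then have "50 * u + K2 * 2 * v + K3 * 2 * z \<le> C * (u + v + z)" unfolding C_def distrib_left distrib_right using nn by linarith
   then show "A * (50 * (1 + ln (real Q))) + real Q powr p * (K2 * (sqrt (2 * \<delta>) * ln (1 / \<delta>))) + real Q powr (2 - b) * (K3 * (2 * \<delta>) powr b)
     \<le> C * (A * (1 + ln (real Q)) + \<delta> powr (1/2) * ln (1 / \<delta>) * real Q powr p + \<delta> powr b * real Q powr (2 - b))"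
    using 1 2 3 unfolding u_def v_def z_def by linarith
  qed
  also have "A * (1 + ln (real Q)) = (real Q + real Q powr (p - 1/2 + \<eta>)) * (1 + ln (real Q))^3"
   unfolding A_def by (simp add: power2_eq_square power3_eq_cube)
  finally show "(\<Sum>i<n. dyadic_weight \<delta> n i * Z i) \<le> K * (C * ((real Q + real Q powr (p - 1/2 + \<eta>)) * (1 + ln (real Q))^3
    + \<delta> powr (1/2) * ln (1 / \<delta>) * real Q powr p + \<delta> powr (1 / real d) * real Q powr (2 - 1 / real d)))"
   unfolding w_def b_def .
 qed
qed

subsection \<open>Counting\<close>

definition rat_points :: "real set \<Rightarrow> nat \<Rightarrow> (int \<times> nat) set" where
 "rat_points I Q = {(a, q). 1 \<le> q \<and> q \<le> Q \<and> of_int a / real q \<in> I}"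

lemma rat_points_eq: "rat_points {\<alpha>..\<beta>} Q = prod.swap ` (SIGMA q:{1..Q}. {\<lceil>\<alpha> * real q\<rceil>..\<lfloor>\<beta> * real q\<rfloor>})"
proof -
 have "a \<in> {\<lceil>\<alpha> * real q\<rceil>..\<lfloor>\<beta> * real q\<rfloor>} \<longleftrightarrow> of_int a / real q \<in> {\<alpha>..\<beta>}" if "q \<ge> 1" for a q
  using int_quotient_in_interval[OF that, of \<alpha> \<beta>] by blast
 then show ?thesis unfolding rat_points_def by (fastforce simp: image_iff)
qed

lemma finite_rat_points: "finite (rat_points {\<alpha>..\<beta>} Q)"
 unfolding rat_points_eq by (intro finite_imageI finite_SigmaI) auto

lemma sum_rat_points: "(\<Sum>(a,q)\<in>rat_points {\<alpha>..\<beta>} Q. F a q) = (\<Sum>q=1..Q. \<Sum>a | of_int a / real q \<in> {\<alpha>..\<beta>}. F a q)"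
proof -
 have "(\<Sum>(a,q)\<in>rat_points {\<alpha>..\<beta>} Q. F a q) = (\<Sum>(q,a)\<in>(SIGMA q:{1..Q}. {\<lceil>\<alpha> * real q\<rceil>..\<lfloor>\<beta> * real q\<rfloor>}). F a q)"
  unfolding rat_points_eq by (subst sum.reindex) (auto simp: case_prod_unfold)
 also have "... = (\<Sum>q=1..Q. \<Sum>a\<in>{\<lceil>\<alpha> * real q\<rceil>..\<lfloor>\<beta> * real q\<rfloor>}. F a q)" by (rule sum.Sigma[symmetric]) auto
 also have "... = (\<Sum>q=1..Q. \<Sum>a | of_int a / real q \<in> {\<alpha>..\<beta>}. F a q)"
  using int_quotient_in_interval[of _ \<alpha> \<beta>] by (intro sum.cong) auto
 finally show ?thesis .
qed

text \<open>Each denominator q contributes (\<beta> - \<alpha>) q up to an error 1. The sum over q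
  gives half of Q^2, and the window length 2\<delta> later restores the factor 2.\<close>

lemma card_rat_points:
 assumes ab: "\<alpha> \<le> \<beta>" "\<beta> \<le> \<alpha> + 1"
 shows "\<bar>real (card (rat_points {\<alpha>..\<beta>} Q)) - (\<beta> - \<alpha>) * real Q ^ 2 / 2\<bar> \<le> 2 * real Q"
proof -
 define N where "N q = real (card {\<lceil>\<alpha> * real q\<rceil>..\<lfloor>\<beta> * real q\<rfloor>})" for q
 have "card (rat_points {\<alpha>..\<beta>} Q) = card (SIGMA q:{1..Q}. {\<lceil>\<alpha> * real q\<rceil>..\<lfloor>\<beta> * real q\<rfloor>})"
  unfolding rat_points_eq by (rule card_image) (auto simp: inj_on_def)
 then have c: "real (card (rat_points {\<alpha>..\<beta>} Q)) = (\<Sum>q=1..Q. N q)" unfolding N_def by simp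
 have n: "\<bar>N q - (\<beta> - \<alpha>) * real q\<bar> \<le> 1" for q
 proof -
  have "\<alpha> * real q \<le> \<beta> * real q" using ab by (intro mult_right_mono) auto
  then have "\<lceil>\<alpha> * real q\<rceil> \<le> \<lfloor>\<beta> * real q\<rfloor> + 1" by linarith
  then have "N q = of_int (\<lfloor>\<beta> * real q\<rfloor> - \<lceil>\<alpha> * real q\<rceil> + 1)" unfolding N_def by simp
  moreover have "(\<beta> - \<alpha>) * real q = \<beta> * real q - \<alpha> * real q" by (simp add: algebra_simps)
  ultimately show ?thesis by simp linarith
 qed
 define D where "D = \<beta> - \<alpha>"
 have D: "0 \<le> D" "D \<le> 1" unfolding D_def using ab by auto
 have "\<bar>(\<Sum>q=1..Q. N q - D * real q)\<bar> \<le> (\<Sum>q=1..Q. 1)"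
  unfolding D_def by (rule order_trans[OF sum_abs]) (intro sum_mono n)
 then have "\<bar>(\<Sum>q=1..Q. N q - D * real q)\<bar> \<le> real Q" by simp
 moreover have "(\<Sum>q=1..Q. N q - D * real q) = (\<Sum>q=1..Q. N q) - (D * real Q ^ 2 / 2 + D * real Q / 2)"
 proof -
  have "(\<Sum>q=1..Q. real q) = real Q * (real Q + 1) / 2" by (induction Q) (auto simp: field_simps)
  then have "(\<Sum>q=1..Q. N q - D * real q) = (\<Sum>q=1..Q. N q) - D * (real Q * (real Q + 1) / 2)"
   by (simp only: sum_subtractf sum_distrib_left[symmetric])
  also have "D * (real Q * (real Q + 1) / 2) = D * real Q ^ 2 / 2 + D * real Q / 2" by (simp add: power2_eq_square field_simps)
  finally show ?thesis .
 qed
 moreover have "0 \<le> D * real Q" "D * real Q \<le> real Q" using D mult_right_mono[OF D(2), of "real Q"] by auto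
 ultimately show ?thesis unfolding c D_def[symmetric] by linarith
qed

text \<open>Only fractions equal to an endpoint can differ, at most one for each endpoint and
  denominator.\<close>

lemma rat_count_closure:
 assumes I: "{\<alpha><..<\<beta>} \<subseteq> I" "I \<subseteq> {\<alpha>..\<beta>}"
 shows "\<bar>real (rat_count f I Q \<delta>) - real (rat_count f {\<alpha>..\<beta>} Q \<delta>)\<bar> \<le> 2 * real Q"
proof -
 define S where "S I = {(a::int, q::nat). 1 \<le> q \<and> q \<le> Q \<and> of_int a / real q \<in> I \<and> int_dist (real q * f (of_int a / real q)) < \<delta>}" for I
 define B where "B = (\<lambda>q. (\<lfloor>\<alpha> * real q\<rfloor>, q)) ` {1..Q} \<union> (\<lambda>q. (\<lfloor>\<beta> * real q\<rfloor>, q)) ` {1..Q}"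
 have fB: "finite B" "card B \<le> 2 * Q"
 proof -
  show "finite B" unfolding B_def by simp
  have "card B \<le> card ((\<lambda>q. (\<lfloor>\<alpha> * real q\<rfloor>, q)) ` {1..Q}) + card ((\<lambda>q. (\<lfloor>\<beta> * real q\<rfloor>, q)) ` {1..Q})" unfolding B_def by (rule card_Un_le)
  also have "... \<le> card {1..Q} + card {1..Q}" by (intro add_mono card_image_le) auto
  finally show "card B \<le> 2 * Q" by simp
 qed
 have fin: "finite (S {\<alpha>..\<beta>})" by (rule finite_subset[OF _ finite_rat_points[of \<alpha> \<beta> Q]]) (auto simp: S_def rat_points_def)
 have s1: "S I \<subseteq> S {\<alpha>..\<beta>}" unfolding S_def using I by auto
 have s2: "S {\<alpha>..\<beta>} \<subseteq> S I \<union> B"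
 proof
  fix p assume p: "p \<in> S {\<alpha>..\<beta>}"
  obtain a q where aq: "p = (a, q)" by (cases p)
  have q: "1 \<le> q" "q \<le> Q" and x: "of_int a / real q \<in> {\<alpha>..\<beta>}" using p unfolding aq S_def by auto
  show "p \<in> S I \<union> B"
  proof (cases "of_int a / real q \<in> I")
   case True
   then show ?thesis using p unfolding aq S_def by auto
  next
   case False
   then have "of_int a / real q = \<alpha> \<or> of_int a / real q = \<beta>" using I x by force
   then have "a = \<lfloor>\<alpha> * real q\<rfloor> \<or> a = \<lfloor>\<beta> * real q\<rfloor>" using q by auto
   then show ?thesis unfolding aq B_def using q by auto
  qed
 qed
 have "card (S I) \<le> card (S {\<alpha>..\<beta>})" using s1 fin by (intro card_mono)
 moreover have "card (S {\<alpha>..\<beta>}) \<le> card (S I \<union> B)" using s2 fB(1) finite_subset[OF s1 fin] by (intro card_mono) auto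
 moreover have "card (S I \<union> B) \<le> card (S I) + card B" by (rule card_Un_le)
 moreover have "rat_count f I Q \<delta> = card (S I)" "rat_count f {\<alpha>..\<beta>} Q \<delta> = card (S {\<alpha>..\<beta>})" unfolding rat_count_def S_def by auto
 ultimately show ?thesis using fB(2) by linarith
qed

definition discrepancy_error :: "nat \<Rightarrow> real \<Rightarrow> nat \<Rightarrow> real \<Rightarrow> real" where
 "discrepancy_error d \<epsilon> Q \<delta> = \<delta> powr (1 / 2) * ln (1 / \<delta>) * real Q powr (2 - 1 / (2 * (real d - 1)))
   + \<delta> powr (1 / real d) * real Q powr (2 - 1 / real d) + real Q powr (1 + \<epsilon>)"

text \<open>For \<open>d \<ge> 3\<close> the off-diagonal term is absorbed by the contribution of the core because
 \<open>\<delta> Q > 1\<close> and \<open>2 - 2/d\<close> exceeds \<open>3/2 - 1/(2(d-1))\<close> by \<open>(d-2)^2 / (2d(d-1))\<close>.\<close>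

lemma logarithmic_terms_absorbed:
 assumes d: "d \<ge> 2" and \<epsilon>: "\<epsilon> > 0"
 defines "p \<equiv> 2 - 1 / (2 * (real d - 1))"
 obtains \<eta> M where "0 < \<eta>" "\<eta> \<le> 1" "M \<ge> 0"
  "\<And>Q \<delta>. Q \<ge> 1 \<Longrightarrow> 1 / real Q < \<delta> \<Longrightarrow> (real Q + real Q powr (p - 1/2 + \<eta>)) * (1 + ln (real Q))^3
    \<le> M * (\<delta> powr (1 / real d) * real Q powr (2 - 1 / real d) + real Q powr (1 + \<epsilon>))"
proof -
 have d1: "real d - 1 \<ge> 1" using d by linarith
 define g where "g = (real d - 2)^2 / (2 * real d * (real d - 1))"
 have pg: "p - 1/2 + g = 2 - 2 / real d"
 proof -
  define u where "u = real d - 1"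
  have u: "u \<noteq> 0" "u + 1 \<noteq> 0" "real d = u + 1" unfolding u_def using d1 d by auto
  have "p - 1/2 = (3 * (u + 1) * u - (u + 1)) / (2 * (u + 1) * u)"
  proof -
   have "(3 * (u + 1) * u - (u + 1)) / (2 * (u + 1) * u) = ((u + 1) * (3 * u - 1)) / ((u + 1) * (2 * u))" by (simp add: algebra_simps)
   also have "... = (3 * u - 1) / (2 * u)" using u(2) by (rule mult_divide_mult_cancel_left)
   also have "... = p - 1/2" unfolding p_def u(3) using u(1) by (simp add: field_simps)
   finally show ?thesis by simp
  qed
  moreover have "g = (u - 1)^2 / (2 * (u + 1) * u)" unfolding g_def u(3) by simp
  ultimately have "p - 1/2 + g = (3 * (u + 1) * u - (u + 1) + (u - 1)^2) / (2 * (u + 1) * u)"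
   by (simp only: add_divide_distrib)
  also have "3 * (u + 1) * u - (u + 1) + (u - 1)^2 = 2 * (u + 1) * u * 2 - 2 * 2 * u" by algebra
  also have "(2 * (u + 1) * u * 2 - 2 * 2 * u) / (2 * (u + 1) * u) = 2 - 2 / real d"
  proof -
   have "(2 * 2) / (2 * (u + 1)) = 2 / (u + 1)" by (rule mult_divide_mult_cancel_left) simp
   then have "4 / (2 * u + 2) = 2 / (u + 1)" by (simp add: distrib_left)
   then show ?thesis unfolding u(3) using u(1,2) by (simp add: diff_divide_distrib)
  qed
  finally show ?thesis .
 qed
 have g1: "g \<le> 1"
 proof -
  have "(real d - 2)^2 \<le> 2 * real d * (real d - 1)" unfolding power2_eq_square using d by (intro mult_mono) auto
  then show ?thesis unfolding g_def using d d1 by (simp add: divide_le_eq)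
 qed
 \<comment> \<open>For d = 2 the exponent p - 1/2 is exactly 1, so the room is taken from
   \<epsilon>; otherwise it is the gap g.\<close>
 define h where "h = (if d = 2 then min 1 \<epsilon> else g)"
 have h: "h > 0" "h \<le> 1"
 proof -
  have "g > 0" if "d \<noteq> 2" unfolding g_def using d d1 that by (intro divide_pos_pos) auto
  then show "h > 0" "h \<le> 1" unfolding h_def using \<epsilon> g1 by auto
 qed
 \<comment> \<open>One half of h goes to \<eta>, and at most the other half to the cube of the
   logarithm.\<close>
 define \<theta> where "\<theta> = min (h/2) \<epsilon>"
 have \<theta>: "\<theta> > 0" "\<theta> \<le> h/2" "\<theta> \<le> \<epsilon>" unfolding \<theta>_def using h \<epsilon> by auto
 define M where "M = (1 + 3 / \<theta>)^3"
 have M: "M \<ge> 0" unfolding M_def using \<theta> by simp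
 show ?thesis
 proof (rule that[of "h/2" "2 * M"])
  show "0 < h/2" "h/2 \<le> 1" "0 \<le> 2 * M" using h M by auto
  fix Q and \<delta> :: real assume Q: "Q \<ge> (1::nat)" and \<delta>: "1 / real Q < \<delta>"
  have Q1: "real Q \<ge> 1" using Q by simp
  define R where "R = \<delta> powr (1 / real d) * real Q powr (2 - 1 / real d)"
  have R: "R \<ge> real Q powr (2 - 2 / real d)" "R \<ge> 0"
  proof -
   have "(1 / real Q) powr (1 / real d) \<le> \<delta> powr (1 / real d)" using \<delta> Q1 by (intro powr_mono2) auto
   then have "(1 / real Q) powr (1 / real d) * real Q powr (2 - 1 / real d) \<le> R" unfolding R_def by (intro mult_right_mono) auto
   moreover have "(1 / real Q) powr (1 / real d) = real Q powr (- (1 / real d))" using Q1 by (simp add: powr_divide powr_minus_divide)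
   moreover have "real Q powr (- (1 / real d)) * real Q powr (2 - 1 / real d) = real Q powr (2 - 2 / real d)"
    unfolding powr_add[symmetric] by (rule arg_cong[where f = "\<lambda>t. real Q powr t"]) (simp add: field_simps)
   ultimately show "R \<ge> real Q powr (2 - 2 / real d)" by simp
   show "R \<ge> 0" unfolding R_def by simp
  qed
  have L: "(1 + ln (real Q))^3 \<le> M * real Q powr \<theta>" unfolding M_def by (rule cubed_log_le[OF Q1 \<theta>(1)])
  have 1: "real Q * real Q powr \<theta> \<le> real Q powr (1 + \<epsilon>)"
  proof -
   have "real Q * real Q powr \<theta> = real Q powr (1 + \<theta>)" using Q1 by (simp add: powr_add)
   also have "... \<le> real Q powr (1 + \<epsilon>)" using Q1 \<theta> by (intro powr_mono) auto
   finally show ?thesis .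
  qed
  have 2: "real Q powr (p - 1/2 + h/2) * real Q powr \<theta> \<le> R + real Q powr (1 + \<epsilon>)"
  proof -
   have "real Q powr (p - 1/2 + h/2) * real Q powr \<theta> = real Q powr (p - 1/2 + h/2 + \<theta>)" by (simp add: powr_add)
   also have "... \<le> real Q powr (p - 1/2 + h)" using Q1 \<theta> by (intro powr_mono) auto
   also have "... \<le> R + real Q powr (1 + \<epsilon>)"
   proof (cases "d = 2")
    case True
    then have "real Q powr (p - 1/2 + h) \<le> real Q powr (1 + \<epsilon>)" using Q1 unfolding p_def h_def by (intro powr_mono) auto
    then show ?thesis using R(2) by linarith
   next
    case False
    then have "real Q powr (p - 1/2 + h) \<le> R" using R(1) pg unfolding h_def by simp
    then show ?thesis by (simp add: add_increasing2)
   qed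
   finally show ?thesis .
  qed
  have "(real Q + real Q powr (p - 1/2 + h/2)) * (1 + ln (real Q))^3 \<le> (real Q + real Q powr (p - 1/2 + h/2)) * (M * real Q powr \<theta>)"
   using L by (intro mult_left_mono) auto
  also have "... = M * (real Q * real Q powr \<theta> + real Q powr (p - 1/2 + h/2) * real Q powr \<theta>)" by (simp add: algebra_simps)
  also have "... \<le> M * (real Q powr (1 + \<epsilon>) + (R + real Q powr (1 + \<epsilon>)))" using 1 2 M by (intro mult_left_mono add_mono) auto
  also have "... \<le> 2 * M * (R + real Q powr (1 + \<epsilon>))"
  proof -
   have "M * (real Q powr (1 + \<epsilon>) + (R + real Q powr (1 + \<epsilon>))) \<le> M * (2 * (R + real Q powr (1 + \<epsilon>)))"
    using R(2) M by (intro mult_left_mono) auto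
   then show ?thesis by (simp only: mult.assoc mult.left_commute)
  qed
  finally show "(real Q + real Q powr (p - 1/2 + h/2)) * (1 + ln (real Q))^3
    \<le> 2 * M * (\<delta> powr (1 / real d) * real Q powr (2 - 1 / real d) + real Q powr (1 + \<epsilon>))" unfolding R_def .
 qed
qed

text \<open>The smoothing inequality is applied with the largest n such that 2^n \<le> Q, so that
  all blocks lie in the range X \<le> Q of the dyadic estimate. The tail 16 (n + 1) |S|/2^n is O(Q
  (1 + log Q)), as S has O(Q^2) elements; this and the rounding error of |S| are absorbed with the
  other logarithmic terms.\<close>

lemma rat_count_discrepancy:
 assumes d: "d \<ge> 2" and e: "e \<le> 1/2" and \<epsilon>: "\<epsilon> > 0"
  and H: "\<And>\<eta>. 0 < \<eta> \<Longrightarrow> \<eta> \<le> 1 \<Longrightarrow> dyadic_estimate d f a e \<eta>"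
 obtains C where "C \<ge> 0" "\<And>\<alpha> \<beta> Q \<delta>. a - e \<le> \<alpha> \<Longrightarrow> \<alpha> \<le> \<beta> \<Longrightarrow> \<beta> \<le> a + e \<Longrightarrow> Q \<ge> 1 \<Longrightarrow> 1 / real Q < \<delta> \<Longrightarrow> \<delta> < 1/2 \<Longrightarrow>
   \<bar>real (rat_count f {\<alpha>..\<beta>} Q \<delta>) - (\<beta> - \<alpha>) * \<delta> * real Q ^ 2\<bar> \<le> C * discrepancy_error d \<epsilon> Q \<delta>"
proof -
 define p where "p = 2 - 1 / (2 * (real d - 1))"
 obtain \<eta> M where \<eta>: "0 < \<eta>" "\<eta> \<le> 1" and M: "M \<ge> 0"
  "\<And>Q \<delta>. Q \<ge> 1 \<Longrightarrow> 1 / real Q < \<delta> \<Longrightarrow> (real Q + real Q powr (p - 1/2 + \<eta>)) * (1 + ln (real Q))^3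
    \<le> M * (\<delta> powr (1 / real d) * real Q powr (2 - 1 / real d) + real Q powr (1 + \<epsilon>))"
  using logarithmic_terms_absorbed[OF d \<epsilon>] unfolding p_def by blast
 obtain K where K: "K \<ge> 0" "\<And>\<alpha> \<beta> Q X. a - e \<le> \<alpha> \<Longrightarrow> \<alpha> \<le> \<beta> \<Longrightarrow> \<beta> \<le> a + e \<Longrightarrow> Q \<ge> 2 \<Longrightarrow> 1 \<le> X \<Longrightarrow> X \<le> Q \<Longrightarrow>
    esum_block f {\<alpha>..\<beta>} Q X \<le> K * dyadic_bound d \<eta> Q X"
  using H[OF \<eta>] by blast
 obtain W where W: "W \<ge> 0" "\<And>n Q \<delta> K Z. 2^n \<le> Q \<Longrightarrow> Q < 2^Suc n \<Longrightarrow> 1 / real Q < \<delta> \<Longrightarrow> \<delta> < 1/2 \<Longrightarrow> K \<ge> 0 \<Longrightarrow>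
   (\<And>i. i < n \<Longrightarrow> Z i \<le> K * dyadic_bound d \<eta> Q (2^i)) \<Longrightarrow>
   (\<Sum>i<n. dyadic_weight \<delta> n i * Z i) \<le> K * (W * ((real Q + real Q powr (p - 1/2 + \<eta>)) * (1 + ln (real Q))^3
    + \<delta> powr (1/2) * ln (1 / \<delta>) * real Q powr p + \<delta> powr (1 / real d) * real Q powr (2 - 1 / real d)))"
  using weighted_error[OF d \<eta>(1)] unfolding p_def by blast
 show ?thesis
 proof (rule that[of "32 * K * W * (M + 1) + 200 * M"])
  show "0 \<le> 32 * K * W * (M + 1) + 200 * M" using K(1) W(1) M(1) by simp
  fix \<alpha> \<beta> \<delta> and Q :: nat
  assume ab: "a - e \<le> \<alpha>" "\<alpha> \<le> \<beta>" "\<beta> \<le> a + e" and Q: "Q \<ge> 1" and \<delta>: "1 / real Q < \<delta>" "\<delta> < 1/2"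
  have ab1: "\<beta> \<le> \<alpha> + 1" using ab e by linarith
  have Q2: "real Q > 2" using order_less_trans[OF \<delta>] Q by (simp add: field_simps)
  then have Q2': "Q \<ge> 2" by linarith
  have d0: "\<delta> > 0" using less_trans[OF _ \<delta>(1), of 0] Q2 by simp
  have ld: "ln (1 / \<delta>) \<ge> 0" using d0 \<delta>(2) by (simp add: ln_ge_zero_iff)
  obtain n where n: "2^n \<le> Q" "Q < 2^Suc n" using ex_power_ivl1[of 2 Q] Q by auto
  define S where "S = rat_points {\<alpha>..\<beta>} Q"
  define y where "y = (\<lambda>(b::int, q::nat). real q * f (of_int b / real q))"
  define E where "E j = (\<Sum>p\<in>S. circ (j * y p))" for j
  have E: "E j = esum f {\<alpha>..\<beta>} Q j" for j
   unfolding E_def S_def y_def esum_def using sum_rat_points[of "\<lambda>b q. circ (j * (real q * f (of_int b / real q)))" \<alpha> \<beta> Q]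
   by (simp add: case_prod_unfold mult.left_commute)
  have fin: "finite S" unfolding S_def by (rule finite_rat_points)
  have rc: "rat_count f {\<alpha>..\<beta>} Q \<delta> = card {p\<in>S. int_dist (y p) < \<delta>}"
   unfolding rat_count_def S_def rat_points_def y_def by (rule arg_cong[where f = card]) auto
  define T where "T = (real Q + real Q powr (p - 1/2 + \<eta>)) * (1 + ln (real Q))^3"
  define A where "A = \<delta> powr (1/2) * ln (1 / \<delta>) * real Q powr p"
  define B where "B = \<delta> powr (1 / real d) * real Q powr (2 - 1 / real d)"
  define G where "G = real Q powr (1 + \<epsilon>)"
  have nn: "A \<ge> 0" "B \<ge> 0" "G \<ge> 0" unfolding A_def B_def G_def using ld by auto
  have TM: "T \<le> M * (B + G)" unfolding T_def B_def G_def by (rule M(2)[OF Q \<delta>(1)])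
  have l: "ln (real Q) \<ge> 0" using Q2 by simp
  have cd: "real (card S) \<le> 3 * real Q ^ 2"
  proof -
   have "(\<beta> - \<alpha>) * real Q ^ 2 \<le> 1 * real Q ^ 2" using ab1 by (intro mult_right_mono) auto
   moreover have "2 * real Q \<le> real Q ^ 2" using Q2 by (simp add: power2_eq_square)
   ultimately show ?thesis using card_rat_points[OF ab(2) ab1, of Q] unfolding S_def by linarith
  qed
  have QT: "real Q * (1 + ln (real Q)) \<le> T"
  proof -
   have "1 * (1 + ln (real Q)) \<le> (1 + ln (real Q))^2 * (1 + ln (real Q))" using l by (intro mult_right_mono one_le_power) auto
   then have "1 + ln (real Q) \<le> (1 + ln (real Q))^3" by (simp add: power2_eq_square power3_eq_cube mult_ac)
   then show ?thesis unfolding T_def using l by (intro mult_mono) auto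
  qed
  have tail: "16 * (real n + 1) * real (card S) / 2^n \<le> 192 * T"
  proof -
   have nQ: "2^n \<le> real Q" "real Q < 2 * 2^n"
   proof -
    have "real (2^n) \<le> real Q" "real Q < real (2^Suc n)" using n by (simp_all only: of_nat_le_iff of_nat_less_iff)
    then show "2^n \<le> real Q" "real Q < 2 * 2^n" by simp_all
   qed
   have ln2: "ln (2::real) \<ge> 1/2" using ln_le_minus_one[of "1/2"] by (simp add: ln_div)
   have "real n * (1/2) \<le> real n * ln 2" using ln2 by (intro mult_left_mono) auto
   also have "... = ln (2^n)" by (simp add: ln_realpow)
   also have "... \<le> ln (real Q)" using nQ(1) Q2 by simp
   finally have n1: "real n + 1 \<le> 2 * (1 + ln (real Q))" by simp
   have "real (card S) / 2^n \<le> 3 * real Q ^ 2 / (real Q / 2)" using cd nQ Q2 by (intro frac_le) auto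
   also have "... = 6 * real Q" using Q2 by (simp add: power2_eq_square)
   finally have "(real n + 1) * (real (card S) / 2^n) \<le> (2 * (1 + ln (real Q))) * (6 * real Q)" using n1 l by (intro mult_mono) auto
   moreover have "16 * (real n + 1) * real (card S) / 2^n = 16 * ((real n + 1) * (real (card S) / 2^n))" by simp
   moreover have "192 * (real Q * (1 + ln (real Q))) = 16 * ((2 * (1 + ln (real Q))) * (6 * real Q))" by algebra
   ultimately have "16 * (real n + 1) * real (card S) / 2^n \<le> 192 * (real Q * (1 + ln (real Q)))" by linarith
   then show ?thesis using QT by linarith
  qed
  have main: "\<bar>real (rat_count f {\<alpha>..\<beta>} Q \<delta>) - 2 * \<delta> * real (card S)\<bar> \<le> 32 * (K * (W * (T + A + B))) + 192 * T"
  proof -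
   have "\<bar>real (rat_count f {\<alpha>..\<beta>} Q \<delta>) - 2 * \<delta> * real (card S)\<bar> \<le>
    2 * (\<Sum>j\<in>{1..<2^n}. min (2 * \<delta>) (1 / real j) * norm (E (real j))) + 16 / 2^n * (\<Sum>i\<le>n. real (card S) + 2 * (\<Sum>j\<in>{1..<2^i}. norm (E (real j))))"
    unfolding rc by (rule smoothing[OF fin d0 \<delta>(2) E_def])
   also have "... \<le> 32 * (\<Sum>i<n. dyadic_weight \<delta> n i * (\<Sum>j\<in>{2^i..<2*2^i}. norm (E (real j)))) + 16 * (real n + 1) * real (card S) / 2^n"
    by (rule dyadic_assembly[OF norm_ge_zero d0])
   also have "(\<Sum>i<n. dyadic_weight \<delta> n i * (\<Sum>j\<in>{2^i..<2*2^i}. norm (E (real j)))) \<le> K * (W * (T + A + B))"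
    unfolding T_def A_def B_def
   proof (rule W(2)[OF n \<delta> K(1)])
    fix i assume i: "i < n"
    have "(2::nat)^i \<le> 2^n" using i by (intro power_increasing) auto
    then have X: "1 \<le> (2::nat)^i" "2^i \<le> Q" using order_trans[OF _ n(1)] by auto
    show "(\<Sum>j\<in>{2^i..<2*2^i}. norm (E (real j))) \<le> K * dyadic_bound d \<eta> Q (2^i)"
     unfolding E by (rule K(2)[OF ab Q2' X])
   qed
   finally show ?thesis using tail by linarith
  qed
  have "\<bar>2 * \<delta> * real (card S) - (\<beta> - \<alpha>) * \<delta> * real Q ^ 2\<bar> = 2 * \<delta> * \<bar>real (card S) - (\<beta> - \<alpha>) * real Q ^ 2 / 2\<bar>"
  proof -
   have "2 * \<delta> * real (card S) - (\<beta> - \<alpha>) * \<delta> * real Q ^ 2 = 2 * \<delta> * (real (card S) - (\<beta> - \<alpha>) * real Q ^ 2 / 2)" by (simp add: field_simps)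
   then show ?thesis using d0 by (simp add: abs_mult)
  qed
  also have "... \<le> 1 * (2 * real Q)" using card_rat_points[OF ab(2) ab1, of Q] \<delta> d0 unfolding S_def by (intro mult_mono) auto
  also have "... \<le> 2 * T"
  proof -
   have "real Q * 1 \<le> real Q * (1 + ln (real Q))" using l by (intro mult_left_mono) auto
   then show ?thesis using QT by simp
  qed
  finally have "\<bar>real (rat_count f {\<alpha>..\<beta>} Q \<delta>) - (\<beta> - \<alpha>) * \<delta> * real Q ^ 2\<bar> \<le> 32 * (K * (W * (T + A + B))) + 194 * T"
   using main by linarith
  also have "... \<le> 32 * (K * (W * (M * (B + G) + A + B))) + 194 * (M * (B + G))"
   using TM K(1) W(1) by (intro add_mono mult_left_mono) auto
  also have "... \<le> (32 * K * W * (M + 1) + 200 * M) * (A + B + G)"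
  proof -
   have "M * (B + G) + A + B \<le> (M + 1) * (A + B + G)" using nn M(1) by (simp add: algebra_simps)
   then have "32 * (K * (W * (M * (B + G) + A + B))) \<le> 32 * (K * (W * ((M + 1) * (A + B + G))))" using K(1) W(1) by (intro mult_left_mono) auto
   moreover have "194 * (M * (B + G)) \<le> 200 * (M * (A + B + G))" using nn M(1) by (intro mult_mono mult_left_mono) auto
   moreover have "32 * (K * (W * ((M + 1) * (A + B + G)))) + 200 * (M * (A + B + G)) = (32 * K * W * (M + 1) + 200 * M) * (A + B + G)" by algebra
   ultimately show ?thesis by linarith
  qed
  finally show "\<bar>real (rat_count f {\<alpha>..\<beta>} Q \<delta>) - (\<beta> - \<alpha>) * \<delta> * real Q ^ 2\<bar> \<le> (32 * K * W * (M + 1) + 200 * M) * discrepancy_error d \<epsilon> Q \<delta>"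
   unfolding discrepancy_error_def A_def B_def G_def p_def .
 qed
qed

section \<open>The asymptotic form\<close>

lemma discrepancy_error_le:
 assumes d: "d \<ge> 2" and \<epsilon>: "\<epsilon> > 0" and Q: "Q \<ge> 1" and \<delta>: "real Q powr (- 1 / (real d - 1) + \<epsilon>) < \<delta>" "\<delta> < 1/2"
 shows "1 / real Q < \<delta>" "discrepancy_error d (\<epsilon>/2) Q \<delta> \<le> \<delta> * real Q ^ 2 * (real Q powr (- (\<epsilon>/2)) * (2 + ln (real Q)))"
proof -
 have Q1: "real Q \<ge> 1" using Q by simp
 have d1: "real d - 1 \<ge> 1" using d by linarith
 define s where "s = - 1 / (real d - 1) + \<epsilon>"
 have "1 / (real d - 1) \<le> 1" using d1 by simp
 then have "-1 \<le> s" unfolding s_def using \<epsilon> by simp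
 then have "real Q powr (-1) \<le> real Q powr s" using Q1 by (intro powr_mono) auto
 then show \<delta>1: "1 / real Q < \<delta>" using \<delta>(1) Q1 unfolding s_def by (simp add: powr_minus_divide)
 then have d0: "\<delta> > 0" using less_trans[OF _ \<delta>1, of 0] Q1 by simp
 have Qs: "real Q powr s > 0" "real Q powr s \<le> \<delta>" using Q1 \<delta>(1) unfolding s_def by auto
 have Q2: "real Q powr (2 - \<epsilon>/2) = real Q ^ 2 * real Q powr (- (\<epsilon>/2))"
 proof -
  have "real Q powr (2 - \<epsilon>/2) = real Q powr 2 * real Q powr (- (\<epsilon>/2))" using powr_add[of "real Q" 2 "- (\<epsilon>/2)"] by simp
  then show ?thesis using Q1 by (simp add: powr_numeral)
 qed
 have neg: "\<delta> powr b \<le> \<delta> * real Q powr (s * (b - 1))" if "b \<le> 1" for b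
 proof -
  have "\<delta> powr b = \<delta> * \<delta> powr (b - 1)" using d0 powr_add[of \<delta> 1 "b - 1"] by simp
  also have "\<delta> powr (b - 1) \<le> (real Q powr s) powr (b - 1)" using Qs that by (intro powr_mono2') auto
  finally show ?thesis using d0 by (simp add: powr_powr)
 qed
 \<comment> \<open>Since \<delta> exceeds Q^s, the factor \<delta>^(b-1) of an error term relative
   to \<delta> is at most Q^(s(b-1)) for b \<le> 1; it remains to compare exponents of Q.\<close>
 have comb: "\<delta> powr b * real Q powr r \<le> \<delta> * real Q powr (2 - \<epsilon>/2)" if "b \<le> 1" "s * (b - 1) + r \<le> 2 - \<epsilon>/2" for b r
 proof -
  have "\<delta> powr b * real Q powr r \<le> \<delta> * real Q powr (s * (b - 1)) * real Q powr r" using neg[OF that(1)] by (intro mult_right_mono) auto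
  also have "... = \<delta> * real Q powr (s * (b - 1) + r)" by (simp add: powr_add)
  also have "... \<le> \<delta> * real Q powr (2 - \<epsilon>/2)" using that d0 Q1 by (intro mult_left_mono powr_mono) auto
  finally show ?thesis .
 qed
 have ld: "0 \<le> ln (1 / \<delta>)" "ln (1 / \<delta>) \<le> ln (real Q)"
 proof -
  show "0 \<le> ln (1 / \<delta>)" using d0 \<delta>(2) by (simp add: ln_ge_zero_iff)
  have "1 / \<delta> \<le> real Q" using \<delta>1 d0 Q1 by (simp add: field_simps)
  then show "ln (1 / \<delta>) \<le> ln (real Q)" using d0 Q1 by (subst ln_le_cancel_iff) auto
 qed
 \<comment> \<open>For b = 1/2 the exponent is exactly 2 - \<epsilon>/2: the threshold Q^(-1/(d-1))
   is where this term meets the main term up to the logarithm. The core term below meets it at the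
   same place.\<close>
 have 1: "\<delta> powr (1/2) * ln (1 / \<delta>) * real Q powr (2 - 1 / (2 * (real d - 1))) \<le> \<delta> * real Q powr (2 - \<epsilon>/2) * ln (real Q)"
 proof -
  define w where "w = 1 / (real d - 1)"
  have w: "1 / (2 * (real d - 1)) = w / 2" "s = \<epsilon> - w" unfolding w_def s_def by simp_all
  have "s * (1/2 - 1) + (2 - 1 / (2 * (real d - 1))) = 2 - \<epsilon>/2" unfolding w by (simp add: field_simps)
  then have h: "\<delta> powr (1/2) * real Q powr (2 - 1 / (2 * (real d - 1))) \<le> \<delta> * real Q powr (2 - \<epsilon>/2)" by (intro comb) auto
  have "(\<delta> powr (1/2) * real Q powr (2 - 1 / (2 * (real d - 1)))) * ln (1 / \<delta>) \<le> (\<delta> * real Q powr (2 - \<epsilon>/2)) * ln (real Q)"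
   by (rule mult_mono[OF h ld(2)]) (use ld d0 in auto)
  then show ?thesis by (simp add: mult_ac)
 qed
 have 2: "\<delta> powr (1 / real d) * real Q powr (2 - 1 / real d) \<le> \<delta> * real Q powr (2 - \<epsilon>/2)"
 proof (rule comb)
  show "1 / real d \<le> 1" using d by simp
  have "s * (1 / real d - 1) + (2 - 1 / real d) = 2 - \<epsilon> * (1 - 1 / real d)"
  proof -
   define u where "u = real d - 1"
   have u: "u > 0" "real d = u + 1" unfolding u_def using d1 by auto
   define v where "v = 1 / (u + 1)"
   have uv: "u * v = 1 - v" unfolding v_def using u(1) by (simp add: field_simps)
   have "(- 1 / u + \<epsilon>) * (v - 1) = (1 / u - \<epsilon>) * (u * v)" unfolding uv by (simp add: algebra_simps add_divide_distrib diff_divide_distrib)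
   also have "... = v - \<epsilon> * (u * v)" using u(1) by (simp add: left_diff_distrib)
   finally have "(- 1 / u + \<epsilon>) * (v - 1) + (2 - v) = 2 - \<epsilon> * (1 - v)" unfolding uv by simp
   then show ?thesis unfolding s_def u_def[symmetric] unfolding u(2) v_def .
  qed
  moreover have "\<epsilon> * (1/2) \<le> \<epsilon> * (1 - 1 / real d)" using \<epsilon> d by (intro mult_left_mono) (auto simp: field_simps)
  ultimately show "s * (1 / real d - 1) + (2 - 1 / real d) \<le> 2 - \<epsilon>/2" by simp
 qed
 have 3: "real Q powr (1 + \<epsilon>/2) \<le> \<delta> * real Q powr (2 - \<epsilon>/2)"
 proof -
  have "1 / (real d - 1) \<le> 1" using d1 by simp
  then have "s * (0 - 1) + (1 + \<epsilon>/2) \<le> 2 - \<epsilon>/2" unfolding s_def by simp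
  from comb[OF _ this] show ?thesis using d0 by simp
 qed
 have "discrepancy_error d (\<epsilon>/2) Q \<delta> \<le> \<delta> * real Q powr (2 - \<epsilon>/2) * ln (real Q) + \<delta> * real Q powr (2 - \<epsilon>/2) + \<delta> * real Q powr (2 - \<epsilon>/2)"
  unfolding discrepancy_error_def using 1 2 3 by linarith
 also have "... = \<delta> * real Q ^ 2 * (real Q powr (- (\<epsilon>/2)) * (2 + ln (real Q)))" unfolding Q2 by (simp add: algebra_simps)
 finally show "discrepancy_error d (\<epsilon>/2) Q \<delta> \<le> \<delta> * real Q ^ 2 * (real Q powr (- (\<epsilon>/2)) * (2 + ln (real Q)))" .
qed

lemma discrepancy_error_negligible:
 assumes d: "d \<ge> 2" and \<epsilon>: "\<epsilon> > 0" and \<eta>: "\<eta> > 0" and C: "C \<ge> 0"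
 shows "\<exists>Q0::nat. \<forall>Q\<ge>Q0. \<forall>\<delta>. real Q powr (- 1 / (real d - 1) + \<epsilon>) < \<delta> \<and> \<delta> < 1 / 2 \<longrightarrow>
  Q \<ge> 1 \<and> 1 / real Q < \<delta> \<and> C * discrepancy_error d (\<epsilon>/2) Q \<delta> \<le> \<eta> * \<delta> * real Q ^ 2"
proof -
 have "((\<lambda>x::real. x powr (- (\<epsilon>/2)) * (2 + ln x)) \<longlongrightarrow> 0) at_top" using \<epsilon> by real_asymp
 then have "(\<lambda>Q. real Q powr (- (\<epsilon>/2)) * (2 + ln (real Q))) \<longlonglongrightarrow> 0" by (rule filterlim_compose[OF _ filterlim_real_sequentially])
 then have "(\<lambda>Q. C * (real Q powr (- (\<epsilon>/2)) * (2 + ln (real Q)))) \<longlonglongrightarrow> C * 0" by (rule tendsto_mult_left)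
 then have "eventually (\<lambda>Q. C * (real Q powr (- (\<epsilon>/2)) * (2 + ln (real Q))) < \<eta>) sequentially"
  by (rule order_tendstoD(2)) (use \<eta> in simp)
 then obtain Q0 where Q0: "\<And>Q. Q \<ge> Q0 \<Longrightarrow> C * (real Q powr (- (\<epsilon>/2)) * (2 + ln (real Q))) < \<eta>"
  unfolding eventually_sequentially by blast
 show ?thesis
 proof (intro exI[of _ "max Q0 1"] allI impI)
  fix Q \<delta> assume Q: "max Q0 1 \<le> Q" and \<delta>: "real Q powr (- 1 / (real d - 1) + \<epsilon>) < \<delta> \<and> \<delta> < 1 / 2"
  have Q1: "Q \<ge> 1" using Q by simp
  note e = discrepancy_error_le[OF d \<epsilon> Q1 conjunct1[OF \<delta>] conjunct2[OF \<delta>]]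
  have "\<delta> > 0" using less_trans[OF _ e(1), of 0] Q1 by simp
  have "C * discrepancy_error d (\<epsilon>/2) Q \<delta> \<le> C * (\<delta> * real Q ^ 2 * (real Q powr (- (\<epsilon>/2)) * (2 + ln (real Q))))"
   by (rule mult_left_mono[OF e(2) C])
  also have "... = (\<delta> * real Q ^ 2) * (C * (real Q powr (- (\<epsilon>/2)) * (2 + ln (real Q))))" by simp
  also have "... \<le> (\<delta> * real Q ^ 2) * \<eta>" using Q0[of Q] Q \<open>\<delta> > 0\<close> by (intro mult_left_mono) auto
  finally show "Q \<ge> 1 \<and> 1 / real Q < \<delta> \<and> C * discrepancy_error d (\<epsilon>/2) Q \<delta> \<le> \<eta> * \<delta> * real Q ^ 2"
   using Q1 e(1) by (simp add: mult_ac)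
 qed
qed

section \<open>Arbitrary intervals\<close>

lemma bounded_interval_real:
 fixes I :: "real set"
 assumes I: "is_interval I" "I \<noteq> {}" "I \<subseteq> {u..v}"
 obtains \<alpha> \<beta> where "u \<le> \<alpha>" "\<alpha> \<le> \<beta>" "\<beta> \<le> v" "{\<alpha><..<\<beta>} \<subseteq> I" "I \<subseteq> {\<alpha>..\<beta>}" "measure lborel I = \<beta> - \<alpha>"
proof -
 have bdd: "bdd_below I" "bdd_above I" using I(3) by (meson bdd_below_mono bdd_above_mono bdd_below_Icc bdd_above_Icc)+
 define \<alpha> where "\<alpha> = Inf I"
 define \<beta> where "\<beta> = Sup I"
 have sub: "I \<subseteq> {\<alpha>..\<beta>}" unfolding \<alpha>_def \<beta>_def using cInf_lower[OF _ bdd(1)] cSup_upper[OF _ bdd(2)] by auto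
 have sup: "{\<alpha><..<\<beta>} \<subseteq> I"
 proof
  fix x assume "x \<in> {\<alpha><..<\<beta>}"
  then obtain y z where "y \<in> I" "y < x" "z \<in> I" "x < z"
   unfolding \<alpha>_def \<beta>_def using cInf_less_iff[OF I(2) bdd(1)] less_cSup_iff[OF I(2) bdd(2)] by auto
  then show "x \<in> I" using mem_is_interval_1_I[OF I(1), of y z x] by simp
 qed
 have ab: "\<alpha> \<le> \<beta>" using sub I(2) by fastforce
 have uv: "u \<le> \<alpha>" "\<beta> \<le> v" unfolding \<alpha>_def \<beta>_def using I(2,3) by (auto intro!: cInf_greatest cSup_least)
 have m: "I \<in> sets lborel" using real_interval_borel_measurable[OF I(1)] by simp
 have "emeasure lborel {\<alpha><..<\<beta>} \<le> emeasure lborel I" using sup m by (intro emeasure_mono) auto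
 moreover have "emeasure lborel I \<le> emeasure lborel {\<alpha>..\<beta>}" using sub by (intro emeasure_mono) auto
 ultimately have "emeasure lborel I = ennreal (\<beta> - \<alpha>)" using ab by simp
 then have "measure lborel I = \<beta> - \<alpha>" using ab by (simp add: measure_def)
 then show ?thesis using that uv ab sup sub by blast
qed

text \<open>Adding the endpoints changes the count by at most 2 Q, which Q^(1+\<epsilon>) absorbs;
  this is the 2 in C + 2.\<close>

lemma interval_discrepancy:
 assumes d: "d \<ge> 2" and e: "e \<le> 1/2" and \<epsilon>: "\<epsilon> > 0" and I: "is_interval I" "I \<subseteq> {a-e..a+e}"
  and H: "\<And>\<eta>. 0 < \<eta> \<Longrightarrow> \<eta> \<le> 1 \<Longrightarrow> dyadic_estimate d f a e \<eta>"
 obtains C where "C \<ge> 0" "\<And>Q \<delta>. Q \<ge> 1 \<Longrightarrow> 1 / real Q < \<delta> \<Longrightarrow> \<delta> < 1/2 \<Longrightarrow>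
   \<bar>real (rat_count f I Q \<delta>) - measure lborel I * \<delta> * real Q ^ 2\<bar> \<le> C * discrepancy_error d \<epsilon> Q \<delta>"
proof (cases "I = {}")
 case True
 then show ?thesis using that[of 0] by (simp add: rat_count_def)
next
 case False
 obtain C where C: "C \<ge> 0" "\<And>\<alpha> \<beta> Q \<delta>. a - e \<le> \<alpha> \<Longrightarrow> \<alpha> \<le> \<beta> \<Longrightarrow> \<beta> \<le> a + e \<Longrightarrow> Q \<ge> 1 \<Longrightarrow> 1 / real Q < \<delta> \<Longrightarrow> \<delta> < 1/2 \<Longrightarrow>
   \<bar>real (rat_count f {\<alpha>..\<beta>} Q \<delta>) - (\<beta> - \<alpha>) * \<delta> * real Q ^ 2\<bar> \<le> C * discrepancy_error d \<epsilon> Q \<delta>"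
  using rat_count_discrepancy[OF d e \<epsilon> H] by blast
 obtain \<alpha> \<beta> where ab: "a - e \<le> \<alpha>" "\<alpha> \<le> \<beta>" "\<beta> \<le> a + e" "{\<alpha><..<\<beta>} \<subseteq> I" "I \<subseteq> {\<alpha>..\<beta>}" "measure lborel I = \<beta> - \<alpha>"
  using bounded_interval_real[OF I(1) False I(2)] by blast
 show ?thesis
 proof (rule that[of "C + 2"])
  show "0 \<le> C + 2" using C(1) by simp
  fix Q :: nat and \<delta> assume Q: "Q \<ge> 1" and \<delta>: "1 / real Q < \<delta>" "\<delta> < 1/2"
  have d0: "\<delta> > 0" using less_trans[OF _ \<delta>(1), of 0] Q by simp
  have ld: "0 \<le> ln (1 / \<delta>)" using d0 \<delta>(2) by (simp add: ln_ge_zero_iff)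
  have "real Q \<le> real Q powr (1 + \<epsilon>)" using powr_mono[of 1 "1 + \<epsilon>" "real Q"] Q \<epsilon> by simp
  moreover have "0 \<le> \<delta> powr (1 / 2) * ln (1 / \<delta>) * real Q powr (2 - 1 / (2 * (real d - 1)))" using ld by simp
  moreover have "0 \<le> \<delta> powr (1 / real d) * real Q powr (2 - 1 / real d)" by simp
  ultimately have "real Q \<le> discrepancy_error d \<epsilon> Q \<delta>" unfolding discrepancy_error_def by linarith
  then show "\<bar>real (rat_count f I Q \<delta>) - measure lborel I * \<delta> * real Q ^ 2\<bar> \<le> (C + 2) * discrepancy_error d \<epsilon> Q \<delta>"
   using C(2)[OF ab(1,2,3) Q \<delta>] rat_count_closure[OF ab(4,5), of f Q \<delta>] unfolding ab(6) distrib_right by linarith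
 qed
qed

theorem theorem1p2:
  fixes d :: nat and a0 :: real and f :: "real \<Rightarrow> real" and U :: "real set"
  assumes "d \<ge> 2"
    and "open U" and "a0 \<in> U"
    and "C_k_on (d + 1) f U"
    and "curve_of_type d f a0"
  shows "\<exists>\<epsilon>0>0. {a0 - \<epsilon>0<..<a0 + \<epsilon>0} \<subseteq> U \<and>
    (\<forall>I. is_interval I \<and> I \<subseteq> {a0 - \<epsilon>0<..<a0 + \<epsilon>0} \<longrightarrow>
      (\<forall>\<epsilon>>0. \<exists>C. \<forall>Q::nat. \<forall>\<delta>::real. Q \<ge> 1 \<and> 1 / real Q < \<delta> \<and> \<delta> < 1 / 2 \<longrightarrow>
        \<bar>real (rat_count f I Q \<delta>) - measure lborel I * \<delta> * real Q ^ 2\<bar>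
          \<le> C * (\<delta> powr (1 / 2) * ln (1 / \<delta>) * real Q powr (2 - 1 / (2 * (real d - 1)))
                 + \<delta> powr (1 / real d) * real Q powr (2 - 1 / real d)
                 + real Q powr (1 + \<epsilon>))) \<and>
      (\<forall>\<epsilon>>0. \<forall>\<eta>>0. \<exists>Q0::nat. \<forall>Q\<ge>Q0. \<forall>\<delta>::real.
        real Q powr (- 1 / (real d - 1) + \<epsilon>) < \<delta> \<and> \<delta> < 1 / 2 \<longrightarrow>
        \<bar>real (rat_count f I Q \<delta>) - measure lborel I * \<delta> * real Q ^ 2\<bar>
          \<le> \<eta> * \<delta> * real Q ^ 2))"
proof -
 obtain e where e: "e > 0" "e \<le> 1/2" "{a0-e..a0+e} \<subseteq> U"
  and H: "\<And>\<eta>. 0 < \<eta> \<Longrightarrow> \<eta> \<le> 1 \<Longrightarrow> dyadic_estimate d f a0 e \<eta>"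
  using dyadic_sum_bound[OF assms] by blast
 show ?thesis
 proof (rule exI[of _ e], intro conjI allI impI)
  show "e > 0" by (rule e)
  show "{a0 - e<..<a0 + e} \<subseteq> U" using e(3) by auto
 next
  fix I and \<epsilon> :: real assume I: "is_interval I \<and> I \<subseteq> {a0 - e<..<a0 + e}" and \<epsilon>: "\<epsilon> > 0"
  have I2: "is_interval I" "I \<subseteq> {a0-e..a0+e}" using I by auto
  obtain C where "\<And>Q \<delta>. Q \<ge> 1 \<Longrightarrow> 1 / real Q < \<delta> \<Longrightarrow> \<delta> < 1/2 \<Longrightarrow>
   \<bar>real (rat_count f I Q \<delta>) - measure lborel I * \<delta> * real Q ^ 2\<bar> \<le> C * discrepancy_error d \<epsilon> Q \<delta>"
   using interval_discrepancy[OF assms(1) e(2) \<epsilon> I2 H] by blast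
  then show "\<exists>C. \<forall>Q::nat. \<forall>\<delta>::real. Q \<ge> 1 \<and> 1 / real Q < \<delta> \<and> \<delta> < 1 / 2 \<longrightarrow>
    \<bar>real (rat_count f I Q \<delta>) - measure lborel I * \<delta> * real Q ^ 2\<bar>
     \<le> C * (\<delta> powr (1 / 2) * ln (1 / \<delta>) * real Q powr (2 - 1 / (2 * (real d - 1)))
         + \<delta> powr (1 / real d) * real Q powr (2 - 1 / real d)
         + real Q powr (1 + \<epsilon>))"
   unfolding discrepancy_error_def by blast
 next
  fix I and \<epsilon> \<eta> :: real assume I: "is_interval I \<and> I \<subseteq> {a0 - e<..<a0 + e}" and \<epsilon>: "\<epsilon> > 0" and \<eta>: "\<eta> > 0"
  have I2: "is_interval I" "I \<subseteq> {a0-e..a0+e}" and \<epsilon>2: "\<epsilon>/2 > 0" using I \<epsilon> by auto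
  \<comment> \<open>The exponent \<epsilon>/2 is taken because Q^(1+\<epsilon>/2) is at most
    \<delta> Q^(2-\<epsilon>/2) on the present range of \<delta>.\<close>
  obtain C where C: "C \<ge> 0" "\<And>Q \<delta>. Q \<ge> 1 \<Longrightarrow> 1 / real Q < \<delta> \<Longrightarrow> \<delta> < 1/2 \<Longrightarrow>
   \<bar>real (rat_count f I Q \<delta>) - measure lborel I * \<delta> * real Q ^ 2\<bar> \<le> C * discrepancy_error d (\<epsilon>/2) Q \<delta>"
   using interval_discrepancy[OF assms(1) e(2) \<epsilon>2 I2 H] by blast
  show "\<exists>Q0::nat. \<forall>Q\<ge>Q0. \<forall>\<delta>::real.
    real Q powr (- 1 / (real d - 1) + \<epsilon>) < \<delta> \<and> \<delta> < 1 / 2 \<longrightarrow>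
    \<bar>real (rat_count f I Q \<delta>) - measure lborel I * \<delta> * real Q ^ 2\<bar> \<le> \<eta> * \<delta> * real Q ^ 2"
   using discrepancy_error_negligible[OF assms(1) \<epsilon> \<eta> C(1)] C(2) by (meson order_trans)
 qed
qed

end
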